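(* As $n\to\infty$, $$\Lambda_n\longrightarrow L_\infty\qquad\text{and}\qquad\widetilde{\Lambda}_n\longrightarrow L_\infty,$$ where in both cases the convergence holds in distribution in the sense of the Hausdorff distance between compact subsets of the closed unit disk $\overline{\mathbb{D}}$.
   Context: $\mathbb{S}_1$ is the unit circle of $\mathbb{C}$; for $x,y\in\mathbb{S}_1$ the chord $[xy]$ is the closed line segment with endpoints $x,y$, and $]xy[$ is the open segment. Two chords $[xy],[x'y']$ do not cross if $]xy[\,\cap\,]x'y'[=\varnothing$. Definition of $L_\infty$. Let $U_1,V_1,U_2,V_2,\ldots$ be independent random variables uniformly distributed over $\mathbb{S}_1$. Set $L_1=[U_1V_1]$ and, for $n\ge1$, $L_{n+1}=L_n$ if the chord $[U_{n+1}V_{n+1}]$ intersects $L_n$, and $L_{n+1}=L_n\cup[U_{n+1}V_{n+1}]$ otherwise. Then $L_\infty=\overline{\bigcup_{n\ge1}L_n}$ is the closure of the increasing union of the sets $L_n$. The $n$-gon. For every $n\ge3$ consider the $n$-gon whose vertices are the $n$th roots of unity $x^n_k=\exp(2i\pi k/n)$, $k=1,2,\ldots,n$. A chord of $\mathbb{S}_1$ is called a diagonal of the $n$-gon if its endpoints belong to the set $\{x^n_k: 1\le k\le n\}$ and if it is not an edge of the $n$-gon. $\mathscr{D}_n$ denotes the set of all diagonals of the $n$-gon. Definition of $\Lambda_n$ ($n\ge4$). Let $c_1$ be chosen uniformly at random in $\mathscr{D}_n$. By induction, for every $1<k\le n-3$, given $c_1,\ldots,c_{k-1}$, the chord $c_k$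 is chosen uniformly at random in the set of all chords in $\mathscr{D}_n$ that do not cross $c_1,c_2,\ldots,c_{k-1}$. Then $\Lambda_n$ is the union of the chords $c_1,c_2,\ldots,c_{n-3}$ (a triangulation of the $n$-gon). Definition of $\widetilde\Lambda_n$. Let $\sigma$ be a uniformly distributed random permutation of $\{1,2,\ldots,n\}$. With $\sigma$ one associates a collection of diagonals of the $n$-gon, constructed recursively as follows. For every integer $0\le k\le n$ one defines a set $M_k$ of disjoint diagonals of the $n$-gon and a set $F_k$ of "free" vertices. Start with $M_0=F_0=\varnothing$. Then, at step $k\in\{1,\ldots,n\}$, either there is a (necessarily unique) free vertex $x\in F_{k-1}$ such that $[x\,x^n_{\sigma(k)}]$ is a diagonal of the $n$-gon that does not intersect the chords in $M_{k-1}$, and one sets $M_k=M_{k-1}\cup\{[x\,x^n_{\sigma(k)}]\}$ and $F_k=F_{k-1}\setminus\{x\}$; or there is no such vertex, and one sets $M_k=M_{k-1}$ and $F_k=F_{k-1}\cup\{x^n_{\sigma(k)}\}$. Then $\widetilde\Lambda_n$ is the union of the chords in $M_n$ (it is not a triangulation of the $n$-gon). *)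

theory Defs
  imports "HOL-Probability.Probability" "HOL-Combinatorics.Permutations"
begin

subsection \<open>Hausdorff distance on compact subsets of the closed unit disk\<close>

definition hausdorff_dist :: "'a::metric_space set \<Rightarrow> 'a set \<Rightarrow> real" where
  "hausdorff_dist A B = max (SUP x\<in>A. infdist x B) (SUP y\<in>B. infdist y A)"

lemma hausdorff_dist_commute: "hausdorff_dist A B = hausdorff_dist B A"
  by (simp add: hausdorff_dist_def max.commute)

lemma hausdorff_dist_leI:
  assumes "A \<noteq> {}" "B \<noteq> {}"
    and "\<And>x. x \<in> A \<Longrightarrow> infdist x B \<le> r" "\<And>y. y \<in> B \<Longrightarrow> infdist y A \<le> r"
  shows "hausdorff_dist A B \<le> r"
  unfolding hausdorff_dist_def using assms by (auto intro!: cSUP_least)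

lemma infdist_le_hausdorff_dist:
  assumes "bounded A" "B \<noteq> {}" "x \<in> A"
  shows "infdist x B \<le> hausdorff_dist A B"
proof -
  obtain b where b: "b \<in> B" using assms by blast
  obtain e where e: "\<And>y. y \<in> A \<Longrightarrow> dist b y \<le> e"
    using assms(1) bounded_any_center[of A b] by blast
  have "bdd_above ((\<lambda>x. infdist x B) ` A)"
    using e b by (intro bdd_aboveI2[where M = e]) (metis dist_commute infdist_le2)
  then have "infdist x B \<le> (SUP x\<in>A. infdist x B)"
    using assms(3) by (rule cSUP_upper2) auto
  then show ?thesis by (simp add: hausdorff_dist_def)
qed

lemma hausdorff_dist_eq_0_imp_subset:
  assumes "bounded A" "closed B" "B \<noteq> {}" "hausdorff_dist A B = 0"
  shows "A \<subseteq> B"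
proof
  fix x assume "x \<in> A"
  then have "infdist x B = 0"
    using infdist_le_hausdorff_dist[OF assms(1,3)] assms(4) infdist_nonneg[of x B]
    by (metis order_antisym)
  then show "x \<in> B"
    using assms in_closed_iff_infdist_zero by blast
qed

lemma infdist_le_hausdorff_dist_add:
  fixes A B C :: "'a::heine_borel set"
  assumes "bounded A" "compact B" "B \<noteq> {}" "C \<noteq> {}" "x \<in> A"
  shows "infdist x C \<le> hausdorff_dist A B + hausdorff_dist B C"
proof -
  obtain b where b: "b \<in> B" "infdist x B = dist x b"
    using infdist_attains_inf[of B x] assms compact_imp_closed by metis
  have "infdist x C \<le> infdist b C + dist x b"
    by (rule infdist_triangle)
  moreover have "infdist b C \<le> hausdorff_dist B C"
    using assms b by (intro infdist_le_hausdorff_dist compact_imp_bounded)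
  moreover have "dist x b \<le> hausdorff_dist A B"
    using infdist_le_hausdorff_dist[of A B x] assms b by simp
  ultimately show ?thesis by linarith
qed

text \<open>The empty set is excluded, as it has no finite Hausdorff distance to the other compact
  sets.\<close>

typedef disk_compact = "{K :: complex set. compact K \<and> K \<noteq> {} \<and> K \<subseteq> cball 0 1}"
  by (rule exI[of _ "{0}"]) auto

setup_lifting type_definition_disk_compact

instantiation disk_compact :: metric_space
begin

lift_definition dist_disk_compact :: "disk_compact \<Rightarrow> disk_compact \<Rightarrow> real"
  is hausdorff_dist .

definition uniformity_disk_compact :: "(disk_compact \<times> disk_compact) filter" where
  "uniformity_disk_compact = (INF e\<in>{0<..}. principal {(x, y). dist x y < e})"

definition open_disk_compact :: "disk_compact set \<Rightarrow> bool" where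
  "open_disk_compact S = (\<forall>x\<in>S. \<forall>\<^sub>F (x', y) in uniformity. x' = x \<longrightarrow> y \<in> S)"

instance
proof
  fix x y z :: disk_compact
  show "dist x y = 0 \<longleftrightarrow> x = y"
  proof
    assume "dist x y = 0"
    then show "x = y"
      by transfer (metis compact_imp_bounded compact_imp_closed hausdorff_dist_commute
          hausdorff_dist_eq_0_imp_subset subset_antisym)
  next
    assume "x = y"
    then show "dist x y = 0"
      by transfer (auto simp: hausdorff_dist_def)
  qed
  show "dist x y \<le> dist x z + dist y z"
  proof transfer
    fix x y z :: "complex set"
    assume *: "compact x \<and> x \<noteq> {} \<and> x \<subseteq> cball 0 1" "compact y \<and> y \<noteq> {} \<and> y \<subseteq> cball 0 1"
      "compact z \<and> z \<noteq> {} \<and> z \<subseteq> cball 0 1"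
    show "hausdorff_dist x y \<le> hausdorff_dist x z + hausdorff_dist y z"
    proof (rule hausdorff_dist_leI)
      show "infdist a y \<le> hausdorff_dist x z + hausdorff_dist y z" if "a \<in> x" for a
        using infdist_le_hausdorff_dist_add[of x z y a] * that
        by (simp add: compact_imp_bounded hausdorff_dist_commute)
      show "infdist a x \<le> hausdorff_dist x z + hausdorff_dist y z" if "a \<in> y" for a
        using infdist_le_hausdorff_dist_add[of y z x a] * that
        by (simp add: compact_imp_bounded hausdorff_dist_commute)
    qed (use * in auto)
  qed
qed (simp_all add: uniformity_disk_compact_def open_disk_compact_def)

end


subsection \<open>Convergence in distribution\<close>

text \<open>Random elements \<open>X n\<close> and \<open>Y\<close> of a topological space, possibly living on different
  probability spaces.\<close>

definition converges_in_distribution ::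
  "(nat \<Rightarrow> 'b measure) \<Rightarrow> (nat \<Rightarrow> 'b \<Rightarrow> 'a::topological_space) \<Rightarrow> 'c measure \<Rightarrow> ('c \<Rightarrow> 'a) \<Rightarrow> bool"
where
  "converges_in_distribution M X N Y \<longleftrightarrow>
     (\<forall>n. X n \<in> borel_measurable (M n)) \<and> Y \<in> borel_measurable N \<and>
     (\<forall>f :: 'a \<Rightarrow> real. continuous_on UNIV f \<longrightarrow> bounded (range f) \<longrightarrow>
        (\<lambda>n. \<integral>\<omega>. f (X n \<omega>) \<partial>M n) \<longlonglongrightarrow> (\<integral>\<omega>. f (Y \<omega>) \<partial>N))"


subsection \<open>The recursive lamination of the disk\<close>

definition uniform_circle :: "complex measure" where
  "uniform_circle =
     distr (uniform_measure lborel {0..2 * pi}) (restrict_space borel (sphere 0 1)) cis"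

text \<open>The sequences are indexed from 1, and \<open>L_seq u v 0\<close> is empty, so that
  \<open>L_seq u v 1\<close> is the chord joining \<open>u 1\<close> and \<open>v 1\<close>.\<close>

fun L_seq :: "(nat \<Rightarrow> complex) \<Rightarrow> (nat \<Rightarrow> complex) \<Rightarrow> nat \<Rightarrow> complex set" where
  "L_seq u v 0 = {}"
| "L_seq u v (Suc n) =
     (if closed_segment (u (Suc n)) (v (Suc n)) \<inter> L_seq u v n \<noteq> {} then L_seq u v n
      else L_seq u v n \<union> closed_segment (u (Suc n)) (v (Suc n)))"

definition L_inf :: "(nat \<Rightarrow> complex) \<Rightarrow> (nat \<Rightarrow> complex) \<Rightarrow> complex set" where
  "L_inf u v = closure (\<Union>n\<in>{1..}. L_seq u v n)"


subsection \<open>Diagonals of the regular polygon\<close>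

definition root_vertex :: "nat \<Rightarrow> nat \<Rightarrow> complex" where
  "root_vertex n k = exp (2 * \<i> * of_real pi * of_nat k / of_nat n)"

definition polygon_edges :: "nat \<Rightarrow> complex set set" where
  "polygon_edges n = {closed_segment (root_vertex n k) (root_vertex n (k + 1)) |k. k \<in> {1..n}}"

definition diagonals :: "nat \<Rightarrow> complex set set" where
  "diagonals n =
     {closed_segment x y |x y. x \<in> root_vertex n ` {1..n} \<and> y \<in> root_vertex n ` {1..n} \<and> x \<noteq> y}
     - polygon_edges n"

text \<open>A closed segment determines its unordered pair of endpoints. In particular every
  nondegenerate chord crosses itself, so a chord not crossing earlier ones is distinct from them.\<close>

definition chords_cross :: "complex set \<Rightarrow> complex set \<Rightarrow> bool" where
  "chords_cross c d \<longleftrightarrow>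
     (\<exists>x y x' y'. c = closed_segment x y \<and> d = closed_segment x' y' \<and>
        open_segment x y \<inter> open_segment x' y' \<noteq> {})"


subsection \<open>Uniform recursive triangulation of the polygon\<close>

text \<open>\<open>random_diagonals n k\<close> is the law of the list of the first \<open>k\<close> chords; it is meaningful
  for \<open>k \<le> n - 3\<close>, where the set of admissible diagonals at each step is nonempty.\<close>

fun random_diagonals :: "nat \<Rightarrow> nat \<Rightarrow> complex set list pmf" where
  "random_diagonals n 0 = return_pmf []"
| "random_diagonals n (Suc k) =
     do {
       cs \<leftarrow> random_diagonals n k;
       c \<leftarrow> pmf_of_set {d \<in> diagonals n. \<forall>c\<in>set cs. \<not> chords_cross d c};
       return_pmf (cs @ [c])
     }"


subsection \<open>Construction from a permutation\<close>

definition joinable :: "nat \<Rightarrow> complex set set \<Rightarrow> complex set \<Rightarrow> complex \<Rightarrow> complex \<Rightarrow> bool" where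
  "joinable n M F y x \<longleftrightarrow>
     x \<in> F \<and> closed_segment x y \<in> diagonals n \<and> (\<forall>c\<in>M. closed_segment x y \<inter> c = {})"

text \<open>\<open>matching_run n \<sigma> M F\<close> states that the chords \<open>M k\<close> and the free vertices \<open>F k\<close> arise
  from the permutation \<open>\<sigma>\<close>. The joinable free vertex is unique except when two neighbouring
  vertices are both free: if 1 and 2 are free in the pentagon, both can be joined to 4. A run may
  then use either vertex.\<close>

definition matching_run ::
  "nat \<Rightarrow> (nat \<Rightarrow> nat) \<Rightarrow> (nat \<Rightarrow> complex set set) \<Rightarrow> (nat \<Rightarrow> complex set) \<Rightarrow> bool"
where
  "matching_run n \<sigma> M F \<longleftrightarrow>
     M 0 = {} \<and> F 0 = {} \<and>
     (\<forall>k\<in>{1..n}. let y = root_vertex n (\<sigma> k) in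
        (\<exists>x. joinable n (M (k - 1)) (F (k - 1)) y x \<and>
             M k = M (k - 1) \<union> {closed_segment x y} \<and> F k = F (k - 1) - {x})
      \<or> ((\<nexists>x. joinable n (M (k - 1)) (F (k - 1)) y x) \<and>
             M k = M (k - 1) \<and> F k = F (k - 1) \<union> {y}))"

end

theory Submission
  imports Defs "HOL-Probability.Random_Permutations"
begin

text \<open>
The chords are described by the angles of their ends, so that crossing becomes the alternation
\<open>separates\<close> of four points in a linear order, for real angles and for vertices of the polygon alike.

All three models are compared with one random binary tree. A \<^emph>\<open>region\<close> is a maximal set of points that
are not ends of chords drawn so far and are not separated by them. A chord splits its region into two,
and the two parts evolve without influence on each other. Draw independent uniform pairs of vertices and
ignore each pair that does not lie in one region: the chords obtained in the end have the law \<open>region_law\<close>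
that splits a region by two uniform distinct points of it and recurses (\<open>completion_pair_run\<close>). Drawing
single vertices and joining the second one in a region to the first gives \<^emph>\<open>the same law\<close>
(\<open>completion_point_run\<close>), as the waiting vertex and its partner are again two uniform distinct points.
The pair model is the discrete analogue of \<open>L_inf\<close>, the point model that of the matching construction.

Both models run for all \<open>n\<close> on one probability space: independent uniform angles, rounded down to a
multiple of \<open>1 / n\<close>, give independent uniform vertices. For a fixed number of draws and large \<open>n\<close> the
rounded run is an order-isomorphic copy of the run with real angles (\<open>rounded_run\<close>). So a finite part
of the limit is already visible, and the later chords of the polygon do not cross it. They are forced to
be close to the limit if the limit is \<^emph>\<open>filling\<close>: its ends are dense and no four points of the circle stay
unseparated forever (\<open>filling_hausdorff_limit\<close>, by compactness).

Almost sure filling is the probabilistic core. A region that reaches four fixed arcs must survive many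
splits. A function of the masses of the arcs, \<open>lyap\<close>, plus a constant, contracts in mean at each split,
summed over those parts that still reach all four arcs (\<open>lyap_contraction\<close>). So the probability that such
a region exists at depth \<open>k\<close> decays geometrically, uniformly in \<open>n\<close> (\<open>prob_deep_alive_tree\<close>), and
\<open>AE_not_always_deep\<close> transfers this to the limit.

The triangulation and the uniform permutation are written as kernels applied to the same rounded draws:
keep the admissible diagonals of the first \<open>n - 3\<close> pairs and complete uniformly
(\<open>random_diagonals_greedy\<close>; rejection does not change the law), respectively drop repeated points and
complete uniformly (\<open>uniform_permutation_from_points\<close>). The kernels are supported near the limit, hence
dominated convergence gives the convergence of \<open>Lambda_n\<close> and of the tree law to \<open>L_inf\<close>. The matching
converges along the coupling to the lamination of the point model, and so does the tree law in its second
representation. The tree law thus identifies the law of that lamination with the law of \<open>L_inf\<close>.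
\<close>


section \<open>Chords of the circle in angular coordinates\<close>

definition arc_in :: "'a::linorder => 'a => 'a => bool" where
  "arc_in u v t \<longleftrightarrow> min u v < t \<and> t < max u v"

definition arc_out :: "'a::linorder => 'a => 'a => bool" where
  "arc_out u v t \<longleftrightarrow> t < min u v \<or> max u v < t"

definition separates :: "'a::linorder => 'a => 'a => 'a => bool" where
  "separates u v s t \<longleftrightarrow> (arc_in u v s \<and> arc_out u v t) \<or> (arc_out u v s \<and> arc_in u v t)"

lemmas side_defs = arc_in_def arc_out_def separates_def

lemma arc_in_commute: "arc_in u v = arc_in v u"
  by (auto simp: arc_in_def fun_eq_iff min_def max_def)

lemma arc_out_commute: "arc_out u v = arc_out v u"
  by (auto simp: arc_out_def fun_eq_iff min_def max_def)

lemma separates_swap_points: "separates u v s t \<longleftrightarrow> separates u v t s"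
  by (auto simp: separates_def)

lemma separates_swap_ends: "separates u v s t \<longleftrightarrow> separates v u s t"
  by (simp add: separates_def arc_in_commute[of u v] arc_out_commute[of u v])

lemma separates_sym: "separates u v s t \<longleftrightarrow> separates s t u v"
  unfolding side_defs by (auto simp: min_def max_def split: if_splits)

lemma arc_in_or_out:
  "t ~= u ==> t ~= v ==> arc_out u v t \<longleftrightarrow> \<not> arc_in u v t"
  by (auto simp: side_defs min_def max_def)

definition circ :: "real => complex" where
  "circ t = cis (2 * pi * t)"

abbreviation chord :: "real => real => complex set" where
  "chord s t \<equiv> closed_segment (circ s) (circ t)"

lemma norm_circ [simp]: "norm (circ t) = 1"
  by (simp add: circ_def)

lemma continuous_on_circ: "continuous_on A circ"
  unfolding circ_def by (intro continuous_intros)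

lemma isCont_circ: "isCont circ t"
  using continuous_on_circ[of UNIV] by (simp add: continuous_on_eq_continuous_at)

text \<open>The line through \<open>circ s\<close> and \<open>circ t\<close> is the zero set of this affine functional.\<close>

definition chordfun :: "real => real => complex => real" where
  "chordfun s t z = Re (z * cis (- (pi * (s + t)))) - cos (pi * (t - s))"

lemma chordfun_circ:
  "chordfun s t (circ r) = - 2 * sin (pi * (r - s)) * sin (pi * (r - t))"
proof -
  have "chordfun s t (circ r) = cos (pi * (r - s) + pi * (r - t)) - cos (pi * (r - s) - pi * (r - t))"
  by (simp add: chordfun_def circ_def cis_mult algebra_simps)
  also have "\<dots> = - 2 * sin (pi * (r - s)) * sin (pi * (r - t))"
  by (simp add: cos_add cos_diff)
  finally show ?thesis .
qed

lemma sin_pi_diff_pos: "0 < (x::real) ==> x < 1 ==> 0 < sin (pi * x)"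
  by (intro sin_gt_zero) auto

lemma sin_pi_diff_neg: "-1 < (x::real) ==> x < 0 ==> sin (pi * x) < 0"
  using sin_pi_diff_pos[of "- x"] by (simp add: )

lemma chordfun_ends [simp]: "chordfun s t (circ s) = 0" "chordfun s t (circ t) = 0"
  by (simp_all add: chordfun_circ)

lemma chordfun_pos:
  assumes "s \<in> {0..<1}" "t \<in> {0..<1}" "arc_in s t r"
  shows "0 < chordfun s t (circ r)"
proof (cases "s < t")
  case True
  then have "0 < sin (pi * (r - s))" "sin (pi * (r - t)) < 0"
  using assms by (auto simp: side_defs intro!: sin_pi_diff_pos sin_pi_diff_neg)
  then show ?thesis unfolding chordfun_circ by (simp add: mult_less_0_iff mult_pos_neg)
next
  case False
  then have "0 < sin (pi * (r - t))" "sin (pi * (r - s)) < 0"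
  using assms by (auto simp: side_defs intro!: sin_pi_diff_pos sin_pi_diff_neg)
  then show ?thesis unfolding chordfun_circ by (simp add: mult_less_0_iff mult_pos_neg)
qed

lemma chordfun_neg:
  assumes "s \<in> {0..<1}" "t \<in> {0..<1}" "r \<in> {0..<1}" "arc_out s t r"
  shows "chordfun s t (circ r) < 0"
proof (cases "r < min s t")
  case True
  then have "sin (pi * (r - t)) < 0" "sin (pi * (r - s)) < 0"
  using assms by (auto simp: side_defs intro!: sin_pi_diff_neg)
  then show ?thesis unfolding chordfun_circ by (simp add: mult_neg_neg)
next
  case False
  then have "0 < sin (pi * (r - t))" "0 < sin (pi * (r - s))"
  using assms by (auto simp: side_defs intro!: sin_pi_diff_pos)
  then show ?thesis unfolding chordfun_circ by simp
qed

lemma chordfun_affine: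
  "chordfun s t ((1 - a) *\<^sub>R x + a *\<^sub>R y) = (1 - a) * chordfun s t x + a * chordfun s t y"
  by (simp add: chordfun_def algebra_simps scaleR_conv_of_real)

lemma chordfun_chord: "z \<in> chord s t ==> chordfun s t z = 0"
  by (auto simp: closed_segment_def chordfun_affine)

text \<open>The affine functional of one chord has the same strict sign at both ends of the other chord.\<close>

lemma chords_disjoint:
  assumes "s \<in> {0..<1}" "t \<in> {0..<1}" "u \<in> {0..<1}" "v \<in> {0..<1}"
  and "u ~= s" "u ~= t" "v ~= s" "v ~= t" "\<not> separates s t u v"
  shows "chord s t \<inter> chord u v = {}"
proof -
  consider "arc_in s t u" "arc_in s t v" | "arc_out s t u" "arc_out s t v"
  using assms arc_in_or_out[of u s t] arc_in_or_out[of v s t] unfolding separates_def by blast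
  then have signs: "(0 < chordfun s t (circ u) \<and> 0 < chordfun s t (circ v)) \<or>
   (chordfun s t (circ u) < 0 \<and> chordfun s t (circ v) < 0)"
  using chordfun_pos[OF assms(1,2)] chordfun_neg[OF assms(1,2)] assms(3,4) by cases blast+
  have *: "chordfun s t z ~= 0" if "z \<in> chord u v" for z
  proof -
  from that obtain a where a: "0 \<le> a" "a \<le> 1" "z = (1 - a) *\<^sub>R circ u + a *\<^sub>R circ v"
   by (auto simp: closed_segment_def)
  have "chordfun s t z = (1 - a) * chordfun s t (circ u) + a * chordfun s t (circ v)"
   by (simp only: a(3) chordfun_affine)
  moreover have "0 < (1 - a) * p + a * q" if "0 < p" "0 < q" for p q :: real
   using that a(1,2) by (cases "a = 0") (simp_all add: add_nonneg_pos)
  moreover have "(1 - a) * p + a * q < 0" if "p < 0" "q < 0" for p q :: real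
   using that a(1,2) by (cases "a = 0") (simp_all add: add_nonpos_neg mult_nonneg_nonpos mult_pos_neg)
  ultimately show ?thesis
   using signs by (metis less_irrefl)
  qed
  then show ?thesis using chordfun_chord by blast
qed

lemma norm_open_segment_less:
  fixes x y z :: complex
  assumes "norm x = 1" "norm y = 1" "z \<in> open_segment x y"
  shows "norm z < 1"
proof -
  have "dist 0 z < max (dist 0 x) (dist 0 y)"
  using assms(3) dist_decreases_open_segment[of z x y 0]
  by (metis dist_commute less_max_iff_disj)
  then show ?thesis using assms by simp
qed

text \<open>The line through two points of the circle meets the open disk exactly in the open segment between them.\<close>

lemma open_segment_chordI:
  assumes "0 \<le> s" "s < t" "t < 1" "chordfun s t z = 0" "norm z < 1"
  shows "z \<in> open_segment (circ s) (circ t)"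
proof -
  define w where "w = z * cis (- (pi * (s + t)))"
  define d where "d = pi * (t - s)"
  have d: "0 < d" "d < pi" using assms by (auto simp: d_def)
  have sd: "0 < sin d" using d by (intro sin_gt_zero) auto
  have z: "z = w * cis (pi * (s + t))" by (simp add: w_def cis_mult mult.assoc)
  have re: "Re w = cos d" using assms(4) by (simp add: chordfun_def w_def d_def)
  have "norm w < 1" using assms(5) by (simp add: w_def norm_mult)
  then have "(cmod w)\<^sup>2 < 1" by (simp add: power_less_one_iff)
  then have "(cos d)\<^sup>2 + (Im w)\<^sup>2 < 1" using re by (simp add: cmod_power2)
  then have "(Im w)\<^sup>2 < (sin d)\<^sup>2" using sin_cos_squared_add[of d] by linarith
  then have im: "\<bar>Im w\<bar> < sin d" using sd
  by (intro power2_less_imp_less[of "\<bar>Im w\<bar>" "sin d"]) auto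
  define a where "a = (Im w + sin d) / (2 * sin d)"
  have a: "0 < a" "a < 1" using im sd by (auto simp: a_def field_simps abs_less_iff)
  have "w = (1 - a) *\<^sub>R cis (- d) + a *\<^sub>R cis d"
  proof (rule complex_eqI)
  show "Re w = Re ((1 - a) *\<^sub>R cis (- d) + a *\<^sub>R cis d)" by (simp add: re algebra_simps)
  show "Im w = Im ((1 - a) *\<^sub>R cis (- d) + a *\<^sub>R cis d)"
   using sd by (simp add: a_def field_simps)
  qed
  then have "z = ((1 - a) *\<^sub>R cis (- d) + a *\<^sub>R cis d) * cis (pi * (s + t))"
  using z by simp
  then have "z = (1 - a) *\<^sub>R (cis (- d) * cis (pi * (s + t))) + a *\<^sub>R (cis d * cis (pi * (s + t)))"
  by (simp add: distrib_right)
  moreover have "cis (- d) * cis (pi * (s + t)) = circ s" "cis d * cis (pi * (s + t)) = circ t"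
  by (auto simp: cis_mult circ_def d_def algebra_simps)
  ultimately have "z = (1 - a) *\<^sub>R circ s + a *\<^sub>R circ t" by simp
  moreover have "circ s ~= circ t"
  proof
  assume "circ s = circ t"
  then have "cis (-d) * cis (pi * (s + t)) = cis d * cis (pi * (s + t))"
   using \<open>cis (- d) * cis (pi * (s + t)) = circ s\<close> \<open>cis d * cis (pi * (s + t)) = circ t\<close>
   by simp
  then have "cis (-d) = cis d" by (simp only: mult_cancel_right cis_neq_zero simp_thms)
  then have "Im (cis (-d)) = Im (cis d)" by simp
  then show False using sd by simp
  qed
  ultimately show ?thesis using a by (auto simp: in_segment)
qed

lemma circ_inj_on: "inj_on circ {0..<1}"
proof (rule inj_onI)
  fix x y :: real assume "x \<in> {0..<1}" "y \<in> {0..<1}" "circ x = circ y"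
  moreover have "circ s ~= circ t" if "0 \<le> s" "s < t" "t < 1" for s t :: real
  proof
  assume *: "circ s = circ t"
  have "arc_in s t ((s+t)/2)" using that by (auto simp: side_defs)
  from chordfun_pos[OF _ _ this] have "0 < chordfun s t (circ ((s+t)/2))" using that by auto
  have "sin (pi * (t - s)) > 0" using that by (intro sin_pi_diff_pos) auto
  have "cis (2 * pi * (t - s)) = 1"
   using * unfolding circ_def by (simp add: right_diff_distrib cis_divide[symmetric])
  then have "cos (2 * (pi * (t - s))) = 1"
   by (simp add: complex_eq_iff mult.assoc)
  then show False using \<open>sin (pi * (t - s)) > 0\<close> by (simp add: cos_double_sin)
  qed
  ultimately show "x = y" by (metis atLeastLessThan_iff linorder_neqE)
qed

lemma separates_imp_open_segments_meet:
  assumes "s \<in> {0..<1}" "t \<in> {0..<1}" "u \<in> {0..<1}" "v \<in> {0..<1}" "separates s t u v"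
  shows "open_segment (circ s) (circ t) \<inter> open_segment (circ u) (circ v) ~= {}"
proof -
  have main: "open_segment (circ s) (circ t) \<inter> open_segment (circ u) (circ v) ~= {}"
  if st: "s < t" "s \<in> {0..<1}" "t \<in> {0..<1}" and uv: "u \<in> {0..<1}" "v \<in> {0..<1}"
   and ins: "arc_in s t u" and outs: "arc_out s t v" for s t u v
  proof -
  define p where "p = chordfun s t (circ u)"
  define q where "q = chordfun s t (circ v)"
  have p: "p > 0" and q: "q < 0"
   unfolding p_def q_def using st uv ins outs by (auto intro!: chordfun_pos chordfun_neg)
  define a where "a = p / (p - q)"
  define z where "z = (1 - a) *\<^sub>R circ u + a *\<^sub>R circ v"
  have a: "0 < a" "a < 1" using p q by (auto simp: a_def field_simps)
  have "u ~= v" using ins outs by (auto simp: side_defs)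
  then have "circ u ~= circ v" using circ_inj_on uv by (auto dest: inj_onD)
  then have z: "z \<in> open_segment (circ u) (circ v)" using a by (auto simp: in_segment z_def)
  have "chordfun s t z = (1 - a) * p + a * q" by (simp add: z_def p_def q_def chordfun_affine)
  also have "\<dots> = 0" using p q by (simp add: a_def field_simps)
  finally have "z \<in> open_segment (circ s) (circ t)"
   using st norm_open_segment_less[OF _ _ z] by (intro open_segment_chordI) auto
  then show ?thesis using z by blast
  qed
  have main2: "open_segment (circ s) (circ t) \<inter> open_segment (circ u) (circ v) ~= {}"
  if "s \<in> {0..<1}" "t \<in> {0..<1}" "u \<in> {0..<1}" "v \<in> {0..<1}" "arc_in s t u" "arc_out s t v" for s t u v
  proof (cases "s < t")
  case True then show ?thesis using main that by blast
  next
  case False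
  then have "t < s" using that by (auto simp: side_defs)
  then show ?thesis using main[of t s u v] that
   by (simp add: arc_in_commute arc_out_commute open_segment_commute)
  qed
  show ?thesis using assms(5) main2[of s t u v] main2[of s t v u] assms
  by (auto simp: separates_def open_segment_commute)
qed


section \<open>Successive splitting of regions by chords\<close>

text \<open>A region carries its points, in the point model the point that waits for a partner, and the number of
  splits that led to it. A node records a split: the region, its depth and the two ends of the chord.\<close>

type_synonym 'a region = "'a set \<times> 'a option \<times> nat"
type_synonym 'a node = "'a set \<times> nat \<times> 'a \<times> 'a"

definition in_part :: "'a::linorder set => 'a => 'a => 'a set" where
  "in_part X u v = {t \<in> X. arc_in u v t}"

definition out_part :: "'a::linorder set => 'a => 'a => 'a set" where
  "out_part X u v = {t \<in> X. arc_out u v t}"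

definition split_region :: "'a::linorder set => nat => 'a => 'a => 'a node set \<times> 'a region list" where
  "split_region X j u v =
   ({(X, j, u, v)}, [(in_part X u v, None, Suc j), (out_part X u v, None, Suc j)])"

fun pair_move :: "'a::linorder \<times> 'a => 'a region => 'a node set \<times> 'a region list" where
  "pair_move (u, v) (X, p, j) =
   (if u \<in> X \<and> v \<in> X \<and> u ~= v then split_region X j u v else ({}, [(X, p, j)]))"

fun point_move :: "'a::linorder => 'a region => 'a node set \<times> 'a region list" where
  "point_move y (X, p, j) =
   (if y \<notin> X then ({}, [(X, p, j)])
   else case p of None => ({}, [(X, Some y, j)])
      | Some x => if x = y then ({}, [(X, p, j)]) else split_region X j x y)"

type_synonym 'a state = "'a node set \<times> 'a region list"

definition step ::
  "('d => 'a region => 'a node set \<times> 'a region list) => 'd => 'a state => 'a state" where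
  "step S d s = (fst s \<union> (\<Union>r\<in>set (snd s). fst (S d r)), concat (map (\<lambda>r. snd (S d r)) (snd s)))"

abbreviation run ::
  "('d => 'a region => 'a node set \<times> 'a region list) => 'd list => 'a state => 'a state" where
  "run S \<equiv> fold (step S)"

definition start :: "'a set => 'a state" where
  "start X = ({}, [(X, None, 0)])"

definition chords_of :: "'a node set => ('a \<times> 'a) set" where
  "chords_of H = (\<lambda>n. snd (snd n)) ` H"

definition ends :: "('a \<times> 'a) set => 'a set" where
  "ends C = fst ` C \<union> snd ` C"

definition pend_ok :: "'a region => bool" where
  "pend_ok r \<longleftrightarrow> (\<forall>x. fst (snd r) = Some x --> x \<in> fst r)"

text \<open>The only features of a move that the invariants use: it may change the waiting point of a region, or
  split the region by a chord between two of its points.\<close>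

definition proper_move :: "'a::linorder region => 'a node set \<times> 'a region list => bool" where
  "proper_move r m \<longleftrightarrow>
   (\<exists>p. m = ({}, [(fst r, p, snd (snd r))]) \<and> (\<forall>x. p = Some x --> x \<in> fst r)) \<or>
   (\<exists>u v. u \<in> fst r \<and> v \<in> fst r \<and> u ~= v \<and> m = split_region (fst r) (snd (snd r)) u v)"

lemma chords_of_simps [simp]:
  "chords_of {} = {}" "chords_of (A \<union> B) = chords_of A \<union> chords_of B"
  "chords_of (insert (X, j, c) A) = insert c (chords_of A)"
  "chords_of (\<Union>r\<in>I. f r) = (\<Union>r\<in>I. chords_of (f r))"
  by (auto simp: chords_of_def)

lemma ends_simps [simp]:
  "ends {} = {}" "ends (A \<union> B) = ends A \<union> ends B" "ends (insert (u, v) A) = {u, v} \<union> ends A"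
  by (auto simp: ends_def)

lemma endsI: "(u, v) \<in> C ==> u \<in> ends C" "(u, v) \<in> C ==> v \<in> ends C"
  by (force simp: ends_def)+

lemma pair_move_proper: "pend_ok r ==> proper_move r (pair_move d r)"
  by (cases d; cases r) (auto simp: proper_move_def pend_ok_def)

lemma point_move_proper: "pend_ok r ==> proper_move r (point_move y r)"
  by (cases r) (auto simp: proper_move_def pend_ok_def split: option.split)

lemma in_part_subset: "in_part X u v \<subseteq> X" and out_part_subset: "out_part X u v \<subseteq> X"
  by (auto simp: in_part_def out_part_def)

lemma arc_in_imp_not_out: "arc_in u v t ==> \<not> arc_out u v t"
  unfolding arc_in_def arc_out_def by (meson less_asym)

lemma not_arc_ends [simp]: "\<not> arc_in u v u" "\<not> arc_in u v v" "\<not> arc_out u v u" "\<not> arc_out u v v"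
  by (auto simp: arc_in_def arc_out_def min_def max_def)

lemma ends_notin_parts [simp]:
  "u \<notin> in_part X u v" "v \<notin> in_part X u v" "u \<notin> out_part X u v" "v \<notin> out_part X u v"
  by (auto simp: in_part_def out_part_def)

lemma parts_disjoint: "in_part X u v \<inter> out_part X u v = {}"
  using arc_in_imp_not_out by (auto simp: in_part_def out_part_def)

lemma proper_move_subset:
  "proper_move r m ==> r' \<in> set (snd m) ==> fst r' \<subseteq> fst r"
  by (auto simp: proper_move_def split_region_def in_part_def out_part_def)

lemma proper_move_disjoint:
  "proper_move r m ==> sorted_wrt (\<lambda>r r'. fst r \<inter> fst r' = {}) (snd m)"
  by (auto simp: proper_move_def split_region_def parts_disjoint)

lemma proper_move_pend_ok: "proper_move r m ==> r' \<in> set (snd m) ==> pend_ok r'"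
  by (auto simp: proper_move_def split_region_def pend_ok_def)

lemma proper_move_chords:
  "proper_move r m ==> (u, v) \<in> chords_of (fst m) ==> u \<in> fst r \<and> v \<in> fst r \<and> u ~= v"
  by (auto simp: proper_move_def split_region_def)

lemma proper_move_ends:
  "proper_move r m ==> r' \<in> set (snd m) ==> fst r' \<inter> ends (chords_of (fst m)) = {}"
  by (auto simp: proper_move_def split_region_def)

lemma proper_move_same_part:
  assumes "proper_move r m" "s \<in> fst r" "t \<in> fst r"
  "s \<notin> ends (chords_of (fst m))" "t \<notin> ends (chords_of (fst m))"
  shows "(\<exists>r'\<in>set (snd m). s \<in> fst r' \<and> t \<in> fst r') \<longleftrightarrow>
  (\<forall>(u, v)\<in>chords_of (fst m). \<not> separates u v s t)"
  using assms(1) unfolding proper_move_def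
proof (elim disjE exE conjE)
  fix p assume "m = ({}, [(fst r, p, snd (snd r))])"
  then show ?thesis using assms by auto
next
  fix u v assume m: "m = split_region (fst r) (snd (snd r)) u v"
  have "s ~= u" "s ~= v" "t ~= u" "t ~= v" using assms(4,5) m by (auto simp: split_region_def)
  then show ?thesis
  using assms(2,3) arc_in_or_out[of s u v] arc_in_or_out[of t u v]
  by (auto simp: m split_region_def in_part_def out_part_def separates_def)
qed

lemma not_separates_across:
  fixes a b :: "'a::linorder"
  assumes "a < s" "s < b" "a < t" "t < b" "u < a \<or> b < u" "v < a \<or> b < v"
  shows "\<not> separates u v s t"
proof -
  have "\<not> separates u v s t" if "a < s" "s < b" "a < t" "t < b" "u < a \<or> b < u" "v < a \<or> b < v" "u \<le> v" for u v
  using that unfolding side_defs by (elim disjE) (auto simp: min_absorb1 max_absorb2)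
  then show ?thesis using assms separates_swap_ends[of u v s t] linear[of u v] by blast
qed

text \<open>If a chord has one pair of points on one side and a second pair on the other, then the chord
  through the first pair does not separate the second pair.\<close>

lemma not_separates_if_separated:
  assumes "separates p q s u" "\<not> separates p q s t" "\<not> separates p q u v"
  "t ~= p" "t ~= q" "v ~= p" "v ~= q"
  shows "\<not> separates u v s t"
proof -
  have t: "arc_out p q t \<longleftrightarrow> \<not> arc_in p q t" and v: "arc_out p q v \<longleftrightarrow> \<not> arc_in p q v"
  using assms arc_in_or_out by blast+
  consider "arc_in p q s" "arc_in p q t" "arc_out p q u" "arc_out p q v"
  | "arc_out p q s" "arc_out p q t" "arc_in p q u" "arc_in p q v"
  using assms(1-3) t v unfolding separates_def by blast
  then show ?thesis
  proof cases
  case 1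
  then show ?thesis
   using not_separates_across[of "min p q" s "max p q" t u v] unfolding arc_in_def arc_out_def by blast
  next
  case 2
  then show ?thesis
   using not_separates_across[of "min p q" u "max p q" v s t] separates_sym[of u v s t]
   unfolding arc_in_def arc_out_def by blast
  qed
qed

text \<open>The regions are disjoint, and two points that are not ends of chords share a region exactly if no chord
  separates them.\<close>

definition consistent :: "'a::linorder set => 'a state => bool" where
  "consistent X0 s \<longleftrightarrow>
   sorted_wrt (\<lambda>r r'. fst r \<inter> fst r' = {}) (snd s) \<and>
   (\<forall>r\<in>set (snd s). fst r \<subseteq> X0 - ends (chords_of (fst s)) \<and> pend_ok r) \<and>
   (\<forall>x\<in>X0 - ends (chords_of (fst s)). \<forall>y\<in>X0 - ends (chords_of (fst s)).
    (\<exists>r\<in>set (snd s). x \<in> fst r \<and> y \<in> fst r) \<longleftrightarrow>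
    (\<forall>(u, v)\<in>chords_of (fst s). \<not> separates u v x y)) \<and>
   (\<forall>(u, v)\<in>chords_of (fst s). u \<in> X0 \<and> v \<in> X0 \<and> u ~= v) \<and>
   (\<forall>(u, v)\<in>chords_of (fst s). \<forall>(u', v')\<in>chords_of (fst s). \<not> separates u v u' v')"

lemma consistent_start: "consistent X (start X)"
  by (auto simp: consistent_def start_def pend_ok_def)

lemma sorted_wrt_concat_map:
  assumes "\<And>x. x \<in> set xs ==> sorted_wrt R (f x)"
  and "\<And>x y a b. x \<in> set xs ==> y \<in> set xs ==> Q x y ==> a \<in> set (f x) ==> b \<in> set (f y) ==> R a b"
  and "sorted_wrt Q xs"
  shows "sorted_wrt R (concat (map f xs))"
  using assms
proof (induction xs)
  case (Cons x xs)
  have "sorted_wrt R (concat (map f xs))"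
  proof (rule Cons.IH)
  show "sorted_wrt R (f y)" if "y \<in> set xs" for y using Cons.prems(1) that by simp
  show "R a b" if "y \<in> set xs" "z \<in> set xs" "Q y z" "a \<in> set (f y)" "b \<in> set (f z)" for y z a b
   using that by (intro Cons.prems(2)[of y z]) auto
  show "sorted_wrt Q xs" using Cons.prems(3) by simp
  qed
  moreover have "R a b" if "a \<in> set (f x)" "y \<in> set xs" "b \<in> set (f y)" for a b y
  using Cons.prems(3) that by (intro Cons.prems(2)[of x y]) auto
  ultimately show ?case using Cons.prems(1) by (auto simp: sorted_wrt_append)
qed simp

lemma sorted_wrt_disjoint_value:
  assumes "sorted_wrt (\<lambda>r r'. fst r \<inter> fst r' = {}) xs" "r \<in> set xs" "r' \<in> set xs"
  "x \<in> fst r" "x \<in> fst r'"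
  shows "r = r'"
proof (rule ccontr)
  assume ne: "r ~= r'"
  obtain i j where ij: "i < length xs" "xs ! i = r" "j < length xs" "xs ! j = r'"
  using assms(2,3) by (meson in_set_conv_nth)
  then have "i ~= j" using ne by auto
  then have "fst r \<inter> fst r' = {}"
  using ij assms(1) unfolding sorted_wrt_iff_nth_less by (metis inf_commute linorder_neqE_nat)
  then show False using assms by auto
qed

lemma consistent_step:
  assumes cons: "consistent X0 s" and pr: "\<And>r. r \<in> set (snd s) ==> proper_move r (S d r)"
  shows "consistent X0 (step S d s)"
proof -
  define H where "H = chords_of (fst s)"
  define R where "R = set (snd s)"
  define N where "N r = chords_of (fst (S d r))" for r
  define H' where "H' = H \<union> (\<Union>r\<in>R. N r)"
  have H': "chords_of (fst (step S d s)) = H'" by (simp add: step_def H'_def H_def R_def N_def)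
  have R': "set (snd (step S d s)) = (\<Union>r\<in>R. set (snd (S d r)))" by (simp add: step_def R_def)
  have pr: "proper_move r (S d r)" if "r \<in> R" for r using pr that by (simp add: R_def)
  have c1: "sorted_wrt (\<lambda>r r'. fst r \<inter> fst r' = {}) (snd s)"
  and c2: "\<And>r. r \<in> R ==> fst r \<subseteq> X0 - ends H"
  and c3: "\<And>x y. x \<in> X0 - ends H ==> y \<in> X0 - ends H ==>
    (\<exists>r\<in>R. x \<in> fst r \<and> y \<in> fst r) \<longleftrightarrow> (\<forall>(u, v)\<in>H. \<not> separates u v x y)"
  and c4: "\<And>u v. (u, v) \<in> H ==> u \<in> X0 \<and> v \<in> X0 \<and> u ~= v"
  and c5: "\<And>u v u' v'. (u, v) \<in> H ==> (u', v') \<in> H ==> \<not> separates u v u' v'"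
  using cons unfolding consistent_def H_def R_def by blast+
  have uniq: "r = r'" if "r \<in> R" "r' \<in> R" "x \<in> fst r" "x \<in> fst r'" for r r' x
  using sorted_wrt_disjoint_value[OF c1] that unfolding R_def by blast
  have Nr: "u \<in> fst r \<and> v \<in> fst r \<and> u ~= v" if "r \<in> R" "(u, v) \<in> N r" for r u v
  using proper_move_chords[OF pr[OF that(1)]] that(2) unfolding N_def by blast
  have across: "\<not> separates u v x y"
  if r: "r \<in> R" "x \<in> fst r" "y \<in> fst r" and r2: "r2 \<in> R" "u \<in> fst r2" "v \<in> fst r2" "r2 ~= r" for r r2 x y u v
  proof -
  have mem: "x \<in> X0 - ends H" "y \<in> X0 - ends H" "u \<in> X0 - ends H" "v \<in> X0 - ends H"
   using c2 r r2 by blast+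
  have "\<not> (\<exists>r3\<in>R. x \<in> fst r3 \<and> u \<in> fst r3)" using uniq r r2 by metis
  then obtain p q where pq: "(p, q) \<in> H" "separates p q x u"
   using c3[OF mem(1,3)] by blast
  have "\<not> separates p q x y" using c3[OF mem(1,2)] r pq by blast
  moreover have "\<not> separates p q u v" using c3[OF mem(3,4)] r2 pq by blast
  ultimately show ?thesis
   using pq mem endsI[OF pq(1)] not_separates_if_separated[of p q x u y v] by blast
  qed
  have ends': "ends H \<subseteq> ends H'" by (auto simp: H'_def ends_def)
  have endsN: "ends (N r) \<subseteq> ends H'" if "r \<in> R" for r using that by (auto simp: H'_def ends_def)
  have endsN_sub: "ends (N r) \<subseteq> fst r" if "r \<in> R" for r
  using Nr[OF that] by (force simp: ends_def)
  have eH': "ends H' = ends H \<union> (\<Union>r\<in>R. ends (N r))" by (auto simp: H'_def ends_def)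
  have "sorted_wrt (\<lambda>r r'. fst r \<inter> fst r' = {}) (snd (step S d s))"
  unfolding step_def snd_conv
  proof (rule sorted_wrt_concat_map[OF _ _ c1])
  show "sorted_wrt (\<lambda>r r'. fst r \<inter> fst r' = {}) (snd (S d r))" if "r \<in> set (snd s)" for r
   using proper_move_disjoint[OF pr[of r]] that unfolding R_def by blast
  fix x y a b assume "x \<in> set (snd s)" "y \<in> set (snd s)" "fst x \<inter> fst y = {}"
   "a \<in> set (snd (S d x))" "b \<in> set (snd (S d y))"
  then show "fst a \<inter> fst b = {}"
   using proper_move_subset[OF pr[of x]] proper_move_subset[OF pr[of y]] unfolding R_def by blast
  qed
  moreover have "fst r' \<subseteq> X0 - ends H' \<and> pend_ok r'" if r': "r' \<in> set (snd (step S d s))" for r'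
  proof -
  from r' obtain r where r: "r \<in> R" "r' \<in> set (snd (S d r))" unfolding R' by blast
  have sub: "fst r' \<subseteq> fst r" using proper_move_subset[OF pr] r by blast
  have "fst r' \<inter> ends (N r) = {}" using proper_move_ends[OF pr] r unfolding N_def by blast
  moreover have "fst r' \<inter> ends (N r2) = {}" if "r2 \<in> R" "r2 ~= r" for r2
   using endsN_sub[OF that(1)] sub uniq[OF that(1) r(1)] that(2) by blast
  ultimately have "fst r' \<subseteq> X0 - ends H'"
   using c2[OF r(1)] sub unfolding eH' by blast
  then show ?thesis using proper_move_pend_ok[OF pr] r by blast
  qed
  moreover have "(\<exists>r'\<in>set (snd (step S d s)). x \<in> fst r' \<and> y \<in> fst r') \<longleftrightarrow>
   (\<forall>(u, v)\<in>H'. \<not> separates u v x y)" if xy: "x \<in> X0 - ends H'" "y \<in> X0 - ends H'" for x y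
  proof
  assume "\<exists>r'\<in>set (snd (step S d s)). x \<in> fst r' \<and> y \<in> fst r'"
  then obtain r r' where r: "r \<in> R" "r' \<in> set (snd (S d r))" "x \<in> fst r'" "y \<in> fst r'"
   unfolding R' by blast
  have mem: "x \<in> fst r" "y \<in> fst r" using proper_move_subset[OF pr[OF r(1)] r(2)] r by auto
  have old: "\<forall>(u, v)\<in>H. \<not> separates u v x y"
   using c3[of x y] xy ends' mem r(1) by blast
  have "\<forall>(u, v)\<in>N r. \<not> separates u v x y"
   using proper_move_same_part[OF pr[OF r(1)] mem] endsN[OF r(1)] xy r unfolding N_def by blast
  moreover have "\<not> separates u v x y" if "r2 \<in> R" "r2 ~= r" "(u, v) \<in> N r2" for r2 u v
   using across[OF r(1) mem that(1)] Nr[OF that(1,3)] that(2) by blast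
  ultimately show "\<forall>(u, v)\<in>H'. \<not> separates u v x y"
   using old unfolding H'_def by blast
  next
  assume new: "\<forall>(u, v)\<in>H'. \<not> separates u v x y"
  then obtain r where r: "r \<in> R" "x \<in> fst r" "y \<in> fst r"
   using c3[of x y] xy ends' unfolding H'_def by blast
  have "\<forall>(u, v)\<in>N r. \<not> separates u v x y" using new r unfolding H'_def by blast
  then show "\<exists>r'\<in>set (snd (step S d s)). x \<in> fst r' \<and> y \<in> fst r'"
   using proper_move_same_part[OF pr[OF r(1)] r(2,3)] endsN[OF r(1)] xy r(1) unfolding N_def R' by blast
  qed
  moreover have "u \<in> X0 \<and> v \<in> X0 \<and> u ~= v" if "(u, v) \<in> H'" for u v
  using that c4 Nr c2 unfolding H'_def by blast
  moreover have "\<not> separates u v u' v'" if uv: "(u, v) \<in> H'" "(u', v') \<in> H'" for u v u' v'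
  proof -
  have on: "\<not> separates a b a' b'" if ab: "(a, b) \<in> H" "r \<in> R" "(a', b') \<in> N r" for a b a' b' r
  proof -
   have "a' \<in> X0 - ends H" "b' \<in> X0 - ends H" using Nr[OF ab(2,3)] c2[OF ab(2)] by auto
   then show ?thesis using c3[of a' b'] Nr[OF ab(2,3)] ab by blast
  qed
  have nn: "\<not> separates a b a' b'"
   if ab: "r \<in> R" "(a, b) \<in> N r" "r' \<in> R" "(a', b') \<in> N r'" for a b a' b' r r'
  proof (cases "r = r'")
   case True
   then have "a' = a" "b' = b"
    using ab pr[OF ab(1)] by (auto simp: N_def proper_move_def split_region_def)
   then show ?thesis by (simp add: separates_def)
  next
   case False
   then show ?thesis using across[OF ab(3) _ _ ab(1)] Nr[OF ab(1,2)] Nr[OF ab(3,4)] by blast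
  qed
  have no: "\<not> separates a b a' b'" if "r \<in> R" "(a, b) \<in> N r" "(a', b') \<in> H" for a b a' b' r
   using on[OF that(3,1,2)] separates_sym[of a b a' b'] by simp
  show ?thesis using uv c5 on no nn unfolding H'_def by blast
  qed
  ultimately show ?thesis unfolding consistent_def H' by blast
qed

lemma consistent_run:
  assumes "\<And>d r. pend_ok r ==> proper_move r (S d r)" "consistent X0 s"
  shows "consistent X0 (run S ds s)"
  using assms(2)
proof (induction ds arbitrary: s)
  case (Cons d ds)
  have "proper_move r (S d r)" if "r \<in> set (snd s)" for r
  using Cons.prems that by (intro assms(1)) (auto simp: consistent_def)
  then show ?case using Cons by (simp add: consistent_step)
qed simp

subsection \<open>Order-preserving relabelling\<close>

text \<open>A run is determined by the order of its draws. The set \<open>D\<close> on which the relabelling \<open>\<phi>\<close> is monotone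
  only needs to contain the draws and the points that are observed later.\<close>

definition region_match :: "('a => 'b) => 'a set => 'a region => 'b region => bool" where
  "region_match \<phi> D r r' \<longleftrightarrow> snd (snd r') = snd (snd r) \<and> fst (snd r') = map_option \<phi> (fst (snd r)) \<and>
   set_option (fst (snd r)) \<subseteq> D \<and> (\<forall>t\<in>D. t \<in> fst r \<longleftrightarrow> \<phi> t \<in> fst r')"

definition state_match :: "('a => 'b) => 'a set => 'a state => 'b state => bool" where
  "state_match \<phi> D s s' \<longleftrightarrow> chords_of (fst s') = map_prod \<phi> \<phi> ` chords_of (fst s) \<and>
   list_all2 (region_match \<phi> D) (snd s) (snd s')"

definition move_match :: "('a => 'b) => 'a set => 'a node set \<times> 'a region list =>
  'b node set \<times> 'b region list => bool" where
  "move_match \<phi> D m m' \<longleftrightarrow> chords_of (fst m') = map_prod \<phi> \<phi> ` chords_of (fst m) \<and>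
   list_all2 (region_match \<phi> D) (snd m) (snd m')"

lemma strict_mono_on_arc:
  fixes \<phi> :: "'a::linorder => 'b::linorder"
  assumes "strict_mono_on D \<phi>" "u \<in> D" "v \<in> D" "t \<in> D"
  shows "arc_in (\<phi> u) (\<phi> v) (\<phi> t) \<longleftrightarrow> arc_in u v t" "arc_out (\<phi> u) (\<phi> v) (\<phi> t) \<longleftrightarrow> arc_out u v t"
proof -
  have lt: "\<phi> a < \<phi> b \<longleftrightarrow> a < b" if "a \<in> D" "b \<in> D" for a b
  using strict_mono_on_less[OF assms(1)] that by blast
  have "min (\<phi> u) (\<phi> v) = \<phi> (min u v)" "max (\<phi> u) (\<phi> v) = \<phi> (max u v)"
  using lt[of u v] lt[of v u] assms by (auto simp: min_def max_def not_le[symmetric])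
  moreover have "min u v \<in> D" "max u v \<in> D" using assms by (auto simp: min_def max_def)
  ultimately show "arc_in (\<phi> u) (\<phi> v) (\<phi> t) \<longleftrightarrow> arc_in u v t" "arc_out (\<phi> u) (\<phi> v) (\<phi> t) \<longleftrightarrow> arc_out u v t"
  using lt assms by (auto simp: arc_in_def arc_out_def)
qed

lemma split_region_match:
  assumes "strict_mono_on D \<phi>" "u \<in> D" "v \<in> D" "\<And>t. t \<in> D ==> t \<in> X \<longleftrightarrow> \<phi> t \<in> X'"
  shows "move_match \<phi> D (split_region X j u v) (split_region X' j (\<phi> u) (\<phi> v))"
  using assms strict_mono_on_arc[OF assms(1-3)]
  by (auto simp: move_match_def split_region_def region_match_def in_part_def out_part_def)

lemma pair_move_match:
  assumes "strict_mono_on D \<phi>" "fst d \<in> D" "snd d \<in> D" "region_match \<phi> D r r'"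
  shows "move_match \<phi> D (pair_move d r) (pair_move (map_prod \<phi> \<phi> d) r')"
proof -
  obtain u v where d: "d = (u, v)" by (cases d)
  obtain X p j where r: "r = (X, p, j)" by (cases r)
  obtain X' where r': "r' = (X', map_option \<phi> p, j)"
  using assms(4) by (cases r') (auto simp: region_match_def r)
  have "\<phi> u = \<phi> v \<longleftrightarrow> u = v"
  using assms(1-3) strict_mono_on_imp_inj_on[OF assms(1)] by (auto simp: d dest: inj_onD)
  moreover have "t \<in> X \<longleftrightarrow> \<phi> t \<in> X'" if "t \<in> D" for t
  using assms(4) that by (auto simp: region_match_def r r')
  ultimately show ?thesis
  using split_region_match[of D \<phi> u v X X' j] assms
  by (auto simp: d r r') (auto simp: move_match_def)
qed

lemma point_move_match:
  assumes "strict_mono_on D \<phi>" "y \<in> D" "region_match \<phi> D r r'"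
  shows "move_match \<phi> D (point_move y r) (point_move (\<phi> y) r')"
proof -
  obtain X p j where r: "r = (X, p, j)" by (cases r)
  obtain X' where r': "r' = (X', map_option \<phi> p, j)"
  using assms(3) by (cases r') (auto simp: region_match_def r)
  have XX': "t \<in> X \<longleftrightarrow> \<phi> t \<in> X'" if "t \<in> D" for t
  using assms(3) that by (auto simp: region_match_def r r')
  have pD: "x \<in> D" if "p = Some x" for x using assms(3) that by (auto simp: region_match_def r)
  have "\<phi> x = \<phi> y \<longleftrightarrow> x = y" if "x \<in> D" for x
  using assms(1,2) that strict_mono_on_imp_inj_on[OF assms(1)] by (auto dest: inj_onD)
  then show ?thesis
  using split_region_match[of D \<phi> _ y X X' j] assms XX' pD
  by (auto simp: r r' split: option.split) (auto simp: move_match_def region_match_def)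
qed

lemma state_match_step:
  assumes "state_match \<phi> D s s'"
  and "\<And>r r'. region_match \<phi> D r r' ==> move_match \<phi> D (S d r) (S' d' r')"
  shows "state_match \<phi> D (step S d s) (step S' d' s')"
proof -
  have "chords_of (\<Union>r\<in>set rs'. fst (S' d' r)) = map_prod \<phi> \<phi> ` chords_of (\<Union>r\<in>set rs. fst (S d r)) \<and>
   list_all2 (region_match \<phi> D) (concat (map (\<lambda>r. snd (S d r)) rs)) (concat (map (\<lambda>r. snd (S' d' r)) rs'))"
  if "list_all2 (region_match \<phi> D) rs rs'" for rs rs'
  using that
  proof (induction rule: list_all2_induct)
  case (Cons r rs r' rs')
  then show ?case using assms(2)[OF Cons(1)]
   by (auto simp: move_match_def image_Un intro!: list_all2_appendI)
  qed auto
  from this[of "snd s" "snd s'"] show ?thesis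
  using assms(1) unfolding state_match_def step_def by (simp add: image_Un)
qed

lemma state_match_run:
  assumes "state_match \<phi> D s s'"
  and "\<And>d r r'. d \<in> set ds ==> region_match \<phi> D r r' ==> move_match \<phi> D (S d r) (S' (\<psi> d) r')"
  shows "state_match \<phi> D (run S ds s) (run S' (map \<psi> ds) s')"
  using assms
proof (induction ds arbitrary: s s')
  case (Cons d ds)
  then show ?case using state_match_step[of \<phi> D s s' S d S' "\<psi> d"] by simp
qed simp

lemma state_match_start:
  assumes "D \<subseteq> X" "\<phi> ` D \<subseteq> X'"
  shows "state_match \<phi> D (start X) (start X')"
  using assms by (auto simp: state_match_def start_def region_match_def)


section \<open>The random splitting tree\<close>

definition union_pmf :: "'a set pmf => 'a set pmf => 'a set pmf" where
  "union_pmf P Q = bind_pmf P (\<lambda>A. map_pmf ((\<union>) A) Q)"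

text \<open>The first argument is fuel: every split removes two points, so the cardinality of \<open>X\<close> suffices
  (\<open>tree_fuel\<close>).\<close>

fun tree :: "nat => 'a::linorder set => nat => 'a node set pmf" where
  "tree 0 X j = return_pmf {}"
| "tree (Suc f) X j =
   (if card X < 2 then return_pmf {} else
   do {
    x \<leftarrow> pmf_of_set X;
    y \<leftarrow> pmf_of_set (X - {x});
    map_pmf (insert (X, j, x, y))
     (union_pmf (tree f (in_part X x y) (Suc j)) (tree f (out_part X x y) (Suc j)))
   })"

fun region_law :: "'a::linorder region => 'a node set pmf" where
  "region_law (X, None, j) = tree (card X) X j"
| "region_law (X, Some x, j) =
   (if card X < 2 then return_pmf {} else
   do {
    y \<leftarrow> pmf_of_set (X - {x});
    map_pmf (insert (X, j, x, y))
     (union_pmf (tree (card X) (in_part X x y) (Suc j)) (tree (card X) (out_part X x y) (Suc j)))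
   })"

fun regions_law :: "'a::linorder region list => 'a node set pmf" where
  "regions_law [] = return_pmf {}"
| "regions_law (r # rs) = union_pmf (region_law r) (regions_law rs)"

text \<open>The law of all splits in the end, given the present state: the open regions are completed
  independently of each other.\<close>

definition completion :: "'a::linorder state => 'a node set pmf" where
  "completion s = map_pmf ((\<union>) (fst s)) (regions_law (snd s))"

lemma bind_pmf_of_set_cong:
  assumes "finite X" "X ~= {}" "\<And>x. x \<in> X ==> f x = g x"
  shows "bind_pmf (pmf_of_set X) f = bind_pmf (pmf_of_set X) g"
  using assms by (intro bind_pmf_cong) (auto simp: set_pmf_of_set)

lemma Un_empty_id [simp]: "(\<union>) {} = (\<lambda>x. x)"
  by (simp add: fun_eq_iff)

lemma Un_singleton_insert: "(\<union>) {x} = insert x"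
  by (simp add: fun_eq_iff)

lemma union_pmf_empty [simp]: "union_pmf (return_pmf {}) Q = Q" "union_pmf P (return_pmf {}) = P"
  by (simp_all add: union_pmf_def bind_return_pmf bind_return_pmf' map_pmf_def[symmetric] pmf.map_ident)

lemma union_pmf_assoc: "union_pmf (union_pmf P Q) R = union_pmf P (union_pmf Q R)"
  by (simp add: union_pmf_def bind_assoc_pmf map_bind_pmf bind_map_pmf map_pmf_def bind_return_pmf Un_assoc)

lemma map_union_pmf:
  "map_pmf ((\<union>) (M \<union> N)) (union_pmf P Q) = union_pmf (map_pmf ((\<union>) M) P) (map_pmf ((\<union>) N) Q)"
  by (simp add: union_pmf_def bind_assoc_pmf map_bind_pmf bind_map_pmf map_pmf_def bind_return_pmf)
   (simp add: Un_ac)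

lemma regions_law_append: "regions_law (rs @ rs') = union_pmf (regions_law rs) (regions_law rs')"
  by (induction rs) (simp_all add: union_pmf_assoc)

lemma completion_append:
  "completion (M \<union> N, rs @ rs') = union_pmf (completion (M, rs)) (completion (N, rs'))"
  by (simp add: completion_def regions_law_append map_union_pmf)

lemma completion_single: "completion ({}, [r]) = region_law r"
  by (simp add: completion_def pmf.map_ident)

lemma in_part_card_less: "finite X ==> u \<in> X ==> card (in_part X u v) < card X"
  by (rule psubset_card_mono) (use in_part_subset[of X u v] ends_notin_parts(1)[of u X v] in blast)+

lemma out_part_card_less: "finite X ==> u \<in> X ==> card (out_part X u v) < card X"
  by (rule psubset_card_mono) (use out_part_subset[of X u v] ends_notin_parts(3)[of u X v] in blast)+

lemma finite_parts [simp]: "finite X ==> finite (in_part X u v)" "finite X ==> finite (out_part X u v)"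
  by (simp_all add: in_part_def out_part_def)

lemma set_pmf_of_set_diff:
  assumes "finite X" "\<not> card X < 2" "x \<in> X"
  shows "X - {x} ~= {}"
proof
  assume "X - {x} = {}"
  then have "X \<subseteq> {x}" by auto
  then have "card X \<le> 1" using card_mono[of "{x}" X] by simp
  then show False using assms by simp
qed

lemma tree_fuel:
  assumes "finite X" "card X \<le> f"
  shows "tree f X j = tree (card X) X j"
  using assms
proof (induction "card X" arbitrary: X f j rule: less_induct)
  case less
  show ?case
  proof (cases "card X < 2")
  case True
  then show ?thesis by (cases f; cases "card X") auto
  next
  case False
  then obtain c where c: "card X = Suc c" by (cases "card X") auto
  obtain f' where f: "f = Suc f'" "c \<le> f'" using less.prems c by (cases f) auto
  have "X ~= {}" using False by auto
  have *: "tree f' (in_part X x y) (Suc j) = tree c (in_part X x y) (Suc j)"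
   "tree f' (out_part X x y) (Suc j) = tree c (out_part X x y) (Suc j)" if x: "x \<in> X" for x y
  proof -
   have lt: "card (in_part X x y) < card X" "card (out_part X x y) < card X"
    using x less.prems by (auto intro: in_part_card_less out_part_card_less)
   show "tree f' (in_part X x y) (Suc j) = tree c (in_part X x y) (Suc j)"
    using less.hyps[OF lt(1), of f'] less.hyps[OF lt(1), of c] lt c f less.prems by simp
   show "tree f' (out_part X x y) (Suc j) = tree c (out_part X x y) (Suc j)"
    using less.hyps[OF lt(2), of f'] less.hyps[OF lt(2), of c] lt c f less.prems by simp
  qed
  have "pmf_of_set X \<bind> (\<lambda>x. pmf_of_set (X - {x}) \<bind> (\<lambda>y. map_pmf (insert (X, j, x, y))
     (union_pmf (tree f' (in_part X x y) (Suc j)) (tree f' (out_part X x y) (Suc j))))) =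
    pmf_of_set X \<bind> (\<lambda>x. pmf_of_set (X - {x}) \<bind> (\<lambda>y. map_pmf (insert (X, j, x, y))
     (union_pmf (tree c (in_part X x y) (Suc j)) (tree c (out_part X x y) (Suc j)))))"
   by (rule bind_pmf_of_set_cong) (use less.prems \<open>X ~= {}\<close> * in simp_all)
  then show ?thesis unfolding f(1) c tree.simps using False c by simp
  qed
qed

lemma region_law_Some:
  assumes "finite X" "x \<in> X" "\<not> card X < 2"
  shows "region_law (X, Some x, j) =
  bind_pmf (pmf_of_set (X - {x})) (\<lambda>y. completion (split_region X j x y))"
proof -
  have "tree (card X) (in_part X x y) (Suc j) = region_law (in_part X x y, None, Suc j)"
  "tree (card X) (out_part X x y) (Suc j) = region_law (out_part X x y, None, Suc j)" for y
  using assms tree_fuel[of "in_part X x y" "card X"] tree_fuel[of "out_part X x y" "card X"]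
   in_part_card_less[of X x y] out_part_card_less[of X x y] by simp_all
  then show ?thesis
  using assms(3) by (simp add: completion_def split_region_def Un_singleton_insert)
qed

lemma region_law_None:
  assumes "finite X" "\<not> card X < 2"
  shows "region_law (X, None, j) = bind_pmf (pmf_of_set X) (\<lambda>x. region_law (X, Some x, j))"
proof -
  obtain c where c: "card X = Suc c" using assms by (cases "card X") auto
  have "X ~= {}" using assms by auto
  have *: "tree c (in_part X x y) (Suc j) = tree (card X) (in_part X x y) (Suc j)"
  "tree c (out_part X x y) (Suc j) = tree (card X) (out_part X x y) (Suc j)" if "x \<in> X" for x y
  using assms that c tree_fuel[of "in_part X x y" "card X"] tree_fuel[of "out_part X x y" "card X"]
   tree_fuel[of "in_part X x y" c] tree_fuel[of "out_part X x y" c]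
   in_part_card_less[of X x y] out_part_card_less[of X x y] by simp_all
  have "region_law (X, None, j) = tree (Suc c) X j" using c by simp
  also have "\<dots> = bind_pmf (pmf_of_set X) (\<lambda>x. region_law (X, Some x, j))"
  proof -
  have "pmf_of_set X \<bind> (\<lambda>x. pmf_of_set (X - {x}) \<bind> (\<lambda>y. map_pmf (insert (X, j, x, y))
     (union_pmf (tree c (in_part X x y) (Suc j)) (tree c (out_part X x y) (Suc j))))) =
    pmf_of_set X \<bind> (\<lambda>x. region_law (X, Some x, j))"
   by (rule bind_pmf_of_set_cong) (use assms \<open>X ~= {}\<close> * in simp_all)
  then show ?thesis using assms by simp
  qed
  finally show ?thesis .
qed

lemma region_law_trivial: "card X < 2 ==> region_law (X, p, j) = return_pmf {}"
  by (cases p; cases "card X") auto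

subsection \<open>Rejection sampling\<close>

text \<open>A draw outside \<open>T\<close> is followed by a fresh uniform draw from \<open>T\<close>; as all elements of \<open>T\<close> have the same
  mass under \<open>p\<close>, the element that is finally used is uniform on \<open>T\<close>.\<close>

lemma bind_pmf_reject:
  fixes p :: "'a pmf" and f :: "'a => 'b pmf"
  assumes "finite T" "T ~= {}" "\<And>c. c \<in> T ==> pmf p c = q"
  shows "bind_pmf p (\<lambda>c. if c \<in> T then f c else bind_pmf (pmf_of_set T) f) = bind_pmf (pmf_of_set T) f"
proof (rule pmf_eqI)
  fix z
  define Q where "Q = pmf (bind_pmf (pmf_of_set T) f) z"
  have Q: "Q = (\<Sum>c\<in>T. pmf (f c) z) / card T"
  unfolding Q_def using assms by (simp add: pmf_bind integral_pmf_of_set)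
  have eq: "pmf (if c \<in> T then f c else bind_pmf (pmf_of_set T) f) z =
   Q + (\<Sum>t\<in>T. (pmf (f t) z - Q) * indicator {t} c)" for c
  using assms(1) by (auto simp: Q_def[symmetric] indicator_def sum.delta if_distrib cong: if_cong)
  have int: "integrable (measure_pmf p) (\<lambda>c. (pmf (f t) z - Q) * indicator {t} c)" for t
  by (intro integrable_mult_right integrable_real_indicator) (auto simp: measure_pmf.emeasure_eq_measure)
  have "pmf (bind_pmf p (\<lambda>c. if c \<in> T then f c else bind_pmf (pmf_of_set T) f)) z =
   (\<integral>c. Q + (\<Sum>t\<in>T. (pmf (f t) z - Q) * indicator {t} c) \<partial>measure_pmf p)"
  unfolding pmf_bind eq ..
  also have "\<dots> = Q + (\<Sum>t\<in>T. (pmf (f t) z - Q) * pmf p t)"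
  using int by (subst Bochner_Integration.integral_add)
   (auto simp: Bochner_Integration.integral_sum measure_pmf_single measure_pmf.prob_space)
  also have "(\<Sum>t\<in>T. (pmf (f t) z - Q) * pmf p t) = q * (\<Sum>t\<in>T. pmf (f t) z - Q)"
  using assms(3) by (simp add: sum_distrib_left mult.commute)
  also have "(\<Sum>t\<in>T. pmf (f t) z - Q) = 0"
  using assms(1,2) by (simp add: sum_subtractf Q)
  finally show "pmf (bind_pmf p (\<lambda>c. if c \<in> T then f c else bind_pmf (pmf_of_set T) f)) z =
   pmf (bind_pmf (pmf_of_set T) f) z" by (simp add: Q_def)
qed

lemma bind_pmf_of_set_reject:
  assumes "finite S" "T \<subseteq> S" "T ~= {}"
  and "\<And>d. d \<in> S ==> K d = (if d \<in> T then f d else bind_pmf (pmf_of_set T) f)"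
  shows "bind_pmf (pmf_of_set S) K = bind_pmf (pmf_of_set T) f"
proof -
  have "S ~= {}" using assms by auto
  have "bind_pmf (pmf_of_set S) K =
   bind_pmf (pmf_of_set S) (\<lambda>c. if c \<in> T then f c else bind_pmf (pmf_of_set T) f)"
  using assms \<open>S ~= {}\<close> by (intro bind_pmf_cong) auto
  also have "\<dots> = bind_pmf (pmf_of_set T) f"
  using assms \<open>S ~= {}\<close> finite_subset
  by (intro bind_pmf_reject[where q = "1 / card S"]) (auto simp: indicator_def)
  finally show ?thesis .
qed

lemma bind_pmf_of_set_distinct_pairs:
  assumes "finite X" "\<not> card X < 2"
  shows "bind_pmf (pmf_of_set X) (\<lambda>x. bind_pmf (pmf_of_set (X - {x})) (\<lambda>y. f (x, y))) =
  bind_pmf (pmf_of_set (SIGMA x:X. X - {x})) f"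
proof (rule pmf_eqI)
  fix z
  have X: "X ~= {}" using assms by auto
  have Xx: "X - {x} ~= {}" if "x \<in> X" for x by (rule set_pmf_of_set_diff[OF assms that])
  have S: "(SIGMA x:X. X - {x}) ~= {}" using X Xx by auto
  have cS: "card (SIGMA x:X. X - {x}) = card X * (card X - 1)"
  using assms by (simp add: card_SigmaI)
  have "pmf (bind_pmf (pmf_of_set X) (\<lambda>x. bind_pmf (pmf_of_set (X - {x})) (\<lambda>y. f (x, y)))) z =
   (\<Sum>x\<in>X. pmf (bind_pmf (pmf_of_set (X - {x})) (\<lambda>y. f (x, y))) z) / card X"
  using assms X by (subst pmf_bind) (simp add: integral_pmf_of_set)
  also have "(\<Sum>x\<in>X. pmf (bind_pmf (pmf_of_set (X - {x})) (\<lambda>y. f (x, y))) z) =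
   (\<Sum>x\<in>X. (\<Sum>y\<in>X - {x}. pmf (f (x, y)) z) / (card X - 1))"
  using assms Xx by (intro sum.cong refl) (simp add: pmf_bind integral_pmf_of_set)
  also have "\<dots> / card X = (\<Sum>x\<in>X. \<Sum>y\<in>X - {x}. pmf (f (x, y)) z) / (card X * (card X - 1))"
  by (simp add: sum_divide_distrib[symmetric] mult.commute)
  also have "(\<Sum>x\<in>X. \<Sum>y\<in>X - {x}. pmf (f (x, y)) z) = (\<Sum>c\<in>(SIGMA x:X. X - {x}). pmf (f c) z)"
  using assms by (subst sum.Sigma) auto
  also have "\<dots> / (card X * (card X - 1)) = pmf (bind_pmf (pmf_of_set (SIGMA x:X. X - {x})) f) z"
  using assms S cS by (subst pmf_bind, subst integral_pmf_of_set) auto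
  finally show "pmf (bind_pmf (pmf_of_set X) (\<lambda>x. bind_pmf (pmf_of_set (X - {x})) (\<lambda>y. f (x, y)))) z =
  pmf (bind_pmf (pmf_of_set (SIGMA x:X. X - {x})) f) z" .
qed

lemma point_move_local:
  assumes "finite V" "fst r \<subseteq> V" "V ~= {}" "pend_ok r"
  shows "bind_pmf (pmf_of_set V) (\<lambda>y. completion (point_move y r)) = region_law r"
proof -
  obtain X p j where r: "r = (X, p, j)" by (cases r)
  have fX: "finite X" using assms r finite_subset by auto
  show ?thesis
  proof (cases "card X < 2")
  case True
  have "completion (point_move y r) = return_pmf {}" for y
  proof (cases p)
   case None
   then show ?thesis using True by (simp add: r completion_single region_law_trivial del: region_law.simps)
  next
   case (Some x)
   then have "X = {x}" using True assms(4) fX r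
    by (metis One_nat_def card_1_singletonE card_eq_0_iff empty_iff fst_conv less_2_cases pend_ok_def singletonD snd_conv)
   then show ?thesis using True Some by (simp add: r completion_single region_law_trivial)
  qed
  then show ?thesis using True by (simp add: r region_law_trivial)
  next
  case False
  then have "X ~= {}" by auto
  show ?thesis
  proof (cases p)
   case None
   have "bind_pmf (pmf_of_set V) (\<lambda>y. completion (point_move y r)) =
     bind_pmf (pmf_of_set X) (\<lambda>x. region_law (X, Some x, j))"
    using assms None r \<open>X ~= {}\<close> region_law_None[OF fX False, of j]
    by (intro bind_pmf_of_set_reject) (auto simp: completion_single)
   then show ?thesis using region_law_None[OF fX False, of j] None r by simp
  next
   case (Some x)
   have x: "x \<in> X" using assms(4) Some r by (auto simp: pend_ok_def)
   have "bind_pmf (pmf_of_set V) (\<lambda>y. completion (point_move y r)) =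
     bind_pmf (pmf_of_set (X - {x})) (\<lambda>y. completion (split_region X j x y))"
    using assms Some r set_pmf_of_set_diff[OF fX False x] region_law_Some[OF fX x False, of j]
    by (intro bind_pmf_of_set_reject) (auto simp: completion_single)
   then show ?thesis using region_law_Some[OF fX x False, of j] Some r by simp
  qed
  qed
qed

lemma pair_move_local:
  assumes "finite V" "fst r \<subseteq> V" "V ~= {}" "fst (snd r) = None"
  shows "bind_pmf (pmf_of_set (V \<times> V)) (\<lambda>d. completion (pair_move d r)) = region_law r"
proof -
  obtain X j where r: "r = (X, None, j)" using assms(4) by (cases r) auto
  have fX: "finite X" using assms r finite_subset by auto
  show ?thesis
  proof (cases "card X < 2")
  case True
  have "pair_move d r = ({}, [r])" for d
  proof (cases d)
   case (Pair u v)
   have "u = v" if "u \<in> X" "v \<in> X"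
    using that True fX card_le_Suc0_iff_eq[OF fX] by auto
   then show ?thesis by (auto simp: r Pair)
  qed
  then show ?thesis by (simp add: completion_single)
  next
  case False
  have "X ~= {}" using False by auto
  let ?T = "SIGMA x:X. X - {x}"
  have eq: "region_law r = bind_pmf (pmf_of_set ?T) (\<lambda>(u, v). completion (split_region X j u v))"
  proof -
   have "region_law r = bind_pmf (pmf_of_set X) (\<lambda>x. bind_pmf (pmf_of_set (X - {x}))
     (\<lambda>y. case (x, y) of (u, v) => completion (split_region X j u v)))"
    unfolding r region_law_None[OF fX False] using fX False \<open>X ~= {}\<close>
    by (intro bind_pmf_of_set_cong) (simp_all add: region_law_Some del: region_law.simps)
   then show ?thesis
    using bind_pmf_of_set_distinct_pairs[OF fX False, of "\<lambda>(u, v). completion (split_region X j u v)"]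
    by simp
  qed
  have "?T ~= {}" using set_pmf_of_set_diff[OF fX False] \<open>X ~= {}\<close> by auto
  have "bind_pmf (pmf_of_set (V \<times> V)) (\<lambda>d. completion (pair_move d r)) =
    bind_pmf (pmf_of_set ?T) (\<lambda>(u, v). completion (split_region X j u v))"
  proof (rule bind_pmf_of_set_reject)
   show "finite (V \<times> V)" "?T \<subseteq> V \<times> V" "?T ~= {}" using assms r \<open>?T ~= {}\<close> by auto
   show "completion (pair_move d r) = (if d \<in> ?T then (\<lambda>(u, v). completion (split_region X j u v)) d
     else bind_pmf (pmf_of_set ?T) (\<lambda>(u, v). completion (split_region X j u v)))" for d
    using eq[symmetric] by (cases d) (auto simp: r completion_single)
  qed
  then show ?thesis using eq by simp
  qed
qed

subsection \<open>Independence of the order of exploration\<close>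

text \<open>If a draw changes at most one of two independent parts, and each part is invariant in law, then
  so is their union: the joint law is affine in each of its two arguments.\<close>

lemma bind_union_pmf_switch:
  assumes "\<And>d. A d = A0 \<or> B d = B0" "bind_pmf p A = A0" "bind_pmf p B = B0"
  shows "bind_pmf p (\<lambda>d. union_pmf (A d) (B d)) = union_pmf A0 B0"
proof (rule pmf_eqI)
  fix z
  have a: "bind_pmf p (\<lambda>d. union_pmf (A d) B0) = union_pmf A0 B0"
  unfolding union_pmf_def assms(2)[symmetric] bind_assoc_pmf ..
  have b: "bind_pmf p (\<lambda>d. union_pmf A0 (B d)) = union_pmf A0 B0"
  proof -
  have "bind_pmf p (\<lambda>d. union_pmf A0 (B d)) = bind_pmf A0 (\<lambda>M. bind_pmf p (\<lambda>d. map_pmf ((\<union>) M) (B d)))"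
   unfolding union_pmf_def by (rule bind_commute_pmf)
  then show ?thesis unfolding union_pmf_def assms(3)[symmetric] map_bind_pmf .
  qed
  have eq: "pmf (union_pmf (A d) (B d)) z =
   pmf (union_pmf (A d) B0) z + pmf (union_pmf A0 (B d)) z - pmf (union_pmf A0 B0) z" for d
  using assms(1)[of d] by auto
  have int: "integrable (measure_pmf p) (\<lambda>d. pmf (K d) z)" for K :: "_ => _ pmf"
  by (rule measure_pmf.integrable_const_bound[where B = 1]) (auto simp: pmf_le_1)
  have "pmf (bind_pmf p (\<lambda>d. union_pmf (A d) (B d))) z =
   (\<integral>d. pmf (union_pmf (A d) B0) z + pmf (union_pmf A0 (B d)) z - pmf (union_pmf A0 B0) z \<partial>p)"
  unfolding pmf_bind eq ..
  also have "\<dots> = pmf (bind_pmf p (\<lambda>d. union_pmf (A d) B0)) z +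
   pmf (bind_pmf p (\<lambda>d. union_pmf A0 (B d))) z - pmf (union_pmf A0 B0) z"
  unfolding pmf_bind using int by (simp add: measure_pmf.prob_space)
  finally show "pmf (bind_pmf p (\<lambda>d. union_pmf (A d) (B d))) z = pmf (union_pmf A0 B0) z"
  by (simp add: a b)
qed

text \<open>A draw concerns at most one region, and averaging the completion of the moved region over the draw
  gives back the law of the region. So the completion is a martingale of laws along the run.\<close>

lemma completion_step_invariant:
  assumes "sorted_wrt (\<lambda>r r'. fst r \<inter> fst r' = {}) (snd s)"
  and loc: "\<And>r. r \<in> set (snd s) ==> bind_pmf p (\<lambda>d. completion (S d r)) = region_law r"
  and one: "\<And>d r r'. fst r \<inter> fst r' = {} ==> S d r = ({}, [r]) \<or> S d r' = ({}, [r'])"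
  shows "bind_pmf p (\<lambda>d. completion (step S d s)) = completion s"
proof -
  define mv where "mv d rs = ((\<Union>r\<in>set rs. fst (S d r)), concat (map (\<lambda>r. snd (S d r)) rs))" for d rs
  have mv_Cons: "completion (mv d (r # rs)) = union_pmf (completion (S d r)) (completion (mv d rs))" for d r rs
  using completion_append[of "fst (S d r)" "fst (mv d rs)" "snd (S d r)" "snd (mv d rs)"]
  by (simp add: mv_def)
  have "bind_pmf p (\<lambda>d. completion (mv d rs)) = regions_law rs"
  if "sorted_wrt (\<lambda>r r'. fst r \<inter> fst r' = {}) rs" "set rs \<subseteq> set (snd s)" for rs
  using that
  proof (induction rs)
  case Nil
  then show ?case by (simp add: mv_def completion_def)
  next
  case (Cons r rs)
  have triv: "completion (mv d rs') = regions_law rs'" if "\<forall>r'\<in>set rs'. S d r' = ({}, [r'])" for d rs'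
   using that
  proof (induction rs')
   case (Cons a rs')
   then show ?case by (simp add: mv_Cons completion_single)
  qed (simp add: mv_def completion_def)
  have "bind_pmf p (\<lambda>d. union_pmf (completion (S d r)) (completion (mv d rs))) =
    union_pmf (region_law r) (regions_law rs)"
  proof (rule bind_union_pmf_switch)
   show "completion (S d r) = region_law r \<or> completion (mv d rs) = regions_law rs" for d
   proof (cases "S d r = ({}, [r])")
    case True
    then show ?thesis by (simp add: completion_single)
   next
    case False
    then have "\<forall>r'\<in>set rs. S d r' = ({}, [r'])" using one[of r _ d] Cons.prems(1) by auto
    then show ?thesis using triv by blast
   qed
   show "bind_pmf p (\<lambda>d. completion (S d r)) = region_law r" using loc Cons.prems by auto
   show "bind_pmf p (\<lambda>d. completion (mv d rs)) = regions_law rs" using Cons by auto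
  qed
  then show ?case by (simp add: mv_Cons)
  qed
  from this[OF assms(1) subset_refl]
  have *: "bind_pmf p (\<lambda>d. completion (mv d (snd s))) = regions_law (snd s)" .
  have "completion (step S d s) = map_pmf ((\<union>) (fst s)) (completion (mv d (snd s)))" for d
  by (simp add: step_def completion_def mv_def pmf.map_comp o_def Un_assoc cong: map_pmf_cong)
  then have "bind_pmf p (\<lambda>d. completion (step S d s)) =
   map_pmf ((\<union>) (fst s)) (bind_pmf p (\<lambda>d. completion (mv d (snd s))))"
  by (simp only: map_bind_pmf)
  also have "\<dots> = completion s" unfolding * by (simp add: completion_def)
  finally show ?thesis .
qed

lemma completion_run_invariant:
  assumes "\<And>s. I s ==> bind_pmf p (\<lambda>d. completion (step S d s)) = completion s"
  and "\<And>s d. I s ==> I (step S d s)" and "I s"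
  shows "bind_pmf (replicate_pmf N p) (\<lambda>ds. completion (run S ds s)) = completion s"
  using assms(3)
proof (induction N arbitrary: s)
  case 0
  then show ?case by (simp add: bind_return_pmf)
next
  case (Suc N)
  have "bind_pmf (replicate_pmf (Suc N) p) (\<lambda>ds. completion (run S ds s)) =
   bind_pmf p (\<lambda>d. bind_pmf (replicate_pmf N p) (\<lambda>ds. completion (run S ds (step S d s))))"
  by (simp add: bind_assoc_pmf bind_return_pmf)
  also have "\<dots> = bind_pmf p (\<lambda>d. completion (step S d s))"
  using Suc.IH assms(2) Suc.prems by simp
  finally show ?case using assms(1) Suc.prems by simp
qed

lemma completion_point_run:
  assumes "finite V" "V ~= {}"
  shows "bind_pmf (replicate_pmf N (pmf_of_set V)) (\<lambda>ds. completion (run point_move ds (start V))) =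
  region_law (V, None, 0)"
proof -
  have "bind_pmf (replicate_pmf N (pmf_of_set V)) (\<lambda>ds. completion (run point_move ds (start V))) =
   completion (start V)"
  proof (rule completion_run_invariant[where I = "consistent V"])
  show "consistent V (start V)" by (rule consistent_start)
  show "consistent V (step point_move d s)" if "consistent V s" for s d
   using that by (intro consistent_step point_move_proper) (auto simp: consistent_def)
  show "bind_pmf (pmf_of_set V) (\<lambda>d. completion (step point_move d s)) = completion s" if c: "consistent V s" for s
  proof (rule completion_step_invariant)
   show "sorted_wrt (\<lambda>r r'. fst r \<inter> fst r' = {}) (snd s)" using c by (simp add: consistent_def)
   show "bind_pmf (pmf_of_set V) (\<lambda>d. completion (point_move d r)) = region_law r" if "r \<in> set (snd s)" for r
    using assms that c unfolding consistent_def by (intro point_move_local) blast+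
   show "point_move d r = ({}, [r]) \<or> point_move d r' = ({}, [r'])" if "fst r \<inter> fst r' = {}" for d r r'
    using that by (cases r; cases r') auto
  qed
  qed
  then show ?thesis by (simp add: start_def completion_single)
qed

lemma completion_pair_run:
  assumes "finite V" "V ~= {}"
  shows "bind_pmf (replicate_pmf N (pmf_of_set (V \<times> V))) (\<lambda>ds. completion (run pair_move ds (start V))) =
  region_law (V, None, 0)"
proof -
  let ?I = "\<lambda>s. consistent V s \<and> (\<forall>r\<in>set (snd s). fst (snd r) = None)"
  have "bind_pmf (replicate_pmf N (pmf_of_set (V \<times> V))) (\<lambda>ds. completion (run pair_move ds (start V))) =
   completion (start V)"
  proof (rule completion_run_invariant[where I = ?I])
  show "?I (start V)" using consistent_start by (simp add: start_def)
  show "?I (step pair_move d s)" if s: "?I s" for s d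
  proof
   show "consistent V (step pair_move d s)"
    using s by (intro consistent_step pair_move_proper) (auto simp: consistent_def)
   show "\<forall>r\<in>set (snd (step pair_move d s)). fst (snd r) = None"
    using s by (cases d) (force simp: step_def split_region_def split: if_splits)
  qed
  show "bind_pmf (pmf_of_set (V \<times> V)) (\<lambda>d. completion (step pair_move d s)) = completion s" if c: "?I s" for s
  proof (rule completion_step_invariant)
   show "sorted_wrt (\<lambda>r r'. fst r \<inter> fst r' = {}) (snd s)" using c by (simp add: consistent_def)
   show "bind_pmf (pmf_of_set (V \<times> V)) (\<lambda>d. completion (pair_move d r)) = region_law r" if "r \<in> set (snd s)" for r
    using assms that c unfolding consistent_def by (intro pair_move_local) blast+
   show "pair_move d r = ({}, [r]) \<or> pair_move d r' = ({}, [r'])" if "fst r \<inter> fst r' = {}" for d r r'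
    using that by (cases d; cases r; cases r') auto
  qed
  qed
  then show ?thesis by (simp add: start_def completion_single)
qed

subsection \<open>Support of the completed laws\<close>

text \<open>The two conditions say that the chords in \<open>C\<close> extend the present ones inside the present regions, in
  particular without crossing them.\<close>

definition confined :: "'a state => ('a \<times> 'a) set => bool" where
  "confined s C \<longleftrightarrow> chords_of (fst s) \<subseteq> C \<and>
   (\<forall>(u, v)\<in>C. (u, v) \<in> chords_of (fst s) \<or> (\<exists>r\<in>set (snd s). u \<in> fst r \<and> v \<in> fst r \<and> u ~= v))"

lemma tree_support:
  assumes "finite X" "A \<in> set_pmf (tree f X j)" "(u, v) \<in> chords_of A"
  shows "u \<in> X \<and> v \<in> X \<and> u ~= v"
  using assms
proof (induction f arbitrary: X j A)
  case (Suc f)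
  then have c: "\<not> card X < 2" by (auto split: if_splits)
  then have "X ~= {}" by auto
  obtain x y A1 A2 where xy: "x \<in> X" "y \<in> X - {x}"
  "A1 \<in> set_pmf (tree f (in_part X x y) (Suc j))" "A2 \<in> set_pmf (tree f (out_part X x y) (Suc j))"
  "A = insert (X, j, x, y) (A1 \<union> A2)"
  using Suc.prems(2) c Suc.prems(1) \<open>X ~= {}\<close> set_pmf_of_set_diff[OF Suc.prems(1) c]
  by (auto simp: union_pmf_def)
  show ?case
  using Suc.IH[OF _ xy(3)] Suc.IH[OF _ xy(4)] Suc.prems xy in_part_subset[of X x y] out_part_subset[of X x y]
  by auto
qed simp

lemma region_law_support:
  assumes "finite (fst r)" "pend_ok r" "A \<in> set_pmf (region_law r)" "(u, v) \<in> chords_of A"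
  shows "u \<in> fst r \<and> v \<in> fst r \<and> u ~= v"
proof -
  obtain X p j where r: "r = (X, p, j)" by (cases r)
  show ?thesis
  proof (cases p)
  case None
  then show ?thesis using assms tree_support[of X A "card X" j u v] by (simp add: r)
  next
  case (Some x)
  then have c: "\<not> card X < 2" using assms by (auto simp: r split: if_splits)
  have x: "x \<in> X" using assms(2) by (simp add: r Some pend_ok_def)
  obtain y A1 A2 where xy: "y \<in> X - {x}"
   "A1 \<in> set_pmf (tree (card X) (in_part X x y) (Suc j))"
   "A2 \<in> set_pmf (tree (card X) (out_part X x y) (Suc j))"
   "A = insert (X, j, x, y) (A1 \<union> A2)"
   using assms c set_pmf_of_set_diff[OF _ c x] by (auto simp: union_pmf_def r Some)
  show ?thesis
   using tree_support[OF _ xy(2)] tree_support[OF _ xy(3)] assms xy x r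
    in_part_subset[of X x y] out_part_subset[of X x y] by auto
  qed
qed

lemma regions_law_support:
  assumes "\<And>r. r \<in> set rs ==> finite (fst r) \<and> pend_ok r" "A \<in> set_pmf (regions_law rs)" "(u, v) \<in> chords_of A"
  shows "\<exists>r\<in>set rs. u \<in> fst r \<and> v \<in> fst r \<and> u ~= v"
  using assms
proof (induction rs arbitrary: A)
  case (Cons r rs)
  obtain A1 A2 where A: "A1 \<in> set_pmf (region_law r)" "A2 \<in> set_pmf (regions_law rs)" "A = A1 \<union> A2"
  using Cons.prems(2) by (auto simp: union_pmf_def)
  consider "(u, v) \<in> chords_of A1" | "(u, v) \<in> chords_of A2" using Cons.prems(3) A(3) by auto
  then show ?case
  proof cases
  case 1
  then show ?thesis using region_law_support[of r A1 u v] A(1) Cons.prems(1) by auto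
  next
  case 2
  then show ?thesis using Cons.IH[OF _ A(2)] Cons.prems(1) by auto
  qed
qed simp

lemma completion_confined:
  assumes "\<And>r. r \<in> set (snd s) ==> finite (fst r) \<and> pend_ok r" "A \<in> set_pmf (completion s)"
  shows "confined s (chords_of A)"
proof -
  obtain B where B: "B \<in> set_pmf (regions_law (snd s))" "A = fst s \<union> B"
  using assms(2) by (auto simp: completion_def)
  show ?thesis
  using regions_law_support[OF assms(1) B(1)] by (auto simp: confined_def B(2))
qed

lemma confined_step:
  assumes "confined (step S d s) C" "\<And>r. r \<in> set (snd s) ==> proper_move r (S d r)"
  shows "confined s C"
  unfolding confined_def
proof (intro conjI ballI)
  show "chords_of (fst s) \<subseteq> C" using assms(1) by (auto simp: confined_def step_def)
  fix c assume "c \<in> C"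
  obtain u v where c: "c = (u, v)" by (cases c)
  consider "(u, v) \<in> chords_of (fst (step S d s))" |
  r' where "r' \<in> set (snd (step S d s))" "u \<in> fst r'" "v \<in> fst r'" "u ~= v"
  using assms(1) \<open>c \<in> C\<close> c unfolding confined_def by blast
  then have "(u, v) \<in> chords_of (fst s) \<or> (\<exists>r\<in>set (snd s). u \<in> fst r \<and> v \<in> fst r \<and> u ~= v)"
  proof cases
  case 1
  then consider "(u, v) \<in> chords_of (fst s)" |
   r where "r \<in> set (snd s)" "(u, v) \<in> chords_of (fst (S d r))"
   by (auto simp: step_def)
  then show ?thesis using proper_move_chords[OF assms(2)] by cases blast+
  next
  case 2
  then obtain r where "r \<in> set (snd s)" "r' \<in> set (snd (S d r))" by (auto simp: step_def)
  then show ?thesis using proper_move_subset[OF assms(2)] 2 by blast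
  qed
  then show "case c of (u, v) => (u, v) \<in> chords_of (fst s) \<or> (\<exists>r\<in>set (snd s). u \<in> fst r \<and> v \<in> fst r \<and> u ~= v)"
  by (simp add: c)
qed

lemma confined_run:
  assumes "\<And>d r. pend_ok r ==> proper_move r (S d r)" "consistent X0 s" "confined (run S ds s) C"
  shows "confined s C"
  using assms(2,3)
proof (induction ds arbitrary: s)
  case (Cons d ds)
  have pr: "proper_move r (S d r)" if "r \<in> set (snd s)" for r
  using assms(1) Cons.prems(1) that by (auto simp: consistent_def)
  then show ?case
  using Cons consistent_step[OF Cons.prems(1), of S d] confined_step[of S d s C] by simp
qed simp

lemma region_law_root:
  assumes "finite (fst r)" "\<not> card (fst r) < 2" "pend_ok r" "A \<in> set_pmf (region_law r)"
  shows "\<exists>u v. (fst r, snd (snd r), u, v) \<in> A"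
proof -
  obtain X p j where r: "r = (X, p, j)" by (cases r)
  have X: "finite X" "\<not> card X < 2" "X ~= {}" using assms r by auto
  have "\<exists>u v. (X, j, u, v) \<in> A" if "A \<in> set_pmf (region_law (X, Some x, j))" for x
  using that X(2) by auto
  then show ?thesis
  using assms X region_law_None[OF X(1,2), of j] by (cases p) (auto simp: r simp del: region_law.simps)
qed

lemma completion_root:
  assumes "A \<in> set_pmf (completion s)" "r \<in> set (snd s)"
  "finite (fst r)" "\<not> card (fst r) < 2" "pend_ok r"
  shows "\<exists>u v. (fst r, snd (snd r), u, v) \<in> A"
proof -
  have "\<exists>u v. (fst r, snd (snd r), u, v) \<in> A" if "A \<in> set_pmf (regions_law rs)" "r \<in> set rs" for rs A
  using that
  proof (induction rs arbitrary: A)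
  case (Cons r' rs)
  then obtain A1 A2 where A: "A1 \<in> set_pmf (region_law r')" "A2 \<in> set_pmf (regions_law rs)" "A = A1 \<union> A2"
   by (auto simp: union_pmf_def)
  show ?case
  proof (cases "r = r'")
   case True
   then show ?thesis using region_law_root[of r A1] A assms by auto
  next
   case False
   then show ?thesis using Cons.IH[OF A(2)] Cons.prems A by auto
  qed
  qed simp
  moreover obtain B where "B \<in> set_pmf (regions_law (snd s))" "A = fst s \<union> B"
  using assms(1) by (auto simp: completion_def)
  ultimately show ?thesis using assms(2) by blast
qed


section \<open>Regions that reach four given arcs\<close>

text \<open>The region has points in each of the four arcs bounded by 0, \<open>r1\<close>, \<open>r2\<close> and \<open>r3\<close>.\<close>

definition alive :: "'a::linorder => 'a => 'a => 'a set => bool" where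
  "alive r1 r2 r3 X \<longleftrightarrow> X \<inter> {..<r1} ~= {} \<and> X \<inter> {r1..<r2} ~= {} \<and> X \<inter> {r2..<r3} ~= {} \<and> X \<inter> {r3..} ~= {}"

lemma aliveE:
  assumes "alive r1 r2 r3 X"
  obtains a b c d where "a \<in> X" "a < r1" "b \<in> X" "r1 \<le> b" "b < r2" "c \<in> X" "r2 \<le> c" "c < r3" "d \<in> X" "r3 \<le> d"
proof -
  obtain a b c d where "a \<in> X \<inter> {..<r1}" "b \<in> X \<inter> {r1..<r2}" "c \<in> X \<inter> {r2..<r3}" "d \<in> X \<inter> {r3..}"
  using assms unfolding alive_def by blast
  then show ?thesis by (intro that[of a b c d]) auto
qed

lemma alive_card:
  assumes "alive r1 r2 r3 X" "finite X"
  shows "4 \<le> card X"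
proof -
  obtain a b c d where abcd: "a \<in> X" "a < r1" "b \<in> X" "r1 \<le> b" "b < r2" "c \<in> X" "r2 \<le> c" "c < r3" "d \<in> X" "r3 \<le> d"
  using assms(1) by (rule aliveE)
  then have "a < b" "b < c" "c < d" by (meson less_le_trans)+
  then have "a < c" "a < d" "b < d" by (meson less_trans)+
  then have "distinct [a, b, c, d]" using \<open>a < b\<close> \<open>b < c\<close> \<open>c < d\<close> by auto
  then have "card {a, b, c, d} = 4" using distinct_card[of "[a, b, c, d]"] by simp
  moreover have "card {a, b, c, d} \<le> card X" using abcd assms(2) by (intro card_mono) auto
  ultimately show ?thesis by simp
qed

lemma alive_mono: "alive r1 r2 r3 Y ==> Y \<subseteq> X ==> alive r1 r2 r3 X"
  unfolding alive_def by blast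

lemma one_part_alive:
  assumes "alive r1 r2 r3 (in_part X u v)" "r1 \<le> r2" "r2 \<le> r3"
  shows "\<not> alive r1 r2 r3 (out_part X u v)"
proof
  assume "alive r1 r2 r3 (out_part X u v)"
  then obtain s where s: "arc_out u v s" "r1 \<le> s" "s < r2" by (auto simp: alive_def out_part_def)
  obtain t t' where "arc_in u v t" "t < r1" "arc_in u v t'" "r3 \<le> t'"
  using assms(1) by (auto simp: alive_def in_part_def)
  then have "min u v < s" "s < max u v"
  using s assms unfolding arc_in_def by (meson less_le_trans less_trans order.strict_trans2)+
  then show False using s(1) unfolding arc_out_def by (meson less_asym)
qed

text \<open>A chord between two opposite arcs separates the two others, so that neither part reaches all four arcs.\<close>

lemma opposite_not_alive:
  assumes "r1 \<le> r2" "r2 \<le> r3"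
  and "(u < r1 \<and> r2 \<le> v \<and> v < r3) \<or> (r1 \<le> u \<and> u < r2 \<and> r3 \<le> v)"
  shows "\<not> alive r1 r2 r3 (in_part X u v)" "\<not> alive r1 r2 r3 (out_part X u v)"
proof -
  have uv: "u < v" using assms by (meson less_le_trans order_trans not_le)
  then have mm: "min u v = u" "max u v = v" by (auto simp: min_def max_def)
  show "\<not> alive r1 r2 r3 (in_part X u v)"
  proof
  assume "alive r1 r2 r3 (in_part X u v)"
  then obtain t t' where "u < t" "t < v" "t < r1" "u < t'" "t' < v" "r3 \<le> t'"
   by (auto simp: alive_def in_part_def arc_in_def mm)
  then show False using assms by (meson less_le_trans less_trans not_less order.trans leD)
  qed
  show "\<not> alive r1 r2 r3 (out_part X u v)"
  proof
  assume "alive r1 r2 r3 (out_part X u v)"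
  then have "out_part X u v \<inter> {r1..<r2} ~= {}" "out_part X u v \<inter> {r2..<r3} ~= {}"
   by (simp_all add: alive_def)
  then obtain t t' where "t \<in> out_part X u v" "r1 \<le> t" "t < r2" "t' \<in> out_part X u v" "r2 \<le> t'" "t' < r3"
   by fastforce
  then have "t < u \<or> v < t" "r1 \<le> t" "t < r2" "t' < u \<or> v < t'" "r2 \<le> t'" "t' < r3"
   by (simp_all add: out_part_def arc_out_def mm)
  then show False using assms by (meson less_le_trans less_trans not_less order.trans leD)
  qed
qed

text \<open>The mass of an arc relative to that of its complement. Over a uniform cut the mean of an
  inverse mass grows logarithmically, while the mean of its square root stays bounded.\<close>

definition ratio :: "'a set => 'a set => real" where
  "ratio G X = sqrt (real (card (X \<inter> G)) / real (card (X - G)))"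

subsection \<open>Sums over distinct integers\<close>

lemma sum_inverse_sqrt_le: "(\<Sum>k=1..n. 1 / sqrt (real k)) \<le> 2 * sqrt (real n)"
proof (induction n)
  case (Suc n)
  have pos: "sqrt (real n + 1) > 0" by simp
  have "sqrt (real n) * sqrt (real n + 1) \<le> real n + 1 / 2"
  using arith_geo_mean_sqrt[of "real n" "real n + 1"] by (simp add: real_sqrt_mult[symmetric] field_simps)
  then have "1 / sqrt (real n + 1) \<le> 2 * sqrt (real n + 1) - 2 * sqrt (real n)"
  using pos by (simp add: field_simps)
  then show ?case using Suc by (simp add: add.commute)
qed simp

lemma sum_inverse_sqrt_inj_le:
  assumes "finite S" "inj_on h S" "\<And>v. v \<in> S ==> h v \<le> n"
  shows "(\<Sum>v\<in>S. 1 / sqrt (real (h v))) \<le> 2 * sqrt (real n)"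
proof -
  have "(\<Sum>v\<in>S. 1 / sqrt (real (h v))) = (\<Sum>k\<in>h ` S. 1 / sqrt (real k))"
  using assms(2) by (simp add: sum.reindex)
  also have "\<dots> \<le> (\<Sum>k\<in>{0..n}. 1 / sqrt (real k))"
  using assms by (intro sum_mono2) auto
  also have "\<dots> = (\<Sum>k=1..n. 1 / sqrt (real k))"
  by (rule sum.mono_neutral_right) auto
  finally show ?thesis using sum_inverse_sqrt_le[of n] by linarith
qed

text \<open>Distinct positive integers sum up to at least \<open>1 + 2 + \<dots>\<close>.\<close>

lemma sum_distinct_nat_ge:
  assumes "finite A" "\<And>a. a \<in> A ==> 1 \<le> a"
  shows "(real (card A))\<^sup>2 / 2 \<le> real (\<Sum>A)"
  using assms
proof (induction A rule: finite_linorder_max_induct)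
  case (insert b A)
  have "A \<subseteq> {1..<b}" using insert by auto
  then have "card A \<le> card {1..<b}" by (intro card_mono) auto
  moreover have "1 \<le> b" using insert.prems by blast
  ultimately have "card A + 1 \<le> b" by simp
  then have "real (card A) + 1 \<le> real b" by linarith
  moreover have "b \<notin> A" using insert.hyps by auto
  ultimately show ?case using insert by (auto simp: power2_eq_square field_simps)
qed simp

lemma sum_inj_nat_ge:
  assumes "finite S" "inj_on h S" "\<And>v. v \<in> S ==> 1 \<le> h v"
  shows "(real (card S))\<^sup>2 / 2 \<le> (\<Sum>v\<in>S. real (h v))"
proof -
  have "(real (card (h ` S)))\<^sup>2 / 2 \<le> real (\<Sum>(h ` S))"
  using assms by (intro sum_distinct_nat_ge) auto
  then show ?thesis using assms(2) by (simp add: card_image sum.reindex)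
qed

subsection \<open>The parts cut off by the chords from a fixed point\<close>

text \<open>Moving the second end of the chord to the next point changes the part by that point, so the sizes of the
  parts are pairwise distinct.\<close>

lemma inj_on_card_parts:
  fixes u :: "'a::linorder"
  assumes "finite X" "S \<subseteq> {v \<in> X \<inter> W. u < v} \<or> S \<subseteq> {v \<in> X \<inter> W. v < u}"
  shows "inj_on (\<lambda>v. card (in_part X u v \<inter> W)) S" "inj_on (\<lambda>v. card (out_part X u v \<inter> W)) S"
proof -
  have inj: "inj_on (\<lambda>v. card (P v)) S"
  if "\<And>v w. v \<in> S ==> w \<in> S ==> v < w ==> P v \<subset> P w \<or> P w \<subset> P v" "\<And>v. finite (P v)" for P :: "'a => 'a set"
  proof (rule linorder_inj_onI')
  show "card (P v) ~= card (P w)" if "v \<in> S" "w \<in> S" "v < w" for v w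
   using \<open>\<And>v w. v \<in> S ==> w \<in> S ==> v < w ==> P v \<subset> P w \<or> P w \<subset> P v\<close>[OF that]
    psubset_card_mono[of "P v" "P w"] psubset_card_mono[of "P w" "P v"] \<open>\<And>v. finite (P v)\<close>
   by (metis less_irrefl)
  qed
  show "inj_on (\<lambda>v. card (in_part X u v \<inter> W)) S"
  proof (rule inj)
  fix v w assume vw: "v \<in> S" "w \<in> S" "v < w"
  show "in_part X u v \<inter> W \<subset> in_part X u w \<inter> W \<or> in_part X u w \<inter> W \<subset> in_part X u v \<inter> W"
  proof (cases "u < v")
   case True
   then have "min u v = u" "max u v = v" "min u w = u" "max u w = w" using vw by (auto simp: min_def max_def)
   then have "in_part X u v \<inter> W \<subseteq> in_part X u w \<inter> W" "v \<in> in_part X u w \<inter> W" "v \<notin> in_part X u v \<inter> W"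
    using vw True assms(2) by (auto simp: in_part_def arc_in_def)
   then show ?thesis by blast
  next
   case False
   then have "v < u" "w < u" using vw assms(2) by auto
   then have "min u v = v" "max u v = u" "min u w = w" "max u w = u" by (auto simp: min_def max_def)
   then have "in_part X u w \<inter> W \<subseteq> in_part X u v \<inter> W" "w \<in> in_part X u v \<inter> W" "w \<notin> in_part X u w \<inter> W"
    using vw \<open>w < u\<close> assms(2) by (auto simp: in_part_def arc_in_def)
   then show ?thesis by blast
  qed
  qed (use assms(1) in auto)
  show "inj_on (\<lambda>v. card (out_part X u v \<inter> W)) S"
  proof (rule inj)
  fix v w assume vw: "v \<in> S" "w \<in> S" "v < w"
  show "out_part X u v \<inter> W \<subset> out_part X u w \<inter> W \<or> out_part X u w \<inter> W \<subset> out_part X u v \<inter> W"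
  proof (cases "u < v")
   case True
   then have "min u v = u" "max u v = v" "min u w = u" "max u w = w" using vw by (auto simp: min_def max_def)
   then have "out_part X u w \<inter> W \<subseteq> out_part X u v \<inter> W" "w \<in> out_part X u v \<inter> W" "w \<notin> out_part X u w \<inter> W"
    using vw True assms(2) by (auto simp: out_part_def arc_out_def)
   then show ?thesis by blast
  next
   case False
   then have "v < u" "w < u" using vw assms(2) by auto
   then have "min u v = v" "max u v = u" "min u w = w" "max u w = u" by (auto simp: min_def max_def)
   then have "out_part X u v \<inter> W \<subseteq> out_part X u w \<inter> W" "v \<in> out_part X u w \<inter> W" "v \<notin> out_part X u v \<inter> W"
    using vw \<open>w < u\<close> assms(2) by (auto simp: out_part_def arc_out_def)
   then show ?thesis by blast
  qed
  qed (use assms(1) in auto)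
qed

lemma sum_inverse_sqrt_parts_le:
  fixes u :: "'a::linorder"
  assumes "finite X"
  shows "(\<Sum>v\<in>X \<inter> W - {u}. 1 / sqrt (real (card (in_part X u v \<inter> W))) + 1 / sqrt (real (card (out_part X u v \<inter> W))))
  \<le> 8 * sqrt (real (card (X \<inter> W)))"
proof -
  let ?f = "\<lambda>v. 1 / sqrt (real (card (in_part X u v \<inter> W)))"
  let ?g = "\<lambda>v. 1 / sqrt (real (card (out_part X u v \<inter> W)))"
  have le: "card (in_part X u v \<inter> W) \<le> card (X \<inter> W)" "card (out_part X u v \<inter> W) \<le> card (X \<inter> W)" for v
  using assms in_part_subset[of X u v] out_part_subset[of X u v] by (auto intro!: card_mono)
  have fin: "finite {v \<in> X \<inter> W. u < v}" "finite {v \<in> X \<inter> W. v < u}" using assms by auto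
  have split: "X \<inter> W - {u} = {v \<in> X \<inter> W. u < v} \<union> {v \<in> X \<inter> W. v < u}" by auto
  have "sum h (X \<inter> W - {u}) = sum h {v \<in> X \<inter> W. u < v} + sum h {v \<in> X \<inter> W. v < u}" for h :: "'a => real"
  unfolding split using fin by (intro sum.union_disjoint) auto
  moreover have "sum ?f {v \<in> X \<inter> W. u < v} \<le> 2 * sqrt (real (card (X \<inter> W)))"
  "sum ?f {v \<in> X \<inter> W. v < u} \<le> 2 * sqrt (real (card (X \<inter> W)))"
  "sum ?g {v \<in> X \<inter> W. u < v} \<le> 2 * sqrt (real (card (X \<inter> W)))"
  "sum ?g {v \<in> X \<inter> W. v < u} \<le> 2 * sqrt (real (card (X \<inter> W)))"
  using fin le inj_on_card_parts[OF assms]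
  by (auto intro!: sum_inverse_sqrt_inj_le)
  ultimately show ?thesis by (simp add: sum.distrib)
qed

lemma sqrt_le_affine:
  assumes "0 \<le> a" "0 < (x::real)" "a \<le> x"
  shows "sqrt (a / x) \<le> 1 - (x - a) / (2 * x)"
proof -
  have "sqrt (a / x * 1) \<le> (a / x + 1) / 2" using assms by (intro arith_geo_mean_sqrt) auto
  also have "\<dots> = 1 - (x - a) / (2 * x)" using assms by (simp add: field_simps)
  finally show ?thesis by simp
qed

lemma sum_squares_four:
  fixes a b c d :: real
  shows "(a + b + c + d)\<^sup>2 \<le> 4 * (a\<^sup>2 + b\<^sup>2 + c\<^sup>2 + d\<^sup>2)"
proof -
  have "4 * (a\<^sup>2 + b\<^sup>2 + c\<^sup>2 + d\<^sup>2) - (a + b + c + d)\<^sup>2 =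
   (a - b)\<^sup>2 + (a - c)\<^sup>2 + (a - d)\<^sup>2 + (b - c)\<^sup>2 + (b - d)\<^sup>2 + (c - d)\<^sup>2"
  by (simp add: power2_eq_square algebra_simps)
  then show ?thesis by (smt (verit) zero_le_power2)
qed

lemma inj_on_imp_inj_on_diff:
  fixes a :: "'a => nat"
  assumes "inj_on a S" "\<And>v. v \<in> S ==> a v < n"
  shows "inj_on (\<lambda>v. n - a v) S"
proof (rule inj_onI)
  fix x y assume "x \<in> S" "y \<in> S" "n - a x = n - a y"
  moreover have "a x < n" "a y < n" using assms(2) \<open>x \<in> S\<close> \<open>y \<in> S\<close> by auto
  ultimately have "a x = a y" by linarith
  then show "x = y" using assms(1) \<open>x \<in> S\<close> \<open>y \<in> S\<close> by (auto dest: inj_onD)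
qed

text \<open>For a fixed end \<open>u\<close> the part that survives has distinct sizes on each of four families of
  other ends, so on average it loses a fixed proportion of its points.\<close>

lemma sum_sqrt_surviving_le:
  fixes u :: "'a::linorder" and a :: "'a => nat"
  assumes X: "finite X" "u \<in> X \<inter> G" and S: "S \<subseteq> X \<inter> G - {u}"
  and a: "\<And>v. v \<in> S ==> a v = card (in_part X u v \<inter> G) \<or> a v = card (out_part X u v \<inter> G)"
  defines "x \<equiv> real (card (X \<inter> G))"
  shows "(\<Sum>v\<in>S. sqrt (real (a v) / x)) \<le> 31 / 32 * (x - 1)"
proof -
  define s where "s = real (card S)"
  have finS: "finite S" using S X finite_subset by blast
  have cXG: "card (X \<inter> G - {u}) = card (X \<inter> G) - 1" "card (X \<inter> G) \<ge> 1"
  using X by (auto simp: Suc_le_eq card_gt_0_iff)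
  have s: "0 \<le> s" "s \<le> x - 1" "1 \<le> x"
  using card_mono[OF _ S] X cXG by (auto simp: s_def x_def)
  have less: "card (in_part X u v \<inter> G) < card (X \<inter> G)" "card (out_part X u v \<inter> G) < card (X \<inter> G)" for v
  proof -
  have "in_part X u v \<inter> G \<subseteq> X \<inter> G - {u}" "out_part X u v \<inter> G \<subseteq> X \<inter> G - {u}"
   using in_part_subset[of X u v] out_part_subset[of X u v] ends_notin_parts[of u X v] by blast+
  then have "card (in_part X u v \<inter> G) \<le> card (X \<inter> G - {u})" "card (out_part X u v \<inter> G) \<le> card (X \<inter> G - {u})"
   using X(1) by (auto intro!: card_mono)
  then show "card (in_part X u v \<inter> G) < card (X \<inter> G)" "card (out_part X u v \<inter> G) < card (X \<inter> G)"
   using cXG by linarith+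
  qed
  have a_less: "a v < card (X \<inter> G)" if "v \<in> S" for v using a[OF that] less[of v] by auto
  define Fm where "Fm b c = {v \<in> S. (u < v) = b \<and> (a v = card (in_part X u v \<inter> G)) = c}" for b c
  have fam: "(real (card (Fm b c)))\<^sup>2 / 2 \<le> (\<Sum>v\<in>Fm b c. x - real (a v))" for b c
  proof -
  have sub: "Fm b c \<subseteq> {v \<in> X \<inter> G. u < v} \<or> Fm b c \<subseteq> {v \<in> X \<inter> G. v < u}"
   using S by (cases b) (auto simp: Fm_def)
  have "inj_on a (Fm b c)"
  proof (cases c)
   case True
   have "inj_on (\<lambda>v. card (in_part X u v \<inter> G)) (Fm b c)" using inj_on_card_parts(1)[OF X(1) sub] .
   moreover have "a v = card (in_part X u v \<inter> G)" if "v \<in> Fm b c" for v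
    using that True by (simp add: Fm_def)
   ultimately show ?thesis by (simp add: inj_on_def)
  next
   case False
   have "inj_on (\<lambda>v. card (out_part X u v \<inter> G)) (Fm b c)" using inj_on_card_parts(2)[OF X(1) sub] .
   moreover have "a v = card (out_part X u v \<inter> G)" if "v \<in> Fm b c" for v
    using that False a[of v] by (auto simp: Fm_def)
   ultimately show ?thesis by (simp add: inj_on_def)
  qed
  then have "inj_on (\<lambda>v. card (X \<inter> G) - a v) (Fm b c)"
  proof (rule inj_on_imp_inj_on_diff)
   show "a v < card (X \<inter> G)" if "v \<in> Fm b c" for v using a_less that by (simp add: Fm_def)
  qed
  moreover have "1 \<le> card (X \<inter> G) - a v" if "v \<in> Fm b c" for v
   using a_less that by (auto simp: Fm_def Suc_le_eq)
  ultimately have "(real (card (Fm b c)))\<^sup>2 / 2 \<le> (\<Sum>v\<in>Fm b c. real (card (X \<inter> G) - a v))"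
   using finS by (intro sum_inj_nat_ge) (auto simp: Fm_def)
  also have "\<dots> = (\<Sum>v\<in>Fm b c. x - real (a v))"
   using a_less by (intro sum.cong) (auto simp: Fm_def x_def less_imp_le of_nat_diff)
  finally show ?thesis .
  qed
  have S4: "S = ((Fm True True \<union> Fm True False) \<union> Fm False True) \<union> Fm False False" by (auto simp: Fm_def)
  have finF: "finite (Fm b c)" for b c using finS by (auto simp: Fm_def)
  have dis: "Fm b c \<inter> Fm b' c' = {}" if "(b, c) ~= (b', c')" for b c b' c' using that by (auto simp: Fm_def)
  have sum4: "sum h S = sum h (Fm True True) + sum h (Fm True False) + sum h (Fm False True) + sum h (Fm False False)"
  for h :: "'a => real"
  by (subst S4) (simp add: sum.union_disjoint finF dis Int_Un_distrib2)
  have s4: "s = real (card (Fm True True)) + real (card (Fm True False)) + real (card (Fm False True)) + real (card (Fm False False))"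
  using sum4[of "\<lambda>_. 1"] by (simp add: s_def)
  have "s\<^sup>2 \<le> 4 * ((real (card (Fm True True)))\<^sup>2 + (real (card (Fm True False)))\<^sup>2 +
   (real (card (Fm False True)))\<^sup>2 + (real (card (Fm False False)))\<^sup>2)"
  unfolding s4 by (rule sum_squares_four)
  then have "s\<^sup>2 / 8 \<le> (\<Sum>v\<in>S. x - real (a v))"
  unfolding sum4 using add_mono[OF add_mono[OF add_mono[OF fam[of True True] fam[of True False]] fam[of False True]] fam[of False False]]
  by argo
  then have lb: "s\<^sup>2 / 8 / (2 * x) \<le> (\<Sum>v\<in>S. x - real (a v)) / (2 * x)"
  using s by (intro divide_right_mono) auto
  have "(\<Sum>v\<in>S. sqrt (real (a v) / x)) \<le> (\<Sum>v\<in>S. 1 - (x - real (a v)) / (2 * x))"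
  using a_less s by (intro sum_mono sqrt_le_affine) (auto simp: x_def less_imp_le)
  also have "\<dots> = s - (\<Sum>v\<in>S. x - real (a v)) / (2 * x)"
  unfolding sum_subtractf sum_divide_distrib[symmetric] s_def by simp
  also have "\<dots> \<le> s - s\<^sup>2 / 8 / (2 * x)" using lb by linarith
  also have "\<dots> \<le> (x - 1) - (x - 1)\<^sup>2 / 8 / (2 * x)"
  proof -
  have "(x - 1 - s) * (x - 1 + s) \<le> (x - 1 - s) * (16 * x)" using s by (intro mult_left_mono) auto
  then have "(x - 1)\<^sup>2 - s\<^sup>2 \<le> (x - 1 - s) * (16 * x)" by (simp add: power2_eq_square algebra_simps)
  then have "((x - 1)\<^sup>2 - s\<^sup>2) / (16 * x) \<le> x - 1 - s"
   using s by (subst pos_divide_le_eq) auto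
  then show ?thesis by (simp add: diff_divide_distrib)
  qed
  also have "\<dots> \<le> 31 / 32 * (x - 1)"
  proof (cases "x = 1")
  case False
  then have "card (X \<inter> G) \<ge> 2" using s by (auto simp: x_def)
  then have "x \<ge> 2" by (simp add: x_def)
  then have "(x - 1) * x \<le> (x - 1) * (2 * (x - 1))" by (intro mult_left_mono) auto
  then show ?thesis using \<open>x \<ge> 2\<close> by (simp add: field_simps power2_eq_square)
  qed simp
  finally show ?thesis .
qed


subsection \<open>A Lyapunov function for the four masses\<close>

text \<open>All points outside \<open>G\<close> lie on one side of a chord with both ends in \<open>G\<close>, as for an arc of the circle.\<close>

definition arc_like :: "'a::linorder set => bool" where
  "arc_like G \<longleftrightarrow> (\<forall>u\<in>G. \<forall>v\<in>G. (\<forall>t. t \<notin> G --> arc_in u v t) \<or> (\<forall>t. t \<notin> G --> arc_out u v t))"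

lemma arc_like_intervals:
  fixes r r' :: "'a::linorder"
  shows "arc_like {..<r}" "arc_like (- {..<r})" "arc_like {r..<r'}" "arc_like (- {r..<r'})"
proof -
  show "arc_like {..<r}" by (auto simp: arc_like_def arc_in_def arc_out_def)
  show "arc_like (- {..<r})" by (auto simp: arc_like_def arc_in_def arc_out_def)
  show "arc_like {r..<r'}"
  unfolding arc_like_def
  proof (intro ballI disjI2 allI impI)
  fix u v t assume *: "u \<in> {r..<r'}" "v \<in> {r..<r'}" "t \<notin> {r..<r'}"
  have "r \<le> min u v" "max u v < r'" "t < r \<or> r' \<le> t" using * by auto
  then show "arc_out u v t" unfolding arc_out_def by (meson less_le_trans)
  qed
  show "arc_like (- {r..<r'})"
  unfolding arc_like_def
  proof (intro ballI)
  fix u v assume "u \<in> - {r..<r'}" "v \<in> - {r..<r'}"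
  then have "u < r \<or> r' \<le> u" "v < r \<or> r' \<le> v" by auto
  then consider "max u v < r" | "r' \<le> min u v" | "min u v < r" "r' \<le> max u v"
   by (auto simp: min_less_iff_disj le_max_iff_disj)
  then show "(\<forall>t. t \<notin> - {r..<r'} --> arc_in u v t) \<or> (\<forall>t. t \<notin> - {r..<r'} --> arc_out u v t)"
  proof cases
   case 3
   then show ?thesis unfolding arc_in_def by (intro disjI1) (meson ComplI atLeastLessThan_iff less_le_trans)
  next
   case 1
   then show ?thesis unfolding arc_out_def by (intro disjI2) (meson ComplI atLeastLessThan_iff less_le_trans)
  next
   case 2
   then show ?thesis unfolding arc_out_def by (intro disjI2) (meson ComplI atLeastLessThan_iff less_le_trans)
  qed
  qed
qed

text \<open>Above the threshold \<open>5632 = 64 * 88\<close> half of the gain \<open>1 / 32\<close> of \<open>lyap_drift\<close> outweighs twice the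
  constant 44; below it \<open>alive_count_drift\<close> with \<open>K = 5632\<close> gives a loss, of which this is half.\<close>

definition drift_rate :: real where "drift_rate = (1 / (5632\<^sup>2 + 1))\<^sup>2 / 8"

definition drift_const :: real where "drift_const = 44 / drift_rate"

lemma drift_rate: "0 < drift_rate" "drift_rate < 1"
  by (simp_all add: drift_rate_def power_divide)

lemma drift_const_pos: "0 < drift_const"
  using drift_rate by (simp add: drift_const_def)

lemma integral_bind_pmf_bounded:
  fixes f :: "'b => real"
  assumes "\<And>y. \<bar>f y\<bar> \<le> B"
  shows "(\<integral>y. f y \<partial>bind_pmf M N) = (\<integral>x. (\<integral>y. f y \<partial>N x) \<partial>M)"
proof -
  have "integrable (measure_pmf p) f" for p
  using assms by (intro measure_pmf.integrable_const_bound[where B = B]) auto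
  note int = this
  have sh: "(\<integral>y. f y + B \<partial>measure_pmf p) = (\<integral>y. f y \<partial>measure_pmf p) + B" for p
  using int by (simp add: measure_pmf.prob_space)
  have nn: "0 \<le> f y + B" for y using assms[of y] by linarith
  have I: "integrable (measure_pmf p) (\<lambda>y. f y + B)" for p using int by simp
  have B0: "0 \<le> B" using assms[of undefined] by linarith
  have J: "\<bar>\<integral>y. f y \<partial>N x\<bar> \<le> B" for x
  proof -
  have "\<bar>\<integral>y. f y \<partial>N x\<bar> \<le> (\<integral>y. \<bar>f y\<bar> \<partial>N x)" by (rule integral_abs_bound)
  also have "\<dots> \<le> (\<integral>y. B \<partial>N x)" using assms int by (intro integral_mono) auto
  finally show ?thesis by (simp add: measure_pmf.prob_space)
  qed
  have J0: "0 \<le> (\<integral>y. f y \<partial>N x) + B" for x using J[of x] by linarith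
  have J': "integrable (measure_pmf M) (\<lambda>x. \<integral>y. f y \<partial>N x)"
  using J by (intro measure_pmf.integrable_const_bound[where B = B]) auto
  have "ennreal (\<integral>y. f y + B \<partial>bind_pmf M N) = (\<integral>\<^sup>+y. ennreal (f y + B) \<partial>bind_pmf M N)"
  using nn I by (intro nn_integral_eq_integral[symmetric]) auto
  also have "\<dots> = (\<integral>\<^sup>+x. (\<integral>\<^sup>+y. ennreal (f y + B) \<partial>N x) \<partial>M)" by simp
  also have "\<dots> = (\<integral>\<^sup>+x. ennreal (\<integral>y. f y + B \<partial>N x) \<partial>M)"
  using nn I by (intro nn_integral_cong nn_integral_eq_integral) auto
  also have "\<dots> = ennreal (\<integral>x. (\<integral>y. f y + B \<partial>N x) \<partial>M)"
  using J' by (intro nn_integral_eq_integral) (auto simp: sh J0)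
  finally have "(\<integral>y. f y + B \<partial>bind_pmf M N) = (\<integral>x. (\<integral>y. f y + B \<partial>N x) \<partial>M)"
  using nn by (subst (asm) ennreal_inj) (auto intro!: Bochner_Integration.integral_nonneg)
  then show ?thesis using J' by (simp add: sh measure_pmf.prob_space)
qed

context
  fixes r1 r2 r3 :: "'a::linorder"
  assumes r12: "r1 \<le> r2" and r23: "r2 \<le> r3"
begin

definition on_alive :: "('a set => real) => 'a set => real" where
  "on_alive \<phi> Y = (if alive r1 r2 r3 Y then \<phi> Y else 0)"

lemma ratio_nonneg: "0 \<le> ratio G X" by (simp add: ratio_def)

lemma on_alive_ratio_le:
  assumes "finite X" "Y \<subseteq> X"
  shows "on_alive (ratio G) Y \<le> sqrt (real (card (X \<inter> G))) * (1 / sqrt (real (card (Y - G))))"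
proof -
  have "card (Y \<inter> G) \<le> card (X \<inter> G)" using assms by (intro card_mono) auto
  then show ?thesis
  by (auto simp: on_alive_def ratio_def real_sqrt_divide intro!: divide_right_mono)
qed

text \<open>If both ends lie in \<open>G\<close>, one part contains the whole complement of \<open>G\<close>, and the part that reaches all
  arcs has lost a proportion of \<open>G\<close> in mean. All other chords cut the complement into parts of distinct
  sizes, which costs at most the mean of an inverse square root, hence a constant.\<close>

lemma ratio_drift:
  assumes X: "finite X" "alive r1 r2 r3 X" and G: "arc_like G"
  and two: "\<And>Y. alive r1 r2 r3 Y ==> Y - G ~= {}"
  defines "m \<equiv> real (card X)"
  shows "(\<Sum>u\<in>X. \<Sum>v\<in>X - {u}. on_alive (ratio G) (in_part X u v) + on_alive (ratio G) (out_part X u v))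
  \<le> m * (m - 1) * (31 / 32 * ratio G X + 11)"
proof -
  define F where "F u v = on_alive (ratio G) (in_part X u v) + on_alive (ratio G) (out_part X u v)" for u v
  define x where "x = real (card (X \<inter> G))"
  define y where "y = real (card (X - G))"
  have F_comm: "F u v = F v u" for u v
  unfolding F_def in_part_def out_part_def by (simp add: arc_in_commute[of u v] arc_out_commute[of u v])
  have F_nonneg: "0 \<le> F u v" for u v by (simp add: F_def on_alive_def ratio_nonneg)
  have xy: "0 \<le> x" "1 \<le> y" "m = x + y"
  proof -
  show "0 \<le> x" by (simp add: x_def)
  show "1 \<le> y" using two[OF X(2)] X(1) by (simp add: y_def Suc_le_eq card_gt_0_iff)
  have "card X = card (X \<inter> G) + card (X - G)"
   using X(1) by (metis card_Int_Diff)
  then show "m = x + y" by (simp add: m_def x_def y_def)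
  qed
  have m4: "4 \<le> m" using alive_card[OF X(2,1)] by (simp add: m_def)
  have outer: "(\<Sum>v\<in>X \<inter> - G - {u}. F u v) \<le> 8 * sqrt x * sqrt y" for u
  proof -
  have "F u v \<le> sqrt x * (1 / sqrt (real (card (in_part X u v \<inter> - G))) + 1 / sqrt (real (card (out_part X u v \<inter> - G))))" for v
   using on_alive_ratio_le[OF X(1) in_part_subset, of G u v] on_alive_ratio_le[OF X(1) out_part_subset, of G u v]
   by (simp add: F_def x_def Diff_eq distrib_left)
  then have "(\<Sum>v\<in>X \<inter> - G - {u}. F u v) \<le> (\<Sum>v\<in>X \<inter> - G - {u}. sqrt x * (1 / sqrt (real (card (in_part X u v \<inter> - G))) + 1 / sqrt (real (card (out_part X u v \<inter> - G)))))"
   by (intro sum_mono)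
  also have "\<dots> \<le> sqrt x * (8 * sqrt y)"
   unfolding sum_distrib_left[symmetric]
   using sum_inverse_sqrt_parts_le[OF X(1), where W = "- G" and u = u]
   by (intro mult_left_mono) (auto simp: y_def x_def Diff_eq)
  finally show ?thesis by simp
  qed
  have sxy: "sqrt x * sqrt y \<le> m / 2"
  using arith_geo_mean_sqrt[of x y] xy by (simp add: real_sqrt_mult)
  have inner: "(\<Sum>v\<in>X \<inter> G - {u}. F u v) \<le> ratio G X * (31 / 32 * (x - 1))" if u: "u \<in> X \<inter> G" for u
  proof -
  define S where "S = {v \<in> X \<inter> G - {u}. alive r1 r2 r3 (in_part X u v) \<or> alive r1 r2 r3 (out_part X u v)}"
  define a where "a v = (if alive r1 r2 r3 (in_part X u v) then card (in_part X u v \<inter> G) else card (out_part X u v \<inter> G))" for v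
  have F: "F u v = ratio G X * sqrt (real (a v) / x)" if v: "v \<in> S" for v
  proof -
   have arcs: "(\<forall>t. t \<notin> G --> arc_in u v t) \<or> (\<forall>t. t \<notin> G --> arc_out u v t)"
    using G u v unfolding arc_like_def S_def by blast
   have x0: "x ~= 0" using u X(1) by (auto simp: x_def)
   have alv: "ratio G P = ratio G X * sqrt (real (card (P \<inter> G)) / x)"
    if P: "P = in_part X u v \<or> P = out_part X u v" "alive r1 r2 r3 P" for P
   proof -
    have "P - G ~= {}" using two[OF P(2)] .
    then have "P - G = X - G"
     using P(1) arcs arc_in_imp_not_out[of u v] unfolding in_part_def out_part_def by blast
    then have "ratio G P = sqrt (real (card (P \<inter> G)) / y)" by (simp add: ratio_def y_def)
    also have "\<dots> = sqrt (x / y) * sqrt (real (card (P \<inter> G)) / x)"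
     using x0 xy by (simp add: real_sqrt_mult[symmetric] field_simps)
    finally show ?thesis by (simp add: ratio_def x_def y_def)
   qed
   show ?thesis
   proof (cases "alive r1 r2 r3 (in_part X u v)")
    case True
    then show ?thesis using one_part_alive[OF True r12 r23] alv[of "in_part X u v"]
     by (simp add: F_def on_alive_def a_def)
   next
    case False
    then have "alive r1 r2 r3 (out_part X u v)" using v by (auto simp: S_def)
    then show ?thesis using False alv[of "out_part X u v"] by (simp add: F_def on_alive_def a_def)
   qed
  qed
  have "(\<Sum>v\<in>X \<inter> G - {u}. F u v) = (\<Sum>v\<in>S. F u v)"
   using X(1) by (intro sum.mono_neutral_right) (auto simp: S_def F_def on_alive_def)
  also have "\<dots> = ratio G X * (\<Sum>v\<in>S. sqrt (real (a v) / x))"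
   by (simp add: F sum_distrib_left)
  also have "\<dots> \<le> ratio G X * (31 / 32 * (x - 1))"
   unfolding x_def
  proof (rule mult_left_mono[OF sum_sqrt_surviving_le[OF X(1) u] ratio_nonneg])
   show "S \<subseteq> X \<inter> G - {u}" by (auto simp: S_def)
   show "a v = card (in_part X u v \<inter> G) \<or> a v = card (out_part X u v \<inter> G)" for v by (simp add: a_def)
  qed
  finally show ?thesis .
  qed
  have fin: "finite (X \<inter> G)" "finite (X \<inter> - G)" using X(1) by auto
  have split: "(\<Sum>v\<in>X - {u}. F u v) = (\<Sum>v\<in>X \<inter> G - {u}. F u v) + (\<Sum>v\<in>X \<inter> - G - {u}. F u v)" for u
  proof -
  have "X - {u} = (X \<inter> G - {u}) \<union> (X \<inter> - G - {u})" by auto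
  then show ?thesis using fin by (simp only:) (intro sum.union_disjoint, auto)
  qed
  have "(\<Sum>u\<in>X. \<Sum>v\<in>X \<inter> G - {u}. F u v) =
   (\<Sum>u\<in>X \<inter> G. \<Sum>v\<in>X \<inter> G - {u}. F u v) + (\<Sum>u\<in>X \<inter> - G. \<Sum>v\<in>X \<inter> G - {u}. F u v)"
  proof -
  have "X = (X \<inter> G) \<union> (X \<inter> - G)" by auto
  then show ?thesis using fin by (metis (no_types, lifting) sum.union_disjoint Compl_disjoint inf_assoc inf_bot_right inf_commute)
  qed
  also have "(\<Sum>u\<in>X \<inter> - G. \<Sum>v\<in>X \<inter> G - {u}. F u v) = (\<Sum>u\<in>X \<inter> - G. \<Sum>v\<in>X \<inter> G. F u v)"
  by (intro sum.cong) auto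
  also have "\<dots> = (\<Sum>v\<in>X \<inter> G. \<Sum>u\<in>X \<inter> - G. F u v)" by (rule sum.swap)
  also have "\<dots> = (\<Sum>v\<in>X \<inter> G. \<Sum>u\<in>X \<inter> - G - {v}. F v u)"
  using F_comm by (intro sum.cong) auto
  also have "\<dots> \<le> (\<Sum>v\<in>X \<inter> G. 8 * sqrt x * sqrt y)" using outer by (intro sum_mono)
  also have "(\<Sum>u\<in>X \<inter> G. \<Sum>v\<in>X \<inter> G - {u}. F u v) \<le> (\<Sum>u\<in>X \<inter> G. ratio G X * (31 / 32 * (x - 1)))"
  using inner by (intro sum_mono)
  finally have A: "(\<Sum>u\<in>X. \<Sum>v\<in>X \<inter> G - {u}. F u v) \<le>
   x * (ratio G X * (31 / 32 * (x - 1))) + x * (8 * sqrt x * sqrt y)" by (simp add: x_def)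
  have B: "(\<Sum>u\<in>X. \<Sum>v\<in>X \<inter> - G - {u}. F u v) \<le> m * (8 * sqrt x * sqrt y)"
  using sum_mono[of X "\<lambda>u. \<Sum>v\<in>X \<inter> - G - {u}. F u v" "\<lambda>_. 8 * sqrt x * sqrt y"] outer
  by (simp add: m_def)
  have "x * (8 * sqrt x * sqrt y) \<le> m * (8 * sqrt x * sqrt y)"
  using xy by (intro mult_right_mono) auto
  moreover have "m * (8 * sqrt x * sqrt y) \<le> 4 * m * m"
  using mult_left_mono[OF sxy, of "8 * m"] m4 by (simp add: mult.assoc mult.left_commute)
  moreover have "8 * m * m \<le> 11 * (m * (m - 1))"
  using mult_left_mono[OF m4, of m] m4 by (simp add: algebra_simps)
  moreover have "x * (ratio G X * (31 / 32 * (x - 1))) \<le> m * (m - 1) * (31 / 32 * ratio G X)"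
  proof -
  have "x * (x - 1) \<le> m * (m - 1)"
  proof -
   have "m * (m - 1) - x * (x - 1) = y * (x + m - 1)" using xy(3) by (simp add: algebra_simps)
   moreover have "0 \<le> y * (x + m - 1)" using xy m4 by (intro mult_nonneg_nonneg) auto
   ultimately show ?thesis by linarith
  qed
  from mult_right_mono[OF this, of "31 / 32 * ratio G X"] show ?thesis
   by (simp add: ratio_nonneg algebra_simps)
  qed
  ultimately have "(\<Sum>u\<in>X. \<Sum>v\<in>X - {u}. F u v) \<le> m * (m - 1) * (31 / 32 * ratio G X) + 11 * (m * (m - 1))"
  using A B unfolding split sum.distrib by linarith
  then show ?thesis unfolding F_def by (simp add: algebra_simps)
qed

definition lyap :: "'a set => real" where
  "lyap X = ratio {..<r2} X + ratio (- {..<r2}) X + ratio {r1..<r3} X + ratio (- {r1..<r3}) X"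

lemma lyap_nonneg: "0 \<le> lyap X" by (simp add: lyap_def ratio_nonneg)

lemma lyap_drift:
  assumes X: "finite X" "alive r1 r2 r3 X"
  defines "m \<equiv> real (card X)"
  shows "(\<Sum>u\<in>X. \<Sum>v\<in>X - {u}. on_alive lyap (in_part X u v) + on_alive lyap (out_part X u v))
  \<le> m * (m - 1) * (31 / 32 * lyap X + 44)"
proof -
  have two: "Y - {..<r2} ~= {}" "Y - (- {..<r2}) ~= {}" "Y - {r1..<r3} ~= {}" "Y - (- {r1..<r3}) ~= {}"
  if Y: "alive r1 r2 r3 Y" for Y
  proof -
  obtain a b c d where abcd: "a \<in> Y" "a < r1" "b \<in> Y" "r1 \<le> b" "b < r2" "c \<in> Y" "r2 \<le> c" "c < r3" "d \<in> Y" "r3 \<le> d"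
   using Y by (rule aliveE)
  have "c \<notin> {..<r2}" "b \<in> {..<r2}" "d \<notin> {r1..<r3}" "b \<in> {r1..<r3}"
   using abcd r23 by auto
  then show "Y - {..<r2} ~= {}" "Y - (- {..<r2}) ~= {}" "Y - {r1..<r3} ~= {}" "Y - (- {r1..<r3}) ~= {}"
   using abcd by blast+
  qed
  note d = ratio_drift[OF X arc_like_intervals(1) two(1)] ratio_drift[OF X arc_like_intervals(2) two(2)]
  ratio_drift[OF X arc_like_intervals(3) two(3)] ratio_drift[OF X arc_like_intervals(4) two(4)]
  have l: "on_alive lyap Y = on_alive (ratio {..<r2}) Y + on_alive (ratio (- {..<r2})) Y +
   on_alive (ratio {r1..<r3}) Y + on_alive (ratio (- {r1..<r3})) Y" for Y
  by (simp add: on_alive_def lyap_def)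
  have "(\<Sum>u\<in>X. \<Sum>v\<in>X - {u}. on_alive lyap (in_part X u v) + on_alive lyap (out_part X u v)) =
   (\<Sum>u\<in>X. \<Sum>v\<in>X - {u}. on_alive (ratio {..<r2}) (in_part X u v) + on_alive (ratio {..<r2}) (out_part X u v)) +
   (\<Sum>u\<in>X. \<Sum>v\<in>X - {u}. on_alive (ratio (- {..<r2})) (in_part X u v) + on_alive (ratio (- {..<r2})) (out_part X u v)) +
   (\<Sum>u\<in>X. \<Sum>v\<in>X - {u}. on_alive (ratio {r1..<r3}) (in_part X u v) + on_alive (ratio {r1..<r3}) (out_part X u v)) +
   (\<Sum>u\<in>X. \<Sum>v\<in>X - {u}. on_alive (ratio (- {r1..<r3})) (in_part X u v) + on_alive (ratio (- {r1..<r3})) (out_part X u v))"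
  unfolding l sum.distrib by linarith
  also have "\<dots> \<le> m * (m - 1) * (31 / 32 * ratio {..<r2} X + 11) + m * (m - 1) * (31 / 32 * ratio (- {..<r2}) X + 11) +
   m * (m - 1) * (31 / 32 * ratio {r1..<r3} X + 11) + m * (m - 1) * (31 / 32 * ratio (- {r1..<r3}) X + 11)"
  unfolding m_def by (intro add_mono d)
  also have "\<dots> = m * (m - 1) * (31 / 32 * lyap X + 44)"
  by (simp only: lyap_def distrib_left)
  finally show ?thesis .
qed

text \<open>If \<open>lyap X\<close> is bounded, then each union of two neighbouring arcs carries a fixed proportion of the
  points. Then some two opposite arcs do, so that with a fixed probability the chord joins these and
  kills both parts.\<close>

lemma alive_count_drift:
  assumes X: "finite X" "alive r1 r2 r3 X" and K: "1 \<le> K" "lyap X \<le> K"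
  defines "m \<equiv> real (card X)" and "e \<equiv> 1 / (K\<^sup>2 + 1)"
  shows "(\<Sum>u\<in>X. \<Sum>v\<in>X - {u}. on_alive (\<lambda>_. 1) (in_part X u v) + on_alive (\<lambda>_. 1) (out_part X u v))
  \<le> m * (m - 1) * (1 - e\<^sup>2 / 4)"
proof -
  define N where "N u v = on_alive (\<lambda>_. 1) (in_part X u v) + on_alive (\<lambda>_. 1) (out_part X u v)" for u v
  define A where "A = X \<inter> {..<r1}"
  define B where "B = X \<inter> {r1..<r2}"
  define C where "C = X \<inter> {r2..<r3}"
  define D where "D = X \<inter> {r3..}"
  define a b c d where "a = real (card A)" and "b = real (card B)" and "c = real (card C)" and "d = real (card D)"
  have finABCD: "finite A" "finite B" "finite C" "finite D" using X by (auto simp: A_def B_def C_def D_def)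
  have AB: "card (A \<union> B) = card A + card B" "card (C \<union> D) = card C + card D" "card (B \<union> C) = card B + card C" "card (A \<union> D) = card A + card D"
  using finABCD r12 r23 by (auto intro!: card_Un_disjoint simp: A_def B_def C_def D_def)
  have sets: "X \<inter> {..<r2} = A \<union> B" "X - {..<r2} = C \<union> D" "X \<inter> {r1..<r3} = B \<union> C" "X - {r1..<r3} = A \<union> D"
  "X \<inter> - {..<r2} = C \<union> D" "X - (- {..<r2}) = A \<union> B" "X \<inter> - {r1..<r3} = A \<union> D" "X - (- {r1..<r3}) = B \<union> C"
  using r12 r23 by (auto simp: A_def B_def C_def D_def)
  have pos: "1 \<le> a" "1 \<le> b" "1 \<le> c" "1 \<le> d"
  using X finABCD by (auto simp: a_def b_def c_def d_def Suc_le_eq card_gt_0_iff alive_def A_def B_def C_def D_def)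
  have m: "m = a + b + c + d"
  proof -
  have "X = (A \<union> B) \<union> (C \<union> D)" "(A \<union> B) \<inter> (C \<union> D) = {}" using sets by auto
  then have "card X = card (A \<union> B) + card (C \<union> D)" using finABCD by (metis card_Un_disjoint finite_UnI)
  then show ?thesis by (simp add: m_def AB a_def b_def c_def d_def)
  qed
  have bound: "p + q \<le> (K\<^sup>2 + 1) * q" if "sqrt (p / q) \<le> K" "1 \<le> p" "1 \<le> q" for p q :: real
  proof -
  have "p / q \<le> K\<^sup>2" using that K(1) by (metis real_sqrt_le_iff real_sqrt_abs abs_of_nonneg order_trans zero_le_one)
  then show ?thesis using that by (simp add: field_simps)
  qed
  have R: "ratio {..<r2} X = sqrt ((a + b) / (c + d))" "ratio (- {..<r2}) X = sqrt ((c + d) / (a + b))"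
  "ratio {r1..<r3} X = sqrt ((b + c) / (a + d))" "ratio (- {r1..<r3}) X = sqrt ((a + d) / (b + c))"
  unfolding ratio_def sets AB a_def b_def c_def d_def by simp_all
  have RK: "sqrt ((a + b) / (c + d)) \<le> K" "sqrt ((c + d) / (a + b)) \<le> K" "sqrt ((b + c) / (a + d)) \<le> K" "sqrt ((a + d) / (b + c)) \<le> K"
  using K(2) ratio_nonneg[of "{..<r2}" X] ratio_nonneg[of "- {..<r2}" X] ratio_nonneg[of "{r1..<r3}" X] ratio_nonneg[of "- {r1..<r3}" X]
  unfolding lyap_def R by linarith+
  define h where "h = e * m / 2"
  have e0: "0 < e" "K\<^sup>2 + 1 > 0" by (simp_all add: e_def add_nonneg_pos)
  have em: "e * m \<le> q" if "m \<le> (K\<^sup>2 + 1) * q" for q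
  using that e0(2) by (simp add: e_def divide_le_eq mult.commute)
  have h4: "2 * h \<le> c + d" "2 * h \<le> a + b" "2 * h \<le> a + d" "2 * h \<le> b + c"
  using bound[OF RK(1)] bound[OF RK(2)] bound[OF RK(3)] bound[OF RK(4)] pos em m
  by (simp_all add: h_def add_ac)
  have h0: "0 \<le> h" using e0 m pos by (simp add: h_def)
  have key: "h\<^sup>2 \<le> a * c + b * d"
  proof (cases "(h \<le> a \<and> h \<le> c) \<or> (h \<le> b \<and> h \<le> d)")
  case True
  then show ?thesis
  proof
   assume "h \<le> a \<and> h \<le> c"
   then have "h * h \<le> a * c" using h0 by (intro mult_mono) auto
   moreover have "0 \<le> b * d" using pos by simp
   ultimately show ?thesis unfolding power2_eq_square by linarith
  next
   assume "h \<le> b \<and> h \<le> d"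
   then have "h * h \<le> b * d" using h0 by (intro mult_mono) auto
   moreover have "0 \<le> a * c" using pos by simp
   ultimately show ?thesis unfolding power2_eq_square by linarith
  qed
  next
  case False
  then show ?thesis using h4 by argo
  qed
  have N1: "N u v \<le> 1 - indicator (A \<times> C \<union> B \<times> D) (u, v)" for u v
  proof (cases "(u, v) \<in> A \<times> C \<union> B \<times> D")
  case True
  then have "(u < r1 \<and> r2 \<le> v \<and> v < r3) \<or> (r1 \<le> u \<and> u < r2 \<and> r3 \<le> v)"
   by (auto simp: A_def B_def C_def D_def)
  then show ?thesis using opposite_not_alive[OF r12 r23, of u v X] True by (simp add: N_def on_alive_def)
  next
  case False
  then show ?thesis using one_part_alive[OF _ r12 r23, of X u v] by (simp add: N_def on_alive_def)
  qed
  have "(\<Sum>u\<in>X. \<Sum>v\<in>X - {u}. N u v) \<le> (\<Sum>u\<in>X. \<Sum>v\<in>X - {u}. 1 - indicator (A \<times> C \<union> B \<times> D) (u, v))"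
  using N1 by (intro sum_mono)
  also have "\<dots> = (\<Sum>p\<in>(SIGMA u:X. X - {u}). 1 - indicator (A \<times> C \<union> B \<times> D) p)"
  using X(1) by (subst sum.Sigma) auto
  also have "\<dots> = real (card (SIGMA u:X. X - {u})) - (\<Sum>p\<in>(SIGMA u:X. X - {u}). indicator (A \<times> C \<union> B \<times> D) p)"
  by (simp add: sum_subtractf)
  also have "real (card (SIGMA u:X. X - {u})) = m * (m - 1)"
  proof -
  have "card (SIGMA u:X. X - {u}) = card X * (card X - 1)" using X(1) by (simp add: card_SigmaI)
  moreover have "1 \<le> card X" using pos m by (simp add: m_def)
  ultimately show ?thesis by (simp add: m_def of_nat_diff)
  qed
  also have "(\<Sum>p\<in>(SIGMA u:X. X - {u}). indicator (A \<times> C \<union> B \<times> D) p) = real (card (A \<times> C \<union> B \<times> D))"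
  proof -
  have sub: "A \<times> C \<union> B \<times> D \<subseteq> (SIGMA u:X. X - {u})"
   using r12 r23 by (auto simp: A_def B_def C_def D_def)
  have "(\<Sum>p\<in>(SIGMA u:X. X - {u}). indicator (A \<times> C \<union> B \<times> D) p) = (\<Sum>p\<in>A \<times> C \<union> B \<times> D. (1::real))"
   using X(1) sub by (intro sum.mono_neutral_cong_right) auto
  then show ?thesis by simp
  qed
  also have "real (card (A \<times> C \<union> B \<times> D)) = a * c + b * d"
  proof -
  have "(A \<times> C) \<inter> (B \<times> D) = {}" by (auto simp: A_def B_def)
  then have "card (A \<times> C \<union> B \<times> D) = card A * card C + card B * card D"
   using finABCD by (simp add: card_Un_disjoint card_cartesian_product)
  then show ?thesis by (simp add: a_def b_def c_def d_def)
  qed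
  also have "m * (m - 1) - (a * c + b * d) \<le> m * (m - 1) - h\<^sup>2" using key by simp
  also have "\<dots> = m * (m - 1) - m * m * (e\<^sup>2 / 4)" by (simp add: h_def power2_eq_square)
  also have "\<dots> \<le> m * (m - 1) * (1 - e\<^sup>2 / 4)"
  proof -
  have "m * (m - 1) * (e\<^sup>2 / 4) \<le> m * m * (e\<^sup>2 / 4)"
   using m pos by (intro mult_right_mono mult_left_mono) auto
  then show ?thesis by (simp add: algebra_simps)
  qed
  finally show ?thesis unfolding N_def .
qed


text \<open>Large values of \<open>lyap\<close> contract by \<open>lyap_drift\<close>; for small values the loss of the added constant is what
  counts, by \<open>alive_count_drift\<close>.\<close>

lemma lyap_contraction:
  assumes X: "finite X" "alive r1 r2 r3 X"
  shows "(\<Sum>u\<in>X. \<Sum>v\<in>X - {u}. on_alive (\<lambda>Y. lyap Y + drift_const) (in_part X u v) +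
    on_alive (\<lambda>Y. lyap Y + drift_const) (out_part X u v))
   \<le> (1 - drift_rate) * (real (card X) * (real (card X) - 1)) * (lyap X + drift_const)"
proof -
  define K :: real where "K = 5632"
  define c where "c = (1 / (K\<^sup>2 + 1))\<^sup>2 / 4"
  define \<eta> where "\<eta> = drift_rate"
  define A where "A = drift_const"
  have \<eta>_c: "\<eta> = c / 2" and A_c: "A = 88 / c"
  by (simp_all add: \<eta>_def c_def drift_rate_def A_def drift_const_def K_def power_divide)
  have c: "0 < c" "c \<le> 1 / 32" by (simp_all add: c_def K_def power_divide)
  have eA: "\<eta> * A = 44" "c * A = 88" using c by (simp_all add: \<eta>_c A_c)
  have A: "0 < A" using c by (simp add: A_c)
  have \<eta>: "0 < \<eta>" "\<eta> \<le> 1 / 64" using c by (simp_all add: \<eta>_c)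
  show ?thesis
  proof -
  define m where "m = real (card X)"
  define N where "N = (\<Sum>u\<in>X. \<Sum>v\<in>X - {u}. on_alive (\<lambda>_. 1) (in_part X u v) + on_alive (\<lambda>_. 1) (out_part X u v))"
  have mm: "0 \<le> m * (m - 1)"
  proof -
   have "X ~= {}" using X(2) by (auto simp: alive_def)
   then have "1 \<le> m" using X(1) by (simp add: m_def Suc_le_eq card_gt_0_iff)
   then show ?thesis by simp
  qed
  have split: "on_alive (\<lambda>Y. lyap Y + A) Y = on_alive lyap Y + A * on_alive (\<lambda>_. 1) Y" for Y
   by (simp add: on_alive_def)
  have "(\<Sum>u\<in>X. \<Sum>v\<in>X - {u}. on_alive (\<lambda>Y. lyap Y + A) (in_part X u v) + on_alive (\<lambda>Y. lyap Y + A) (out_part X u v)) =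
    (\<Sum>u\<in>X. \<Sum>v\<in>X - {u}. on_alive lyap (in_part X u v) + on_alive lyap (out_part X u v)) + A * N"
   unfolding split N_def sum_distrib_left sum.distrib[symmetric] by (simp add: algebra_simps)
  also have "\<dots> \<le> m * (m - 1) * (31 / 32 * lyap X + 44) + A * N"
   unfolding m_def using lyap_drift[OF X] by simp
  also have "\<dots> \<le> (1 - \<eta>) * (m * (m - 1)) * (lyap X + A)"
  proof (cases "lyap X \<le> K")
   case True
   \<comment> \<open>A fixed proportion of the chords leaves no part alive: the loss \<open>c * A = 88\<close> of the constant pays for the 44 and for \<open>\<eta> * A = 44\<close>.\<close>
   have "N \<le> m * (m - 1) * (1 - c)"
    using alive_count_drift[OF X _ True] unfolding N_def m_def c_def by (simp add: K_def)
   then have "A * N \<le> A * (m * (m - 1) * (1 - c))" using A by (intro mult_left_mono) auto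
   also have "\<dots> = m * (m - 1) * (A - c * A)" by (simp add: algebra_simps)
   also have "\<dots> = m * (m - 1) * (A - 88)" by (simp only: eA(2))
   finally have "A * N \<le> m * (m - 1) * (A - 88)" .
   then have "m * (m - 1) * (31 / 32 * lyap X + 44) + A * N \<le> m * (m - 1) * (31 / 32 * lyap X + A - 44)"
    by (simp add: algebra_simps)
   also have "\<dots> \<le> m * (m - 1) * ((1 - \<eta>) * (lyap X + A))"
   proof (rule mult_left_mono[OF _ mm])
    have "\<eta> * lyap X \<le> 1 / 64 * lyap X" using \<eta>(2) lyap_nonneg by (rule mult_right_mono)
    then show "31 / 32 * lyap X + A - 44 \<le> (1 - \<eta>) * (lyap X + A)"
     using eA(1) lyap_nonneg[of X] by (simp add: algebra_simps)
   qed
   finally show ?thesis by (simp add: mult_ac)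
  next
   case False
   have "N \<le> m * (m - 1)"
   proof -
    have "N \<le> (\<Sum>u\<in>X. \<Sum>v\<in>X - {u}. 1)"
     unfolding N_def using one_part_alive[OF _ r12 r23] by (intro sum_mono) (auto simp: on_alive_def)
    also have "\<dots> = m * real (card X - 1)" using X(1) by (simp add: m_def)
    also have "\<dots> = m * (m - 1)"
     using alive_card[OF X(2,1)] by (simp add: m_def of_nat_diff)
    finally show ?thesis .
   qed
   then have "A * N \<le> A * (m * (m - 1))" using A by (intro mult_left_mono) auto
   then have "m * (m - 1) * (31 / 32 * lyap X + 44) + A * N \<le> m * (m - 1) * (31 / 32 * lyap X + 44 + A)"
    by (simp add: algebra_simps)
   also have "\<dots> \<le> m * (m - 1) * ((1 - \<eta>) * (lyap X + A))"
   proof (rule mult_left_mono[OF _ mm])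
    have "\<eta> * lyap X \<le> 1 / 64 * lyap X" using \<eta>(2) lyap_nonneg by (rule mult_right_mono)
    then show "31 / 32 * lyap X + 44 + A \<le> (1 - \<eta>) * (lyap X + A)"
     using eA(1) False unfolding K_def by (simp only: left_diff_distrib distrib_left)
   qed
   finally show ?thesis by (simp add: mult_ac)
  qed
  finally show ?thesis by (simp add: m_def A_def \<eta>_def)
  qed
qed


subsection \<open>Long survival in the splitting tree is unlikely\<close>

definition deep_alive :: "nat => 'a node set => bool" where
  "deep_alive k H \<longleftrightarrow> (\<exists>X j u v. (X, j, u, v) \<in> H \<and> k \<le> j \<and> alive r1 r2 r3 X)"

lemma tree_nodes_subset:
  "finite X ==> H \<in> set_pmf (tree f X j) ==> (Y, i, u, v) \<in> H ==> Y \<subseteq> X"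
proof (induction f arbitrary: X j H)
  case (Suc f)
  then have c: "\<not> card X < 2" by (auto split: if_splits)
  then have "X ~= {}" by auto
  obtain x y A1 A2 where xy: "x \<in> X" "y \<in> X - {x}"
  "A1 \<in> set_pmf (tree f (in_part X x y) (Suc j))" "A2 \<in> set_pmf (tree f (out_part X x y) (Suc j))"
  "H = insert (X, j, x, y) (A1 \<union> A2)"
  using Suc.prems(2) c Suc.prems(1) \<open>X ~= {}\<close> set_pmf_of_set_diff[OF Suc.prems(1) c]
  by (auto simp: union_pmf_def)
  have "finite (in_part X x y)" "finite (out_part X x y)" using Suc.prems(1) by auto
  then show ?case
  using Suc.IH[OF _ xy(3)] Suc.IH[OF _ xy(4)] Suc.prems xy in_part_subset[of X x y] out_part_subset[of X x y]
  by blast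
qed simp

lemma prob_union_pmf_le:
  assumes "\<And>A B. P (A \<union> B) ==> P A \<or> P B"
  shows "measure_pmf.prob (union_pmf p q) {A. P A} \<le> measure_pmf.prob p {A. P A} + measure_pmf.prob q {A. P A}"
proof -
  have "union_pmf p q = map_pmf (\<lambda>(A, B). A \<union> B) (pair_pmf p q)"
  by (simp add: union_pmf_def pair_pmf_def map_bind_pmf map_pmf_def bind_assoc_pmf bind_return_pmf)
  then have "measure_pmf.prob (union_pmf p q) {A. P A} = measure_pmf.prob (pair_pmf p q) {(A, B). P (A \<union> B)}"
  by (simp add: vimage_def case_prod_unfold)
  also have "\<dots> \<le> measure_pmf.prob (pair_pmf p q) ({z. P (fst z)} \<union> {z. P (snd z)})"
  by (intro measure_pmf.finite_measure_mono) (auto dest: assms)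
  also have "\<dots> \<le> measure_pmf.prob (pair_pmf p q) {z. P (fst z)} + measure_pmf.prob (pair_pmf p q) {z. P (snd z)}"
  by (rule measure_Un_le) auto
  also have "measure_pmf.prob (pair_pmf p q) {z. P (fst z)} = measure_pmf.prob (map_pmf fst (pair_pmf p q)) {A. P A}"
  by (simp add: vimage_def)
  also have "measure_pmf.prob (pair_pmf p q) {z. P (snd z)} = measure_pmf.prob (map_pmf snd (pair_pmf p q)) {A. P A}"
  by (simp add: vimage_def)
  finally show ?thesis by (simp add: map_fst_pair_pmf map_snd_pair_pmf)
qed

lemma prob_bind_pmf_of_set:
  assumes "finite X" "X ~= {}"
  shows "measure_pmf.prob (bind_pmf (pmf_of_set X) K) E = (\<Sum>x\<in>X. measure_pmf.prob (K x) E) / real (card X)"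
proof -
  have "measure_pmf.prob (bind_pmf (pmf_of_set X) K) E = (\<integral>y. indicator E y \<partial>bind_pmf (pmf_of_set X) K)"
  by simp
  also have "\<dots> = (\<integral>x. (\<integral>y. indicator E y \<partial>K x) \<partial>pmf_of_set X)"
  by (rule integral_bind_pmf_bounded[where B = 1]) (auto simp: indicator_def)
  finally show ?thesis using assms by (simp add: integral_pmf_of_set)
qed

text \<open>Induction over the tree with a union bound at each split. The factor \<open>\<beta>\<close> per level is less than the
  contraction factor by the margin that \<open>lyap_contraction\<close> leaves.\<close>

lemma prob_deep_alive_tree:
  assumes "finite X"
  defines "\<beta> \<equiv> 1 / (1 - drift_rate / 2)"
  shows "measure_pmf.prob (tree f X j) {H. deep_alive k H} \<le>
  2 / (drift_const * drift_rate * \<beta> ^ k) * \<beta> ^ j * on_alive (\<lambda>Y. lyap Y + drift_const) X"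
  using assms(1)
proof (induction f arbitrary: X j)
  case 0
  have "0 \<le> on_alive (\<lambda>Y. lyap Y + drift_const) X"
  using lyap_nonneg[of X] drift_const_pos by (simp add: on_alive_def)
  then show ?case using drift_rate drift_const_pos by (simp add: deep_alive_def \<beta>_def)
next
  case (Suc f)
  define C where "C = 2 / (drift_const * drift_rate * \<beta> ^ k)"
  define g where "g = on_alive (\<lambda>Y. lyap Y + drift_const)"
  have \<beta>: "1 \<le> \<beta>" "\<beta> * (1 - drift_rate) \<le> 1 - drift_rate / 2"
  proof -
  have p: "0 < 1 - drift_rate / 2" using drift_rate by simp
  have "1 - drift_rate \<le> (1 - drift_rate / 2) * (1 - drift_rate / 2)" by (simp add: algebra_simps)
  then show "\<beta> * (1 - drift_rate) \<le> 1 - drift_rate / 2"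
   using p by (simp add: \<beta>_def pos_divide_le_eq)
  show "1 \<le> \<beta>" using drift_rate by (simp add: \<beta>_def)
  qed
  have C: "0 \<le> C" using \<beta> drift_rate drift_const_pos by (simp add: C_def)
  show ?case
  proof (cases "alive r1 r2 r3 X")
  case False
  have "measure_pmf.prob (tree (Suc f) X j) {H. deep_alive k H} = 0"
  proof (subst measure_pmf_zero_iff, rule ccontr)
   assume "set_pmf (tree (Suc f) X j) \<inter> {H. deep_alive k H} ~= {}"
   then obtain H Y i u v where "H \<in> set_pmf (tree (Suc f) X j)" "(Y, i, u, v) \<in> H" "alive r1 r2 r3 Y"
    by (auto simp: deep_alive_def)
   then have "Y \<subseteq> X" using tree_nodes_subset[OF Suc.prems, of H "Suc f" j Y i u v] by simp
   then show False using alive_mono[of r1 r2 r3 Y X] \<open>alive r1 r2 r3 Y\<close> False by simp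
  qed
  then show ?thesis using False by (simp add: on_alive_def)
  next
  case True
  define m where "m = real (card X)"
  have c2: "\<not> card X < 2" using alive_card[OF True Suc.prems] by simp
  then have X: "X ~= {}" by auto
  have m: "2 \<le> m" using c2 by (simp add: m_def)
  let ?E = "{H. deep_alive k H}"
  define q where "q x y = measure_pmf.prob (map_pmf (insert (X, j, x, y))
     (union_pmf (tree f (in_part X x y) (Suc j)) (tree f (out_part X x y) (Suc j)))) ?E" for x y
  have q: "q x y \<le> (if k \<le> j then 1 else 0) + C * \<beta> ^ Suc j * (g (in_part X x y) + g (out_part X x y))" for x y
  proof (cases "k \<le> j")
   case True
   have "q x y \<le> 1" by (simp add: q_def)
   moreover have "0 \<le> C * \<beta> ^ Suc j * (g (in_part X x y) + g (out_part X x y))"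
    using C \<beta> lyap_nonneg drift_const_pos
    by (intro mult_nonneg_nonneg add_nonneg_nonneg) (auto simp: g_def on_alive_def less_imp_le)
   ultimately show ?thesis using True by simp
  next
   case False
   have "q x y \<le> measure_pmf.prob (union_pmf (tree f (in_part X x y) (Suc j)) (tree f (out_part X x y) (Suc j))) ?E"
    unfolding q_def measure_map_pmf using False
    by (intro measure_pmf.finite_measure_mono) (auto simp: deep_alive_def)
   also have "\<dots> \<le> measure_pmf.prob (tree f (in_part X x y) (Suc j)) ?E + measure_pmf.prob (tree f (out_part X x y) (Suc j)) ?E"
    by (rule prob_union_pmf_le) (unfold deep_alive_def, blast)
   also have "\<dots> \<le> C * \<beta> ^ Suc j * g (in_part X x y) + C * \<beta> ^ Suc j * g (out_part X x y)"
    unfolding C_def g_def using Suc.prems by (intro add_mono Suc.IH) auto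
   finally show ?thesis using False by (simp add: distrib_left)
  qed
  have "measure_pmf.prob (tree (Suc f) X j) ?E = (\<Sum>x\<in>X. (\<Sum>y\<in>X - {x}. q x y) / real (card (X - {x}))) / m"
  proof -
   have "measure_pmf.prob (tree (Suc f) X j) ?E = (\<Sum>x\<in>X. measure_pmf.prob (bind_pmf (pmf_of_set (X - {x})) (\<lambda>y.
     map_pmf (insert (X, j, x, y)) (union_pmf (tree f (in_part X x y) (Suc j)) (tree f (out_part X x y) (Suc j))))) ?E) / m"
    unfolding tree.simps if_not_P[OF c2] prob_bind_pmf_of_set[OF Suc.prems X] m_def ..
   then show ?thesis
    using Suc.prems set_pmf_of_set_diff[OF Suc.prems c2]
    by (simp add: prob_bind_pmf_of_set q_def del: measure_map_pmf)
  qed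
  also have "\<dots> = (\<Sum>x\<in>X. \<Sum>y\<in>X - {x}. q x y) / (m * (m - 1))"
   using Suc.prems c2 by (simp add: m_def of_nat_diff sum_divide_distrib[symmetric] mult.commute)
  also have "\<dots> \<le> (\<Sum>x\<in>X. \<Sum>y\<in>X - {x}. (if k \<le> j then 1 else 0) + C * \<beta> ^ Suc j * (g (in_part X x y) + g (out_part X x y))) / (m * (m - 1))"
   using q m by (intro divide_right_mono sum_mono) auto
  also have "(\<Sum>x\<in>X. \<Sum>y\<in>X - {x}. (if k \<le> j then 1 else 0) + C * \<beta> ^ Suc j * (g (in_part X x y) + g (out_part X x y))) =
    (if k \<le> j then 1 else 0) * (m * (m - 1)) + C * \<beta> ^ Suc j * (\<Sum>x\<in>X. \<Sum>y\<in>X - {x}. g (in_part X x y) + g (out_part X x y))"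
  proof -
   have "(\<Sum>x\<in>X. \<Sum>y\<in>X - {x}. (if k \<le> j then 1 else 0)) = (if k \<le> j then 1 else 0) * (m * (m - 1))"
    using Suc.prems c2 by (simp add: m_def of_nat_diff)
   then show ?thesis by (subst sum.distrib, subst sum.distrib) (simp add: sum_distrib_left)
  qed
  also have "\<dots> / (m * (m - 1)) \<le> ((if k \<le> j then 1 else 0) * (m * (m - 1)) +
    C * \<beta> ^ Suc j * ((1 - drift_rate) * (m * (m - 1)) * (lyap X + drift_const))) / (m * (m - 1))"
   using lyap_contraction[OF Suc.prems True] m C \<beta> unfolding g_def m_def
   by (intro divide_right_mono add_left_mono mult_left_mono) auto
  also have "\<dots> = (if k \<le> j then 1 else 0) + C * \<beta> ^ j * (\<beta> * (1 - drift_rate)) * (lyap X + drift_const)"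
   using m by (simp add: add_divide_distrib)
  also have "\<dots> \<le> (if k \<le> j then 1 else 0) + C * \<beta> ^ j * (1 - drift_rate / 2) * (lyap X + drift_const)"
   using C \<beta> lyap_nonneg[of X] drift_const_pos
   by (intro add_left_mono mult_right_mono mult_left_mono) auto
  also have "\<dots> \<le> C * \<beta> ^ j * (lyap X + drift_const)"
  proof (cases "k \<le> j")
   case True
   have "1 = C * \<beta> ^ k * (drift_rate / 2) * drift_const"
    using \<beta> drift_rate drift_const_pos by (simp add: C_def)
   also have "\<dots> \<le> C * \<beta> ^ j * (drift_rate / 2) * (lyap X + drift_const)"
    using C \<beta> True drift_rate drift_const_pos lyap_nonneg[of X]
    by (intro mult_mono power_increasing) auto
   finally show ?thesis using True by (simp add: algebra_simps)
  next
   case False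
   have "0 \<le> C * \<beta> ^ j * (drift_rate / 2) * (lyap X + drift_const)"
    using C \<beta> drift_rate drift_const_pos lyap_nonneg[of X] by simp
   then show ?thesis using False by (simp add: algebra_simps)
  qed
  finally show ?thesis using True by (simp add: C_def on_alive_def)
  qed
qed

end


section \<open>Laminations that fill the disk\<close>

lemma dist_circ_le: "dist (circ s) (circ t) \<le> 2 * pi * \<bar>s - t\<bar>"
proof -
  define x y where "x = 2 * pi * s" and "y = 2 * pi * t"
  have two: "(2::real) ~= 0" by simp
  have "(dist (circ s) (circ t))\<^sup>2 = (cos x - cos y)\<^sup>2 + (sin x - sin y)\<^sup>2"
  by (simp add: dist_norm cmod_power2 circ_def x_def y_def)
  also have "\<dots> = 2 - 2 * cos (x - y)"
  using sin_cos_squared_add[of x] sin_cos_squared_add[of y]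
  by (simp add: cos_diff power2_eq_square algebra_simps)
  also have "\<dots> = (2 * sin ((x - y) / 2))\<^sup>2"
  using cos_double_sin[of "(x - y) / 2"] unfolding nonzero_mult_div_cancel_left[OF two] times_divide_eq_right
  by (simp add: power_mult_distrib)
  finally have "dist (circ s) (circ t) = \<bar>2 * sin ((x - y) / 2)\<bar>"
  by (metis abs_of_nonneg power2_eq_iff_nonneg abs_ge_zero power2_abs zero_le_dist)
  also have "\<dots> \<le> 2 * \<bar>(x - y) / 2\<bar>"
  using abs_sin_x_le_abs_x[of "(x - y) / 2"] by (simp add: abs_mult)
  also have "\<dots> = 2 * pi * \<bar>s - t\<bar>"
  by (simp add: x_def y_def right_diff_distrib[symmetric] abs_mult)
  finally show ?thesis .
qed

lemma circ_periodic: "circ (t + 1) = circ t"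
  by (simp add: circ_def distrib_left cis_mult[symmetric])

definition chord_point :: "real => real => real => complex" where
  "chord_point a b t = (1 - t) *\<^sub>R circ a + t *\<^sub>R circ b"

lemma chord_altdef: "chord a b = chord_point a b ` {0..1}"
  by (auto simp: closed_segment_def chord_point_def)

lemma chord_point_mem: "0 \<le> t ==> t \<le> 1 ==> chord_point a b t \<in> chord a b"
  by (auto simp: chord_altdef)

lemma dist_chord_point_le:
  assumes "0 \<le> t" "t \<le> 1"
  shows "dist (chord_point a b t) (chord_point u v t) \<le> dist (circ a) (circ u) + dist (circ b) (circ v)"
proof -
  have "chord_point a b t - chord_point u v t = (1 - t) *\<^sub>R (circ a - circ u) + t *\<^sub>R (circ b - circ v)"
  by (simp add: chord_point_def algebra_simps)
  then have "dist (chord_point a b t) (chord_point u v t) \<le>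
   norm ((1 - t) *\<^sub>R (circ a - circ u)) + norm (t *\<^sub>R (circ b - circ v))"
  unfolding dist_norm by (metis norm_triangle_ineq)
  also have "\<dots> = (1 - t) * dist (circ a) (circ u) + t * dist (circ b) (circ v)"
  using assms by (simp add: dist_norm)
  also have "\<dots> \<le> 1 * dist (circ a) (circ u) + 1 * dist (circ b) (circ v)"
  using assms by (intro add_mono mult_right_mono) auto
  finally show ?thesis by simp
qed

lemma chord_commute: "chord a b = chord b a"
  by (rule closed_segment_commute)

definition chord_union :: "(real \<times> real) set => complex set" where
  "chord_union C = (\<Union>(u, v)\<in>C. chord u v)"

lemma chord_unionI: "(u, v) \<in> C ==> z \<in> chord u v ==> z \<in> chord_union C"
  by (auto simp: chord_union_def)

lemma chord_union_mono: "C \<subseteq> C' ==> chord_union C \<subseteq> chord_union C'"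
  by (auto simp: chord_union_def)

lemma chord_subset_disk: "chord a b \<subseteq> cball 0 1"
  by (rule closed_segment_subset) (auto simp: )

lemma chord_union_subset_disk: "chord_union C \<subseteq> cball 0 1"
  using chord_subset_disk by (fastforce simp: chord_union_def)

abbreviation limit_set :: "(nat => (real \<times> real) set) => complex set" where
  "limit_set L \<equiv> closure (\<Union>N. chord_union (L N))"

text \<open>The last two conditions say that the ends are dense and that no four points of the circle remain
  mutually unseparated; 0 and 1 are both admitted there, although they are the same point.\<close>

definition filling :: "(nat => (real \<times> real) set) => bool" where
  "filling L \<longleftrightarrow> incseq L \<and> (\<forall>N. finite (L N)) \<and>
   (\<forall>N. \<forall>(u, v)\<in>L N. u \<in> {0<..<1} \<and> v \<in> {0<..<1} \<and> u ~= v) \<and>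
   (\<forall>N. \<forall>(u, v)\<in>L N. \<forall>(u', v')\<in>L N. \<not> separates u v u' v') \<and>
   (\<forall>p q. 0 \<le> p --> p < q --> q \<le> 1 --> (\<exists>N. \<exists>u\<in>ends (L N). p < u \<and> u < q)) \<and>
   \<not> (\<exists>z1 z2 z3 z4. 0 \<le> z1 \<and> z1 < z2 \<and> z2 < z3 \<and> z3 < z4 \<and> z4 \<le> 1 \<and>
    (\<forall>N. \<forall>(u, v)\<in>L N. \<forall>s\<in>{z1, z2, z3, z4}. \<forall>t\<in>{z1, z2, z3, z4}. \<not> separates u v s t))"

lemma filling_range:
  assumes "filling L" "(u, v) \<in> L N"
  shows "0 < u \<and> u < 1 \<and> 0 < v \<and> v < 1 \<and> u ~= v"
proof -
  have "\<forall>N. \<forall>(u, v)\<in>L N. u \<in> {0<..<1} \<and> v \<in> {0<..<1} \<and> u ~= v"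
  using assms(1) unfolding filling_def by blast
  then show ?thesis using assms(2) by fastforce
qed

text \<open>Among pairwise non-crossing intervals, the ones around a midpoint are nested. Either they exhaust
  the whole interval, or an end of their union is strictly inside none of the intervals.\<close>

lemma noncrossing_cover:
  fixes a b :: real
  assumes "a < b" and I: "\<And>u v. (u, v) \<in> I ==> a \<le> u \<and> u < v \<and> v \<le> b"
  and nc: "\<And>u v u' v'. (u, v) \<in> I ==> (u', v') \<in> I ==> \<not> (u < u' \<and> u' < v \<and> v < v')"
  and cov: "\<And>p. a < p ==> p < b ==> \<exists>(u, v)\<in>I. u < p \<and> p < v"
  and "0 < \<delta>"
  shows "\<exists>(u, v)\<in>I. u < a + \<delta> \<and> b - \<delta> < v"
proof -
  define t where "t = (a + b) / 2"
  define J where "J = {(u, v) \<in> I. u < t \<and> t < v}"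
  have t: "a < t" "t < b" using assms(1) by (auto simp: t_def)
  have J: "J ~= {}" using cov[OF t] by (auto simp: J_def)
  have bddl: "bdd_below (fst ` J)" using I by (intro bdd_belowI2[where m = a]) (auto simp: J_def)
  have bddu: "bdd_above (snd ` J)" using I by (intro bdd_aboveI2[where M = b]) (auto simp: J_def)
  obtain u1 v1 where 1: "(u1, v1) \<in> J" "u1 < a + \<delta>"
  proof (rule ccontr)
  assume no: "\<not> thesis"
  define x where "x = Inf (fst ` J)"
  have lb: "x \<le> u" if "(u, v) \<in> J" for u v
   unfolding x_def using that bddl by (metis cInf_lower fst_conv image_eqI)
  have "\<And>u v. (u, v) \<in> J ==> a + \<delta> \<le> u" using no that by (meson not_less)
  then have "a + \<delta> \<le> x" unfolding x_def using J by (intro cInf_greatest) auto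
  moreover have "x < t" using J lb by (fastforce simp: J_def)
  ultimately obtain u v where uv: "(u, v) \<in> I" "u < x" "x < v"
   using cov[of x] t assms(5) by force
  obtain u' v' where u': "(u', v') \<in> J" "u' < v"
   using cInf_lessD[of "fst ` J" v] J uv(3) by (auto simp: x_def)
  show False
  proof (cases "t < v")
   case True
   then have "(u, v) \<in> J" using uv \<open>x < t\<close> by (auto simp: J_def)
   then show False using lb uv(2) by force
  next
   case False
   then have "u < u' \<and> u' < v \<and> v < v'" using u' uv lb[OF u'(1)] by (auto simp: J_def)
   then show False using nc[of u v u' v'] uv u' by (auto simp: J_def)
  qed
  qed
  obtain u2 v2 where 2: "(u2, v2) \<in> J" "b - \<delta> < v2"
  proof (rule ccontr)
  assume no: "\<not> thesis"
  define x where "x = Sup (snd ` J)"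
  have ub: "v \<le> x" if "(u, v) \<in> J" for u v
   unfolding x_def using that bddu by (metis cSup_upper snd_conv image_eqI)
  have "\<And>u v. (u, v) \<in> J ==> v \<le> b - \<delta>" using no that by (meson not_less)
  then have "x \<le> b - \<delta>" unfolding x_def using J by (intro cSup_least) auto
  moreover have "t < x" using J ub by (fastforce simp: J_def)
  ultimately obtain u v where uv: "(u, v) \<in> I" "u < x" "x < v"
   using cov[of x] t assms(5) by force
  obtain u' v' where u': "(u', v') \<in> J" "u < v'"
   using less_cSupD[of "snd ` J" u] J uv(2) by (auto simp: x_def)
  show False
  proof (cases "u < t")
   case True
   then have "(u, v) \<in> J" using uv \<open>t < x\<close> by (auto simp: J_def)
   then show False using ub uv(3) by force
  next
   case False
   then have "u' < u \<and> u < v' \<and> v' < v" using u' uv ub[OF u'(1)] by (auto simp: J_def)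
   then show False using nc[of u' v' u v] uv u' by (auto simp: J_def)
  qed
  qed
  show ?thesis
  proof (cases "u2 \<le> u1")
  case True
  then show ?thesis using 1 2 by (auto simp: J_def intro!: bexI[of _ "(u2, v2)"])
  next
  case False
  then have "\<not> v1 < v2" using nc[of u1 v1 u2 v2] 1 2 by (auto simp: J_def)
  then show ?thesis using 1 2 by (auto simp: J_def intro!: bexI[of _ "(u1, v1)"])
  qed
qed

text \<open>If a chord that no chord of the lamination separates stays away from the lamination, then the chords on
  each of its two sides are, seen from its ends, a non-crossing family that cannot exhaust the side. This
  yields two further points, and together with the ends four points that are never separated.\<close>

lemma filling_no_far_chord_aux:
  assumes fill: "filling L" and ab: "0 \<le> a" "a < b" "b \<le> 1" "a ~= 0 \<or> b ~= 1"
  and ns: "\<And>N u v. (u, v) \<in> L N ==> \<not> separates u v a b"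
  and z: "z \<in> chord a b" and far: "\<And>N w. w \<in> chord_union (L N) ==> \<epsilon> \<le> dist z w" and "0 < \<epsilon>"
  shows False
proof -
  define C where "C = (\<Union>N. L N)"
  have inc: "incseq L" using fill by (simp add: filling_def)
  have C01: "0 < u \<and> u < 1 \<and> 0 < v \<and> v < 1 \<and> u ~= v" if "(u, v) \<in> C" for u v
  using filling_range[OF fill] that unfolding C_def by blast
  have Cns: "\<not> separates u v u' v'" if CC: "(u, v) \<in> C" "(u', v') \<in> C" for u v u' v'
  proof -
  obtain N M where "(u, v) \<in> L N" "(u', v') \<in> L M" using CC unfolding C_def by blast
  then have "(u, v) \<in> L (max N M)" "(u', v') \<in> L (max N M)"
   using inc by (meson incseqD max.cobounded1 max.cobounded2 subsetD)+
  then show ?thesis using fill unfolding filling_def by blast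
  qed
  have Cab: "\<not> separates u v a b" if "(u, v) \<in> C" for u v using ns that by (auto simp: C_def)
  obtain t where t: "0 \<le> t" "t \<le> 1" "z = chord_point a b t" using z by (auto simp: chord_altdef)
  define \<delta> where "\<delta> = \<epsilon> / (8 * pi)"
  have \<delta>: "0 < \<delta>" using assms(9) by (simp add: \<delta>_def)
  have close: False if cl: "(u, v) \<in> C \<or> (v, u) \<in> C" "circ u = circ u'" "circ v = circ v'" "\<bar>a - u'\<bar> < \<delta>" "\<bar>b - v'\<bar> < \<delta>" for u v u' v'
  proof -
  have m: "chord_point u v t \<in> chord u v" using t by (intro chord_point_mem) auto
  have m': "chord_point u v t \<in> chord v u" by (subst chord_commute) (rule m)
  have "dist z (chord_point u v t) \<le> dist (circ a) (circ u) + dist (circ b) (circ v)"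
   unfolding t(3) using t by (intro dist_chord_point_le) auto
  also have "\<dots> \<le> 2 * pi * \<bar>a - u'\<bar> + 2 * pi * \<bar>b - v'\<bar>"
   unfolding cl(2,3) by (intro add_mono dist_circ_le)
  also have "\<dots> < 2 * pi * \<delta> + 2 * pi * \<delta>"
   using cl(4,5) by (intro add_strict_mono mult_strict_left_mono) auto
  also have "\<dots> < \<epsilon>" using assms(9) by (simp add: \<delta>_def)
  finally have "dist z (chord_point u v t) < \<epsilon>" .
  moreover obtain N where "(u, v) \<in> L N \<or> (v, u) \<in> L N" using cl(1) unfolding C_def by blast
  then have "chord_point u v t \<in> chord_union (L N)"
   using m m' by (auto intro: chord_unionI)
  ultimately show False using far[of "chord_point u v t" N] by simp
  qed
  \<comment> \<open>a point of the arc between \<open>a\<close> and \<open>b\<close> that no chord cuts off from \<open>[a,b]\<close>\<close>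
  obtain p where p: "a < p" "p < b" and pI: "\<And>u v. (u, v) \<in> C ==> a \<le> min u v ==> max u v \<le> b ==> \<not> arc_in u v p"
  proof (rule ccontr)
  assume no: "\<not> thesis"
  note obt = that
  define I where "I = {(min u v, max u v) | u v. (u, v) \<in> C \<and> a \<le> min u v \<and> max u v \<le> b}"
  have "\<exists>(x, y)\<in>I. x < a + \<delta> \<and> b - \<delta> < y"
  proof (rule noncrossing_cover[OF ab(2) _ _ _ \<delta>])
   show "a \<le> x \<and> x < y \<and> y \<le> b" if xy: "(x, y) \<in> I" for x y
   proof -
    obtain u v where uv: "(u, v) \<in> C" "a \<le> x" "y \<le> b" "x = min u v" "y = max u v"
     using xy by (auto simp: I_def)
    then show ?thesis using C01[OF uv(1)] by (auto simp: min_def max_def)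
   qed
   show "\<not> (x < x' \<and> x' < y \<and> y < y')" if xy: "(x, y) \<in> I" "(x', y') \<in> I" for x y x' y'
   proof
    assume "x < x' \<and> x' < y \<and> y < y'"
    then have "separates x y x' y'" by (auto simp: side_defs)
    moreover have "\<exists>u v. ((u, v) \<in> C \<or> (v, u) \<in> C) \<and> x = u \<and> y = v" if "(x, y) \<in> I" for x y
     using that by (auto simp: I_def min_def max_def)
    ultimately show False
     using xy Cns separates_swap_ends separates_swap_points by metis
   qed
   show "\<exists>(x, y)\<in>I. x < q \<and> q < y" if "a < q" "q < b" for q
   proof -
    have "\<exists>u v. (u, v) \<in> C \<and> a \<le> min u v \<and> max u v \<le> b \<and> arc_in u v q"
     using no obt[of q] that by blast
    then show ?thesis unfolding I_def arc_in_def by blast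
   qed
  qed
  then obtain u v where uv: "(u, v) \<in> C" "a \<le> min u v" "max u v \<le> b" "min u v < a + \<delta>" "b - \<delta> < max u v"
   by (auto simp: I_def)
  show False using uv close[of "min u v" "max u v" "min u v" "max u v"]
   by (auto simp: min_def max_def split: if_splits)
  qed
  define lift where "lift x = (if b \<le> x then x else x + 1)" for x
  have circ_lift: "circ (lift x) = circ x" for x by (simp add: lift_def circ_periodic)
  define out where "out x \<longleftrightarrow> x \<le> a \<or> b \<le> x" for x
  obtain q' where q': "b < q'" "q' < a + 1"
  and qI: "\<And>u v. (u, v) \<in> C ==> out u ==> out v ==> \<not> (min (lift u) (lift v) < q' \<and> q' < max (lift u) (lift v))"
  proof (rule ccontr)
  assume no: "\<not> thesis"
  note obt = that
  define I where "I = {(min (lift u) (lift v), max (lift u) (lift v)) | u v. (u, v) \<in> C \<and> out u \<and> out v}"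
  have ba: "b < a + 1" using ab by linarith
  have "\<exists>(x, y)\<in>I. x < b + \<delta> \<and> (a + 1) - \<delta> < y"
  proof (rule noncrossing_cover[OF ba _ _ _ \<delta>])
   show "b \<le> x \<and> x < y \<and> y \<le> a + 1" if xy: "(x, y) \<in> I" for x y
   proof -
    obtain u v where uv: "(u, v) \<in> C" "out u" "out v" "x = min (lift u) (lift v)" "y = max (lift u) (lift v)"
     using xy by (auto simp: I_def)
    have "b \<le> lift s \<and> lift s \<le> a + 1" if "out s" "0 < s" "s < 1" for s
     using that ab by (auto simp: lift_def out_def)
    moreover have "lift u ~= lift v" using C01[OF uv(1)] by (auto simp: lift_def)
    ultimately show ?thesis using uv C01[OF uv(1)] by (auto simp: min_def max_def)
   qed
   show "\<not> (x < x' \<and> x' < y \<and> y < y')" if xy: "(x, y) \<in> I" "(x', y') \<in> I" for x y x' y'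
   proof
    assume lt: "x < x' \<and> x' < y \<and> y < y'"
    have ex: "\<exists>u v. ((u, v) \<in> C \<or> (v, u) \<in> C) \<and> out u \<and> out v \<and> x = lift u \<and> y = lift v" if "(x, y) \<in> I" for x y
     using that unfolding I_def min_def max_def by (auto split: if_splits)
    obtain u v where uv1: "(u, v) \<in> C \<or> (v, u) \<in> C" "out u" "out v" "x = lift u" "y = lift v"
     using ex[OF xy(1)] by blast
    obtain u' v' where uv2: "(u', v') \<in> C \<or> (v', u') \<in> C" "out u'" "out v'" "x' = lift u'" "y' = lift v'"
     using ex[OF xy(2)] by blast
    note uv = uv1 uv2
    have b4: "0 < u" "u < 1" "0 < v" "v < 1" "0 < u'" "u' < 1" "0 < v'" "v' < 1"
     using C01 uv(1,6) by blast+
    have "separates u v u' v'"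
    proof -
     consider "u < u'" "u' < v" "v < v'" | "v' < u" "u < u'" "u' < v" | "v < v'" "v' < u" "u < u'" |
      "u' < v" "v < v'" "v' < u"
      using lt b4 uv(2,3,7,8) ab unfolding uv(4,5,9,10) lift_def out_def
      by (auto split: if_splits)
     then show ?thesis by cases (auto simp: side_defs min_def max_def)
    qed
    then show False using Cns uv(1,6) separates_swap_ends separates_swap_points by metis
   qed
   show "\<exists>(x, y)\<in>I. x < s \<and> s < y" if "b < s" "s < a + 1" for s
   proof -
    have "\<exists>u v. (u, v) \<in> C \<and> out u \<and> out v \<and> min (lift u) (lift v) < s \<and> s < max (lift u) (lift v)"
     using no obt[of s] that by blast
    then show ?thesis unfolding I_def by blast
   qed
  qed
  then obtain u v where uv: "(u, v) \<in> C" "min (lift u) (lift v) < b + \<delta>" "a + 1 - \<delta> < max (lift u) (lift v)"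
   "out u" "out v" by (auto simp: I_def)
  have rng: "b \<le> lift s \<and> lift s \<le> a + 1" if "out s" "0 < s" "s < 1" for s
   using that ab by (auto simp: lift_def out_def)
  have per: "circ (lift s - 1) = circ s" for s using circ_lift[of s] circ_periodic[of "lift s - 1"] by simp
  show False
  proof (cases "lift u \<le> lift v")
   case True
   then show False
    using uv rng[of u] rng[of v] C01[OF uv(1)] close[of v u "lift v - 1" "lift u"] per[of v] circ_lift[of u]
    by (auto simp: abs_less_iff)
  next
   case False
   then show False
    using uv rng[of u] rng[of v] C01[OF uv(1)] close[of u v "lift u - 1" "lift v"] per[of u] circ_lift[of v]
    by (auto simp: abs_less_iff)
  qed
  qed
  define q where "q = (if q' \<le> 1 then q' else q' - 1)"
  have q: "(b < q \<and> q \<le> 1) \<or> (0 < q \<and> q < a)" using q' ab by (auto simp: q_def)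
  have one_side: "(\<forall>x\<in>{a, p, b, q}. \<not> arc_in u v x) \<or> (\<forall>x\<in>{a, p, b, q}. \<not> arc_out u v x)" if uv: "(u, v) \<in> C" for u v
  proof -
  define x y where "x = min u v" and "y = max u v"
  have xy: "0 < x" "x < y" "y < 1" using C01[OF uv] by (auto simp: x_def y_def)
  have sab: "\<not> (x < a \<and> a < y \<and> y < b)" "\<not> (a < x \<and> x < b \<and> b < y)"
   using Cab[OF uv] ab(2) unfolding separates_def arc_in_def arc_out_def x_def[symmetric] y_def[symmetric] by linarith+
  have pp: "\<not> (x < p \<and> p < y)" if "a \<le> x" "y \<le> b"
   using pI[OF uv] that unfolding arc_in_def x_def y_def by blast
  have "out u \<and> out v \<longleftrightarrow> out x \<and> out y" "min (lift u) (lift v) = min (lift x) (lift y)" "max (lift u) (lift v) = max (lift x) (lift y)"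
   by (auto simp: x_def y_def min_def max_def)
  then have qq: "\<not> (min (lift x) (lift y) < q' \<and> q' < max (lift x) (lift y))" if "out x" "out y"
   using qI[OF uv] that by metis
  consider "a \<le> x" "y \<le> b" | "x \<le> a" "b \<le> y" | "y \<le> a" | "b \<le> x" using sab xy ab by linarith
  then show ?thesis
   unfolding arc_in_def arc_out_def x_def[symmetric] y_def[symmetric]
  proof cases
   case 1
   then show "(\<forall>z\<in>{a, p, b, q}. \<not> (x < z \<and> z < y)) \<or> (\<forall>z\<in>{a, p, b, q}. \<not> (z < x \<or> y < z))"
    using pp q by auto
  next
   case 2
   then have "out x" "out y" "\<not> b \<le> x" using ab by (auto simp: out_def)
   then have "\<not> (y < q' \<and> q' < x + 1)" using qq xy 2 by (auto simp: lift_def)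
   then have "x \<le> q \<and> q \<le> y" using q' xy 2 ab by (auto simp: q_def split: if_splits)
   then show "(\<forall>z\<in>{a, p, b, q}. \<not> (x < z \<and> z < y)) \<or> (\<forall>z\<in>{a, p, b, q}. \<not> (z < x \<or> y < z))"
    using 2 p by auto
  next
   case 3
   then have "out x" "out y" "\<not> b \<le> x" "\<not> b \<le> y" using ab xy by (auto simp: out_def)
   then have "\<not> (x + 1 < q' \<and> q' < y + 1)" using qq xy by (auto simp: lift_def)
   then have "\<not> (x < q \<and> q < y)" using q' xy 3 ab by (auto simp: q_def split: if_splits)
   then show "(\<forall>z\<in>{a, p, b, q}. \<not> (x < z \<and> z < y)) \<or> (\<forall>z\<in>{a, p, b, q}. \<not> (z < x \<or> y < z))"
    using 3 p by auto
  next
   case 4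
   then have "out x" "out y" "b \<le> y" using ab xy by (auto simp: out_def)
   then have "\<not> (x < q' \<and> q' < y)" using qq xy 4 by (auto simp: lift_def)
   then have "\<not> (x < q \<and> q < y)" using q' xy 4 ab by (auto simp: q_def split: if_splits)
   then show "(\<forall>z\<in>{a, p, b, q}. \<not> (x < z \<and> z < y)) \<or> (\<forall>z\<in>{a, p, b, q}. \<not> (z < x \<or> y < z))"
    using 4 p by auto
  qed
  qed
  have nsep: "\<not> separates u v s t" if "(u, v) \<in> L N" "s \<in> {a, p, b, q}" "t \<in> {a, p, b, q}" for N u v s t
  using one_side[of u v] that unfolding separates_def C_def by blast
  have no4: "\<not> (0 \<le> z1 \<and> z1 < z2 \<and> z2 < z3 \<and> z3 < z4 \<and> z4 \<le> 1 \<and>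
    (\<forall>N. \<forall>(u, v)\<in>L N. \<forall>s\<in>{z1, z2, z3, z4}. \<forall>t\<in>{z1, z2, z3, z4}. \<not> separates u v s t))" for z1 z2 z3 z4
  using fill unfolding filling_def by blast
  show False
  using q
  proof
  assume "b < q \<and> q \<le> 1"
  then show False using no4[of a p b q] nsep ab p by auto
  next
  assume qa: "0 < q \<and> q < a"
  have "{q, a, p, b} = {a, p, b, q}" by auto
  then show False using no4[of q a p b] nsep ab p qa by auto
  qed
qed


lemma filling_no_far_chord:
  assumes fill: "filling L" and ab: "a \<in> {0..1}" "b \<in> {0..1}"
  and ns: "\<And>N u v. (u, v) \<in> L N ==> \<not> separates u v a b"
  and z: "z \<in> chord a b" and far: "\<And>N w. w \<in> chord_union (L N) ==> \<epsilon> \<le> dist z w" and "0 < \<epsilon>"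
  shows False
proof -
  have "circ a ~= circ b"
  proof
  assume "circ a = circ b"
  then have za: "z = circ a" using z by simp
  define \<delta> where "\<delta> = min (1 / 2) (\<epsilon> / (8 * pi))"
  have \<delta>: "0 < \<delta>" "\<delta> \<le> 1 / 2" "\<delta> \<le> \<epsilon> / (8 * pi)" using assms(7) by (auto simp: \<delta>_def)
  obtain p q where pq: "0 \<le> p" "p < q" "q \<le> 1" "\<And>u. p < u ==> u < q ==> \<bar>a - u\<bar> < \<delta>"
  proof (cases "a \<le> 1 / 2")
   case True
   then show ?thesis using ab \<delta> by (intro that[of a "a + \<delta>"]) auto
  next
   case False
   then show ?thesis using ab \<delta> by (intro that[of "a - \<delta>" a]) auto
  qed
  then obtain N u where u: "u \<in> ends (L N)" "p < u" "u < q" using fill unfolding filling_def by metis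
  then have "circ u \<in> chord_union (L N)" by (auto simp: ends_def chord_union_def)
  moreover have "dist z (circ u) < \<epsilon>"
  proof -
   have "dist z (circ u) \<le> 2 * pi * \<bar>a - u\<bar>" unfolding za by (rule dist_circ_le)
   also have "\<dots> < 2 * pi * \<delta>" using pq(4)[OF u(2,3)] by simp
   also have "\<dots> \<le> 2 * pi * (\<epsilon> / (8 * pi))" using \<delta>(3) by (intro mult_left_mono) auto
   also have "\<dots> < \<epsilon>" using assms(7) by simp
   finally show ?thesis .
  qed
  ultimately show False using far by force
  qed
  then have ne: "a ~= b" "\<not> (a = 0 \<and> b = 1)" "\<not> (a = 1 \<and> b = 0)" using circ_periodic[of 0] by auto
  show False
  proof (cases "a < b")
  case True
  then show False using filling_no_far_chord_aux[OF fill, of a b z \<epsilon>] assms ne by auto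
  next
  case False
  have "z \<in> chord b a" by (subst chord_commute) (rule z)
  moreover have "\<not> separates u v b a" if "(u, v) \<in> L N" for N u v using ns[OF that] separates_swap_points by metis
  ultimately show False using False filling_no_far_chord_aux[OF fill, of b a z \<epsilon>] assms ne by auto
  qed
qed

subsection \<open>Rounding to the vertices of a polygon\<close>

definition rnd :: "nat => real => nat" where
  "rnd n t = nat \<lfloor>real n * t\<rfloor>"

abbreviation rnd2 :: "nat => real \<times> real => nat \<times> nat" where
  "rnd2 n \<equiv> map_prod (rnd n) (rnd n)"

lemma rnd_mono: "s \<le> t ==> rnd n s \<le> rnd n t"
  by (auto simp: rnd_def intro!: nat_mono floor_mono mult_left_mono)

lemma rnd_min_max: "rnd n (min s t) = min (rnd n s) (rnd n t)" "rnd n (max s t) = max (rnd n s) (rnd n t)"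
  using rnd_mono[of s t n] rnd_mono[of t s n] by (auto simp: min_def max_def)

lemma rnd_bounds:
  assumes "0 \<le> t" "0 < n"
  shows "real (rnd n t) / real n \<le> t" "t < real (rnd n t) / real n + 1 / real n"
proof -
  have "real (rnd n t) = of_int \<lfloor>real n * t\<rfloor>" using assms by (simp add: rnd_def)
  moreover have "of_int \<lfloor>real n * t\<rfloor> \<le> real n * t" "real n * t < of_int \<lfloor>real n * t\<rfloor> + 1" by linarith+
  ultimately show "real (rnd n t) / real n \<le> t" "t < real (rnd n t) / real n + 1 / real n"
  using assms by (simp_all add: field_simps)
qed

lemma rnd_less: "0 \<le> t ==> t < 1 ==> 0 < n ==> rnd n t < n"
proof -
  assume t: "0 \<le> t" "t < 1" "0 < n"
  then have "real (rnd n t) / real n < 1" using rnd_bounds(1)[of t n] by linarith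
  then show "rnd n t < n" using t by (simp add: divide_less_eq)
qed

lemma eventually_rnd_less:
  assumes lim: "(\<lambda>k. real (s k) / real (n k)) \<longlonglongrightarrow> y" and n: "filterlim n at_top sequentially" and x: "0 \<le> x"
  shows "x < y ==> eventually (\<lambda>k. rnd (n k) x < s k) sequentially"
  and "y < x ==> eventually (\<lambda>k. s k < rnd (n k) x) sequentially"
proof -
  have pos: "eventually (\<lambda>k. 0 < n k) sequentially" using n unfolding filterlim_at_top by (auto dest: spec[of _ "Suc 0"] simp: Suc_le_eq)
  have inv: "(\<lambda>k. 1 / real (n k)) \<longlonglongrightarrow> 0"
  using filterlim_compose[OF lim_1_over_n n] .
  show "eventually (\<lambda>k. rnd (n k) x < s k) sequentially" if "x < y"
  using order_tendstoD(1)[OF lim that] pos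
  proof eventually_elim
  case (elim k)
  then have "real (rnd (n k) x) / real (n k) < real (s k) / real (n k)" using rnd_bounds(1)[OF x, of "n k"] by linarith
  then show ?case using elim by (simp add: divide_less_cancel)
  qed
  show "eventually (\<lambda>k. s k < rnd (n k) x) sequentially" if "y < x"
  proof -
  have "(\<lambda>k. real (s k) / real (n k) + 1 / real (n k)) \<longlonglongrightarrow> y + 0" using lim inv by (rule tendsto_add)
  then have "eventually (\<lambda>k. real (s k) / real (n k) + 1 / real (n k) < x) sequentially"
   using that by (intro order_tendstoD(2)) auto
  then show ?thesis using pos
  proof eventually_elim
   case (elim k)
   then have "real (s k) / real (n k) < real (rnd (n k) x) / real (n k)" using rnd_bounds(2)[OF x, of "n k"] by linarith
   then show ?case using elim by (simp add: divide_less_cancel)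
  qed
  qed
qed

lemma eventually_rnd_separates:
  assumes s: "(\<lambda>k. real (s k) / real (n k)) \<longlonglongrightarrow> a" and t: "(\<lambda>k. real (t k) / real (n k)) \<longlonglongrightarrow> b"
  and n: "filterlim n at_top sequentially" and uv: "0 \<le> u" "0 \<le> v" "separates u v a b"
  shows "eventually (\<lambda>k. separates (rnd (n k) u) (rnd (n k) v) (s k) (t k)) sequentially"
proof -
  have mm: "0 \<le> min u v" "0 \<le> max u v" using uv by auto
  have ins: "eventually (\<lambda>k. arc_in (rnd (n k) u) (rnd (n k) v) (s k)) sequentially"
  if "(\<lambda>k. real (s k) / real (n k)) \<longlonglongrightarrow> a" "arc_in u v a" for s a
  using eventually_rnd_less(1)[OF that(1) n mm(1)] eventually_rnd_less(2)[OF that(1) n mm(2)] that(2)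
  unfolding arc_in_def rnd_min_max by (simp add: eventually_conj_iff)
  have outs: "eventually (\<lambda>k. arc_out (rnd (n k) u) (rnd (n k) v) (s k)) sequentially"
  if "(\<lambda>k. real (s k) / real (n k)) \<longlonglongrightarrow> a" "arc_out u v a" for s a
  proof (cases "a < min u v")
  case True
  then show ?thesis using eventually_rnd_less(2)[OF that(1) n mm(1)]
   unfolding arc_out_def rnd_min_max by (auto elim: eventually_mono)
  next
  case False
  then have "max u v < a" using that(2) unfolding arc_out_def by blast
  then show ?thesis using eventually_rnd_less(1)[OF that(1) n mm(2)]
   unfolding arc_out_def rnd_min_max by (auto elim: eventually_mono)
  qed
  show ?thesis
  using uv(3) unfolding separates_def
  proof (elim disjE conjE)
  assume "arc_in u v a" "arc_out u v b"
  from ins[OF s this(1)] outs[OF t this(2)] show "eventually (\<lambda>k. arc_in (rnd (n k) u) (rnd (n k) v) (s k) \<and> arc_out (rnd (n k) u) (rnd (n k) v) (t k) \<or>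
    arc_out (rnd (n k) u) (rnd (n k) v) (s k) \<and> arc_in (rnd (n k) u) (rnd (n k) v) (t k)) sequentially"
   by eventually_elim simp
  next
  assume "arc_out u v a" "arc_in u v b"
  from outs[OF s this(1)] ins[OF t this(2)] show "eventually (\<lambda>k. arc_in (rnd (n k) u) (rnd (n k) v) (s k) \<and> arc_out (rnd (n k) u) (rnd (n k) v) (t k) \<or>
    arc_out (rnd (n k) u) (rnd (n k) v) (s k) \<and> arc_in (rnd (n k) u) (rnd (n k) v) (t k)) sequentially"
   by eventually_elim simp
  qed
qed

lemma filling_noncrossing_close:
  assumes fill: "filling L" and "0 < \<epsilon>"
  shows "\<exists>N0. \<forall>N\<ge>N0. \<exists>n0. \<forall>n\<ge>n0. \<forall>i<n. \<forall>j<n.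
  (\<forall>(u, v)\<in>L N. \<not> separates (rnd n u) (rnd n v) i j) -->
  (\<forall>z\<in>chord (i / n) (j / n). \<exists>w\<in>chord_union (L N). dist z w < \<epsilon>)"
proof (rule ccontr)
  assume no: "\<not> ?thesis"
  define ok where "ok N n \<longleftrightarrow> (\<forall>i<n. \<forall>j<n. (\<forall>(u, v)\<in>L N. \<not> separates (rnd n u) (rnd n v) i j) -->
  (\<forall>z\<in>chord (i / n) (j / n). \<exists>w\<in>chord_union (L N). dist z w < \<epsilon>))" for N n
  have no': "\<not> (\<exists>N0. \<forall>N\<ge>N0. \<exists>n0. \<forall>n\<ge>n0. ok N n)" using no unfolding ok_def .
  define bad where "bad k N n i j t \<longleftrightarrow> k \<le> N \<and> k \<le> n \<and> i < n \<and> j < n \<and>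
  (\<forall>(u, v)\<in>L N. \<not> separates (rnd n u) (rnd n v) i j) \<and> 0 \<le> t \<and> t \<le> 1 \<and>
  (\<forall>w\<in>chord_union (L N). \<epsilon> \<le> dist (chord_point (real i / real n) (real j / real n) t) w)" for k N n i j t
  have "\<exists>N n i j t. bad k N n i j t" for k
  proof -
  obtain N n where N: "k \<le> N" "k \<le> n" "\<not> ok N n" using no' by meson
  then obtain i j z where ij: "i < n" "j < n" "\<forall>(u, v)\<in>L N. \<not> separates (rnd n u) (rnd n v) i j"
   and z: "z \<in> chord (i / n) (j / n)" "\<not> (\<exists>w\<in>chord_union (L N). dist z w < \<epsilon>)"
   unfolding ok_def by blast
  obtain t where "0 \<le> t" "t \<le> 1" "z = chord_point (i / n) (j / n) t"
   using z(1) unfolding chord_altdef by auto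
  then have "bad k N n i j t" using N(1,2) ij z(2) unfolding bad_def by (simp add: not_less)
  then show ?thesis by blast
  qed
  then obtain N n i j t where bad: "bad k (N k) (n k) (i k) (j k) (t k)" for k by metis
  define X where "X k = (real (i k) / real (n k), real (j k) / real (n k), t k)" for k
  have "compact ({0..1::real} \<times> {0..1::real} \<times> {0..1::real})" by (intro compact_Times) auto
  moreover have "X k \<in> {0..1} \<times> {0..1} \<times> {0..1}" for k
  using bad[of k] by (auto simp: X_def bad_def)
  ultimately obtain l r where lr: "l \<in> {0..1} \<times> {0..1} \<times> {0..1}" "strict_mono r" "(X \<circ> r) \<longlonglongrightarrow> l"
  unfolding compact_def by (metis (full_types))
  obtain a b c where l: "l = (a, b, c)" by (cases l) auto
  have i: "(\<lambda>k. real (i (r k)) / real (n (r k))) \<longlonglongrightarrow> a"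
  and j: "(\<lambda>k. real (j (r k)) / real (n (r k))) \<longlonglongrightarrow> b" and t: "(\<lambda>k. t (r k)) \<longlonglongrightarrow> c"
  using tendsto_fst[OF lr(3)] tendsto_fst[OF tendsto_snd[OF lr(3)]] tendsto_snd[OF tendsto_snd[OF lr(3)]]
  by (simp_all add: X_def l o_def)
  have n: "filterlim (\<lambda>k. n (r k)) at_top sequentially"
  proof (rule filterlim_at_top_mono[OF filterlim_subseq[OF lr(2)]])
  show "eventually (\<lambda>k. r k \<le> n (r k)) sequentially" using bad by (auto simp: bad_def)
  qed
  have inc: "incseq L" using fill by (simp add: filling_def)
  have rk: "k \<le> r k" for k using seq_suble[OF lr(2)] .
  have sub: "L M \<subseteq> L (N (r k))" if "M \<le> k" for M k
  proof -
  have "M \<le> N (r k)" using that rk[of k] bad[of "r k"] by (auto simp: bad_def)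
  then show ?thesis using inc by (auto dest: incseqD)
  qed
  define zs where "zs k = chord_point (real (i (r k)) / real (n (r k))) (real (j (r k)) / real (n (r k))) (t (r k))" for k
  define z where "z = chord_point a b c"
  have "(\<lambda>k. circ (real (i (r k)) / real (n (r k)))) \<longlonglongrightarrow> circ a" "(\<lambda>k. circ (real (j (r k)) / real (n (r k)))) \<longlonglongrightarrow> circ b"
  using i j isCont_tendsto_compose[OF isCont_circ] by blast+
  then have zs: "zs \<longlonglongrightarrow> z"
  unfolding zs_def z_def chord_point_def using t by (intro tendsto_intros)
  show False
  proof (rule filling_no_far_chord[OF fill _ _ _ _ _ assms(2)])
  show "a \<in> {0..1}" "b \<in> {0..1}" using lr(1) l by auto
  show "z \<in> chord a b" using lr(1) l by (auto simp: z_def intro: chord_point_mem)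
  show "\<not> separates u v a b" if uv: "(u, v) \<in> L M" for M u v
  proof
   assume "separates u v a b"
   moreover have "0 \<le> u" "0 \<le> v" using filling_range[OF fill uv] by auto
   ultimately have "eventually (\<lambda>k. separates (rnd (n (r k)) u) (rnd (n (r k)) v) (i (r k)) (j (r k))) sequentially"
    using i j n by (intro eventually_rnd_separates)
   moreover have "eventually (\<lambda>k. M \<le> k) sequentially" by simp
   ultimately have "eventually (\<lambda>k. False) sequentially"
   proof eventually_elim
    case (elim k)
    then show False using bad[of "r k"] sub[of M k] uv by (auto simp: bad_def)
   qed
   then show False by simp
  qed
  show "\<epsilon> \<le> dist z w" if w: "w \<in> chord_union (L M)" for M w
  proof (rule tendsto_lowerbound)
   show "(\<lambda>k. dist (zs k) w) \<longlonglongrightarrow> dist z w" using zs by (intro tendsto_intros)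
   have "\<epsilon> \<le> dist (zs k) w" if "M \<le> k" for k
    using bad[of "r k"] w chord_union_mono[OF sub[OF that]] by (auto simp: bad_def zs_def)
   then show "eventually (\<lambda>k. \<epsilon> \<le> dist (zs k) w) sequentially" by (auto simp: eventually_sequentially)
  qed simp
  qed
qed

lemma closure_incseq_close:
  fixes A :: "nat => complex set"
  assumes "incseq A" "bounded (\<Union>N. A N)" "0 < \<epsilon>"
  shows "\<exists>N0. \<forall>N\<ge>N0. \<forall>y\<in>closure (\<Union>N. A N). \<exists>w\<in>A N. dist y w < \<epsilon>"
proof -
  define U where "U N = (\<Union>w\<in>A N. ball w \<epsilon>)" for N
  have "compact (closure (\<Union>N. A N))" using assms(2) by (simp add: compact_closure)
  moreover have "closure (\<Union>N. A N) \<subseteq> (\<Union>N\<in>UNIV. U N)"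
  proof
  fix y assume "y \<in> closure (\<Union>N. A N)"
  then obtain w where "w \<in> (\<Union>N. A N)" "dist w y < \<epsilon>" using assms(3) closure_approachable by blast
  then show "y \<in> (\<Union>N\<in>UNIV. U N)" by (auto simp: U_def)
  qed
  moreover have "open (U M)" for M unfolding U_def by (intro open_UN ballI open_ball)
  ultimately obtain F where F: "finite F" "closure (\<Union>N. A N) \<subseteq> (\<Union>N\<in>F. U N)"
  by (metis compactE_image)
  show ?thesis
  proof (intro exI allI impI ballI)
  fix N y assume N: "Max (insert 0 F) \<le> N" and "y \<in> closure (\<Union>N. A N)"
  then obtain M where "M \<in> F" "y \<in> U M" using F(2) by blast
  then obtain w where M: "M \<in> F" "w \<in> A M" "dist w y < \<epsilon>" by (auto simp: U_def)
  then have "M \<le> N" using F N by (meson Max_ge finite_insert insertCI order_trans)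
  then have "w \<in> A N" using M assms(1) by (auto dest: incseqD)
  then show "\<exists>w\<in>A N. dist y w < \<epsilon>" using M by (auto simp: dist_commute)
  qed
qed

definition polygon_chords :: "nat => (nat \<times> nat) set => complex set" where
  "polygon_chords n S = (\<Union>(i, j)\<in>S. chord (real i / real n) (real j / real n))"

text \<open>A chord of the polygon that does not cross the rounded chords of \<open>L N\<close> is close to \<open>L N\<close>, and \<open>L N\<close> is
  close to its limit and, after rounding, part of \<open>S\<close>.\<close>

theorem filling_hausdorff_limit:
  assumes fill: "filling L" and "0 < \<epsilon>"
  shows "\<exists>N n0. \<forall>n\<ge>n0. \<forall>S. S \<subseteq> {..<n} \<times> {..<n} --> rnd2 n ` L N \<subseteq> S -->
  (\<forall>(i, j)\<in>S. \<forall>(u, v)\<in>L N. \<not> separates (rnd n u) (rnd n v) i j) -->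
  S ~= {} \<and> hausdorff_dist (polygon_chords n S) (limit_set L) \<le> \<epsilon>"
proof -
  define K where "K = limit_set L"
  have inc: "incseq (\<lambda>N. chord_union (L N))"
  using fill by (auto simp: filling_def incseq_def intro!: chord_union_mono)
  have bdd: "bounded (\<Union>N. chord_union (L N))"
  by (rule bounded_subset[of "cball 0 1"]) (use chord_union_subset_disk in auto)
  obtain N1 where N1: "\<And>N. N1 \<le> N ==> \<forall>y\<in>K. \<exists>w\<in>chord_union (L N). dist y w < \<epsilon> / 3"
  using closure_incseq_close[OF inc bdd, of "\<epsilon> / 3"] assms(2) unfolding K_def by (metis divide_pos_pos zero_less_numeral)
  obtain N0 where N0: "\<And>N. N0 \<le> N ==> \<exists>n0. \<forall>n\<ge>n0. \<forall>i<n. \<forall>j<n.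
  (\<forall>(u, v)\<in>L N. \<not> separates (rnd n u) (rnd n v) i j) -->
  (\<forall>z\<in>chord (i / n) (j / n). \<exists>w\<in>chord_union (L N). dist z w < \<epsilon>)"
  using filling_noncrossing_close[OF assms] by blast
  have "\<exists>N. ends (L N) ~= {}" using fill unfolding filling_def by (metis empty_iff zero_le_one order_refl zero_less_one)
  then obtain N2 where N2: "L N2 ~= {}" by (auto simp: ends_def)
  define N where "N = max N0 (max N1 N2)"
  have LN: "L N ~= {}"
  proof -
  have "incseq L" using fill unfolding filling_def by blast
  then have "L N2 \<subseteq> L N" by (rule incseqD) (simp add: N_def)
  then show ?thesis using N2 by auto
  qed
  obtain n1 where n1: "\<And>n i j z. n1 \<le> n ==> i < n ==> j < n ==>
  (\<forall>(u, v)\<in>L N. \<not> separates (rnd n u) (rnd n v) i j) ==> z \<in> chord (i / n) (j / n) ==>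
  \<exists>w\<in>chord_union (L N). dist z w < \<epsilon>"
  using N0[of N] unfolding N_def by (meson max.cobounded1)
  obtain n2 :: nat where n2: "12 * pi / \<epsilon> < real n2" using reals_Archimedean2 by blast
  show ?thesis
  proof (rule exI[of _ N], rule exI[of _ "max n1 (max n2 1)"], intro allI impI conjI)
  fix n S assume n: "max n1 (max n2 1) \<le> n" and S: "S \<subseteq> {..<n} \<times> {..<n}"
   and sup: "rnd2 n ` L N \<subseteq> S"
   and nc: "\<forall>(i, j)\<in>S. \<forall>(u, v)\<in>L N. \<not> separates (rnd n u) (rnd n v) i j"
  show "S ~= {}" using LN sup by auto
  then have ne: "polygon_chords n S ~= {}" by (auto simp: polygon_chords_def)
  have n0: "0 < n" "12 * pi / \<epsilon> < real n" using n n2 by auto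
  then have small: "2 * pi * (1 / real n) < \<epsilon> / 6" using assms(2) by (simp add: field_simps)
  have K: "chord_union (L N) \<subseteq> K" unfolding K_def using closure_subset by fast
  have "chord_union (L N) ~= {}" using LN by (auto simp: chord_union_def)
  then have Kne: "K ~= {}" using K by auto
  show "hausdorff_dist (polygon_chords n S) (limit_set L) \<le> \<epsilon>"
   unfolding K_def[symmetric]
  proof (rule hausdorff_dist_leI[OF ne Kne])
   fix x assume "x \<in> polygon_chords n S"
   then obtain i j where ij: "(i, j) \<in> S" "x \<in> chord (i / n) (j / n)" by (auto simp: polygon_chords_def)
   then obtain w where "w \<in> chord_union (L N)" "dist x w < \<epsilon>"
    using n1[OF _ _ _ _ ij(2)] n S nc by fastforce
   then show "infdist x K \<le> \<epsilon>" using K by (intro infdist_le2[of w]) auto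
  next
   fix y assume "y \<in> K"
   moreover have "N1 \<le> N" by (simp add: N_def le_max_iff_disj)
   ultimately obtain w where w: "w \<in> chord_union (L N)" "dist y w < \<epsilon> / 3" using N1 by blast
   then obtain u v where uv: "(u, v) \<in> L N" "w \<in> chord u v" by (auto simp: chord_union_def)
   then obtain t where t: "0 \<le> t" "t \<le> 1" "w = chord_point u v t" by (auto simp: chord_altdef)
   define w' where "w' = chord_point (rnd n u / n) (rnd n v / n) t"
   have "w' \<in> chord (rnd n u / n) (rnd n v / n)" unfolding w'_def using t by (intro chord_point_mem)
   moreover have "(rnd n u, rnd n v) \<in> S" using sup uv by force
   ultimately have w': "w' \<in> polygon_chords n S" by (auto simp: polygon_chords_def)
   have uv0: "0 \<le> u" "0 \<le> v" using filling_range[OF fill uv(1)] by auto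
   have "dist w w' \<le> dist (circ u) (circ (rnd n u / n)) + dist (circ v) (circ (rnd n v / n))"
    unfolding t(3) w'_def using t by (intro dist_chord_point_le)
   also have "\<dots> \<le> 2 * pi * \<bar>u - rnd n u / n\<bar> + 2 * pi * \<bar>v - rnd n v / n\<bar>"
    by (intro add_mono dist_circ_le)
   also have "\<dots> \<le> 2 * pi * (1 / n) + 2 * pi * (1 / n)"
    using rnd_bounds[OF uv0(1) n0(1)] rnd_bounds[OF uv0(2) n0(1)] by (intro add_mono mult_left_mono) auto
   also have "\<dots> < \<epsilon> / 6 + \<epsilon> / 6" using small by (intro add_strict_mono)
   finally have "dist w w' < \<epsilon> / 3" by simp
   then have "dist y w' \<le> \<epsilon>" using w(2) dist_triangle[of y w' w] assms(2) by linarith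
   then show "infdist y (polygon_chords n S) \<le> \<epsilon>" using w' by (intro infdist_le2[of w']) auto
  qed
  qed
qed


section \<open>Runs with real draws\<close>

lemma rnd_tendsto: "0 \<le> t ==> (\<lambda>n. real (rnd n t) / real n) \<longlonglongrightarrow> t"
proof (rule tendsto_sandwich[of "\<lambda>n. t - 1 / real n" _ _ "\<lambda>_. t"])
  assume t: "0 \<le> t"
  show "eventually (\<lambda>n. t - 1 / real n \<le> real (rnd n t) / real n) sequentially"
  using eventually_gt_at_top[of 0]
  proof eventually_elim
  case (elim n)
  then show ?case using rnd_bounds(2)[OF t, of n] by linarith
  qed
  show "eventually (\<lambda>n. real (rnd n t) / real n \<le> t) sequentially"
  using eventually_gt_at_top[of 0]
  proof eventually_elim
  case (elim n)
  then show ?case using rnd_bounds(1)[OF t, of n] by linarith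
  qed
  have "(\<lambda>n. t - 1 / real n) \<longlonglongrightarrow> t - 0" by (intro tendsto_intros lim_1_over_n)
  then show "(\<lambda>n. t - 1 / real n) \<longlonglongrightarrow> t" by simp
qed simp

lemma eventually_rnd_strict_mono:
  assumes "finite D" "\<And>t. t \<in> D ==> 0 \<le> t"
  shows "eventually (\<lambda>n. strict_mono_on D (rnd n)) sequentially"
proof -
  have "eventually (\<lambda>n. s < t --> rnd n s < rnd n t) sequentially" if "s \<in> D" "t \<in> D" for s t
  proof (cases "s < t")
  case True
  have "filterlim (\<lambda>n::nat. n) at_top sequentially" by (rule filterlim_ident)
  from eventually_rnd_less(1)[OF rnd_tendsto this assms(2)[OF that(1)] True] assms(2)[OF that(2)]
  show ?thesis by (auto elim: eventually_mono)
  qed simp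
  then have "eventually (\<lambda>n. \<forall>s\<in>D. \<forall>t\<in>D. s < t --> rnd n s < rnd n t) sequentially"
  using assms(1) by (intro eventually_ball_finite ballI) auto
  then show ?thesis by eventually_elim (auto simp: strict_mono_on_def)
qed

lemma closure_in_part:
  fixes X :: "real set"
  assumes "open X" "u \<in> X" "v \<in> X" "u ~= v" "z \<in> closure X" "\<not> arc_out u v z"
  shows "z \<in> closure (in_part X u v)"
proof -
  define a b where "a = min u v" and "b = max u v"
  have ab: "a < b" "a \<in> X" "b \<in> X" using assms by (auto simp: a_def b_def min_def max_def)
  have part: "in_part X u v = {a<..<b} \<inter> X" by (auto simp: in_part_def arc_in_def a_def b_def)
  have "a \<le> z" "z \<le> b" using assms(6) unfolding arc_out_def a_def b_def by linarith+
  then consider "z \<in> {a<..<b}" | "z = a" | "z = b" by (metis greaterThanLessThan_iff less_eq_real_def)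
  then show ?thesis
  proof cases
  case 1
  then show ?thesis using open_Int_closure_subset[of "{a<..<b}" X] assms(5) unfolding part by auto
  next
  case 2
  obtain d where d: "0 < d" "ball a d \<subseteq> X" using assms(1) ab by (meson openE)
  show ?thesis unfolding closure_approachable
  proof (intro allI impI)
   fix e :: real assume "0 < e"
   define g where "g = min e (min d (b - a))"
   have "0 < g" "g \<le> e" "g \<le> d" "g \<le> b - a" using \<open>0 < e\<close> d(1) ab by (auto simp: g_def)
   moreover from this have "a + g / 2 \<in> X" using d(2) by (auto simp: subset_iff dist_real_def)
   ultimately show "\<exists>y\<in>in_part X u v. dist y z < e"
    unfolding part using 2 ab by (intro bexI[of _ "a + g / 2"]) (auto simp: dist_real_def)
  qed
  next
  case 3
  obtain d where d: "0 < d" "ball b d \<subseteq> X" using assms(1) ab by (meson openE)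
  show ?thesis unfolding closure_approachable
  proof (intro allI impI)
   fix e :: real assume "0 < e"
   define g where "g = min e (min d (b - a))"
   have "0 < g" "g \<le> e" "g \<le> d" "g \<le> b - a" using \<open>0 < e\<close> d(1) ab by (auto simp: g_def)
   moreover from this have "b - g / 2 \<in> X" using d(2) by (auto simp: subset_iff dist_real_def)
   ultimately show "\<exists>y\<in>in_part X u v. dist y z < e"
    unfolding part using 3 ab by (intro bexI[of _ "b - g / 2"]) (auto simp: dist_real_def)
  qed
  qed
qed

lemma closure_out_part:
  fixes X :: "real set"
  assumes "open X" "u \<in> X" "v \<in> X" "u ~= v" "z \<in> closure X" "\<not> arc_in u v z"
  shows "z \<in> closure (out_part X u v)"
proof -
  define a b where "a = min u v" and "b = max u v"
  have ab: "a < b" "a \<in> X" "b \<in> X" using assms by (auto simp: a_def b_def min_def max_def)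
  have part: "out_part X u v = ({..<a} \<union> {b<..}) \<inter> X" by (auto simp: out_part_def arc_out_def a_def b_def)
  have "z \<le> a \<or> b \<le> z" using assms(6) unfolding arc_in_def a_def b_def by linarith
  then consider "z \<in> {..<a} \<union> {b<..}" | "z = a" | "z = b"
  by (metis UnCI greaterThan_iff lessThan_iff less_eq_real_def)
  then show ?thesis
  proof cases
  case 1
  have "open ({..<a} \<union> {b<..})" by (intro open_Un open_lessThan open_greaterThan)
  then show ?thesis using 1 open_Int_closure_subset[of "{..<a} \<union> {b<..}" X] assms(5) unfolding part by blast
  next
  case 2
  obtain d where d: "0 < d" "ball a d \<subseteq> X" using assms(1) ab by (meson openE)
  show ?thesis unfolding closure_approachable
  proof (intro allI impI)
   fix e :: real assume "0 < e"
   define g where "g = min e d"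
   have "0 < g" "g \<le> e" "g \<le> d" using \<open>0 < e\<close> d(1) ab by (auto simp: g_def)
   moreover from this have "a - g / 2 \<in> X" using d(2) by (auto simp: subset_iff dist_real_def)
   ultimately show "\<exists>y\<in>out_part X u v. dist y z < e"
    unfolding part using 2 ab by (intro bexI[of _ "a - g / 2"]) (auto simp: dist_real_def)
  qed
  next
  case 3
  obtain d where d: "0 < d" "ball b d \<subseteq> X" using assms(1) ab by (meson openE)
  show ?thesis unfolding closure_approachable
  proof (intro allI impI)
   fix e :: real assume "0 < e"
   define g where "g = min e d"
   have "0 < g" "g \<le> e" "g \<le> d" using \<open>0 < e\<close> d(1) ab by (auto simp: g_def)
   moreover from this have "b + g / 2 \<in> X" using d(2) by (auto simp: subset_iff dist_real_def)
   ultimately show "\<exists>y\<in>out_part X u v. dist y z < e"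
    unfolding part using 3 ab by (intro bexI[of _ "b + g / 2"]) (auto simp: dist_real_def)
  qed
  qed
qed

lemma open_parts:
  fixes X :: "real set"
  assumes "open X"
  shows "open (in_part X u v)" "open (out_part X u v)"
proof -
  have "in_part X u v = {min u v<..<max u v} \<inter> X" "out_part X u v = ({..<min u v} \<union> {max u v<..}) \<inter> X"
  by (auto simp: in_part_def out_part_def arc_in_def arc_out_def)
  then show "open (in_part X u v)" "open (out_part X u v)"
  using assms by (auto intro!: open_Int open_Un)
qed

definition deep_region :: "'a::linorder => 'a => 'a => nat => 'a region list => bool" where
  "deep_region r1 r2 r3 k rs \<longleftrightarrow> (\<exists>r\<in>set rs. k \<le> snd (snd r) \<and> alive r1 r2 r3 (fst r))"

lemma consistent_same_region:
  assumes "consistent X0 s" "x \<in> X0 - ends (chords_of (fst s))" "y \<in> X0 - ends (chords_of (fst s))"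
  shows "(\<exists>r\<in>set (snd s). x \<in> fst r \<and> y \<in> fst r) \<longleftrightarrow> (\<forall>(u, v)\<in>chords_of (fst s). \<not> separates u v x y)"
proof -
  have "\<forall>x\<in>X0 - ends (chords_of (fst s)). \<forall>y\<in>X0 - ends (chords_of (fst s)).
    (\<exists>r\<in>set (snd s). x \<in> fst r \<and> y \<in> fst r) \<longleftrightarrow> (\<forall>(u, v)\<in>chords_of (fst s). \<not> separates u v x y)"
  using assms(1) unfolding consistent_def by (elim conjE)
  from bspec[OF bspec[OF this assms(2)] assms(3)] show ?thesis .
qed

lemma finite_nodes_step:
  assumes "finite (fst s)" "\<And>r. r \<in> set (snd s) ==> proper_move r (S d r)"
  shows "finite (fst (step S d s))"
proof -
  have "finite (fst m)" if "proper_move r m" for r and m :: "'a node set \<times> 'a region list"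
  using that by (auto simp: proper_move_def split_region_def)
  then have "finite (fst (S d r))" if "r \<in> set (snd s)" for r using assms(2)[OF that] by blast
  then show ?thesis using assms(1) by (simp add: step_def)
qed

text \<open>The parameters allow for the pair model and the point model at once: \<open>\<psi> \<phi>\<close> relabels a draw, \<open>pts\<close> gives
  the points of a draw. By \<open>hit\<close>, every region that contains an interval is split inside it sooner or later;
  the second alternative is needed for a point that first has to wait.\<close>

locale real_run =
  fixes S :: "'d => real region => real node set \<times> real region list"
  and S' :: "'e => nat region => nat node set \<times> nat region list"
  and \<psi> :: "(real => nat) => 'd => 'e" and pts :: "'d => real set" and d :: "nat => 'd"
  assumes proper: "\<And>x r. pend_ok r ==> proper_move r (S x r)"
  and matching: "\<And>D \<phi> x r r'. strict_mono_on D \<phi> ==> pts x \<subseteq> D ==> region_match \<phi> D r r' ==>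
   move_match \<phi> D (S x r) (S' (\<psi> \<phi> x) r')"
  and pts: "\<And>i. finite (pts (d i)) \<and> pts (d i) \<subseteq> {0<..<1}"
  and hit: "\<And>p q N. 0 \<le> p ==> p < q ==> q \<le> 1 ==> \<exists>m\<ge>N. \<forall>r. {p<..<q} \<subseteq> fst r -->
   (\<exists>X j u v. (X, j, u, v) \<in> fst (S (d m) r) \<and> p < v \<and> v < q) \<or>
   (\<exists>r'. S (d m) r = ({}, [r']) \<and> (\<exists>X j u v. (X, j, u, v) \<in> fst (S (d (Suc m)) r') \<and> p < v \<and> v < q))"
begin

definition st :: "nat => real state" where
  "st N = run S (map d [0..<N]) (start {0<..<1})"

definition lam :: "nat => (real \<times> real) set" where
  "lam N = chords_of (fst (st N))"

lemma st_0: "st 0 = start {0<..<1}" and st_Suc: "st (Suc N) = step S (d N) (st N)"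
  by (simp_all add: st_def)

lemma consistent_st: "consistent {0<..<1} (st N)"
  unfolding st_def by (rule consistent_run[OF proper consistent_start])

lemma proper_st: "r \<in> set (snd (st N)) ==> proper_move r (S x r)"
  using consistent_st[of N] by (intro proper) (auto simp: consistent_def)

lemma mem_st_Suc: "r' \<in> set (snd (st (Suc N))) \<longleftrightarrow> (\<exists>r\<in>set (snd (st N)). r' \<in> set (snd (S (d N) r)))"
  by (simp add: st_Suc step_def)

lemma node_st_Suc: "r \<in> set (snd (st N)) ==> nd \<in> fst (S (d N) r) ==> nd \<in> fst (st (Suc N))"
  by (auto simp: st_Suc step_def)

lemma lam_mono: "incseq lam"
  by (rule incseq_SucI) (auto simp: lam_def st_Suc step_def)

lemma finite_lam: "finite (lam N)"
proof -
  have "finite (fst (st N))"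
  proof (induction N)
  case 0
  then show ?case by (simp add: st_0 start_def)
  next
  case (Suc N)
  then show ?case unfolding st_Suc by (intro finite_nodes_step proper_st)
  qed
  then show ?thesis by (simp add: lam_def chords_of_def)
qed

lemma lam_ends_dense:
  assumes pq: "0 \<le> p" "p < q" "q \<le> 1"
  shows "\<exists>N. \<exists>u\<in>ends (lam N). p < u \<and> u < q"
proof (rule ccontr)
  assume no: "\<not> ?thesis"
  have reg: "\<exists>r\<in>set (snd (st N)). {p<..<q} \<subseteq> fst r" for N
  proof -
  have free: "x \<in> {0<..<1} - ends (lam N)" if "p < x" "x < q" for x using that no pq by auto
  have nosep: "\<not> separates u v x y" if xy: "p < x" "x < q" "p < y" "y < q" and uv: "(u, v) \<in> lam N" for x y u v
  proof -
   have "u \<notin> {p<..<q}" "v \<notin> {p<..<q}" using no endsI[OF uv] by auto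
   then show ?thesis using xy by (auto simp: side_defs min_def max_def)
  qed
  have c: "(\<exists>r\<in>set (snd (st N)). x \<in> fst r \<and> y \<in> fst r)" if xy: "p < x" "x < q" "p < y" "y < q" for x y
  proof -
   have "\<forall>(u, v)\<in>lam N. \<not> separates u v x y" using nosep[OF xy] by blast
   then show ?thesis
    using consistent_same_region[OF consistent_st[of N], of x y] free[OF xy(1,2)] free[OF xy(3,4)]
    unfolding lam_def by simp
  qed
  define x0 where "x0 = (p + q) / 2"
  have x0: "p < x0" "x0 < q" using pq by (auto simp: x0_def)
  obtain r where r: "r \<in> set (snd (st N))" "x0 \<in> fst r" using c[OF x0 x0] by blast
  have "y \<in> fst r" if y: "p < y" "y < q" for y
  proof -
   obtain r' where r': "r' \<in> set (snd (st N))" "x0 \<in> fst r'" "y \<in> fst r'" using c[OF x0 y] by blast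
   have "sorted_wrt (\<lambda>r r'. fst r \<inter> fst r' = {}) (snd (st N))" using consistent_st[of N] by (simp add: consistent_def)
   from sorted_wrt_disjoint_value[OF this r'(1) r(1) r'(2) r(2)] show ?thesis using r'(3) by simp
  qed
  then show ?thesis using r by (intro bexI[of _ r]) auto
  qed
  obtain m where m: "\<And>r. {p<..<q} \<subseteq> fst r ==>
   (\<exists>X j u v. (X, j, u, v) \<in> fst (S (d m) r) \<and> p < v \<and> v < q) \<or>
   (\<exists>r'. S (d m) r = ({}, [r']) \<and> (\<exists>X j u v. (X, j, u, v) \<in> fst (S (d (Suc m)) r') \<and> p < v \<and> v < q))"
  using hit[OF pq, of 0] by blast
  have nonode: False if "r \<in> set (snd (st N))" "(X, j, u, v) \<in> fst (S (d N) r)" "p < v" "v < q" for N r X j u v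
  proof -
  have "(u, v) \<in> lam (Suc N)" using node_st_Suc[OF that(1,2)] by (force simp: lam_def chords_of_def)
  from endsI(2)[OF this] show False using no that(3,4) by blast
  qed
  obtain r where r: "r \<in> set (snd (st m))" "{p<..<q} \<subseteq> fst r" using reg by blast
  have n1: "\<not> (\<exists>X j u v. (X, j, u, v) \<in> fst (S (d m) r) \<and> p < v \<and> v < q)" using nonode[OF r(1)] by blast
  then obtain r' where r': "S (d m) r = ({}, [r'])" "\<exists>X j u v. (X, j, u, v) \<in> fst (S (d (Suc m)) r') \<and> p < v \<and> v < q"
  using m[OF r(2)] by blast
  moreover have "r' \<in> set (snd (st (Suc m)))" unfolding mem_st_Suc using r(1) r' by force
  ultimately show False using nonode r'(2) by blast
qed

definition nonsep :: "real set => bool" where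
  "nonsep Z \<longleftrightarrow> (\<forall>N. \<forall>(u, v)\<in>lam N. \<forall>s\<in>Z. \<forall>t\<in>Z. \<not> separates u v s t)"

text \<open>In the closure, because the points of \<open>Z\<close> may be ends of chords themselves.\<close>

definition surrounds :: "real set => real region => bool" where
  "surrounds Z r \<longleftrightarrow> open (fst r) \<and> Z \<subseteq> closure (fst r)"

lemma surrounds_step:
  assumes "nonsep Z" "r \<in> set (snd (st N))" "surrounds Z r"
  obtains r' where "r' \<in> set (snd (st (Suc N)))" "surrounds Z r'" "snd (snd r) \<le> snd (snd r')"
  "fst (S (d N) r) = {} ==> fst r' = fst r \<and> S (d N) r = ({}, [r'])"
  "fst (S (d N) r) ~= {} ==> Suc (snd (snd r)) = snd (snd r')"
proof -
  have "proper_move r (S (d N) r)" using proper_st[OF assms(2)] .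
  then consider p where "S (d N) r = ({}, [(fst r, p, snd (snd r))])" |
  u v where "u \<in> fst r" "v \<in> fst r" "u ~= v" "S (d N) r = split_region (fst r) (snd (snd r)) u v"
  unfolding proper_move_def by blast
  then show ?thesis
  proof cases
  case 1
  show ?thesis
   by (rule that[of "(fst r, p, snd (snd r))"]) (use 1 assms mem_st_Suc in \<open>auto simp: surrounds_def intro!: bexI[of _ r]\<close>)
  next
  case 2
  let ?i = "(in_part (fst r) u v, None, Suc (snd (snd r)))" and ?o = "(out_part (fst r) u v, None, Suc (snd (snd r)))"
  have mem: "?i \<in> set (snd (st (Suc N)))" "?o \<in> set (snd (st (Suc N)))"
   unfolding mem_st_Suc using assms(2) 2(4) by (auto simp: split_region_def intro!: bexI[of _ r])
  have "(u, v) \<in> lam (Suc N)"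
   using node_st_Suc[OF assms(2), of "(fst r, snd (snd r), u, v)"] 2(4)
   by (force simp: lam_def chords_of_def split_region_def)
  then have "\<not> separates u v s t" if "s \<in> Z" "t \<in> Z" for s t using assms(1) that unfolding nonsep_def by blast
  then have "(\<forall>z\<in>Z. \<not> arc_out u v z) \<or> (\<forall>z\<in>Z. \<not> arc_in u v z)" unfolding separates_def by blast
  then show ?thesis
  proof
   assume o: "\<forall>z\<in>Z. \<not> arc_out u v z"
   have "surrounds Z ?i"
    using assms(3) 2 closure_in_part[of "fst r" u v] o open_parts by (auto simp: surrounds_def)
   then show ?thesis using mem 2(4) by (intro that[of ?i]) (auto simp: split_region_def)
  next
   assume i: "\<forall>z\<in>Z. \<not> arc_in u v z"
   have "surrounds Z ?o"
    using assms(3) 2 closure_out_part[of "fst r" u v] i open_parts by (auto simp: surrounds_def)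
   then show ?thesis using mem 2(4) by (intro that[of ?o]) (auto simp: split_region_def)
  qed
  qed
qed

lemma surrounds_later:
  assumes "nonsep Z" "r \<in> set (snd (st N))" "surrounds Z r" "N \<le> M"
  shows "\<exists>r'\<in>set (snd (st M)). surrounds Z r' \<and> snd (snd r) \<le> snd (snd r')"
  using assms(4)
proof (induction M rule: dec_induct)
  case base
  then show ?case using assms by blast
next
  case (step M)
  then obtain r1 where "r1 \<in> set (snd (st M))" "surrounds Z r1" "snd (snd r) \<le> snd (snd r1)" by blast
  then obtain r2 where "r2 \<in> set (snd (st (Suc M)))" "surrounds Z r2" "snd (snd r1) \<le> snd (snd r2)"
  using surrounds_step[OF assms(1)] by blast
  then show ?case using \<open>snd (snd r) \<le> snd (snd r1)\<close> by (meson order_trans)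
qed

text \<open>As long as the region of \<open>Z\<close> is not split it contains a fixed interval, and \<open>hit\<close> ends that.\<close>

lemma surrounds_deeper:
  assumes Z: "nonsep Z" "Z ~= {}" and r: "r \<in> set (snd (st N))" "surrounds Z r"
  shows "\<exists>M. \<exists>r'\<in>set (snd (st M)). surrounds Z r' \<and> snd (snd r) < snd (snd r')"
proof (rule ccontr)
  assume no: "\<not> ?thesis"
  have stay: "\<exists>r'\<in>set (snd (st M)). surrounds Z r' \<and> fst r' = fst r \<and> snd (snd r') = snd (snd r)" if "N \<le> M" for M
  using that
  proof (induction M rule: dec_induct)
  case base
  then show ?case using r by blast
  next
  case (step M)
  then obtain r1 where r1: "r1 \<in> set (snd (st M))" "surrounds Z r1" "fst r1 = fst r" "snd (snd r1) = snd (snd r)" by blast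
  obtain r2 where r2: "r2 \<in> set (snd (st (Suc M)))" "surrounds Z r2" "snd (snd r1) \<le> snd (snd r2)"
   "fst (S (d M) r1) = {} ==> fst r2 = fst r1 \<and> S (d M) r1 = ({}, [r2])"
   "fst (S (d M) r1) ~= {} ==> Suc (snd (snd r1)) = snd (snd r2)"
   using surrounds_step[OF Z(1) r1(1,2)] by blast
  have "\<not> snd (snd r) < snd (snd r2)" using no r2(1,2) by blast
  then show ?case using r2 r1 by (intro bexI[of _ r2]) auto
  qed
  have X: "open (fst r)" "fst r ~= {}" "fst r \<subseteq> {0<..<1}"
  using r Z(2) consistent_st[of N] by (auto simp: surrounds_def consistent_def)
  then obtain x where x: "x \<in> fst r" by blast
  obtain e where e: "0 < e" "ball x e \<subseteq> fst r" using X(1) x by (meson openE)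
  have pq: "0 \<le> max 0 (x - e)" "max 0 (x - e) < min 1 (x + e)" "min 1 (x + e) \<le> 1"
  using X(3) x e(1) by auto
  have sub: "{max 0 (x - e)<..<min 1 (x + e)} \<subseteq> fst r"
  using e(2) by (auto simp: subset_iff dist_real_def abs_less_iff)
  obtain m where m: "N \<le> m" "\<And>r1. fst r1 = fst r ==> fst (S (d m) r1) ~= {} \<or>
   (\<exists>r'. S (d m) r1 = ({}, [r']) \<and> fst (S (d (Suc m)) r') ~= {})"
  using hit[OF pq, of N] sub by (metis empty_iff)
  obtain r1 where r1: "r1 \<in> set (snd (st m))" "surrounds Z r1" "fst r1 = fst r" "snd (snd r1) = snd (snd r)"
  using stay[OF m(1)] by blast
  obtain r2 where r2: "r2 \<in> set (snd (st (Suc m)))" "surrounds Z r2" "snd (snd r1) \<le> snd (snd r2)"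
  "fst (S (d m) r1) = {} ==> fst r2 = fst r1 \<and> S (d m) r1 = ({}, [r2])"
  "fst (S (d m) r1) ~= {} ==> Suc (snd (snd r1)) = snd (snd r2)"
  using surrounds_step[OF Z(1) r1(1,2)] by blast
  have nosplit: "fst (S (d m) r1) = {}"
  proof (rule ccontr)
  assume "fst (S (d m) r1) ~= {}"
  then have "snd (snd r) < snd (snd r2)" using r2(5) r1(4) by simp
  then show False using no r2(1,2) by blast
  qed
  then have "fst (S (d (Suc m)) r2) ~= {}" using m(2)[OF r1(3)] r2(4) by auto
  then obtain r3 where "r3 \<in> set (snd (st (Suc (Suc m))))" "surrounds Z r3" "Suc (snd (snd r2)) = snd (snd r3)"
  using surrounds_step[OF Z(1) r2(1,2)] by blast
  moreover have "snd (snd r) < Suc (snd (snd r2))" using r2(3) r1(4) by simp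
  ultimately show False using no by metis
qed

lemma surrounds_deep:
  assumes "nonsep Z" "Z ~= {}" "Z \<subseteq> {0..1}"
  shows "\<exists>M. \<exists>r\<in>set (snd (st M)). surrounds Z r \<and> k \<le> snd (snd r)"
proof (induction k)
  case 0
  have "surrounds Z ({0<..<1}, None, 0)" using assms(3) by (auto simp: surrounds_def)
  then show ?case by (intro exI[of _ 0] bexI[of _ "({0<..<1}, None, 0)"]) (auto simp: st_0 start_def)
next
  case (Suc k)
  then obtain M r where "r \<in> set (snd (st M))" "surrounds Z r" "k \<le> snd (snd r)" by blast
  then show ?case using surrounds_deeper[OF assms(1,2)] by (meson Suc_leI le_less_trans)
qed

lemma surrounds_alive:
  assumes "surrounds {z1, z2, z3, z4} r" "z1 < r1" "r1 < z2" "z2 < r2" "r2 < z3" "z3 < r3" "r3 < z4"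
  shows "alive r1 r2 r3 (fst r)"
proof -
  have meet: "W \<inter> fst r ~= {}" if "open W" "z \<in> W" "z \<in> {z1, z2, z3, z4}" for W z
  proof -
  have "z \<in> closure (fst r)" using assms(1) that(3) unfolding surrounds_def by blast
  then have "W \<inter> closure (fst r) ~= {}" using that(2) by blast
  then show ?thesis using open_Int_closure_eq_empty[OF that(1), of "fst r"] by simp
  qed
  have "{..<r1} \<inter> fst r ~= {}" "{r1<..<r2} \<inter> fst r ~= {}" "{r2<..<r3} \<inter> fst r ~= {}" "{r3<..} \<inter> fst r ~= {}"
  using meet[of "{..<r1}" z1] meet[of "{r1<..<r2}" z2] meet[of "{r2<..<r3}" z3] meet[of "{r3<..}" z4] assms(2-) by auto
  then show ?thesis unfolding alive_def by (auto simp: less_imp_le)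
qed

lemma rounded_run:
  assumes "finite D0" "D0 \<subseteq> {0<..<1}"
  shows "eventually (\<lambda>n. \<exists>D. D0 \<subseteq> D \<and> strict_mono_on D (rnd n) \<and>
  state_match (rnd n) D (st N) (run S' (map (\<lambda>i. \<psi> (rnd n) (d i)) [0..<N]) (start {..<n}))) sequentially"
proof -
  define D where "D = D0 \<union> (\<Union>i<N. pts (d i))"
  have D: "finite D" "D \<subseteq> {0<..<1}" using assms pts by (auto simp: D_def)
  have "eventually (\<lambda>n. strict_mono_on D (rnd n)) sequentially"
  using D by (intro eventually_rnd_strict_mono) auto
  then show ?thesis using eventually_gt_at_top[of 0]
  proof eventually_elim
  case (elim n)
  have "state_match (rnd n) D (run S (map d [0..<N]) (start {0<..<1}))
   (run S' (map (\<psi> (rnd n)) (map d [0..<N])) (start {..<n}))"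
  proof (rule state_match_run)
   show "state_match (rnd n) D (start {0<..<1}) (start {..<n})"
    using D elim(2) by (intro state_match_start) (auto intro!: rnd_less)
   show "move_match (rnd n) D (S x r) (S' (\<psi> (rnd n) x) r')"
    if "x \<in> set (map d [0..<N])" "region_match (rnd n) D r r'" for x r r'
    using that elim(1) by (intro matching) (auto simp: D_def)
  qed
  then show ?case using elim(1) by (intro exI[of _ D]) (auto simp: D_def st_def o_def)
  qed
qed

lemma deep_region_rounded:
  assumes "deep_region r1 r2 r3 k (snd (st N))" "0 < r1" "r1 < r2" "r2 < r3" "r3 < 1"
  shows "eventually (\<lambda>n. deep_region (rnd n r1) (rnd n r2) (rnd n r3) k
  (snd (run S' (map (\<lambda>i. \<psi> (rnd n) (d i)) [0..<N]) (start {..<n})))) sequentially"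
proof -
  obtain r where r: "r \<in> set (snd (st N))" "k \<le> snd (snd r)" "alive r1 r2 r3 (fst r)"
  using assms(1) by (auto simp: deep_region_def)
  obtain t1 t2 t3 t4 where t: "t1 \<in> fst r" "t1 < r1" "t2 \<in> fst r" "r1 \<le> t2" "t2 < r2" "t3 \<in> fst r" "r2 \<le> t3" "t3 < r3" "t4 \<in> fst r" "r3 \<le> t4"
  using r(3) by (rule aliveE)
  have "fst r \<subseteq> {0<..<1}" using consistent_st[of N] r(1) unfolding consistent_def by blast
  then have "eventually (\<lambda>n. \<exists>D. {t1, t2, t3, t4, r1, r2, r3} \<subseteq> D \<and> strict_mono_on D (rnd n) \<and>
  state_match (rnd n) D (st N) (run S' (map (\<lambda>i. \<psi> (rnd n) (d i)) [0..<N]) (start {..<n}))) sequentially"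
  using t assms by (intro rounded_run) auto
  then show ?thesis
  proof eventually_elim
  case (elim n)
  then obtain D where D: "{t1, t2, t3, t4, r1, r2, r3} \<subseteq> D" "strict_mono_on D (rnd n)"
   "list_all2 (region_match (rnd n) D) (snd (st N)) (snd (run S' (map (\<lambda>i. \<psi> (rnd n) (d i)) [0..<N]) (start {..<n})))"
   by (auto simp: state_match_def)
  obtain r' where r': "r' \<in> set (snd (run S' (map (\<lambda>i. \<psi> (rnd n) (d i)) [0..<N]) (start {..<n})))" "region_match (rnd n) D r r'"
   using D(3) r(1) unfolding list_all2_conv_all_nth by (metis in_set_conv_nth)
  have mem: "rnd n t \<in> fst r'" if "t \<in> {t1, t2, t3, t4}" for t
   using r'(2) that t D(1) unfolding region_match_def by blast
  have lt: "rnd n x < rnd n y" if "x \<in> D" "y \<in> D" "x < y" for x y using D(2) that by (auto simp: strict_mono_on_def)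
  have "rnd n t1 < rnd n r1" "rnd n r1 \<le> rnd n t2" "rnd n t2 < rnd n r2" "rnd n r2 \<le> rnd n t3" "rnd n t3 < rnd n r3" "rnd n r3 \<le> rnd n t4"
   using lt t D(1) by (auto intro!: rnd_mono)
  then have "alive (rnd n r1) (rnd n r2) (rnd n r3) (fst r')"
   using mem unfolding alive_def by (auto simp: disjoint_iff)
  moreover have "snd (snd r') = snd (snd r)" using r'(2) by (simp add: region_match_def)
  ultimately show ?case using r'(1) r(2) unfolding deep_region_def by (intro bexI[of _ r']) auto
  qed
qed

text \<open>Four points that are never separated are surrounded by regions of every depth. Rational numbers
  between these points bound four arcs that all these regions reach, also after rounding.\<close>

theorem filling_lam:
  assumes "\<And>r1 r2 r3. r1 \<in> \<rat> ==> r2 \<in> \<rat> ==> r3 \<in> \<rat> ==> 0 < r1 ==> r1 < r2 ==> r2 < r3 ==> r3 < 1 ==>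
  \<exists>k. \<not> (eventually (\<lambda>N. eventually (\<lambda>n. deep_region (rnd n r1) (rnd n r2) (rnd n r3) k
   (snd (run S' (map (\<lambda>i. \<psi> (rnd n) (d i)) [0..<N]) (start {..<n})))) sequentially) sequentially)"
  shows "filling lam"
  unfolding filling_def
proof (intro conjI)
  show "\<forall>N. \<forall>(u, v)\<in>lam N. u \<in> {0<..<1} \<and> v \<in> {0<..<1} \<and> u ~= v"
  using consistent_st unfolding consistent_def lam_def by blast
  show "\<forall>N. \<forall>(u, v)\<in>lam N. \<forall>(u', v')\<in>lam N. \<not> separates u v u' v'"
  using consistent_st unfolding consistent_def lam_def by blast
  show "\<forall>p q. 0 \<le> p --> p < q --> q \<le> 1 --> (\<exists>N. \<exists>u\<in>ends (lam N). p < u \<and> u < q)"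
  using lam_ends_dense by blast
  show "\<not> (\<exists>z1 z2 z3 z4. 0 \<le> z1 \<and> z1 < z2 \<and> z2 < z3 \<and> z3 < z4 \<and> z4 \<le> 1 \<and>
    (\<forall>N. \<forall>(u, v)\<in>lam N. \<forall>s\<in>{z1, z2, z3, z4}. \<forall>t\<in>{z1, z2, z3, z4}. \<not> separates u v s t))"
  proof
  assume "\<exists>z1 z2 z3 z4. 0 \<le> z1 \<and> z1 < z2 \<and> z2 < z3 \<and> z3 < z4 \<and> z4 \<le> 1 \<and>
    (\<forall>N. \<forall>(u, v)\<in>lam N. \<forall>s\<in>{z1, z2, z3, z4}. \<forall>t\<in>{z1, z2, z3, z4}. \<not> separates u v s t)"
  then obtain z1 z2 z3 z4 where z: "0 \<le> z1" "z1 < z2" "z2 < z3" "z3 < z4" "z4 \<le> 1" and ns: "nonsep {z1, z2, z3, z4}"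
   unfolding nonsep_def by blast
  obtain r1 r2 r3 where r: "r1 \<in> \<rat>" "z1 < r1" "r1 < z2" "r2 \<in> \<rat>" "z2 < r2" "r2 < z3" "r3 \<in> \<rat>" "z3 < r3" "r3 < z4"
   using Rats_dense_in_real z(2,3,4) by metis
  obtain k where k: "\<not> (eventually (\<lambda>N. eventually (\<lambda>n. deep_region (rnd n r1) (rnd n r2) (rnd n r3) k
   (snd (run S' (map (\<lambda>i. \<psi> (rnd n) (d i)) [0..<N]) (start {..<n})))) sequentially) sequentially)"
   using assms[OF r(1,4,7)] r z by (meson le_less_trans less_le_trans less_trans)
  have Z01: "{z1, z2, z3, z4} \<subseteq> {0..1}" using z by auto
  obtain M rM where M: "rM \<in> set (snd (st M))" "surrounds {z1, z2, z3, z4} rM" "k \<le> snd (snd rM)"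
   using surrounds_deep[OF ns _ Z01, of k] by blast
  have "eventually (\<lambda>n. deep_region (rnd n r1) (rnd n r2) (rnd n r3) k
   (snd (run S' (map (\<lambda>i. \<psi> (rnd n) (d i)) [0..<N]) (start {..<n})))) sequentially" if "M \<le> N" for N
  proof (rule deep_region_rounded)
   from surrounds_later[OF ns M(1,2) that]
   obtain rN where "rN \<in> set (snd (st N))" "surrounds {z1, z2, z3, z4} rN" "snd (snd rM) \<le> snd (snd rN)"
    by blast
   then show "deep_region r1 r2 r3 k (snd (st N))"
    using M(3) surrounds_alive[of z1 z2 z3 z4 rN r1 r2 r3] r unfolding deep_region_def by (meson order_trans)
  qed (use r z in auto)
  then have "eventually (\<lambda>N. eventually (\<lambda>n. deep_region (rnd n r1) (rnd n r2) (rnd n r3) k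
   (snd (run S' (map (\<lambda>i. \<psi> (rnd n) (d i)) [0..<N]) (start {..<n})))) sequentially) sequentially"
   by (rule eventually_sequentiallyI)
  with k show False by contradiction
  qed
qed (use lam_mono finite_lam in auto)

end


section \<open>Deep regions are rare\<close>

text \<open>A deep region in the run is the root of some node of its completion, unless it has too few points to
  reach four arcs.\<close>

lemma prob_deep_region_le:
  fixes V :: "'a::linorder set"
  assumes V: "finite V" and r12: "r1 \<le> r2" and r23: "r2 \<le> r3"
  and law: "bind_pmf p (\<lambda>ds. completion (run S ds (start V))) = region_law (V, None, 0)"
  and proper: "\<And>x r. pend_ok r ==> proper_move r (S x r)"
  shows "measure_pmf.prob p {ds. deep_region r1 r2 r3 k (snd (run S ds (start V)))} \<le>
  measure_pmf.prob (region_law (V, None, 0)) {H. deep_alive r1 r2 r3 k H}"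
proof -
  let ?E = "{H. deep_alive r1 r2 r3 k H}"
  let ?D = "{ds. deep_region r1 r2 r3 k (snd (run S ds (start V)))}"
  have one: "measure_pmf.prob (completion (run S ds (start V))) ?E = 1" if dd: "ds \<in> ?D" for ds
  proof -
  have c: "consistent V (run S ds (start V))" by (rule consistent_run[OF proper consistent_start])
  obtain r where r: "r \<in> set (snd (run S ds (start V)))" "k \<le> snd (snd r)" "alive r1 r2 r3 (fst r)"
   using dd unfolding deep_region_def by blast
  have f: "finite (fst r)" "pend_ok r" using c r(1) V unfolding consistent_def by (auto intro: finite_subset)
  have "\<not> card (fst r) < 2" using alive_card[OF r(3) f(1)] by simp
  then have "deep_alive r1 r2 r3 k A" if "A \<in> set_pmf (completion (run S ds (start V)))" for A
   using completion_root[OF that r(1) f(1) _ f(2)] r(2,3) unfolding deep_alive_def[OF r12 r23] by blast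
  then have "AE A in completion (run S ds (start V)). A \<in> ?E" by (auto simp: AE_measure_pmf_iff)
  then show ?thesis using measure_pmf.prob_eq_1[of ?E] by simp
  qed
  have "measure_pmf.prob p ?D = (\<integral>ds. indicator ?D ds \<partial>p)" by simp
  also have "\<dots> \<le> (\<integral>ds. measure_pmf.prob (completion (run S ds (start V))) ?E \<partial>p)"
  proof (rule integral_mono)
  show "integrable (measure_pmf p) (\<lambda>ds. measure_pmf.prob (completion (run S ds (start V))) ?E)"
   by (rule measure_pmf.integrable_const_bound[where B = 1]) auto
  show "indicator ?D ds \<le> measure_pmf.prob (completion (run S ds (start V))) ?E" for ds
   using one[of ds] by (auto simp: indicator_def)
  qed (auto intro!: integrable_real_indicator simp: measure_pmf.emeasure_eq_measure)
  also have "\<dots> = (\<integral>ds. (\<integral>H. indicator ?E H \<partial>completion (run S ds (start V))) \<partial>p)" by simp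
  also have "\<dots> = (\<integral>H. indicator ?E H \<partial>bind_pmf p (\<lambda>ds. completion (run S ds (start V))))"
  by (rule integral_bind_pmf_bounded[symmetric, where B = 1]) (auto simp: indicator_def)
  finally show ?thesis unfolding law by simp
qed

lemma eventually_ratio_le:
  assumes "0 \<le> a" "a < b" "\<And>n. {rnd n a..<rnd n b} \<subseteq> {..<n} - G n"
  shows "eventually (\<lambda>n. ratio (G n) {..<n} \<le> sqrt (2 / (b - a))) sequentially"
proof -
  obtain n0 :: nat where n0: "2 / (b - a) < real n0" using reals_Archimedean2 by blast
  have "ratio (G n) {..<n} \<le> sqrt (2 / (b - a))" if n: "max n0 1 \<le> n" for n
  proof -
  have np: "0 < n" "2 / (b - a) < real n" using n n0 by auto
  have "rnd n a \<le> rnd n b" using assms(2) by (intro rnd_mono) auto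
  then have "real (card {rnd n a..<rnd n b}) = real (rnd n b) - real (rnd n a)" by (simp add: of_nat_diff)
  moreover have "real (rnd n a) \<le> real n * a" "real n * b < real (rnd n b) + 1"
   using rnd_bounds[of a n] rnd_bounds[of b n] assms np by (auto simp: field_simps)
  ultimately have "real n * (b - a) - 1 < real (card {rnd n a..<rnd n b})" by (simp add: algebra_simps)
  moreover have "2 < real n * (b - a)" using np assms(2) by (simp add: field_simps)
  ultimately have "real n * (b - a) / 2 < real (card {rnd n a..<rnd n b})" by linarith
  also have "\<dots> \<le> real (card ({..<n} - G n))" by (intro of_nat_mono card_mono assms(3)) simp
  finally have c: "real n * (b - a) / 2 < real (card ({..<n} - G n))" .
  have "real (card ({..<n} \<inter> G n)) / real (card ({..<n} - G n)) \<le> real n / (real n * (b - a) / 2)"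
  proof (rule frac_le)
   show "real (card ({..<n} \<inter> G n)) \<le> real n" using card_mono[of "{..<n}" "{..<n} \<inter> G n"] by simp
   show "0 < real n * (b - a) / 2" using np assms by simp
  qed (use c in auto)
  also have "\<dots> = 2 / (b - a)" using np by simp
  finally show ?thesis by (simp add: ratio_def)
  qed
  then show ?thesis by (rule eventually_sequentiallyI)
qed

text \<open>Each of the four arcs contains a fixed proportion of the vertices in the limit.\<close>

lemma eventually_lyap_le:
  assumes "0 < r1" "r1 < r2" "r2 < r3" "r3 < 1"
  shows "\<exists>B\<ge>0. eventually (\<lambda>n. lyap (rnd n r1) (rnd n r2) (rnd n r3) {..<n} \<le> B) sequentially"
proof -
  have le: "rnd n r1 \<le> rnd n r2" "rnd n r2 \<le> rnd n r3" for n using assms by (auto intro!: rnd_mono)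
  have ln: "rnd n r3 \<le> n" "rnd n r2 \<le> n" "rnd n r1 \<le> n" for n
  using assms rnd_less[of r3 n] rnd_less[of r2 n] rnd_less[of r1 n] by (cases "n = 0"; auto simp: rnd_def)+
  have r0: "rnd n 0 = 0" for n by (simp add: rnd_def)
  have "eventually (\<lambda>n. ratio {..<rnd n r2} {..<n} \<le> sqrt (2 / (r3 - r2))) sequentially"
  by (rule eventually_ratio_le) (use assms ln in \<open>auto intro: less_le_trans\<close>)
  moreover have "eventually (\<lambda>n. ratio (- {..<rnd n r2}) {..<n} \<le> sqrt (2 / (r2 - 0))) sequentially"
  by (rule eventually_ratio_le) (use assms ln r0 in \<open>auto intro: less_le_trans\<close>)
  moreover have "eventually (\<lambda>n. ratio {rnd n r1..<rnd n r3} {..<n} \<le> sqrt (2 / (r1 - 0))) sequentially"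
  by (rule eventually_ratio_le) (use assms ln r0 in \<open>auto intro: less_le_trans\<close>)
  moreover have "eventually (\<lambda>n. ratio (- {rnd n r1..<rnd n r3}) {..<n} \<le> sqrt (2 / (r3 - r1))) sequentially"
  by (rule eventually_ratio_le) (use assms ln in \<open>auto intro: less_le_trans\<close>)
  ultimately have "eventually (\<lambda>n. lyap (rnd n r1) (rnd n r2) (rnd n r3) {..<n} \<le>
   sqrt (2 / (r3 - r2)) + sqrt (2 / (r2 - 0)) + sqrt (2 / (r1 - 0)) + sqrt (2 / (r3 - r1))) sequentially"
  proof eventually_elim
  case (elim n)
  then show ?case unfolding lyap_def[OF le] by linarith
  qed
  moreover have "0 \<le> sqrt (2 / (r3 - r2)) + sqrt (2 / (r2 - 0)) + sqrt (2 / (r1 - 0)) + sqrt (2 / (r3 - r1))"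
  using assms by simp
  ultimately show ?thesis by blast
qed

lemma eventually_prob_deep_alive_le:
  assumes "0 < r1" "r1 < r2" "r2 < r3" "r3 < 1" "0 < \<epsilon>"
  shows "\<exists>k. eventually (\<lambda>n. measure_pmf.prob (region_law ({..<n}, None, 0))
  {H. deep_alive (rnd n r1) (rnd n r2) (rnd n r3) k H} \<le> \<epsilon>) sequentially"
proof -
  obtain B where B: "0 \<le> B" "eventually (\<lambda>n. lyap (rnd n r1) (rnd n r2) (rnd n r3) {..<n} \<le> B) sequentially"
  using eventually_lyap_le[OF assms(1-4)] by blast
  define \<beta> where "\<beta> = 1 / (1 - drift_rate / 2)"
  define C where "C = 2 / (drift_const * drift_rate) * (B + drift_const)"
  have \<beta>: "1 < \<beta>" using drift_rate by (simp add: \<beta>_def)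
  obtain k where k: "C / \<epsilon> < \<beta> ^ k" using real_arch_pow[OF \<beta>] by blast
  have "C / \<beta> ^ k \<le> \<epsilon>"
  using k assms(5) \<beta> by (simp add: field_simps)
  have le: "rnd n r1 \<le> rnd n r2" "rnd n r2 \<le> rnd n r3" for n using assms by (auto intro!: rnd_mono)
  show ?thesis
  proof (rule exI[of _ k], use B(2) in eventually_elim)
  case (elim n)
  have "measure_pmf.prob (region_law ({..<n}, None, 0)) {H. deep_alive (rnd n r1) (rnd n r2) (rnd n r3) k H} \<le>
    2 / (drift_const * drift_rate * \<beta> ^ k) * \<beta> ^ 0 *
    on_alive (rnd n r1) (rnd n r2) (rnd n r3) (\<lambda>Y. lyap (rnd n r1) (rnd n r2) (rnd n r3) Y + drift_const) {..<n}"
   unfolding region_law.simps \<beta>_def by (rule prob_deep_alive_tree[OF le]) simp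
  also have "\<dots> \<le> 2 / (drift_const * drift_rate * \<beta> ^ k) * \<beta> ^ 0 * (B + drift_const)"
   using elim B(1) drift_const_pos drift_rate \<beta> by (intro mult_left_mono) (auto simp: on_alive_def[OF le])
  also have "\<dots> = C / \<beta> ^ k" by (simp add: C_def)
  finally show ?case using \<open>C / \<beta> ^ k \<le> \<epsilon>\<close> by linarith
  qed
qed

lemma (in prob_space) prob_eventually_le:
  assumes "\<And>n. {\<omega> \<in> space M. P n \<omega>} \<in> events" "eventually (\<lambda>n. prob {\<omega> \<in> space M. P n \<omega>} \<le> c) sequentially"
  shows "prob {\<omega> \<in> space M. eventually (\<lambda>n. P n \<omega>) sequentially} \<le> c"
proof -
  define B where "B m = {\<omega> \<in> space M. \<forall>n\<ge>m. P n \<omega>}" for m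
  obtain n0 where n0: "\<And>n. n0 \<le> n ==> prob {\<omega> \<in> space M. P n \<omega>} \<le> c"
  using assms(2) by (auto simp: eventually_sequentially)
  have Bm: "B m \<in> events" for m
  proof -
  have "B m = (\<Inter>n\<in>{m..}. {\<omega> \<in> space M. P n \<omega>})" by (auto simp: B_def)
  then show ?thesis using assms(1) by auto
  qed
  have "incseq B" by (auto simp: incseq_def B_def)
  then have "(\<lambda>m. prob (B m)) \<longlonglongrightarrow> prob (\<Union>m. B m)"
  using Bm by (intro finite_Lim_measure_incseq) auto
  moreover have "prob (B m) \<le> c" for m
  proof -
  have "B m \<subseteq> {\<omega> \<in> space M. P (max m n0) \<omega>}" by (auto simp: B_def)
  then have "prob (B m) \<le> prob {\<omega> \<in> space M. P (max m n0) \<omega>}" using assms(1) by (intro finite_measure_mono) auto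
  then show ?thesis using n0[of "max m n0"] by simp
  qed
  ultimately have "prob (\<Union>m. B m) \<le> c" by (intro LIMSEQ_le_const2) auto
  moreover have "(\<Union>m. B m) = {\<omega> \<in> space M. eventually (\<lambda>n. P n \<omega>) sequentially}"
  by (auto simp: B_def eventually_sequentially)
  ultimately show ?thesis by simp
qed

text \<open>If the event that a region is deep at time \<open>N\<close> had, for all large \<open>N\<close> and then all large
  \<open>n\<close>, probability at most \<open>\<epsilon> k\<close> with \<open>\<epsilon> k\<close> tending to 0, then almost surely no region stays alive.\<close>

lemma (in prob_space) AE_not_always_deep:
  fixes Z :: "nat => nat => 'a => 'e"
  assumes law: "\<And>n N. 0 < n ==> distr M (count_space UNIV) (\<lambda>\<omega>. map (\<lambda>i. Z n i \<omega>) [0..<N]) = measure_pmf (replicate_pmf N (p n))"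
  and meas: "\<And>n N. (\<lambda>\<omega>. map (\<lambda>i. Z n i \<omega>) [0..<N]) \<in> M \<rightarrow>\<^sub>M count_space UNIV"
  and comp: "\<And>n N. 0 < n ==> bind_pmf (replicate_pmf N (p n)) (\<lambda>ds. completion (run S ds (start {..<n}))) = region_law ({..<n}, None, 0)"
  and proper: "\<And>x r. pend_ok r ==> proper_move r (S x r)"
  and r: "0 < r1" "r1 < r2" "r2 < r3" "r3 < 1"
  shows "AE \<omega> in M. \<exists>k. \<not> (eventually (\<lambda>N. eventually (\<lambda>n. deep_region (rnd n r1) (rnd n r2) (rnd n r3) k
   (snd (run S (map (\<lambda>i. Z n i \<omega>) [0..<N]) (start {..<n})))) sequentially) sequentially)"
proof -
  define P where "P k N n \<omega> \<longleftrightarrow> deep_region (rnd n r1) (rnd n r2) (rnd n r3) k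
   (snd (run S (map (\<lambda>i. Z n i \<omega>) [0..<N]) (start {..<n})))" for k N n \<omega>
  have Pm: "{\<omega> \<in> space M. P k N n \<omega>} \<in> events" for k N n
  proof -
  have "{\<omega> \<in> space M. P k N n \<omega>} = (\<lambda>\<omega>. map (\<lambda>i. Z n i \<omega>) [0..<N]) -` {ds. deep_region (rnd n r1) (rnd n r2) (rnd n r3) k
   (snd (run S ds (start {..<n})))} \<inter> space M" by (auto simp: P_def)
  then show ?thesis by (simp only:) (rule measurable_sets[OF meas], simp)
  qed
  have Pev: "{\<omega> \<in> space M. eventually (\<lambda>n. P k N n \<omega>) sequentially} \<in> events" for k N
  using Pm by (rule sets_Collect_eventually_sequentially)
  have Pev2: "{\<omega> \<in> space M. eventually (\<lambda>N. eventually (\<lambda>n. P k N n \<omega>) sequentially) sequentially} \<in> events" for k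
  using Pev by (rule sets_Collect_eventually_sequentially)
  have small: "\<exists>k. prob {\<omega> \<in> space M. eventually (\<lambda>N. eventually (\<lambda>n. P k N n \<omega>) sequentially) sequentially} \<le> \<epsilon>" if "0 < \<epsilon>" for \<epsilon>
  proof -
  obtain k where k: "eventually (\<lambda>n. measure_pmf.prob (region_law ({..<n}, None, 0))
    {H. deep_alive (rnd n r1) (rnd n r2) (rnd n r3) k H} \<le> \<epsilon>) sequentially"
   using eventually_prob_deep_alive_le[OF r \<open>0 < \<epsilon>\<close>] by blast
  have "eventually (\<lambda>n. prob {\<omega> \<in> space M. P k N n \<omega>} \<le> \<epsilon>) sequentially" for N
   using k eventually_gt_at_top[of 0]
  proof eventually_elim
   case (elim n)
   have "prob {\<omega> \<in> space M. P k N n \<omega>} = measure (distr M (count_space UNIV) (\<lambda>\<omega>. map (\<lambda>i. Z n i \<omega>) [0..<N]))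
     {ds. deep_region (rnd n r1) (rnd n r2) (rnd n r3) k (snd (run S ds (start {..<n})))}"
    using meas by (subst measure_distr) (auto simp: P_def intro!: arg_cong[where f = prob])
   also have "\<dots> \<le> measure_pmf.prob (region_law ({..<n}, None, 0)) {H. deep_alive (rnd n r1) (rnd n r2) (rnd n r3) k H}"
    unfolding law[OF elim(2)] by (rule prob_deep_region_le[OF _ _ _ comp[OF elim(2)] proper]) (use r in \<open>auto intro!: rnd_mono\<close>)
   finally show ?case using elim(1) by linarith
  qed
  then have "prob {\<omega> \<in> space M. eventually (\<lambda>n. P k N n \<omega>) sequentially} \<le> \<epsilon>" for N
   by (intro prob_eventually_le Pm)
  then have "prob {\<omega> \<in> space M. eventually (\<lambda>N. eventually (\<lambda>n. P k N n \<omega>) sequentially) sequentially} \<le> \<epsilon>"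
   by (intro prob_eventually_le Pev) auto
  then show ?thesis by blast
  qed
  define Bad where "Bad = (\<Inter>k. {\<omega> \<in> space M. eventually (\<lambda>N. eventually (\<lambda>n. P k N n \<omega>) sequentially) sequentially})"
  have Bad: "Bad \<in> events" unfolding Bad_def using Pev2 by auto
  have "prob Bad \<le> \<epsilon>" if \<epsilon>: "0 < \<epsilon>" for \<epsilon>
  proof -
  obtain k where k: "prob {\<omega> \<in> space M. eventually (\<lambda>N. eventually (\<lambda>n. P k N n \<omega>) sequentially) sequentially} \<le> \<epsilon>"
   using small[OF \<epsilon>] by blast
  have "prob Bad \<le> prob {\<omega> \<in> space M. eventually (\<lambda>N. eventually (\<lambda>n. P k N n \<omega>) sequentially) sequentially}"
   using Pev2 by (intro finite_measure_mono) (auto simp: Bad_def)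
  then show ?thesis using k by linarith
  qed
  then have "prob Bad = 0" by (metis field_le_epsilon add_0 measure_nonneg order_antisym)
  then have "AE \<omega> in M. \<omega> \<notin> Bad" using Bad by (simp add: prob_eq_0)
  then show ?thesis using AE_space by eventually_elim (auto simp: Bad_def P_def)
qed

section \<open>Laws of finite sequences of independent draws\<close>

lemma pmf_replicate:
  "pmf (replicate_pmf N p) l = (if length l = N then (\<Prod>i<N. pmf p (l ! i)) else 0)"
proof (induction N arbitrary: l)
  case 0
  then show ?case by (cases l) (auto simp: pmf_return)
next
  case (Suc N)
  have eq: "replicate_pmf (Suc N) p = map_pmf (\<lambda>(x, xs). x # xs) (pair_pmf p (replicate_pmf N p))"
  by (simp add: pair_pmf_def map_bind_pmf bind_return_pmf map_pmf_def bind_assoc_pmf)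
  show ?case
  proof (cases l)
  case Nil
  have "[] \<notin> set_pmf (replicate_pmf (Suc N) p)" unfolding set_replicate_pmf by simp
  then show ?thesis using Nil by (simp add: set_pmf_iff del: replicate_pmf.simps)
  next
  case (Cons x xs)
  have "pmf (replicate_pmf (Suc N) p) l = pmf (map_pmf (\<lambda>(x, xs). x # xs) (pair_pmf p (replicate_pmf N p))) ((\<lambda>(x, xs). x # xs) (x, xs))"
   unfolding eq Cons by simp
  also have "\<dots> = pmf (pair_pmf p (replicate_pmf N p)) (x, xs)"
   by (rule pmf_map_inj') (auto simp: inj_def)
  also have "\<dots> = pmf p x * pmf (replicate_pmf N p) xs" by (rule pmf_pair)
  finally show ?thesis using Suc.IH[of xs] Cons 
   by (auto simp: prod.lessThan_Suc_shift simp del: prod.lessThan_Suc)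
  qed
qed

lemma (in prob_space) distr_list_eq_replicate:
  fixes W :: "nat => 'a => 'e::countable"
  assumes meas: "\<And>i. i < N ==> W i \<in> M \<rightarrow>\<^sub>M count_space UNIV"
  and law: "\<And>l. length l = N ==> prob {\<omega> \<in> space M. \<forall>i<N. W i \<omega> = l ! i} = (\<Prod>i<N. pmf p (l ! i))"
  shows "(\<lambda>\<omega>. map (\<lambda>i. W i \<omega>) [0..<N]) \<in> M \<rightarrow>\<^sub>M count_space UNIV"
  and "distr M (count_space UNIV) (\<lambda>\<omega>. map (\<lambda>i. W i \<omega>) [0..<N]) = measure_pmf (replicate_pmf N p)"
proof -
  have pre: "(\<lambda>\<omega>. map (\<lambda>i. W i \<omega>) [0..<N]) -` {l} \<inter> space M =
   (if length l = N then {\<omega> \<in> space M. \<forall>i<N. W i \<omega> = l ! i} else {})" for l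
  proof -
  have "map (\<lambda>i. W i \<omega>) [0..<N] = l \<longleftrightarrow> length l = N \<and> (\<forall>i<N. W i \<omega> = l ! i)" for \<omega>
   unfolding list_eq_iff_nth_eq by fastforce
  then show ?thesis by (simp add: vimage_def Int_def conj_commute)
  qed
  have ev: "{\<omega> \<in> space M. \<forall>i<N. W i \<omega> = l ! i} \<in> events" for l
  proof -
  have "{\<omega> \<in> space M. \<forall>i<N. W i \<omega> = l ! i} = (\<Inter>i\<in>{..<N}. {\<omega> \<in> space M. W i \<omega> = l ! i}) \<inter> space M" by auto
  moreover have "{\<omega> \<in> space M. W i \<omega> = l ! i} \<in> events" if "i < N" for i
   using measurable_sets[OF meas[OF that], of "{l ! i}"] by (simp add: vimage_def Int_def conj_commute)
  ultimately show ?thesis by (cases "N = 0") auto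
  qed
  show meas': "(\<lambda>\<omega>. map (\<lambda>i. W i \<omega>) [0..<N]) \<in> M \<rightarrow>\<^sub>M count_space UNIV"
  by (subst measurable_count_space_eq2_countable) (auto simp: pre ev)
  show "distr M (count_space UNIV) (\<lambda>\<omega>. map (\<lambda>i. W i \<omega>) [0..<N]) = measure_pmf (replicate_pmf N p)"
  proof (rule measure_eqI_countable[of _ UNIV])
  fix l :: "'e list"
  have "emeasure (distr M (count_space UNIV) (\<lambda>\<omega>. map (\<lambda>i. W i \<omega>) [0..<N])) {l} =
    emeasure M ((\<lambda>\<omega>. map (\<lambda>i. W i \<omega>) [0..<N]) -` {l} \<inter> space M)"
   using meas' by (subst emeasure_distr) auto
  also have "\<dots> = ennreal (pmf (replicate_pmf N p) l)"
   using law[of l] unfolding pre pmf_replicate by (simp add: emeasure_eq_measure)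
  finally show "emeasure (distr M (count_space UNIV) (\<lambda>\<omega>. map (\<lambda>i. W i \<omega>) [0..<N])) {l} =
    emeasure (measure_pmf (replicate_pmf N p)) {l}" by (simp add: emeasure_pmf_single)
  qed auto
qed

lemma prob_replicate_avoid:
  fixes c :: "'e::countable"
  shows "measure_pmf.prob (replicate_pmf N p) {l. c \<notin> set l} = (1 - pmf p c) ^ N"
proof (induction N)
  case 0
  then show ?case by simp
next
  case (Suc N)
  have eq: "replicate_pmf (Suc N) p = map_pmf (\<lambda>(x, xs). x # xs) (pair_pmf p (replicate_pmf N p))"
  by (simp add: pair_pmf_def map_bind_pmf bind_return_pmf map_pmf_def bind_assoc_pmf)
  have "measure_pmf.prob (replicate_pmf (Suc N) p) {l. c \<notin> set l} =
   measure_pmf.prob (pair_pmf p (replicate_pmf N p)) ((- {c}) \<times> {l. c \<notin> set l})"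
  unfolding eq measure_map_pmf by (rule arg_cong[where f = "measure_pmf.prob _"]) auto
  also have "\<dots> = measure_pmf.prob p (- {c}) * measure_pmf.prob (replicate_pmf N p) {l. c \<notin> set l}"
  by (rule measure_pmf_prob_product) auto
  also have "measure_pmf.prob p (- {c}) = 1 - pmf p c"
  using measure_pmf.prob_compl[of "{c}" p] by (simp add: Compl_eq_Diff_UNIV measure_pmf_single)
  finally show ?case using Suc by simp
qed


section \<open>The angles of the random endpoints\<close>

text \<open>The angle divided by \<open>2 * pi\<close>, so that the circle is \<open>{0..<1}\<close>.\<close>

definition ang :: "complex => real" where
  "ang = the_inv_into {0..<1} circ"

lemma circ_image: "circ ` {0..<1} = sphere 0 1"
proof
  show "circ ` {0..<1} \<subseteq> sphere 0 1" by auto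
  show "sphere 0 1 \<subseteq> circ ` {0..<1}"
  proof
  fix z :: complex assume z: "z \<in> sphere 0 1"
  define t where "t = Arg2pi z / (2 * pi)"
  have "z = cis (Arg2pi z)" using z Arg2pi_eq[of z] by (simp add: cis_conv_exp)
  then have "z = circ t" by (simp add: circ_def t_def)
  moreover have "t \<in> {0..<1}" using Arg2pi[of z] by (simp add: t_def)
  ultimately show "z \<in> circ ` {0..<1}" by blast
  qed
qed

lemma ang_circ: "t \<in> {0..<1} ==> ang (circ t) = t"
  unfolding ang_def by (rule the_inv_into_f_f[OF circ_inj_on])

lemma ang_range:
  assumes "norm z = 1"
  shows "ang z \<in> {0..<1}" "circ (ang z) = z"
proof -
  have "z \<in> circ ` {0..<1}" using assms by (simp add: circ_image)
  then show "ang z \<in> {0..<1}" "circ (ang z) = z" by (auto simp: ang_circ)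
qed

lemma circ_image_borel:
  assumes "a \<le> b"
  shows "circ ` {a..<b} \<in> sets borel"
proof -
  have "{a..<b} = (\<Union>n. {a..b - 1 / real (Suc n)})"
  proof (intro set_eqI iffI)
  fix x assume x: "x \<in> {a..<b}"
  then obtain n where "1 / real (Suc n) < b - x" using nat_approx_posE[of "b - x"] by auto
  then show "x \<in> (\<Union>n. {a..b - 1 / real (Suc n)})" using x by (auto intro!: exI[of _ n])
  next
  fix x assume "x \<in> (\<Union>n. {a..b - 1 / real (Suc n)})"
  then obtain n where n: "a \<le> x" "x \<le> b - 1 / real (Suc n)" by auto
  have "0 < 1 / real (Suc n)" by simp
  then have "x < b" using n(2) by linarith
  then show "x \<in> {a..<b}" using n(1) by simp
  qed
  then have "circ ` {a..<b} = (\<Union>n. circ ` {a..b - 1 / real (Suc n)})" by (simp only: image_UN)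
  moreover have "circ ` {a..b - 1 / real (Suc n)} \<in> sets borel" for n
  by (intro borel_compact compact_continuous_image continuous_on_circ) auto
  ultimately show ?thesis by auto
qed

lemma space_uniform_circle [simp]: "space uniform_circle = sphere 0 1"
  and sets_uniform_circle [simp]: "sets uniform_circle = sets (restrict_space borel (sphere 0 1))"
  by (simp_all add: uniform_circle_def space_restrict_space)

lemma circ_image_in_sets: "a \<le> b ==> circ ` {a..<b} \<in> sets uniform_circle"
  using circ_image_borel by (auto simp: sets_restrict_space intro!: image_eqI[of _ _ "circ ` {a..<b}"])

lemma emeasure_uniform_circle_arc:
  assumes ab: "0 \<le> a" "a \<le> b" "b \<le> 1"
  shows "emeasure uniform_circle (circ ` {a..<b}) = ennreal (b - a)"
proof -
  let ?A = "circ ` {a..<b}" and ?I = "{0..2 * pi}"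
  have cisb: "cis \<in> borel_measurable borel" by (intro borel_measurable_continuous_onI continuous_intros)
  then have "cis \<in> borel_measurable (uniform_measure lborel ?I)" by (simp add: measurable_def)
  then have cis: "cis \<in> uniform_measure lborel ?I \<rightarrow>\<^sub>M restrict_space borel (sphere 0 1)"
  by (intro measurable_restrict_space2) auto
  have A: "?A \<in> sets (restrict_space borel (sphere 0 1))" using circ_image_in_sets[OF ab(2)] by simp
  have pre: "cis -` ?A \<in> sets lborel"
  using measurable_sets[OF cisb circ_image_borel[OF ab(2)]] by simp
  have cis_eq: "cis \<theta> = circ (\<theta> / (2 * pi))" for \<theta> by (simp add: circ_def)
  have sub: "?I \<inter> cis -` ?A = {2 * pi * a..<2 * pi * b} \<union> (cis -` ?A \<inter> {2 * pi})"
  proof (intro set_eqI)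
  fix \<theta>
  consider "\<theta> < 0" | "2 * pi < \<theta>" | "\<theta> = 2 * pi" | "0 \<le> \<theta>" "\<theta> < 2 * pi" by linarith
  then show "\<theta> \<in> ?I \<inter> cis -` ?A \<longleftrightarrow> \<theta> \<in> {2 * pi * a..<2 * pi * b} \<union> (cis -` ?A \<inter> {2 * pi})"
  proof cases
   case 1
   have "0 \<le> 2 * pi * a" using ab by simp
   then show ?thesis using 1 by auto
  next
   case 2
   have "2 * pi * b \<le> 2 * pi * 1" using ab by (intro mult_left_mono) auto
   then have "\<not> \<theta> < 2 * pi * b" "\<not> \<theta> \<le> 2 * pi" "\<theta> ~= 2 * pi" using 2 by linarith+
   then show ?thesis by simp
  next
   case 3
   have "2 * pi * b \<le> 2 * pi * 1" using ab by (intro mult_left_mono) auto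
   then show ?thesis using 3 by auto
  next
   case 4
   then have t: "\<theta> / (2 * pi) \<in> {0..<1}" by auto
   have "cis \<theta> \<in> ?A \<longleftrightarrow> \<theta> / (2 * pi) \<in> {a..<b}"
   proof
    assume "cis \<theta> \<in> ?A"
    then obtain x where x: "x \<in> {a..<b}" "circ (\<theta> / (2 * pi)) = circ x" unfolding cis_eq by blast
    then have "x \<in> {0..<1}" using ab by auto
    then have "\<theta> / (2 * pi) = x" using x t by (intro inj_onD[OF circ_inj_on]) auto
    then show "\<theta> / (2 * pi) \<in> {a..<b}" using x by simp
   qed (simp only: cis_eq imageI)
   also have "\<dots> \<longleftrightarrow> \<theta> \<in> {2 * pi * a..<2 * pi * b}" by (auto simp: field_simps)
   finally show ?thesis using 4 by auto
  qed
  qed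
  have null: "cis -` ?A \<inter> {2 * pi} \<in> null_sets lborel" by (rule finite_imp_null_set_lborel) auto
  have "emeasure uniform_circle ?A = emeasure (uniform_measure lborel ?I) (cis -` ?A \<inter> space (uniform_measure lborel ?I))"
  unfolding uniform_circle_def by (rule emeasure_distr[OF cis A])
  also have "\<dots> = emeasure lborel (?I \<inter> cis -` ?A) / emeasure lborel ?I"
  using pre by simp
  also have "emeasure lborel (?I \<inter> cis -` ?A) = emeasure lborel {2 * pi * a..<2 * pi * b}"
  unfolding sub by (rule emeasure_Un_null_set[OF _ null]) simp
  also have "\<dots> = ennreal (2 * pi * (b - a))"
  using ab by (simp add: right_diff_distrib mult_left_mono)
  also have "\<dots> / emeasure lborel ?I = ennreal (b - a)"
  using ab by (simp add: divide_ennreal)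
  finally show ?thesis .
qed

lemma rnd_ang:
  assumes "norm z = 1" "0 < n"
  shows "rnd n (ang z) = c \<longleftrightarrow> c < n \<and> z \<in> circ ` {real c / real n..<real (Suc c) / real n}"
proof -
  have t: "ang z \<in> {0..<1}" "circ (ang z) = z" using ang_range[OF assms(1)] by auto
  have "rnd n (ang z) = c \<longleftrightarrow> real c / real n \<le> ang z \<and> ang z < real (Suc c) / real n"
  proof
  assume "rnd n (ang z) = c"
  then show "real c / real n \<le> ang z \<and> ang z < real (Suc c) / real n"
   using rnd_bounds[of "ang z" n] t assms(2) by (auto simp: add_divide_distrib[symmetric] add.commute)
  next
  assume "real c / real n \<le> ang z \<and> ang z < real (Suc c) / real n"
  then have "real c \<le> real n * ang z" "real n * ang z < real c + 1" using assms(2) by (auto simp: field_simps)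
  then have "\<lfloor>real n * ang z\<rfloor> = int c" by (simp add: floor_eq_iff)
  then show "rnd n (ang z) = c" by (simp add: rnd_def)
  qed
  also have "\<dots> \<longleftrightarrow> c < n \<and> z \<in> circ ` {real c / real n..<real (Suc c) / real n}"
  proof
  assume *: "real c / real n \<le> ang z \<and> ang z < real (Suc c) / real n"
  then have "real c / real n < 1" using t by auto
  then have "c < n" using assms(2) by (simp add: divide_less_eq)
  then show "c < n \<and> z \<in> circ ` {real c / real n..<real (Suc c) / real n}" using * t(2)[symmetric] by auto
  next
  assume *: "c < n \<and> z \<in> circ ` {real c / real n..<real (Suc c) / real n}"
  then obtain s where s: "real c / real n \<le> s" "s < real (Suc c) / real n" "z = circ s" by auto
  have "real (Suc c) / real n \<le> 1" using * by (simp add: divide_le_eq)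
  moreover have "0 \<le> real c / real n" by simp
  ultimately have "0 \<le> s" "s < 1" using s(1,2) by linarith+
  then have "s \<in> {0..<1}" by simp
  then show "real c / real n \<le> ang z \<and> ang z < real (Suc c) / real n" using s ang_circ by auto
  qed
  finally show ?thesis .
qed

locale circle_pairs = prob_space \<Omega> for \<Omega> :: "'w measure" +
  fixes U V :: "nat => 'w => complex"
  assumes indep: "indep_vars (\<lambda>_. uniform_circle) (case_sum U V) ({1..} <+> {1..})"
  and distr_U: "\<And>i. i \<ge> 1 ==> distr \<Omega> uniform_circle (U i) = uniform_circle"
  and distr_V: "\<And>i. i \<ge> 1 ==> distr \<Omega> uniform_circle (V i) = uniform_circle"
begin

text \<open>The points in the order \<open>U 1, V 1, U 2, V 2, \<dots>\<close>.\<close>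

definition pt :: "nat => 'w => complex" where
  "pt i = (if even i then U (i div 2 + 1) else V (i div 2 + 1))"

definition y :: "nat => 'w => real" where
  "y i \<omega> = ang (pt i \<omega>)"

lemma pt_measurable: "pt i \<in> \<Omega> \<rightarrow>\<^sub>M uniform_circle"
proof -
  have "case_sum U V k \<in> \<Omega> \<rightarrow>\<^sub>M uniform_circle" if "k \<in> {1..} <+> {1..}" for k
  using indep that unfolding indep_vars_def by blast
  from this[of "Inl (i div 2 + 1)"] this[of "Inr (i div 2 + 1)"] show ?thesis by (auto simp: pt_def)
qed

lemma prob_pt_product:
  assumes "finite J" "J ~= {}" "\<And>i. i \<in> J ==> A i \<in> sets uniform_circle"
  shows "prob (\<Inter>i\<in>J. pt i -` A i \<inter> space \<Omega>) = (\<Prod>i\<in>J. prob (pt i -` A i \<inter> space \<Omega>))"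
proof -
  define h :: "nat => nat + nat" where "h i = (if even i then Inl (i div 2 + 1) else Inr (i div 2 + 1))" for i
  have inj: "inj h"
  proof (rule injI)
  fix i j assume "h i = h j"
  then have "even i = even j" "i div 2 = j div 2" by (auto simp: h_def split: if_splits)
  then show "i = j" by (metis even_two_times_div_two odd_two_times_div_two_succ)
  qed
  have h: "case_sum U V (h i) = pt i" for i by (auto simp: h_def pt_def fun_eq_iff)
  have inv: "inv h (h i) = i" for i using inj by simp
  have "(\<Inter>i\<in>J. pt i -` A i \<inter> space \<Omega>) = (\<Inter>k\<in>h ` J. case_sum U V k -` A (inv h k) \<inter> space \<Omega>)"
  by (simp add: h inv)
  also have "prob \<dots> = (\<Prod>k\<in>h ` J. prob (case_sum U V k -` A (inv h k) \<inter> space \<Omega>))"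
  proof (rule indep_varsD[OF indep])
  have "h i \<in> {1..} <+> {1..}" for i by (auto simp: h_def intro!: InlI InrI)
  then show "h ` J \<subseteq> {1..} <+> {1..}" by blast
  show "A (inv h k) \<in> sets uniform_circle" if "k \<in> h ` J" for k using assms(3) that inv by auto
  qed (use assms in auto)
  also have "\<dots> = (\<Prod>i\<in>J. prob (pt i -` A i \<inter> space \<Omega>))"
  using inj by (subst prod.reindex) (auto simp: h inv intro: inj_on_subset[OF inj])
  finally show ?thesis .
qed

lemma pt_norm: "\<omega> \<in> space \<Omega> ==> norm (pt i \<omega>) = 1"
  using measurable_space[OF pt_measurable, of \<omega> i] by simp

lemma y_range: "\<omega> \<in> space \<Omega> ==> y i \<omega> \<in> {0..<1}" and circ_y: "\<omega> \<in> space \<Omega> ==> circ (y i \<omega>) = pt i \<omega>"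
  using ang_range[OF pt_norm] by (auto simp: y_def)

lemma distr_pt: "distr \<Omega> uniform_circle (pt i) = uniform_circle"
  using distr_U distr_V by (simp add: pt_def)

lemma prob_cell:
  assumes "0 < n"
  shows "prob {\<omega> \<in> space \<Omega>. rnd n (y i \<omega>) = c} = pmf (pmf_of_set {..<n}) c"
  and "{\<omega> \<in> space \<Omega>. rnd n (y i \<omega>) = c} = pt i -` (if c < n then circ ` {real c / real n..<real (Suc c) / real n} else {}) \<inter> space \<Omega>"
proof -
  let ?A = "if c < n then circ ` {real c / real n..<real (Suc c) / real n} else {}"
  define B where "B = circ ` {real c / real n..<real (Suc c) / real n}"
  have "rnd n (y i \<omega>) = c \<longleftrightarrow> c < n \<and> pt i \<omega> \<in> B" if "\<omega> \<in> space \<Omega>" for \<omega>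
  unfolding y_def B_def by (rule rnd_ang[OF pt_norm[OF that] assms])
  then show eq: "{\<omega> \<in> space \<Omega>. rnd n (y i \<omega>) = c} = pt i -` ?A \<inter> space \<Omega>"
  unfolding B_def[symmetric] by auto
  have A: "?A \<in> sets uniform_circle" using circ_image_in_sets[of "real c / real n" "real (Suc c) / real n"] by (simp add: divide_right_mono)
  have "emeasure \<Omega> (pt i -` ?A \<inter> space \<Omega>) = emeasure (distr \<Omega> uniform_circle (pt i)) ?A"
  using pt_measurable A by (simp add: emeasure_distr)
  also have "\<dots> = ennreal (if c < n then 1 / real n else 0)"
  unfolding distr_pt using emeasure_uniform_circle_arc[of "real c / real n" "real (Suc c) / real n"] assms
  by (simp add: divide_right_mono diff_divide_distrib[symmetric] del: of_nat_Suc)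
  finally have em: "emeasure \<Omega> (pt i -` ?A \<inter> space \<Omega>) = ennreal (if c < n then 1 / real n else 0)" .
  show "prob {\<omega> \<in> space \<Omega>. rnd n (y i \<omega>) = c} = pmf (pmf_of_set {..<n}) c"
  proof -
  have "{..<n} ~= {}" using assms by auto
  then have "pmf (pmf_of_set {..<n}) c = (if c < n then 1 / real n else 0)" by (subst pmf_of_set) (auto simp: indicator_def)
  then show ?thesis unfolding eq using em by (simp only: emeasure_eq_measure ennreal_inj measure_nonneg) (simp split: if_splits)
  qed
qed

lemma prob_cells:
  assumes "0 < n" "finite J"
  shows "prob {\<omega> \<in> space \<Omega>. \<forall>i\<in>J. rnd n (y i \<omega>) = c i} = (\<Prod>i\<in>J. pmf (pmf_of_set {..<n}) (c i))"
proof (cases "J = {}")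
  case True
  then show ?thesis by (simp add: prob_space)
next
  case False
  define A where "A i = (if c i < n then circ ` {real (c i) / real n..<real (Suc (c i)) / real n} else {})" for i
  have A: "A i \<in> sets uniform_circle" for i
  using circ_image_in_sets[of "real (c i) / real n" "real (Suc (c i)) / real n"] by (simp add: A_def divide_right_mono)
  have eq: "{\<omega> \<in> space \<Omega>. rnd n (y i \<omega>) = c i} = pt i -` A i \<inter> space \<Omega>" for i
  unfolding A_def by (rule prob_cell(2)[OF assms(1)])
  have "{\<omega> \<in> space \<Omega>. \<forall>i\<in>J. rnd n (y i \<omega>) = c i} = (\<Inter>i\<in>J. pt i -` A i \<inter> space \<Omega>)"
  unfolding eq[symmetric] using False by auto
  also have "prob \<dots> = (\<Prod>i\<in>J. prob (pt i -` A i \<inter> space \<Omega>))"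
  using assms(2) False A by (intro prob_pt_product) auto
  also have "\<dots> = (\<Prod>i\<in>J. pmf (pmf_of_set {..<n}) (c i))"
  unfolding eq[symmetric] prob_cell(1)[OF assms(1)] ..
  finally show ?thesis .
qed

lemma rnd_y_measurable: "(\<lambda>\<omega>. rnd n (y i \<omega>)) \<in> \<Omega> \<rightarrow>\<^sub>M count_space UNIV"
proof (cases "n = 0")
  case True
  then show ?thesis by (simp add: rnd_def)
next
  case False
  have "{\<omega> \<in> space \<Omega>. rnd n (y i \<omega>) = c} \<in> events" for c
  using prob_cell(2)[of n i c] False measurable_sets[OF pt_measurable]
   circ_image_in_sets[of "real c / real n" "real (Suc c) / real n"] by (simp add: divide_right_mono)
  then show ?thesis
  by (subst measurable_count_space_eq2_countable) (auto simp: vimage_def Int_def conj_commute)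
qed

lemma cell_event: "{\<omega> \<in> space \<Omega>. rnd n (y i \<omega>) = c} \<in> events"
  using measurable_sets[OF rnd_y_measurable, of "{c}" n i] by (simp add: vimage_def Int_def conj_commute)

lemma rnd_y_in: "\<omega> \<in> space \<Omega> ==> 0 < n ==> rnd n (y i \<omega>) < n"
  using y_range[of \<omega> i] by (auto intro!: rnd_less)

lemma point_list_law:
  shows "(\<lambda>\<omega>. map (\<lambda>i. rnd n (y i \<omega>)) [0..<N]) \<in> \<Omega> \<rightarrow>\<^sub>M count_space UNIV"
  and "0 < n ==> distr \<Omega> (count_space UNIV) (\<lambda>\<omega>. map (\<lambda>i. rnd n (y i \<omega>)) [0..<N]) =
   measure_pmf (replicate_pmf N (pmf_of_set {..<n}))"
proof -
  have l: "prob {\<omega> \<in> space \<Omega>. \<forall>i<N. rnd n (y i \<omega>) = l ! i} = (\<Prod>i<N. pmf (pmf_of_set {..<n}) (l ! i))" if "0 < n" for l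
  using prob_cells[OF that, of "{..<N}" "(!) l"] by (simp add: Ball_def)
  show "0 < n ==> distr \<Omega> (count_space UNIV) (\<lambda>\<omega>. map (\<lambda>i. rnd n (y i \<omega>)) [0..<N]) =
   measure_pmf (replicate_pmf N (pmf_of_set {..<n}))"
  by (rule distr_list_eq_replicate(2)[OF rnd_y_measurable l])
  show "(\<lambda>\<omega>. map (\<lambda>i. rnd n (y i \<omega>)) [0..<N]) \<in> \<Omega> \<rightarrow>\<^sub>M count_space UNIV"
  proof (cases "n = 0")
  case True
  then show ?thesis by (simp add: rnd_def)
  next
  case False
  then show ?thesis by (intro distr_list_eq_replicate(1)[OF rnd_y_measurable l]) auto
  qed
qed

definition pairs :: "nat => nat => 'w => nat \<times> nat" where
  "pairs n i \<omega> = (rnd n (y (2 * i) \<omega>), rnd n (y (2 * i + 1) \<omega>))"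

lemma pairs_measurable: "pairs n i \<in> \<Omega> \<rightarrow>\<^sub>M count_space UNIV"
  unfolding pairs_def using measurable_Pair[OF rnd_y_measurable[of n "2 * i"] rnd_y_measurable[of n "2 * i + 1"]]
  by (simp add: pair_measure_countable)

lemma pair_list_law:
  shows "(\<lambda>\<omega>. map (\<lambda>i. pairs n (m + i) \<omega>) [0..<N]) \<in> \<Omega> \<rightarrow>\<^sub>M count_space UNIV"
  and "0 < n ==> distr \<Omega> (count_space UNIV) (\<lambda>\<omega>. map (\<lambda>i. pairs n (m + i) \<omega>) [0..<N]) =
   measure_pmf (replicate_pmf N (pmf_of_set ({..<n} \<times> {..<n})))"
proof -
  have l: "prob {\<omega> \<in> space \<Omega>. \<forall>i<N. pairs n (m + i) \<omega> = l ! i} = (\<Prod>i<N. pmf (pmf_of_set ({..<n} \<times> {..<n})) (l ! i))"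
  if n: "0 < n" for l
  proof -
  define c where "c j = (if even j then fst (l ! (j div 2 - m)) else snd (l ! (j div 2 - m)))" for j
  define q where "q = pmf (pmf_of_set {..<n})"
  have J: "{2 * m..<2 * m + 2 * N} = (\<Union>i\<in>{..<N}. {2 * (m + i), 2 * (m + i) + 1})"
  proof (intro set_eqI iffI)
   fix j assume "j \<in> {2 * m..<2 * m + 2 * N}"
   then have "j div 2 - m < N" "m \<le> j div 2" by auto
   moreover have "j = 2 * (j div 2) \<or> j = 2 * (j div 2) + 1" by presburger
   ultimately show "j \<in> (\<Union>i\<in>{..<N}. {2 * (m + i), 2 * (m + i) + 1})"
    by (intro UN_I[of "j div 2 - m"]) auto
  qed auto
  have "{\<omega> \<in> space \<Omega>. \<forall>i<N. pairs n (m + i) \<omega> = l ! i} = {\<omega> \<in> space \<Omega>. \<forall>j\<in>{2 * m..<2 * m + 2 * N}. rnd n (y j \<omega>) = c j}"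
   unfolding J by (auto simp: pairs_def c_def prod_eq_iff)
  also have "prob \<dots> = (\<Prod>j\<in>{2 * m..<2 * m + 2 * N}. q (c j))"
   unfolding q_def by (rule prob_cells[OF n]) simp
  also have "\<dots> = (\<Prod>i<N. \<Prod>j\<in>{2 * (m + i), 2 * (m + i) + 1}. q (c j))"
   unfolding J
  proof (rule prod.UNION_disjoint, simp, simp, intro ballI impI)
   fix i j :: nat assume "i ~= j"
   moreover have "2 * (m + i) ~= 2 * (m + j) + 1" "2 * (m + i) + 1 ~= 2 * (m + j)" by presburger+
   ultimately show "{2 * (m + i), 2 * (m + i) + 1} \<inter> {2 * (m + j), 2 * (m + j) + 1} = {}" by auto
  qed
  also have "\<dots> = (\<Prod>i<N. q (fst (l ! i)) * q (snd (l ! i)))"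
   by (intro prod.cong) (auto simp: c_def)
  also have "\<dots> = (\<Prod>i<N. pmf (pmf_of_set ({..<n} \<times> {..<n})) (l ! i))"
  proof (intro prod.cong refl)
   fix i
   have "{..<n} ~= {}" using n by auto
   then have "pmf (pmf_of_set ({..<n} \<times> {..<n})) (a, b) = q a * q b" for a b
    by (simp add: q_def card_cartesian_product indicator_def)
   then show "q (fst (l ! i)) * q (snd (l ! i)) = pmf (pmf_of_set ({..<n} \<times> {..<n})) (l ! i)"
    by (cases "l ! i") simp
  qed
  finally show ?thesis .
  qed
  show "0 < n ==> distr \<Omega> (count_space UNIV) (\<lambda>\<omega>. map (\<lambda>i. pairs n (m + i) \<omega>) [0..<N]) =
   measure_pmf (replicate_pmf N (pmf_of_set ({..<n} \<times> {..<n})))"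
  by (rule distr_list_eq_replicate(2)[OF pairs_measurable l])
  show "(\<lambda>\<omega>. map (\<lambda>i. pairs n (m + i) \<omega>) [0..<N]) \<in> \<Omega> \<rightarrow>\<^sub>M count_space UNIV"
  proof (cases "n = 0")
  case True
  then show ?thesis by (simp add: rnd_def pairs_def)
  next
  case False
  then show ?thesis by (intro distr_list_eq_replicate(1)[OF pairs_measurable l]) auto
  qed
qed

lemma prob_same_cell:
  assumes "0 < n" "i ~= j"
  shows "prob {\<omega> \<in> space \<Omega>. rnd n (y i \<omega>) = rnd n (y j \<omega>)} = 1 / real n"
  and "{\<omega> \<in> space \<Omega>. rnd n (y i \<omega>) = rnd n (y j \<omega>)} \<in> events"
proof -
  let ?E = "\<lambda>k. {\<omega> \<in> space \<Omega>. \<forall>l\<in>{i, j}. rnd n (y l \<omega>) = k}"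
  have ev: "?E k \<in> events" for k
  proof -
  have "?E k = {\<omega> \<in> space \<Omega>. rnd n (y i \<omega>) = k} \<inter> {\<omega> \<in> space \<Omega>. rnd n (y j \<omega>) = k}" by auto
  then show ?thesis using cell_event[of n i k] cell_event[of n j k] by (simp only: sets.Int)
  qed
  have eq: "{\<omega> \<in> space \<Omega>. rnd n (y i \<omega>) = rnd n (y j \<omega>)} = (\<Union>k\<in>{..<n}. ?E k)"
  using rnd_y_in[OF _ assms(1)] by auto
  show "{\<omega> \<in> space \<Omega>. rnd n (y i \<omega>) = rnd n (y j \<omega>)} \<in> events" unfolding eq using ev by auto
  have "prob {\<omega> \<in> space \<Omega>. rnd n (y i \<omega>) = rnd n (y j \<omega>)} = prob (\<Union>k\<in>{..<n}. ?E k)" by (simp only: eq)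
  also have " \<dots> = (\<Sum>k<n. prob (?E k))"
  using ev by (intro finite_measure_finite_Union) (auto simp: disjoint_family_on_def)
  also have "\<dots> = (\<Sum>k<n. (1 / real n) * (1 / real n))"
  proof (intro sum.cong refl)
  fix k assume "k \<in> {..<n}"
  then have "pmf (pmf_of_set {..<n}) k = 1 / real n" by (subst pmf_of_set) auto
  then show "prob (?E k) = 1 / real n * (1 / real n)"
   using prob_cells[OF assms(1), of "{i, j}" "\<lambda>_. k"] assms(2) by simp
  qed
  finally show "prob {\<omega> \<in> space \<Omega>. rnd n (y i \<omega>) = rnd n (y j \<omega>)} = 1 / real n" using assms by simp
qed

lemma AE_null_if_le:
  assumes "\<And>n. 0 < n ==> {\<omega> \<in> space \<Omega>. P n \<omega>} \<in> events" "\<And>n::nat. 0 < n ==> prob {\<omega> \<in> space \<Omega>. P n \<omega>} \<le> 1 / real n"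
  and "\<And>\<omega> n. Q \<omega> ==> 0 < n ==> P n \<omega>"
  shows "AE \<omega> in \<Omega>. \<not> Q \<omega>"
proof -
  define B where "B = (\<Inter>n. {\<omega> \<in> space \<Omega>. P (Suc n) \<omega>})"
  have B: "B \<in> events" unfolding B_def using assms(1) by (intro sets.countable_INT) auto
  have le: "prob B \<le> 1 / real n" if "0 < n" for n
  proof -
  have "B \<subseteq> {\<omega> \<in> space \<Omega>. P n \<omega>}" using that by (cases n) (auto simp: B_def)
  then have "prob B \<le> prob {\<omega> \<in> space \<Omega>. P n \<omega>}" using assms(1) that by (intro finite_measure_mono) auto
  then show ?thesis using assms(2)[OF that] by linarith
  qed
  have "prob B = 0"
  proof (rule ccontr)
  assume "prob B ~= 0"
  then have "0 < prob B" by (simp add: zero_less_measure_iff)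
  then obtain n where "1 / real (Suc n) < prob B" by (meson nat_approx_posE)
  then show False using le[of "Suc n"] by simp
  qed
  then have "AE \<omega> in \<Omega>. \<omega> \<notin> B" using B by (simp add: prob_eq_0)
  then show ?thesis using AE_space by eventually_elim (use assms(3) in \<open>auto simp: B_def\<close>)
qed

lemma AE_distinct: "AE \<omega> in \<Omega>. \<forall>i j. i ~= j --> y i \<omega> ~= y j \<omega>"
proof -
  have "AE \<omega> in \<Omega>. \<not> (i ~= j \<and> y i \<omega> = y j \<omega>)" for i j
  proof (cases "i = j")
  case False
  show ?thesis
  proof (rule AE_null_if_le[where P = "\<lambda>n \<omega>. rnd n (y i \<omega>) = rnd n (y j \<omega>)"])
   show "{\<omega> \<in> space \<Omega>. rnd n (y i \<omega>) = rnd n (y j \<omega>)} \<in> events" if "0 < n" for n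
    by (rule prob_same_cell(2)[OF that False])
  qed (use prob_same_cell(1)[OF _ False] in auto)
  qed simp
  then have "AE \<omega> in \<Omega>. \<forall>i. \<forall>j. \<not> (i ~= j \<and> y i \<omega> = y j \<omega>)" by (simp add: AE_all_countable)
  then show ?thesis by eventually_elim blast
qed

lemma AE_nonzero: "AE \<omega> in \<Omega>. \<forall>i. y i \<omega> ~= 0"
proof -
  have "AE \<omega> in \<Omega>. \<not> (y i \<omega> = 0)" for i
  proof (rule AE_null_if_le[where P = "\<lambda>n \<omega>. rnd n (y i \<omega>) = 0"])
  show "{\<omega> \<in> space \<Omega>. rnd n (y i \<omega>) = 0} \<in> events" for n by (rule cell_event)
  show "prob {\<omega> \<in> space \<Omega>. rnd n (y i \<omega>) = 0} \<le> 1 / real n" if "0 < n" for n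
  proof -
   have "{..<n} ~= {}" using that by auto
   then show ?thesis unfolding prob_cell(1)[OF that] by (subst pmf_of_set) (auto simp: indicator_def)
  qed
  qed (simp add: rnd_def)
  then show ?thesis by (simp add: AE_all_countable)
qed

lemma AE_hits: "AE \<omega> in \<Omega>. \<forall>p q m. 0 \<le> p --> p < q --> q \<le> 1 -->
  (\<exists>i\<ge>m. y (2 * i) \<omega> \<in> {p<..<q} \<and> y (2 * i + 1) \<omega> \<in> {p<..<q})"
proof -
  have "AE \<omega> in \<Omega>. \<not> (\<forall>i. pairs n (m + i) \<omega> ~= (k, k))" if nk: "0 < n" "k < n" for n k m
  proof -
  have le: "prob {\<omega> \<in> space \<Omega>. (k, k) \<notin> set (map (\<lambda>i. pairs n (m + i) \<omega>) [0..<N])} = (1 - 1 / (real n * real n)) ^ N" for N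
  proof -
   have "prob {\<omega> \<in> space \<Omega>. (k, k) \<notin> set (map (\<lambda>i. pairs n (m + i) \<omega>) [0..<N])} =
     measure (distr \<Omega> (count_space UNIV) (\<lambda>\<omega>. map (\<lambda>i. pairs n (m + i) \<omega>) [0..<N])) {l. (k, k) \<notin> set l}"
    using pair_list_law(1)[of n m N] by (subst measure_distr) (auto intro!: arg_cong[where f = prob])
   also have "\<dots> = (1 - pmf (pmf_of_set ({..<n} \<times> {..<n})) (k, k)) ^ N"
    unfolding pair_list_law(2)[OF nk(1)] by (rule prob_replicate_avoid)
   also have "pmf (pmf_of_set ({..<n} \<times> {..<n})) (k, k) = 1 / (real n * real n)"
    using nk by (subst pmf_of_set) (auto simp: card_cartesian_product)
   finally show ?thesis .
  qed
  have evt: "{\<omega> \<in> space \<Omega>. (k, k) \<notin> set (map (\<lambda>i. pairs n (m + i) \<omega>) [0..<N])} \<in> events" for N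
   using measurable_sets[OF pair_list_law(1)[of n m N], of "{l. (k, k) \<notin> set l}"] by (simp add: vimage_def Int_def conj_commute)
  have r: "\<bar>1 - 1 / (real n * real n)\<bar> < 1" 
  proof -
   have "1 \<le> real n * real n" using nk mult_mono[of 1 "real n" 1 "real n"] by simp
   then have "0 < 1 / (real n * real n)" "1 / (real n * real n) \<le> 1" by simp_all
   then show ?thesis by linarith
  qed
  have "\<exists>N. (1 - 1 / (real n * real n)) ^ N < 1 / real l" if "0 < l" for l
   using real_arch_pow_inv[of "1 / real l" "\<bar>1 - 1 / (real n * real n)\<bar>"] r that
   by (metis abs_ge_self le_less_trans of_nat_0_less_iff power_abs zero_less_divide_1_iff)
  then obtain N where N: "\<And>l. 0 < l ==> (1 - 1 / (real n * real n)) ^ N l < 1 / real l" by metis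
  show ?thesis
   by (rule AE_null_if_le[where P = "\<lambda>l \<omega>. (k, k) \<notin> set (map (\<lambda>i. pairs n (m + i) \<omega>) [0..<N l])"])
     (use le evt N in \<open>auto simp: less_imp_le\<close>)
  qed
  then have "AE \<omega> in \<Omega>. \<forall>n k m. 0 < n --> k < n --> (\<exists>i. pairs n (m + i) \<omega> = (k, k))"
  by (simp add: AE_all_countable)
  then show ?thesis using AE_space
  proof eventually_elim
  case (elim \<omega>)
  show ?case
  proof (intro allI impI)
   fix p q :: real and m :: nat assume pq: "0 \<le> p" "p < q" "q \<le> 1"
   obtain n :: nat where n: "3 / (q - p) < real n" using reals_Archimedean2 by blast
   have "0 < 3 / (q - p)" using pq by simp
   then have n0: "0 < n" using n by (cases n) auto
   have gap: "3 < real n * (q - p)" using n pq by (simp add: field_simps)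
   define k where "k = nat (\<lfloor>real n * p\<rfloor> + 1)"
   have "0 \<le> \<lfloor>real n * p\<rfloor>" using pq by simp
   then have k: "real n * p < real k" "real k \<le> real n * p + 1"
    unfolding k_def by (simp_all add: of_nat_nat)
   have "real n * q \<le> real n" using pq mult_left_mono[of q 1 "real n"] by simp
   then have kn: "real k + 1 < real n * q" "k < n" using k gap by (auto simp: right_diff_distrib)
   obtain i where i: "pairs n (m + i) \<omega> = (k, k)" using elim(1) n0 kn(2) by blast
   have in_pq: "t \<in> {p<..<q}" if "rnd n t = k" "0 \<le> t" for t
   proof -
    have "real k / real n \<le> t" "t < (real k + 1) / real n"
     using rnd_bounds[OF that(2) n0] that(1) by (auto simp: add_divide_distrib)
    moreover have "p < real k / real n" "(real k + 1) / real n < q" using k kn n0 by (auto simp: field_simps)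
    ultimately show ?thesis by auto
   qed
   show "\<exists>i\<ge>m. y (2 * i) \<omega> \<in> {p<..<q} \<and> y (2 * i + 1) \<omega> \<in> {p<..<q}"
    using i y_range[OF elim(2)] by (intro exI[of _ "m + i"]) (auto simp: pairs_def intro!: in_pq simp del: greaterThanLessThan_iff)
  qed
  qed
qed

lemma AE_pair_not_deep: "AE \<omega> in \<Omega>. \<forall>r1\<in>\<rat>. \<forall>r2\<in>\<rat>. \<forall>r3\<in>\<rat>. 0 < r1 --> r1 < r2 --> r2 < r3 --> r3 < 1 -->
  (\<exists>k. \<not> (eventually (\<lambda>N. eventually (\<lambda>n. deep_region (rnd n r1) (rnd n r2) (rnd n r3) k
   (snd (run pair_move (map (\<lambda>i. pairs n i \<omega>) [0..<N]) (start {..<n})))) sequentially) sequentially))"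
proof -
  have "AE \<omega> in \<Omega>. 0 < r1 --> r1 < r2 --> r2 < r3 --> r3 < 1 -->
  (\<exists>k. \<not> (eventually (\<lambda>N. eventually (\<lambda>n. deep_region (rnd n r1) (rnd n r2) (rnd n r3) k
   (snd (run pair_move (map (\<lambda>i. pairs n i \<omega>) [0..<N]) (start {..<n})))) sequentially) sequentially))" for r1 r2 r3
  proof (cases "0 < r1 \<and> r1 < r2 \<and> r2 < r3 \<and> r3 < 1")
  case True
  have "AE \<omega> in \<Omega>. \<exists>k. \<not> (eventually (\<lambda>N. eventually (\<lambda>n. deep_region (rnd n r1) (rnd n r2) (rnd n r3) k
   (snd (run pair_move (map (\<lambda>i. pairs n i \<omega>) [0..<N]) (start {..<n})))) sequentially) sequentially)"
  proof (rule AE_not_always_deep[where p = "\<lambda>n. pmf_of_set ({..<n} \<times> {..<n})"])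
   show "distr \<Omega> (count_space UNIV) (\<lambda>\<omega>. map (\<lambda>i. pairs n i \<omega>) [0..<N]) =
     measure_pmf (replicate_pmf N (pmf_of_set ({..<n} \<times> {..<n})))" if "0 < n" for n N
    using pair_list_law(2)[OF that, of 0 N] by simp
   show "(\<lambda>\<omega>. map (\<lambda>i. pairs n i \<omega>) [0..<N]) \<in> \<Omega> \<rightarrow>\<^sub>M count_space UNIV" for n N
    using pair_list_law(1)[of n 0 N] by simp
   show "replicate_pmf N (pmf_of_set ({..<n} \<times> {..<n})) \<bind> (\<lambda>ds. completion (run pair_move ds (start {..<n}))) =
     region_law ({..<n}, None, 0)" if "0 < n" for n N :: nat
    using that by (intro completion_pair_run) (auto simp: lessThan_empty_iff)
   show "proper_move r (pair_move x r)" if "pend_ok r" for x :: "nat \<times> nat" and r by (rule pair_move_proper[OF that])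
  qed (use True in auto)
  then show ?thesis by simp
  qed auto
  then show ?thesis by (intro AE_ball_countable'[OF _ countable_rat]) auto
qed

lemma AE_point_not_deep: "AE \<omega> in \<Omega>. \<forall>r1\<in>\<rat>. \<forall>r2\<in>\<rat>. \<forall>r3\<in>\<rat>. 0 < r1 --> r1 < r2 --> r2 < r3 --> r3 < 1 -->
  (\<exists>k. \<not> (eventually (\<lambda>N. eventually (\<lambda>n. deep_region (rnd n r1) (rnd n r2) (rnd n r3) k
   (snd (run point_move (map (\<lambda>i. rnd n (y i \<omega>)) [0..<N]) (start {..<n})))) sequentially) sequentially))"
proof -
  have "AE \<omega> in \<Omega>. 0 < r1 --> r1 < r2 --> r2 < r3 --> r3 < 1 -->
  (\<exists>k. \<not> (eventually (\<lambda>N. eventually (\<lambda>n. deep_region (rnd n r1) (rnd n r2) (rnd n r3) k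
   (snd (run point_move (map (\<lambda>i. rnd n (y i \<omega>)) [0..<N]) (start {..<n})))) sequentially) sequentially))" for r1 r2 r3
  proof (cases "0 < r1 \<and> r1 < r2 \<and> r2 < r3 \<and> r3 < 1")
  case True
  have "AE \<omega> in \<Omega>. \<exists>k. \<not> (eventually (\<lambda>N. eventually (\<lambda>n. deep_region (rnd n r1) (rnd n r2) (rnd n r3) k
   (snd (run point_move (map (\<lambda>i. rnd n (y i \<omega>)) [0..<N]) (start {..<n})))) sequentially) sequentially)"
  proof (rule AE_not_always_deep[where p = "\<lambda>n. pmf_of_set {..<n}"])
   show "distr \<Omega> (count_space UNIV) (\<lambda>\<omega>. map (\<lambda>i. rnd n (y i \<omega>)) [0..<N]) =
     measure_pmf (replicate_pmf N (pmf_of_set {..<n}))" if "0 < n" for n N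
    using point_list_law(2)[OF that] .
   show "(\<lambda>\<omega>. map (\<lambda>i. rnd n (y i \<omega>)) [0..<N]) \<in> \<Omega> \<rightarrow>\<^sub>M count_space UNIV" for n N
    by (rule point_list_law(1))
   show "replicate_pmf N (pmf_of_set {..<n}) \<bind> (\<lambda>ds. completion (run point_move ds (start {..<n}))) =
     region_law ({..<n}, None, 0)" if "0 < n" for n N :: nat
    using that by (intro completion_point_run) (auto simp: lessThan_empty_iff)
   show "proper_move r (point_move x r)" if "pend_ok r" for x :: nat and r by (rule point_move_proper[OF that])
  qed (use True in auto)
  then show ?thesis by simp
  qed auto
  then show ?thesis by (intro AE_ball_countable'[OF _ countable_rat]) auto
qed

end


section \<open>Diagonals of the polygon\<close>

subsection \<open>Non-crossing sets of diagonals extend to triangulations\<close>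

text \<open>Each diagonal once, with its ends in increasing order; the pair \<open>(0, n - 1)\<close> is an edge.\<close>

definition diag_ends :: "nat => (nat \<times> nat) set" where
  "diag_ends n = {(i, j). i + 2 \<le> j \<and> j < n \<and> \<not> (i = 0 \<and> j = n - 1)}"

lemma finite_diag_ends [simp]: "finite (diag_ends n)"
  by (rule finite_subset[of _ "{..<n} \<times> {..<n}"]) (auto simp: diag_ends_def)

lemma separates_iff_less:
  fixes a b i j :: "'a::linorder"
  assumes "a < b" "i < j"
  shows "separates a b i j \<longleftrightarrow> (a < i \<and> i < b \<and> b < j) \<or> (i < a \<and> a < j \<and> j < b)"
  using assms by (auto simp: side_defs min_def max_def)

text \<open>If nothing can be added, then below every chord \<open>(i, j)\<close> lies a triangle: the largest \<open>m < j\<close> joined to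
  \<open>i\<close> is also joined to \<open>j\<close>, since a chord separating \<open>m\<close> from \<open>j\<close> could only start at \<open>i\<close> and contradict the
  choice of \<open>m\<close>. By induction \<open>j - i - 1\<close> chords lie between \<open>i\<close> and \<open>j\<close>.\<close>

lemma noncrossing_diagonals_extend:
  assumes S: "S \<subseteq> diag_ends n" "card S < n - 3"
  and nc: "\<And>i j k l. (i, j) \<in> S ==> (k, l) \<in> S ==> \<not> separates i j k l"
  shows "\<exists>(i, j)\<in>diag_ends n - S. \<forall>(k, l)\<in>S. \<not> separates i j k l"
proof (rule ccontr)
  assume "\<not> (\<exists>(i, j)\<in>diag_ends n - S. \<forall>(k, l)\<in>S. \<not> separates i j k l)"
  then have maximal: "\<exists>k l. (k, l) \<in> S \<and> separates i j k l" if "(i, j) \<in> diag_ends n" "(i, j) \<notin> S" for i j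
  using that by blast
  define S' where "S' = insert (0, n - 1) S"
  define ok where "ok i j \<longleftrightarrow> j = i + 1 \<or> (i, j) \<in> S'" for i j
  define W where "W i j = {(a, b) \<in> S'. i \<le> a \<and> b \<le> j}" for i j
  have n: "3 < n" using S(2) by simp
  have finS': "finite S'" unfolding S'_def using S(1) finite_subset finite_diag_ends by blast
  have finW: "finite (W i j)" for i j
  by (rule finite_subset[OF _ finS']) (auto simp: W_def)
  have inS': "a + 2 \<le> b \<and> b \<le> n - 1" if "(a, b) \<in> S'" for a b
  using that S(1) n by (auto simp: S'_def diag_ends_def)
  have nc': "\<not> (a < i \<and> i < b \<and> b < j)" if "(a, b) \<in> S'" "(i, j) \<in> S'" for a b i j
  proof
  assume *: "a < i \<and> i < b \<and> b < j"
  have r: "b \<le> n - 1" "j \<le> n - 1" using inS' that by auto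
  then have "(a, b) \<in> S" "(i, j) \<in> S" using that * by (auto simp: S'_def)
  from nc[OF this] show False using * by (simp add: separates_iff_less)
  qed
  have count: "j - i - 1 \<le> card (W i j)" if "i < j" "j < n" "ok i j" for i j
  using that
  proof (induction "j - i" arbitrary: i j rule: less_induct)
  case less
  show ?case
  proof (cases "j = i + 1")
   case False
   then have ij: "(i, j) \<in> S'" "i + 2 \<le> j" using less.prems by (auto simp: ok_def)
   define B where "B = {m. i < m \<and> m < j \<and> ok i m}"
   have B: "finite B" "i + 1 \<in> B" using ij by (auto simp: B_def ok_def)
   define m where "m = Max B"
   have m: "m \<in> B" "\<And>k. k \<in> B ==> k \<le> m"
    unfolding m_def using B Max_in[OF B(1)] Max_ge[OF B(1)] by blast+
   have im: "i < m" "m < j" "ok i m" using m(1) by (auto simp: B_def)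
   have mj: "ok m j"
   proof (rule ccontr)
    assume no: "\<not> ok m j"
    then have "(m, j) \<in> diag_ends n" "(m, j) \<notin> S"
     using im less.prems by (auto simp: ok_def diag_ends_def S'_def)
    then obtain a b where ab: "(a, b) \<in> S" "separates m j a b" using maximal by blast
    have ab': "(a, b) \<in> S'" "a < b" using ab(1) inS'[of a b] by (auto simp: S'_def)
    have "(m < a \<and> a < j \<and> j < b) \<or> (a < m \<and> m < b \<and> b < j)"
     using ab(2) ab'(2) im(2) by (simp add: separates_iff_less)
    then have b: "a < m" "m < b" "b < j" using nc'[OF ij(1) ab'(1)] im by auto
    have "i \<le> a" using nc'[OF ab'(1) ij(1)] b im by auto
    moreover have "a ~= i"
    proof
     assume "a = i"
     then have "b \<in> B" using b ab' im by (auto simp: B_def ok_def)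
     then show False using m(2) b by force
    qed
    ultimately have "i < a" by simp
    then have "(i, m) \<in> S'" using im b by (auto simp: ok_def)
    then show False using nc'[OF _ ab'(1), of i m] \<open>i < a\<close> b by auto
   qed
   have "m - i - 1 \<le> card (W i m)" by (rule less.hyps) (use im less.prems in auto)
   moreover have "j - m - 1 \<le> card (W m j)" by (rule less.hyps) (use im mj less.prems in auto)
   moreover have "card (insert (i, j) (W i m \<union> W m j)) \<le> card (W i j)"
    using im ij by (intro card_mono finW) (auto simp: W_def)
   moreover have "card (insert (i, j) (W i m \<union> W m j)) = Suc (card (W i m) + card (W m j))"
   proof -
    have "W i m \<inter> W m j = {}" by (auto simp: W_def dest!: inS')
    moreover have "(i, j) \<notin> W i m \<union> W m j" using im by (auto simp: W_def)
    ultimately show ?thesis by (simp add: card_Un_disjoint finW)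
   qed
   ultimately show ?thesis using im by linarith
  qed simp
  qed
  have "n - 2 \<le> card (W 0 (n - 1))" using count[of 0 "n - 1"] n by (simp add: ok_def S'_def)
  also have "\<dots> \<le> card S'" using finS' by (intro card_mono) (auto simp: W_def)
  also have "\<dots> \<le> Suc (card S)" unfolding S'_def using finS' by (metis card_insert_le_m1 S'_def card.infinite card_insert_if finite_insert le_SucI order_refl)
  finally show False using S(2) by simp
qed

subsection \<open>Chords between vertices\<close>

definition vertex_chord :: "nat => nat \<times> nat => complex set" where
  "vertex_chord n c = chord (real (fst c) / real n) (real (snd c) / real n)"

lemma vertex_angle: "i < n ==> real i / real n \<in> {0..<1}"
  by (simp add: divide_less_eq)

lemma vertex_inj: "i < n ==> j < n ==> circ (real i / real n) = circ (real j / real n) \<longleftrightarrow> i = j"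
  using inj_onD[OF circ_inj_on, of "real i / real n" "real j / real n"] vertex_angle[of i n] vertex_angle[of j n] by auto

lemma vertex_chord_commute: "vertex_chord n (i, j) = vertex_chord n (j, i)"
  unfolding vertex_chord_def fst_conv snd_conv by (rule chord_commute)

lemma vertex_chord_eq:
  assumes "i < n" "j < n" "k < n" "l < n"
  shows "vertex_chord n (i, j) = vertex_chord n (k, l) \<longleftrightarrow> {i, j} = {k, l}"
  unfolding vertex_chord_def fst_conv snd_conv closed_segment_eq
  using vertex_inj assms by (auto simp: doubleton_eq_iff)

lemma root_vertex_circ: "root_vertex n k = circ (real k / real n)"
  by (simp add: root_vertex_def circ_def cis_conv_exp mult_ac)

lemma root_vertex_mod:
  assumes "0 < n"
  shows "root_vertex n k = root_vertex n (k mod n)"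
proof -
  have "circ (t + real m) = circ t" for t m
  proof (induction m)
  case (Suc m)
  then show ?case using circ_periodic[of "t + real m"] by (simp add: algebra_simps)
  qed simp
  moreover have "real k / real n = real (k mod n) / real n + real (k div n)"
  using assms by (simp add: field_simps) (metis div_mult_mod_eq mult.commute add.commute of_nat_add of_nat_mult)
  ultimately show ?thesis by (simp add: root_vertex_circ)
qed

lemma root_vertex_image:
  assumes "0 < n"
  shows "root_vertex n ` {1..n} = root_vertex n ` {..<n}"
proof
  show "root_vertex n ` {1..n} \<subseteq> root_vertex n ` {..<n}"
  proof
  fix z assume "z \<in> root_vertex n ` {1..n}"
  then obtain k where "z = root_vertex n k" by blast
  then have "z = root_vertex n (k mod n)" using root_vertex_mod[OF assms] by simp
  then show "z \<in> root_vertex n ` {..<n}" using assms by (intro image_eqI[of _ _ "k mod n"]) auto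
  qed
  show "root_vertex n ` {..<n} \<subseteq> root_vertex n ` {1..n}"
  proof
  fix z assume "z \<in> root_vertex n ` {..<n}"
  then obtain k where k: "k < n" "z = root_vertex n k" by auto
  show "z \<in> root_vertex n ` {1..n}"
  proof (cases "k = 0")
   case True
   then have "z = root_vertex n n" using root_vertex_mod[OF assms, of n] k by simp
   then show ?thesis using assms by auto
  next
   case False
   then show ?thesis using k by auto
  qed
  qed
qed

lemma polygon_edges_eq:
  assumes "3 \<le> n"
  shows "polygon_edges n = vertex_chord n ` ({(i, i + 1) |i. i + 1 < n} \<union> {(0, n - 1)})"
proof -
  have edge: "closed_segment (root_vertex n k) (root_vertex n (k + 1)) =
   (if k + 1 < n then vertex_chord n (k, k + 1) else if k + 1 = n then vertex_chord n (0, n - 1) else vertex_chord n (0, 1))"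
  if "k \<in> {1..n}" for k
  proof -
  have "k \<le> n" using that by simp
  then consider "k + 1 < n" | "k + 1 = n" | "k = n" by linarith
  then show ?thesis
  proof cases
   case 2
   then have "closed_segment (root_vertex n k) (root_vertex n (k + 1)) = vertex_chord n (n - 1, 0)"
    using root_vertex_mod[of n n] assms by (auto simp: vertex_chord_def root_vertex_circ)
   then show ?thesis using 2 vertex_chord_commute by auto
  next
   case 3
   then have "root_vertex n k = root_vertex n 0" "root_vertex n (k + 1) = root_vertex n 1"
    using root_vertex_mod[of n n] root_vertex_mod[of n "n + 1", unfolded mod_add_self1] assms by simp_all
   then show ?thesis using 3 by (simp add: vertex_chord_def root_vertex_circ)
  qed (simp add: vertex_chord_def root_vertex_circ)
  qed
  show ?thesis
  proof
  show "polygon_edges n \<subseteq> vertex_chord n ` ({(i, i + 1) |i. i + 1 < n} \<union> {(0, n - 1)})"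
  proof
   fix e assume "e \<in> polygon_edges n"
   then obtain k where "k \<in> {1..n}" "e = closed_segment (root_vertex n k) (root_vertex n (k + 1))"
    unfolding polygon_edges_def by blast
   then show "e \<in> vertex_chord n ` ({(i, i + 1) |i. i + 1 < n} \<union> {(0, n - 1)})"
    using edge[of k] assms by (auto split: if_splits intro!: image_eqI[of _ _ "(0, 1)"])
  qed
  show "vertex_chord n ` ({(i, i + 1) |i. i + 1 < n} \<union> {(0, n - 1)}) \<subseteq> polygon_edges n"
  proof
   fix e assume "e \<in> vertex_chord n ` ({(i, i + 1) |i. i + 1 < n} \<union> {(0, n - 1)})"
   then consider i where "i + 1 < n" "i ~= 0" "e = vertex_chord n (i, i + 1)" | "e = vertex_chord n (0, 1)"
    | "e = vertex_chord n (0, n - 1)" by fastforce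
   then have "\<exists>k\<in>{1..n}. e = closed_segment (root_vertex n k) (root_vertex n (k + 1))"
   proof cases
    case 1
    then show ?thesis using edge[of i] by (intro bexI[of _ i]) auto
   next
    case 2
    then show ?thesis using edge[of n] assms by (intro bexI[of _ n]) auto
   next
    case 3
    then show ?thesis using edge[of "n - 1"] assms by (intro bexI[of _ "n - 1"]) auto
   qed
   then show "e \<in> polygon_edges n" unfolding polygon_edges_def by blast
  qed
  qed
qed

lemma diagonals_eq:
  assumes "3 \<le> n"
  shows "diagonals n = vertex_chord n ` diag_ends n"
proof -
  define A where "A = {(i, j). i < j \<and> j < n}"
  define E where "E = {(i, i + 1) |i. i + 1 < n} \<union> {(0, n - 1)}"
  have chords: "{closed_segment x y |x y. x \<in> root_vertex n ` {1..n} \<and> y \<in> root_vertex n ` {1..n} \<and> x ~= y} =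
   vertex_chord n ` A"
  proof
  show "vertex_chord n ` A \<subseteq> {closed_segment x y |x y. x \<in> root_vertex n ` {1..n} \<and> y \<in> root_vertex n ` {1..n} \<and> x ~= y}"
  proof
   fix e assume "e \<in> vertex_chord n ` A"
   then obtain i j where ij: "i < j" "j < n" "e = vertex_chord n (i, j)" by (auto simp: A_def)
   have "root_vertex n i ~= root_vertex n j" using ij vertex_inj[of i n j] by (simp add: root_vertex_circ)
   moreover have "root_vertex n i \<in> root_vertex n ` {1..n}" "root_vertex n j \<in> root_vertex n ` {1..n}"
    using root_vertex_image[of n] ij by auto
   moreover have "e = closed_segment (root_vertex n i) (root_vertex n j)"
    using ij by (simp add: vertex_chord_def root_vertex_circ)
   ultimately show "e \<in> {closed_segment x y |x y. x \<in> root_vertex n ` {1..n} \<and> y \<in> root_vertex n ` {1..n} \<and> x ~= y}"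
    by blast
  qed
  show "{closed_segment x y |x y. x \<in> root_vertex n ` {1..n} \<and> y \<in> root_vertex n ` {1..n} \<and> x ~= y} \<subseteq> vertex_chord n ` A"
  proof
   fix e assume "e \<in> {closed_segment x y |x y. x \<in> root_vertex n ` {1..n} \<and> y \<in> root_vertex n ` {1..n} \<and> x ~= y}"
   then obtain x y where xy: "x \<in> root_vertex n ` {1..n}" "y \<in> root_vertex n ` {1..n}" "x ~= y" "e = closed_segment x y" by blast
   have im: "root_vertex n ` {1..n} = root_vertex n ` {..<n}" using assms by (intro root_vertex_image) simp
   obtain i j where ij: "i < n" "j < n" "x = root_vertex n i" "y = root_vertex n j" using xy unfolding im by blast
   have e: "e = vertex_chord n (i, j)" using xy ij by (simp add: vertex_chord_def root_vertex_circ)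
   consider "i < j" | "j < i" using ij xy by fastforce
   then show "e \<in> vertex_chord n ` A"
   proof cases
    case 1
    then show ?thesis using e ij by (intro image_eqI[of _ _ "(i, j)"]) (auto simp: A_def)
   next
    case 2
    then show ?thesis using e ij vertex_chord_commute[of n i j] by (intro image_eqI[of _ _ "(j, i)"]) (auto simp: A_def)
   qed
  qed
  qed
  have edges: "polygon_edges n = vertex_chord n ` E" unfolding E_def by (rule polygon_edges_eq[OF assms])
  have sub: "E \<subseteq> A" using assms by (auto simp: A_def E_def)
  have inj: "inj_on (vertex_chord n) A"
  by (rule inj_onI) (auto simp: A_def vertex_chord_eq doubleton_eq_iff)
  have diff: "A - E = diag_ends n" by (auto simp: A_def E_def diag_ends_def)
  show ?thesis
  unfolding diagonals_def chords edges diff[symmetric] by (rule inj_on_image_set_diff[OF inj Diff_subset sub, symmetric])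
qed

lemma finite_diagonals: "3 \<le> n ==> finite (diagonals n)"
  by (simp add: diagonals_eq)

lemma open_chords_with_common_end_disjoint:
  assumes "p \<in> {0..<1}" "a \<in> {0..<1}" "b \<in> {0..<1}" "a ~= b" "p ~= a" "p ~= b"
  shows "open_segment (circ p) (circ a) \<inter> open_segment (circ p) (circ b) = {}"
proof (rule ccontr)
  assume "open_segment (circ p) (circ a) \<inter> open_segment (circ p) (circ b) ~= {}"
  then obtain z where z: "z \<in> open_segment (circ p) (circ a)" "z \<in> open_segment (circ p) (circ b)" by blast
  have "z \<in> chord p a" using z(1) open_closed_segment by blast
  then have 0: "chordfun p a z = 0" by (rule chordfun_chord)
  obtain t where t: "0 < t" "z = (1 - t) *\<^sub>R circ p + t *\<^sub>R circ b" using z(2) by (auto simp: in_segment)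
  have "chordfun p a z = t * chordfun p a (circ b)" unfolding t(2) chordfun_affine by simp
  moreover have "chordfun p a (circ b) ~= 0"
  using arc_in_or_out[of b p a] chordfun_pos[of p a b] chordfun_neg[of p a b] assms by force
  ultimately show False using 0 t(1) by simp
qed

lemma chords_cross_iff:
  assumes "i < n" "j < n" "k < n" "l < n" "i ~= j" "k ~= l"
  shows "chords_cross (vertex_chord n (i, j)) (vertex_chord n (k, l)) \<longleftrightarrow> separates i j k l \<or> {i, j} = {k, l}"
proof -
  define \<theta> where "\<theta> m = real m / real n" for m
  have \<theta>: "\<theta> m \<in> {0..<1}" if "m < n" for m using vertex_angle[OF that] by (simp add: \<theta>_def)
  have \<theta>_less: "\<theta> a < \<theta> b \<longleftrightarrow> a < b" for a b using assms by (auto simp: \<theta>_def divide_less_cancel)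
  have \<theta>_eq: "\<theta> a = \<theta> b \<longleftrightarrow> a = b" for a b using assms by (auto simp: \<theta>_def)
  have sep: "separates (\<theta> i) (\<theta> j) (\<theta> k) (\<theta> l) \<longleftrightarrow> separates i j k l"
  by (simp add: side_defs min_def max_def \<theta>_less not_less[symmetric])
  have "chords_cross (vertex_chord n (i, j)) (vertex_chord n (k, l)) \<longleftrightarrow>
   open_segment (circ (\<theta> i)) (circ (\<theta> j)) \<inter> open_segment (circ (\<theta> k)) (circ (\<theta> l)) ~= {}"
  proof -
  have open_eq: "open_segment x y = open_segment a b" if "closed_segment a b = closed_segment x y" for x y a b :: complex
  proof -
   have "{a, b} = {x, y}" using that by (simp only: closed_segment_eq)
   then show ?thesis using that by (simp only: open_segment_def)
  qed
  have vc: "vertex_chord n (a, b) = closed_segment (circ (\<theta> a)) (circ (\<theta> b))" for a b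
   by (simp only: vertex_chord_def \<theta>_def fst_conv snd_conv)
  show ?thesis
   unfolding chords_cross_def vc
  proof (intro iffI)
   assume "\<exists>x y x' y'. chord (\<theta> i) (\<theta> j) = closed_segment x y \<and> chord (\<theta> k) (\<theta> l) = closed_segment x' y' \<and>
    open_segment x y \<inter> open_segment x' y' ~= {}"
   then obtain x y x' y' where *: "chord (\<theta> i) (\<theta> j) = closed_segment x y" "chord (\<theta> k) (\<theta> l) = closed_segment x' y'"
    "open_segment x y \<inter> open_segment x' y' ~= {}" by (elim exE conjE)
   show "open_segment (circ (\<theta> i)) (circ (\<theta> j)) \<inter> open_segment (circ (\<theta> k)) (circ (\<theta> l)) ~= {}"
    using *(3) unfolding open_eq[OF *(1)] open_eq[OF *(2)] .
  qed (intro exI conjI, rule refl, rule refl)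
  qed
  also have "\<dots> \<longleftrightarrow> separates i j k l \<or> {i, j} = {k, l}"
  proof
  assume "separates i j k l \<or> {i, j} = {k, l}"
  then show "open_segment (circ (\<theta> i)) (circ (\<theta> j)) \<inter> open_segment (circ (\<theta> k)) (circ (\<theta> l)) ~= {}"
  proof
   assume "separates i j k l"
   then show ?thesis using sep \<theta> assms by (intro separates_imp_open_segments_meet) auto
  next
   assume "{i, j} = {k, l}"
   then have "open_segment (circ (\<theta> k)) (circ (\<theta> l)) = open_segment (circ (\<theta> i)) (circ (\<theta> j))"
    by (auto simp: doubleton_eq_iff open_segment_commute)
   moreover have "circ (\<theta> i) ~= circ (\<theta> j)" using vertex_inj[of i n j] assms by (simp add: \<theta>_def)
   ultimately show ?thesis by (simp only: Int_absorb open_segment_eq_empty not_False_eq_True)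
  qed
  next
  assume meet: "open_segment (circ (\<theta> i)) (circ (\<theta> j)) \<inter> open_segment (circ (\<theta> k)) (circ (\<theta> l)) ~= {}"
  show "separates i j k l \<or> {i, j} = {k, l}"
  proof (rule ccontr)
   assume no: "\<not> (separates i j k l \<or> {i, j} = {k, l})"
   have share: "open_segment (circ (\<theta> p)) (circ (\<theta> a)) \<inter> open_segment (circ (\<theta> p)) (circ (\<theta> b)) = {}"
    if "p < n" "a < n" "b < n" "a ~= b" "p ~= a" "p ~= b" for p a b
    using that by (intro open_chords_with_common_end_disjoint \<theta>) (auto simp: \<theta>_eq)
   consider "i = k" | "i = l" | "j = k" | "j = l" | "k ~= i" "k ~= j" "l ~= i" "l ~= j" by blast
   then show False
   proof cases
    case 1
    then show ?thesis using meet no share[of i j l] assms by auto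
   next
    case 2
    then show ?thesis using meet no share[of i j k] assms open_segment_commute[of "circ (\<theta> k)"] by auto
   next
    case 3
    then show ?thesis using meet no share[of j i l] assms open_segment_commute[of "circ (\<theta> i)"] by auto
   next
    case 4
    then show ?thesis using meet no share[of j i k] assms open_segment_commute[of "circ (\<theta> i)"] open_segment_commute[of "circ (\<theta> k)"] by auto
   next
    case 5
    have "chord (\<theta> i) (\<theta> j) \<inter> chord (\<theta> k) (\<theta> l) = {}"
     using 5 no sep assms by (intro chords_disjoint \<theta>) (auto simp: \<theta>_eq)
    then show ?thesis using meet open_closed_segment by blast
   qed
  qed
  qed
  finally show ?thesis .
qed

section \<open>The recursive triangulation as a rejection scheme\<close>

definition allowed :: "nat => complex set list => complex set set" where
  "allowed n cs = {d \<in> diagonals n. \<forall>c\<in>set cs. \<not> chords_cross d c}"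

fun extend_uniformly :: "nat => nat => complex set list => complex set list pmf" where
  "extend_uniformly n 0 cs = return_pmf cs"
| "extend_uniformly n (Suc k) cs = pmf_of_set (allowed n cs) \<bind> (\<lambda>c. extend_uniformly n k (cs @ [c]))"

definition try_chord :: "nat => complex set => complex set list => complex set list" where
  "try_chord n c cs = (if c \<in> allowed n cs then cs @ [c] else cs)"

definition noncrossing_diagonals :: "nat => complex set list => bool" where
  "noncrossing_diagonals n cs \<longleftrightarrow> set cs \<subseteq> diagonals n \<and> sorted_wrt (\<lambda>c d. \<not> chords_cross d c) cs"

lemma extend_uniformly_Suc:
  "extend_uniformly n (Suc k) cs =
   extend_uniformly n k cs \<bind> (\<lambda>cs'. pmf_of_set (allowed n cs') \<bind> (\<lambda>c. return_pmf (cs' @ [c])))"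
proof (induction k arbitrary: cs)
  case 0
  then show ?case by (simp add: bind_return_pmf)
next
  case (Suc k)
  have "extend_uniformly n (Suc (Suc k)) cs = pmf_of_set (allowed n cs) \<bind> (\<lambda>c. extend_uniformly n (Suc k) (cs @ [c]))"
  by (rule extend_uniformly.simps)
  also have "\<dots> = pmf_of_set (allowed n cs) \<bind> (\<lambda>c. extend_uniformly n k (cs @ [c]) \<bind>
   (\<lambda>cs'. pmf_of_set (allowed n cs') \<bind> (\<lambda>c. return_pmf (cs' @ [c]))))"
  by (simp only: Suc)
  also have "\<dots> = extend_uniformly n (Suc k) cs \<bind> (\<lambda>cs'. pmf_of_set (allowed n cs') \<bind> (\<lambda>c. return_pmf (cs' @ [c])))"
  by (simp add: bind_assoc_pmf)
  finally show ?case .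
qed

lemma random_diagonals_eq: "random_diagonals n k = extend_uniformly n k []"
proof (induction k)
  case (Suc k)
  show ?case unfolding random_diagonals.simps(2) extend_uniformly_Suc Suc allowed_def ..
qed simp

lemma noncrossing_diagonals_snoc:
  "noncrossing_diagonals n cs ==> c \<in> allowed n cs ==> noncrossing_diagonals n (cs @ [c])"
  by (auto simp: noncrossing_diagonals_def sorted_wrt_append allowed_def)

lemma finite_allowed: "3 \<le> n ==> finite (allowed n cs)"
  using finite_diagonals by (simp add: allowed_def)

lemma noncrossing_not_separates:
  assumes "noncrossing_diagonals n cs" "i < n" "j < n" "k < n" "l < n" "i ~= j" "k ~= l"
  and "vertex_chord n (i, j) \<in> set cs" "vertex_chord n (k, l) \<in> set cs"
  shows "\<not> separates i j k l"
proof
  assume sep: "separates i j k l"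
  obtain a b where ab: "a < length cs" "cs ! a = vertex_chord n (i, j)" "b < length cs" "cs ! b = vertex_chord n (k, l)"
  using assms(8,9) by (auto simp: in_set_conv_nth)
  have nc: "\<not> chords_cross (cs ! y) (cs ! x)" if "x < y" "y < length cs" for x y
  using assms(1) that by (auto simp: noncrossing_diagonals_def sorted_wrt_iff_nth_less)
  have "{i, j} ~= {k, l}" using sep by (auto simp: doubleton_eq_iff separates_def)
  then have "a ~= b" using ab vertex_chord_eq[of i n j k l] assms by metis
  then consider "a < b" | "b < a" by linarith
  then show False
  proof cases
  case 1
  then show ?thesis using nc[of a b] ab chords_cross_iff[of k n l i j] assms sep separates_sym[of i j k l] by simp
  next
  case 2
  then show ?thesis using nc[of b a] ab chords_cross_iff[of i n j k l] assms sep by simp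
  qed
qed

lemma allowed_nonempty:
  assumes nc: "noncrossing_diagonals n cs" and len: "length cs < n - 3"
  shows "allowed n cs ~= {}"
proof -
  have n: "3 \<le> n" using len by simp
  define S where "S = {c \<in> diag_ends n. vertex_chord n c \<in> set cs}"
  have inj: "inj_on (vertex_chord n) (diag_ends n)"
  by (rule inj_onI) (auto simp: diag_ends_def vertex_chord_eq doubleton_eq_iff)
  have "card S = card (vertex_chord n ` S)"
  using inj by (intro card_image[symmetric]) (auto simp: S_def intro: inj_on_subset)
  also have "\<dots> \<le> card (set cs)" by (intro card_mono) (auto simp: S_def)
  also have "\<dots> \<le> length cs" by (rule card_length)
  finally have cardS: "card S < n - 3" using len by simp
  have "\<exists>(i, j)\<in>diag_ends n - S. \<forall>(k, l)\<in>S. \<not> separates i j k l"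
  proof (rule noncrossing_diagonals_extend[OF _ cardS])
  fix i j k l assume "(i, j) \<in> S" "(k, l) \<in> S"
  then show "\<not> separates i j k l"
   by (intro noncrossing_not_separates[OF nc]) (auto simp: S_def diag_ends_def)
  qed (auto simp: S_def)
  then obtain i j where ij: "(i, j) \<in> diag_ends n" "(i, j) \<notin> S" "\<forall>(k, l)\<in>S. \<not> separates i j k l" by blast
  have "vertex_chord n (i, j) \<in> allowed n cs"
  unfolding allowed_def
  proof (intro CollectI conjI ballI)
  show "vertex_chord n (i, j) \<in> diagonals n" using ij(1) by (simp add: diagonals_eq[OF n])
  fix c assume c: "c \<in> set cs"
  then have "c \<in> vertex_chord n ` diag_ends n"
   using nc unfolding noncrossing_diagonals_def diagonals_eq[OF n] by blast
  then obtain k l where kl: "(k, l) \<in> diag_ends n" "c = vertex_chord n (k, l)" by auto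
  then have "(k, l) \<in> S" using c by (simp add: S_def)
  then have "\<not> separates i j k l" "(i, j) ~= (k, l)" using ij by auto
  moreover have "i < j" "j < n" "k < l" "l < n" using ij(1) kl(1) by (auto simp: diag_ends_def)
  ultimately show "\<not> chords_cross (vertex_chord n (i, j)) c"
   unfolding kl(2) by (subst chords_cross_iff) (auto simp: doubleton_eq_iff)
  qed
  then show ?thesis by blast
qed

lemma extend_uniformly_support:
  assumes "noncrossing_diagonals n cs" "length cs + k \<le> n - 3" "cs' \<in> set_pmf (extend_uniformly n k cs)"
  shows "noncrossing_diagonals n cs' \<and> set cs \<subseteq> set cs'"
  using assms
proof (induction k arbitrary: cs)
  case (Suc k)
  have "3 \<le> n" "allowed n cs ~= {}" using Suc.prems allowed_nonempty[of n cs] by auto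
  then have "set_pmf (pmf_of_set (allowed n cs)) = allowed n cs" using finite_allowed by (intro set_pmf_of_set) auto
  then obtain c where c: "c \<in> allowed n cs" "cs' \<in> set_pmf (extend_uniformly n k (cs @ [c]))"
  using Suc.prems(3) by auto
  show ?case
  using Suc.IH[OF noncrossing_diagonals_snoc[OF Suc.prems(1) c(1)] _ c(2)] Suc.prems(2) by auto
qed simp

lemma pmf_vertex_chord:
  assumes "3 \<le> n" "c \<in> diagonals n"
  shows "pmf (map_pmf (vertex_chord n) (pmf_of_set ({..<n} \<times> {..<n}))) c = 2 / (real n * real n)"
proof -
  obtain i j where ij: "(i, j) \<in> diag_ends n" "c = vertex_chord n (i, j)"
  using assms by (auto simp: diagonals_eq)
  then have ij': "i < j" "j < n" by (auto simp: diag_ends_def)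
  have "({..<n} \<times> {..<n}) \<inter> vertex_chord n -` {c} = {(i, j), (j, i)}"
  using ij' by (auto simp: ij(2) vertex_chord_eq doubleton_eq_iff)
  then have "card (({..<n} \<times> {..<n}) \<inter> vertex_chord n -` {c}) = 2" using ij' by simp
  moreover have "0 \<in> {..<n}" using assms(1) by simp
  then have "{..<n} \<times> {..<n} ~= {}" by blast
  ultimately show ?thesis by (simp add: pmf_map measure_pmf_of_set card_cartesian_product)
qed

text \<open>The ordered pairs give every diagonal the mass \<open>2 / n\<^sup>2\<close>, so rejection applies. The bound on \<open>N\<close> ensures
  that before each draw there is still an admissible diagonal.\<close>

lemma extend_uniformly_greedy:
  assumes "noncrossing_diagonals n cs" "length cs + N \<le> n - 3"
  shows "replicate_pmf N (pmf_of_set ({..<n} \<times> {..<n})) \<bind>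
   (\<lambda>ds. let cs' = fold (\<lambda>c. try_chord n (vertex_chord n c)) ds cs in extend_uniformly n (n - 3 - length cs') cs') =
  extend_uniformly n (n - 3 - length cs) cs"
  using assms
proof (induction N arbitrary: cs)
  case 0
  then show ?case by (simp add: bind_return_pmf)
next
  case (Suc N)
  let ?P = "pmf_of_set ({..<n} \<times> {..<n})"
  define G where "G cs = extend_uniformly n (n - 3 - length cs) cs" for cs
  have n: "3 \<le> n" using Suc.prems by simp
  have ne: "allowed n cs ~= {}" using allowed_nonempty[OF Suc.prems(1)] Suc.prems(2) by simp
  have G: "G cs = pmf_of_set (allowed n cs) \<bind> (\<lambda>c. G (cs @ [c]))"
  proof -
  have k: "n - 3 - length cs = Suc (n - 3 - Suc (length cs))" using Suc.prems(2) by simp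
  show ?thesis unfolding G_def k extend_uniformly.simps(2) length_append_singleton ..
  qed
  have IH: "replicate_pmf N ?P \<bind> (\<lambda>ds. G (fold (\<lambda>c. try_chord n (vertex_chord n c)) ds (try_chord n (vertex_chord n c) cs))) =
   (if vertex_chord n c \<in> allowed n cs then G (cs @ [vertex_chord n c]) else G cs)" for c
  proof -
  have IH0: "replicate_pmf N ?P \<bind> (\<lambda>ds. G (fold (\<lambda>c. try_chord n (vertex_chord n c)) ds cs')) = G cs'"
   if "noncrossing_diagonals n cs'" "length cs' + N \<le> n - 3" for cs'
   using Suc.IH[OF that] unfolding G_def Let_def .
  show ?thesis
  proof (cases "vertex_chord n c \<in> allowed n cs")
   case True
   then have "try_chord n (vertex_chord n c) cs = cs @ [vertex_chord n c]" by (simp add: try_chord_def)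
   moreover have "noncrossing_diagonals n (cs @ [vertex_chord n c])"
    by (rule noncrossing_diagonals_snoc[OF Suc.prems(1) True])
   ultimately show ?thesis using IH0 True Suc.prems(2) by simp
  next
   case False
   then have "try_chord n (vertex_chord n c) cs = cs" by (simp add: try_chord_def)
   then show ?thesis using IH0[OF Suc.prems(1)] False Suc.prems(2) by simp
  qed
  qed
  have "replicate_pmf (Suc N) ?P \<bind> (\<lambda>ds. G (fold (\<lambda>c. try_chord n (vertex_chord n c)) ds cs)) =
   ?P \<bind> (\<lambda>c. replicate_pmf N ?P \<bind> (\<lambda>ds. G (fold (\<lambda>c. try_chord n (vertex_chord n c)) ds (try_chord n (vertex_chord n c) cs))))"
  by (simp add: replicate_pmf.simps bind_assoc_pmf bind_return_pmf)
  also have "\<dots> = ?P \<bind> (\<lambda>c. if vertex_chord n c \<in> allowed n cs then G (cs @ [vertex_chord n c]) else G cs)"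
  by (simp only: IH)
  also have "\<dots> = map_pmf (vertex_chord n) ?P \<bind> (\<lambda>c. if c \<in> allowed n cs then G (cs @ [c]) else pmf_of_set (allowed n cs) \<bind> (\<lambda>c. G (cs @ [c])))"
  unfolding G[symmetric] by (simp add: bind_map_pmf)
  also have "\<dots> = pmf_of_set (allowed n cs) \<bind> (\<lambda>c. G (cs @ [c]))"
  by (rule bind_pmf_reject[OF finite_allowed[OF n] ne pmf_vertex_chord[OF n]]) (auto simp: allowed_def)
  finally show ?case using G by (simp add: G_def Let_def)
qed

lemma noncrossing_diagonals_greedy:
  assumes "noncrossing_diagonals n cs"
  shows "noncrossing_diagonals n (fold (\<lambda>c. try_chord n (vertex_chord n c)) ds cs) \<and>
  length (fold (\<lambda>c. try_chord n (vertex_chord n c)) ds cs) \<le> length cs + length ds"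
  using assms
proof (induction ds arbitrary: cs)
  case (Cons c ds)
  define cs' where "cs' = try_chord n (vertex_chord n c) cs"
  have "noncrossing_diagonals n cs'" "length cs' \<le> Suc (length cs)"
  using noncrossing_diagonals_snoc[OF Cons.prems, of "vertex_chord n c"] Cons.prems by (simp_all add: cs'_def try_chord_def)
  then show ?case using Cons.IH[of cs'] by (simp add: cs'_def)
qed simp

lemma random_diagonals_greedy:
  assumes "N \<le> n - 3"
  shows "random_diagonals n (n - 3) = replicate_pmf N (pmf_of_set ({..<n} \<times> {..<n})) \<bind>
   (\<lambda>ds. let cs = fold (\<lambda>c. try_chord n (vertex_chord n c)) ds [] in extend_uniformly n (n - 3 - length cs) cs)"
proof -
  have "noncrossing_diagonals n []" by (simp add: noncrossing_diagonals_def)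
  from extend_uniformly_greedy[OF this, of N] show ?thesis using assms unfolding random_diagonals_eq by simp
qed

lemma greedy_support:
  assumes "length ds \<le> n - 3" "cs = fold (\<lambda>c. try_chord n (vertex_chord n c)) ds []"
  and "cs' \<in> set_pmf (extend_uniformly n (n - 3 - length cs) cs)"
  shows "noncrossing_diagonals n cs' \<and> set cs \<subseteq> set cs'"
proof (rule extend_uniformly_support[OF _ _ assms(3)])
  have "noncrossing_diagonals n []" by (simp add: noncrossing_diagonals_def)
  from noncrossing_diagonals_greedy[OF this, of ds]
  show "noncrossing_diagonals n cs" "length cs + (n - 3 - length cs) \<le> n - 3"
  using assms(1) by (auto simp: assms(2))
qed


section \<open>The two families of runs\<close>

text \<open>Auxiliary points between 0, \<open>u\<close> and \<open>v\<close> keep the rounded ends from being neighbours.\<close>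

lemma eventually_rounded_diagonal:
  assumes "u \<in> {0<..<1}" "v \<in> {0<..<1}" "u ~= v"
  shows "eventually (\<lambda>n. rnd n u < n \<and> rnd n v < n \<and> rnd n u ~= rnd n v \<and>
  vertex_chord n (rnd n u, rnd n v) \<in> diagonals n) sequentially"
proof -
  have main: "eventually (\<lambda>n. rnd n a < n \<and> rnd n b < n \<and> (rnd n a, rnd n b) \<in> diag_ends n) sequentially"
  if ab: "0 < a" "a < b" "b < 1" for a b
  proof -
  define D where "D = {a / 2, a, (a + b) / 2, b}"
  have "eventually (\<lambda>n. strict_mono_on D (rnd n)) sequentially"
   by (rule eventually_rnd_strict_mono) (use ab in \<open>auto simp: D_def\<close>)
  then show ?thesis using eventually_gt_at_top[of 0]
  proof eventually_elim
   case (elim n)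
   have "rnd n (a / 2) < rnd n a" "rnd n a < rnd n ((a + b) / 2)" "rnd n ((a + b) / 2) < rnd n b"
    using strict_mono_onD[OF elim(1)] ab by (auto simp: D_def)
   moreover have "rnd n a < n" "rnd n b < n" using ab elim(2) by (auto intro!: rnd_less)
   ultimately show ?case by (auto simp: diag_ends_def)
  qed
  qed
  have "eventually (\<lambda>n. rnd n (min u v) < n \<and> rnd n (max u v) < n \<and> (rnd n (min u v), rnd n (max u v)) \<in> diag_ends n) sequentially"
  by (rule main) (use assms in auto)
  then show ?thesis using eventually_ge_at_top[of 3]
  proof eventually_elim
  case (elim n)
  then have "vertex_chord n (rnd n (min u v), rnd n (max u v)) \<in> diagonals n" by (simp add: diagonals_eq)
  moreover have "rnd n (min u v) ~= rnd n (max u v)" using elim by (auto simp: diag_ends_def)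
  ultimately show ?case
   using elim vertex_chord_commute[of n "rnd n u" "rnd n v"] by (cases "u \<le> v") (auto simp: min_def max_def)
  qed
qed

locale pair_run =
  fixes d :: "nat => real \<times> real"
  assumes d_range: "\<And>i. fst (d i) \<in> {0<..<1}" "\<And>i. snd (d i) \<in> {0<..<1}"
  and d_distinct: "\<And>i j. fst (d i) ~= snd (d j)" "\<And>i j. i ~= j ==> fst (d i) ~= fst (d j)"
   "\<And>i j. i ~= j ==> snd (d i) ~= snd (d j)"
  and d_dense: "\<And>p q m. 0 \<le> p ==> p < q ==> q \<le> 1 ==> \<exists>i\<ge>m. fst (d i) \<in> {p<..<q} \<and> snd (d i) \<in> {p<..<q}"
begin

sublocale real_run pair_move pair_move "\<lambda>\<phi>. map_prod \<phi> \<phi>" "\<lambda>c. {fst c, snd c}" d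
proof
  show "proper_move r (pair_move x r)" if "pend_ok r" for x :: "real \<times> real" and r by (rule pair_move_proper[OF that])
  show "move_match \<phi> D (pair_move x r) (pair_move (map_prod \<phi> \<phi> x) r')"
  if "strict_mono_on D \<phi>" "{fst x, snd x} \<subseteq> D" "region_match \<phi> D r r'"
  for D and \<phi> :: "real => nat" and x r r'
  by (rule pair_move_match[OF that(1) _ _ that(3)]) (use that(2) in auto)
  show "finite {fst (d i), snd (d i)} \<and> {fst (d i), snd (d i)} \<subseteq> {0<..<1}" for i using d_range by simp
  show "\<exists>m\<ge>N. \<forall>r. {p<..<q} \<subseteq> fst r -->
   (\<exists>X j u v. (X, j, u, v) \<in> fst (pair_move (d m) r) \<and> p < v \<and> v < q) \<or>
   (\<exists>r'. pair_move (d m) r = ({}, [r']) \<and>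
    (\<exists>X j u v. (X, j, u, v) \<in> fst (pair_move (d (Suc m)) r') \<and> p < v \<and> v < q))"
  if pq: "0 \<le> p" "p < q" "q \<le> 1" for p q N
  proof -
  obtain i where i: "N \<le> i" "fst (d i) \<in> {p<..<q}" "snd (d i) \<in> {p<..<q}" using d_dense[OF pq, of N] by blast
  have "\<exists>X j u v. (X, j, u, v) \<in> fst (pair_move (d i) r) \<and> p < v \<and> v < q" if r: "{p<..<q} \<subseteq> fst r" for r
  proof -
   obtain X e j where X: "r = (X, e, j)" by (cases r)
   have "fst (d i) \<in> X" "snd (d i) \<in> X" using r i X by auto
   moreover obtain u v where uv: "d i = (u, v)" by (cases "d i")
   ultimately have "(X, j, u, v) \<in> fst (pair_move (d i) r)"
    using d_distinct(1)[of i i] by (simp add: X split_region_def)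
   moreover have "p < v \<and> v < q" using i(3) uv by simp
   ultimately show ?thesis by blast
  qed
  then show ?thesis using i(1) by blast
  qed
qed

lemma lam_0: "lam 0 = {}"
  by (simp add: lam_def st_0 start_def)

lemma lam_Suc_region:
  "lam (Suc N) = lam N \<union> (if \<exists>r\<in>set (snd (st N)). fst (d N) \<in> fst r \<and> snd (d N) \<in> fst r then {d N} else {})"
proof -
  have "chords_of (fst (pair_move (d N) r)) = (if fst (d N) \<in> fst r \<and> snd (d N) \<in> fst r then {d N} else {})" for r
  proof -
  obtain X e j where "r = (X, e, j)" by (cases r)
  moreover obtain u v where "d N = (u, v)" by (cases "d N")
  ultimately show ?thesis using d_distinct(1)[of N N] by (simp add: split_region_def)
  qed
  then show ?thesis by (auto simp: lam_def st_Suc step_def)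
qed

lemma lam_subset: "lam N \<subseteq> d ` {..<N}"
proof (induction N)
  case (Suc N)
  then show ?case unfolding lam_Suc_region by (auto simp: lessThan_Suc)
qed (simp add: lam_0)

text \<open>A drawn pair lies in one region exactly if no earlier chord separates it, which is the rule that
  defines \<open>L_seq\<close>.\<close>

lemma lam_Suc:
  "lam (Suc N) = (if \<exists>(u, v)\<in>lam N. separates u v (fst (d N)) (snd (d N)) then lam N else insert (d N) (lam N))"
proof -
  have "fst (d N) \<notin> ends (lam N) \<and> snd (d N) \<notin> ends (lam N)"
  proof -
  have "\<exists>i<N. e = fst (d i) \<or> e = snd (d i)" if "e \<in> ends (lam N)" for e
   using that lam_subset[of N] unfolding ends_def by fastforce
  then show ?thesis using d_distinct by (metis less_irrefl)
  qed
  then have "(\<exists>r\<in>set (snd (st N)). fst (d N) \<in> fst r \<and> snd (d N) \<in> fst r) \<longleftrightarrow>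
   (\<forall>(u, v)\<in>lam N. \<not> separates u v (fst (d N)) (snd (d N)))"
  using consistent_same_region[OF consistent_st, of "fst (d N)" N "snd (d N)"] d_range[of N]
  by (simp add: lam_def)
  then show ?thesis unfolding lam_Suc_region by auto
qed

lemma lam_disjoint_ends:
  assumes "(a, b) \<in> lam N"
  shows "a ~= fst (d N)" "a ~= snd (d N)" "b ~= fst (d N)" "b ~= snd (d N)" "a \<in> {0<..<1}" "b \<in> {0<..<1}"
proof -
  obtain i where "i < N" "d i = (a, b)" using lam_subset[of N] assms by force
  then show "a ~= fst (d N)" "a ~= snd (d N)" "b ~= fst (d N)" "b ~= snd (d N)" "a \<in> {0<..<1}" "b \<in> {0<..<1}"
  using d_distinct[of i N] d_distinct(1)[of N i] d_range[of i] by auto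
qed

lemma L_seq_eq_lam:
  assumes "\<And>i. u (Suc i) = circ (fst (d i))" "\<And>i. v (Suc i) = circ (snd (d i))"
  shows "L_seq u v N = chord_union (lam N)"
proof (induction N)
  case 0
  then show ?case by (simp add: lam_0 chord_union_def)
next
  case (Suc N)
  let ?c = "chord (fst (d N)) (snd (d N))"
  have in01: "fst (d N) \<in> {0..<1}" "snd (d N) \<in> {0..<1}" using d_range[of N] by auto
  have meet: "chord a b \<inter> ?c ~= {} \<longleftrightarrow> separates a b (fst (d N)) (snd (d N))" if "(a, b) \<in> lam N" for a b
  proof -
  note e = lam_disjoint_ends[OF that]
  have ab: "a \<in> {0..<1}" "b \<in> {0..<1}" using e(5,6) by auto
  show ?thesis
  proof
   assume "chord a b \<inter> ?c ~= {}"
   then show "separates a b (fst (d N)) (snd (d N))"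
    using chords_disjoint[OF ab in01] e(1-4) by metis
  next
   assume "separates a b (fst (d N)) (snd (d N))"
   from separates_imp_open_segments_meet[OF ab in01 this]
   show "chord a b \<inter> ?c ~= {}" using open_closed_segment by blast
  qed
  qed
  have "?c \<inter> chord_union (lam N) ~= {} \<longleftrightarrow> (\<exists>(a, b)\<in>lam N. separates a b (fst (d N)) (snd (d N)))"
  (is "?L \<longleftrightarrow> ?R")
  proof
  assume ?L
  then obtain a b where "(a, b) \<in> lam N" "chord a b \<inter> ?c ~= {}" unfolding chord_union_def by fastforce
  then show ?R using meet by blast
  next
  assume ?R
  then obtain a b where "(a, b) \<in> lam N" "chord a b \<inter> ?c ~= {}" using meet by blast
  then show ?L unfolding chord_union_def by fastforce
  qed
  moreover have "chord_union (insert (d N) (lam N)) = chord_union (lam N) \<union> ?c"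
  by (auto simp: chord_union_def split_beta)
  ultimately show ?case unfolding lam_Suc L_seq.simps(2) assms Suc.IH by simp
qed

lemma L_inf_eq_lam:
  assumes "\<And>i. u (Suc i) = circ (fst (d i))" "\<And>i. v (Suc i) = circ (snd (d i))"
  shows "L_inf u v = limit_set lam"
proof -
  have "(\<Union>n\<in>{1..}. L_seq u v n) = (\<Union>N. chord_union (lam N))"
  proof
  show "(\<Union>N. chord_union (lam N)) \<subseteq> (\<Union>n\<in>{1..}. L_seq u v n)"
  proof
   fix z assume "z \<in> (\<Union>N. chord_union (lam N))"
   then obtain N where "z \<in> chord_union (lam N)" by blast
   then have "z \<in> chord_union (lam (Suc N))" using chord_union_mono lam_mono by (metis incseq_SucD subsetD)
   then show "z \<in> (\<Union>n\<in>{1..}. L_seq u v n)" unfolding L_seq_eq_lam[OF assms, symmetric] by force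
  qed
  qed (auto simp: L_seq_eq_lam[OF assms])
  then show ?thesis unfolding L_inf_def by (rule arg_cong)
qed

text \<open>For large \<open>n\<close>, rounding keeps the order of the finitely many points, so the greedy choice of diagonals
  accepts the same chords as the run with real angles.\<close>

lemma greedy_rounded:
  "eventually (\<lambda>n. set (fold (\<lambda>c. try_chord n (vertex_chord n c)) (map (\<lambda>i. rnd2 n (d i)) [0..<N]) []) =
   vertex_chord n ` rnd2 n ` lam N) sequentially"
proof (induction N)
  case 0
  then show ?case by (simp add: lam_0)
next
  case (Suc N)
  let ?R = "\<lambda>n. rnd2 n"
  define u v where "u = fst (d N)" and "v = snd (d N)"
  define D where "D = {u, v} \<union> fst ` lam N \<union> snd ` lam N"
  have uv: "u \<in> {0<..<1}" "v \<in> {0<..<1}" "u ~= v" using d_range[of N] d_distinct(1)[of N N] by (auto simp: u_def v_def)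
  have "finite D" using finite_lam by (simp add: D_def)
  moreover have "D \<subseteq> {0<..<1}" using uv lam_disjoint_ends(5,6) by (auto simp: D_def)
  ultimately have "eventually (\<lambda>n. strict_mono_on D (rnd n)) sequentially"
  by (intro eventually_rnd_strict_mono) (auto dest!: subsetD)
  then show ?case using Suc.IH eventually_rounded_diagonal[OF uv]
  proof eventually_elim
  case (elim n)
  define cs where "cs = fold (\<lambda>c. try_chord n (vertex_chord n c)) (map (\<lambda>i. ?R n (d i)) [0..<N]) []"
  have cs: "set cs = vertex_chord n ` ?R n ` lam N" using elim(2) by (simp add: cs_def)
  have dN: "?R n (d N) = (rnd n u, rnd n v)" by (simp add: u_def v_def map_prod_def split_beta)
  have inj: "inj_on (rnd n) D" using elim(1) by (rule strict_mono_on_imp_inj_on)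
  have cross: "chords_cross (vertex_chord n (rnd n u, rnd n v)) (vertex_chord n (?R n (a, b))) \<longleftrightarrow> separates a b u v"
   if ab: "(a, b) \<in> lam N" for a b
  proof -
   have D: "a \<in> D" "b \<in> D" "u \<in> D" "v \<in> D" using ab by (force simp: D_def)+
   have ne: "a ~= u" "a ~= v" "b ~= u" "b ~= v" "a ~= b"
    using lam_disjoint_ends[OF ab] lam_subset[of N] ab d_distinct(1) by (auto simp: u_def v_def) (metis fst_conv imageE snd_conv subsetD)
   have r: "rnd n a ~= rnd n b" "rnd n a ~= rnd n u" "rnd n a ~= rnd n v" using inj_onD[OF inj] D ne by blast+
   have lt: "rnd n a < n" "rnd n b < n" using lam_disjoint_ends(5,6)[OF ab] elim(3) by (auto intro!: rnd_less)
   have "chords_cross (vertex_chord n (rnd n u, rnd n v)) (vertex_chord n (rnd n a, rnd n b)) \<longleftrightarrow>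
     separates (rnd n u) (rnd n v) (rnd n a) (rnd n b)"
    using r lt elim(3) by (subst chords_cross_iff) auto
   also have "\<dots> \<longleftrightarrow> separates u v a b"
    unfolding separates_def using strict_mono_on_arc[OF elim(1), of u v] D by simp
   finally show ?thesis using separates_sym[of u v a b] by simp
  qed
  have acc: "vertex_chord n (rnd n u, rnd n v) \<in> allowed n cs \<longleftrightarrow> \<not> (\<exists>(a, b)\<in>lam N. separates a b u v)"
   unfolding allowed_def cs using elim(3) cross by fastforce
  have fold: "fold (\<lambda>c. try_chord n (vertex_chord n c)) (map (\<lambda>i. ?R n (d i)) [0..<Suc N]) [] =
    try_chord n (vertex_chord n (rnd n u, rnd n v)) cs"
   by (simp add: cs_def dN)
  show ?case
  proof (cases "\<exists>(a, b)\<in>lam N. separates a b u v")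
   case True
   then show ?thesis unfolding fold lam_Suc u_def[symmetric] v_def[symmetric] using acc cs by (simp add: try_chord_def)
  next
   case False
   then have "try_chord n (vertex_chord n (rnd n u, rnd n v)) cs = cs @ [vertex_chord n (?R n (d N))]"
    using acc by (simp only: try_chord_def dN) simp
   moreover have "lam (Suc N) = insert (d N) (lam N)" using False by (simp only: lam_Suc u_def v_def if_False)
   ultimately show ?thesis unfolding fold using cs by simp
  qed
  qed
qed

end

locale point_run =
  fixes x :: "nat => real"
  assumes x_range: "\<And>i. x i \<in> {0<..<1}" and x_distinct: "\<And>i j. i ~= j ==> x i ~= x j"
  and x_dense: "\<And>p q m. 0 \<le> p ==> p < q ==> q \<le> 1 ==> \<exists>i\<ge>m. x (2 * i) \<in> {p<..<q} \<and> x (2 * i + 1) \<in> {p<..<q}"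
begin

sublocale real_run point_move point_move "\<lambda>\<phi>. \<phi>" "\<lambda>t. {t}" x
proof
  show "proper_move r (point_move t r)" if "pend_ok r" for t :: real and r by (rule point_move_proper[OF that])
  show "move_match \<phi> D (point_move t r) (point_move (\<phi> t) r')"
  if "strict_mono_on D \<phi>" "{t} \<subseteq> D" "region_match \<phi> D r r'"
  for D and \<phi> :: "real => nat" and t r r'
  by (rule point_move_match[OF that(1) _ that(3)]) (use that(2) in auto)
  show "finite {x i} \<and> {x i} \<subseteq> {0<..<1}" for i using x_range by simp
  show "\<exists>m\<ge>N. \<forall>r. {p<..<q} \<subseteq> fst r -->
   (\<exists>X j u v. (X, j, u, v) \<in> fst (point_move (x m) r) \<and> p < v \<and> v < q) \<or>
   (\<exists>r'. point_move (x m) r = ({}, [r']) \<and>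
    (\<exists>X j u v. (X, j, u, v) \<in> fst (point_move (x (Suc m)) r') \<and> p < v \<and> v < q))"
  if "0 \<le> p" "p < q" "q \<le> 1" for p q N
  proof -
  obtain i where i: "N \<le> i" "x (2 * i) \<in> {p<..<q}" "x (2 * i + 1) \<in> {p<..<q}" using x_dense \<open>0 \<le> p\<close> \<open>p < q\<close> \<open>q \<le> 1\<close> by blast
  define m where "m = 2 * i"
  have m: "p < x m" "x m < q" "p < x (Suc m)" "x (Suc m) < q" "x m ~= x (Suc m)" using i x_distinct by (auto simp: m_def)
  have "(\<exists>X j u v. (X, j, u, v) \<in> fst (point_move (x m) r) \<and> p < v \<and> v < q) \<or>
   (\<exists>r'. point_move (x m) r = ({}, [r']) \<and>
    (\<exists>X j u v. (X, j, u, v) \<in> fst (point_move (x (Suc m)) r') \<and> p < v \<and> v < q))" if r: "{p<..<q} \<subseteq> fst r" for r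
  proof -
   obtain X e j where X: "r = (X, e, j)" by (cases r)
   have mem: "x m \<in> X" "x (Suc m) \<in> X" using r m X by auto
   have next_hit: "(X, j, x m, x (Suc m)) \<in> fst (point_move (x (Suc m)) (X, Some (x m), j))"
    using mem m by (simp add: split_region_def)
   show ?thesis
   proof (cases "e = None \<or> e = Some (x m)")
    case True
    then have "point_move (x m) r = ({}, [(X, Some (x m), j)])" using mem X by auto
    then show ?thesis using next_hit m by blast
   next
    case False
    then obtain z where "e = Some z" "z ~= x m" by auto
    then have "(X, j, z, x m) \<in> fst (point_move (x m) r)" using mem X by (simp add: split_region_def)
    then show ?thesis using m by blast
   qed
  qed
  moreover have "N \<le> m" using i by (simp add: m_def)
  ultimately show ?thesis by blast
  qed
qed

end

section \<open>Closeness of finite chord sets to the limit\<close>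

lemma chords_cross_commute: "chords_cross c d \<longleftrightarrow> chords_cross d c"
  unfolding chords_cross_def by (metis inf_commute)

lemma diagonal_set_close:
  assumes fill: "filling L" and "0 < \<epsilon>"
  shows "\<exists>N. eventually (\<lambda>n. \<forall>C. C \<subseteq> diagonals n --> vertex_chord n ` rnd2 n ` L N \<subseteq> C -->
  (\<forall>c\<in>C. \<forall>d\<in>C. c ~= d --> \<not> chords_cross c d) -->
  C ~= {} \<and> hausdorff_dist (\<Union>C) (limit_set L) \<le> \<epsilon>) sequentially"
proof -
  obtain N n0 where "\<forall>n\<ge>n0. \<forall>S. S \<subseteq> {..<n} \<times> {..<n} --> rnd2 n ` L N \<subseteq> S -->
  (\<forall>(i, j)\<in>S. \<forall>(u, v)\<in>L N. \<not> separates (rnd n u) (rnd n v) i j) -->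
  S ~= {} \<and> hausdorff_dist (polygon_chords n S) (limit_set L) \<le> \<epsilon>"
  using filling_hausdorff_limit[OF assms] by (elim exE)
  note lim = this[THEN spec, THEN mp, THEN spec, THEN mp, THEN mp, THEN mp]
  have "C ~= {} \<and> hausdorff_dist (\<Union>C) (limit_set L) \<le> \<epsilon>"
  if n: "max n0 3 \<le> n" and C: "C \<subseteq> diagonals n" "vertex_chord n ` rnd2 n ` L N \<subseteq> C"
   and nc: "\<forall>c\<in>C. \<forall>d\<in>C. c ~= d --> \<not> chords_cross c d" for n C
  proof -
  have n3: "3 \<le> n" "n0 \<le> n" using n by auto
  define S where "S = {(i, j). i < n \<and> j < n \<and> i ~= j \<and> vertex_chord n (i, j) \<in> C}"
  have dia: "\<exists>i j. i < n \<and> j < n \<and> i ~= j \<and> c = vertex_chord n (i, j)" if c: "c \<in> diagonals n" for c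
  proof -
   obtain i j where ij: "(i, j) \<in> diag_ends n" "c = vertex_chord n (i, j)" using c unfolding diagonals_eq[OF n3(1)] by auto
   then have "i < n" "j < n" "i ~= j" by (auto simp: diag_ends_def)
   then show ?thesis using ij(2) by blast
  qed
  have rounded: "(rnd n u, rnd n v) \<in> S" if uv: "(u, v) \<in> L N" for u v
  proof -
   have r: "rnd n u < n" "rnd n v < n" using filling_range[OF fill uv] n3 by (auto intro!: rnd_less)
   have mem: "vertex_chord n (rnd n u, rnd n v) \<in> C" using C(2) uv by force
   then obtain i j where ij: "i < n" "j < n" "i ~= j" "vertex_chord n (rnd n u, rnd n v) = vertex_chord n (i, j)"
    using dia C(1) by blast
   then have "{rnd n u, rnd n v} = {i, j}" using vertex_chord_eq r by blast
   then show ?thesis using ij(3) r mem by (auto simp: S_def doubleton_eq_iff)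
  qed
  have "S ~= {} \<and> hausdorff_dist (polygon_chords n S) (limit_set L) \<le> \<epsilon>"
  proof (rule lim[OF n3(2)])
   show "S \<subseteq> {..<n} \<times> {..<n}" by (auto simp: S_def)
   show "rnd2 n ` L N \<subseteq> S" using rounded by auto
   have nsep: "\<not> separates a b i j" if "(a, b) \<in> S" "(i, j) \<in> S" for a b i j
   proof
    assume sep: "separates a b i j"
    then have "{a, b} ~= {i, j}" by (auto simp: doubleton_eq_iff separates_def)
    moreover have lt: "a < n" "b < n" "i < n" "j < n" "a ~= b" "i ~= j" using that by (auto simp: S_def)
    ultimately have "vertex_chord n (a, b) ~= vertex_chord n (i, j)" using vertex_chord_eq by blast
    moreover have "vertex_chord n (a, b) \<in> C" "vertex_chord n (i, j) \<in> C" using that by (auto simp: S_def)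
    ultimately have "\<not> chords_cross (vertex_chord n (a, b)) (vertex_chord n (i, j))" using nc by blast
    then show False using sep chords_cross_iff[OF lt] by blast
   qed
   show "\<forall>(i, j)\<in>S. \<forall>(u, v)\<in>L N. \<not> separates (rnd n u) (rnd n v) i j"
    using nsep[OF rounded] by blast
  qed
  moreover have "polygon_chords n S = \<Union>C"
  proof
   show "polygon_chords n S \<subseteq> \<Union>C" by (auto simp: polygon_chords_def S_def vertex_chord_def)
   show "\<Union>C \<subseteq> polygon_chords n S"
   proof
    fix z assume "z \<in> \<Union>C"
    then obtain c where c: "c \<in> C" "z \<in> c" by blast
    then obtain i j where ij: "i < n" "j < n" "i ~= j" "c = vertex_chord n (i, j)" using dia C(1) by blast
    then have "(i, j) \<in> S" using c by (simp add: S_def)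
    moreover have "z \<in> chord (real i / real n) (real j / real n)" using c ij by (simp add: vertex_chord_def)
    ultimately show "z \<in> polygon_chords n S" unfolding polygon_chords_def by blast
   qed
  qed
  moreover have "C ~= {}" if "S ~= {}" using that by (auto simp: S_def)
  ultimately show ?thesis by simp
  qed
  then have "eventually (\<lambda>n. \<forall>C. C \<subseteq> diagonals n --> vertex_chord n ` rnd2 n ` L N \<subseteq> C -->
  (\<forall>c\<in>C. \<forall>d\<in>C. c ~= d --> \<not> chords_cross c d) -->
  C ~= {} \<and> hausdorff_dist (\<Union>C) (limit_set L) \<le> \<epsilon>) sequentially"
  unfolding eventually_sequentially by (intro exI[of _ "max n0 3"] allI impI)
  then show ?thesis by blast
qed

lemma (in real_run) confined_close:
  assumes fill: "filling lam" and "0 < \<epsilon>" and proper': "\<And>x r. pend_ok r ==> proper_move r (S' x r)"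
  shows "\<exists>N. eventually (\<lambda>n. \<forall>C. confined (run S' (map (\<lambda>i. \<psi> (rnd n) (d i)) [0..<N]) (start {..<n})) C -->
  C ~= {} \<and> C \<subseteq> {..<n} \<times> {..<n} \<and> hausdorff_dist (polygon_chords n C) (limit_set lam) \<le> \<epsilon>) sequentially"
proof -
  obtain N n0 where "\<forall>n\<ge>n0. \<forall>S. S \<subseteq> {..<n} \<times> {..<n} --> rnd2 n ` lam N \<subseteq> S -->
  (\<forall>(i, j)\<in>S. \<forall>(u, v)\<in>lam N. \<not> separates (rnd n u) (rnd n v) i j) -->
  S ~= {} \<and> hausdorff_dist (polygon_chords n S) (limit_set lam) \<le> \<epsilon>"
  using filling_hausdorff_limit[OF assms(1,2)] by (elim exE)
  note lim = this[THEN spec, THEN mp, THEN spec, THEN mp, THEN mp, THEN mp]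
  have "eventually (\<lambda>n. \<exists>D. {} \<subseteq> D \<and> strict_mono_on D (rnd n) \<and>
  state_match (rnd n) D (st N) (run S' (map (\<lambda>i. \<psi> (rnd n) (d i)) [0..<N]) (start {..<n}))) sequentially"
  by (rule rounded_run) auto
  then have "eventually (\<lambda>n. \<forall>C. confined (run S' (map (\<lambda>i. \<psi> (rnd n) (d i)) [0..<N]) (start {..<n})) C -->
  C ~= {} \<and> C \<subseteq> {..<n} \<times> {..<n} \<and> hausdorff_dist (polygon_chords n C) (limit_set lam) \<le> \<epsilon>) sequentially"
  using eventually_ge_at_top[of n0]
  proof eventually_elim
  case (elim n)
  define s where "s = run S' (map (\<lambda>i. \<psi> (rnd n) (d i)) [0..<N]) (start {..<n})"
  have chords: "chords_of (fst s) = rnd2 n ` lam N"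
   using elim(1) by (auto simp: state_match_def lam_def s_def)
  have cons: "consistent {..<n} s" unfolding s_def by (rule consistent_run[OF proper' consistent_start])
  have H: "u \<in> {..<n} \<and> v \<in> {..<n}" "\<not> separates u' v' u v"
   if "(u, v) \<in> chords_of (fst s)" "(u', v') \<in> chords_of (fst s)" for u v u' v'
   using cons that unfolding consistent_def by blast+
  have R: "fst r \<subseteq> {..<n} - ends (chords_of (fst s))" if "r \<in> set (snd s)" for r
   using cons that unfolding consistent_def by blast
  show ?case
  proof (intro allI impI)
   fix C assume "confined (run S' (map (\<lambda>i. \<psi> (rnd n) (d i)) [0..<N]) (start {..<n})) C"
   then have C: "chords_of (fst s) \<subseteq> C"
    "\<And>u v. (u, v) \<in> C ==> (u, v) \<in> chords_of (fst s) \<or> (\<exists>r\<in>set (snd s). u \<in> fst r \<and> v \<in> fst r)"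
    unfolding s_def[symmetric] confined_def by blast+
   have sub: "C \<subseteq> {..<n} \<times> {..<n}"
   proof (rule subsetI)
    fix c assume c: "c \<in> C"
    obtain u v where uv: "c = (u, v)" by (cases c)
    show "c \<in> {..<n} \<times> {..<n}" using C(2)[of u v] c uv H(1)[of u v] R by blast
   qed
   have nsep: "\<not> separates a b i j" if ab: "(a, b) \<in> chords_of (fst s)" and ij: "(i, j) \<in> C" for a b i j
    using C(2)[OF ij]
   proof
    assume "(i, j) \<in> chords_of (fst s)"
    then show ?thesis using H(2)[OF _ ab] by blast
   next
    assume e: "\<exists>r\<in>set (snd s). i \<in> fst r \<and> j \<in> fst r"
    then have "i \<in> {..<n} - ends (chords_of (fst s))" "j \<in> {..<n} - ends (chords_of (fst s))" using R by blast+
    from consistent_same_region[OF cons this] show ?thesis using e ab by blast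
   qed
   have "\<not> separates (rnd n u) (rnd n v) i j" if ij: "(i, j) \<in> C" and uv: "(u, v) \<in> lam N" for i j u v
   proof -
    have "(rnd n u, rnd n v) \<in> chords_of (fst s)" unfolding chords using uv by force
    then show ?thesis using nsep ij by blast
   qed
   then have "\<forall>(i, j)\<in>C. \<forall>(u, v)\<in>lam N. \<not> separates (rnd n u) (rnd n v) i j" by blast
   from lim[OF elim(2) sub C(1)[unfolded chords] this]
   have "C ~= {} \<and> hausdorff_dist (polygon_chords n C) (limit_set lam) \<le> \<epsilon>" .
   then show "C ~= {} \<and> C \<subseteq> {..<n} \<times> {..<n} \<and> hausdorff_dist (polygon_chords n C) (limit_set lam) \<le> \<epsilon>"
    using sub by blast
  qed
  qed
  then show ?thesis by blast
qed


section \<open>Random compact sets\<close>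

lemma dist_Abs_disk_compact:
  assumes "compact A" "A ~= {}" "A \<subseteq> cball 0 1" "compact B" "B ~= {}" "B \<subseteq> cball 0 1"
  shows "dist (Abs_disk_compact A) (Abs_disk_compact B) = hausdorff_dist A B"
  using assms by (simp add: dist_disk_compact.rep_eq Abs_disk_compact_inverse)

text \<open>The projection of a closed set along the compact square of the two segment parameters.\<close>

lemma closed_meeting_segments:
  "closed {(a, b, c, d) | a b c d :: complex. closed_segment a b \<inter> closed_segment c d ~= {}}"
proof -
  define S where "S = {((s, t), (a, b, c, d)) | (s::real) (t::real) (a::complex) b c d.
  (1 - s) *\<^sub>R a + s *\<^sub>R b = (1 - t) *\<^sub>R c + t *\<^sub>R d}"
  have "S = {x. (1 - fst (fst x)) *\<^sub>R fst (snd x) + fst (fst x) *\<^sub>R fst (snd (snd x)) =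
   (1 - snd (fst x)) *\<^sub>R fst (snd (snd (snd x))) + snd (fst x) *\<^sub>R snd (snd (snd (snd x)))}"
  by (auto simp: S_def)
  also have "closed \<dots>" by (intro closed_Collect_eq continuous_intros)
  finally have "closed {y. \<exists>x. x \<in> {0..1} \<times> {0..1} \<and> (x, y) \<in> S}"
  by (intro closed_compact_projection compact_Times compact_Icc)
  also have "{y. \<exists>x. x \<in> {0..1} \<times> {0..1} \<and> (x, y) \<in> S} =
   {(a, b, c, d) | a b c d :: complex. closed_segment a b \<inter> closed_segment c d ~= {}}"
  proof (intro set_eqI)
  fix y :: "complex \<times> complex \<times> complex \<times> complex"
  obtain a b c d where y: "y = (a, b, c, d)" by (cases y) auto
  have "(\<exists>x. x \<in> {0..1} \<times> {0..1} \<and> (x, y) \<in> S) \<longleftrightarrow>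
   (\<exists>s t. 0 \<le> s \<and> s \<le> 1 \<and> 0 \<le> t \<and> t \<le> 1 \<and> (1 - s) *\<^sub>R a + s *\<^sub>R b = (1 - t) *\<^sub>R c + t *\<^sub>R d)"
   by (auto simp: S_def y)
  also have "\<dots> \<longleftrightarrow> closed_segment a b \<inter> closed_segment c d ~= {}"
  proof
   assume "\<exists>s t. 0 \<le> s \<and> s \<le> 1 \<and> 0 \<le> t \<and> t \<le> 1 \<and> (1 - s) *\<^sub>R a + s *\<^sub>R b = (1 - t) *\<^sub>R c + t *\<^sub>R d"
   then obtain s t where st: "0 \<le> s" "s \<le> 1" "0 \<le> t" "t \<le> 1"
    "(1 - s) *\<^sub>R a + s *\<^sub>R b = (1 - t) *\<^sub>R c + t *\<^sub>R d" by (elim exE conjE)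
   have "(1 - s) *\<^sub>R a + s *\<^sub>R b \<in> closed_segment a b" using st by (auto simp: in_segment)
   moreover have "(1 - s) *\<^sub>R a + s *\<^sub>R b \<in> closed_segment c d"
    unfolding st(5) using st by (auto simp: in_segment)
   ultimately show "closed_segment a b \<inter> closed_segment c d ~= {}" by blast
  next
   assume "closed_segment a b \<inter> closed_segment c d ~= {}"
   then obtain z where z: "z \<in> closed_segment a b" "z \<in> closed_segment c d" by blast
   obtain s where s: "0 \<le> s" "s \<le> 1" "z = (1 - s) *\<^sub>R a + s *\<^sub>R b" using z(1) unfolding in_segment by (elim exE conjE)
   obtain t where t: "0 \<le> t" "t \<le> 1" "z = (1 - t) *\<^sub>R c + t *\<^sub>R d" using z(2) unfolding in_segment by (elim exE conjE)
   show "\<exists>s t. 0 \<le> s \<and> s \<le> 1 \<and> 0 \<le> t \<and> t \<le> 1 \<and> (1 - s) *\<^sub>R a + s *\<^sub>R b = (1 - t) *\<^sub>R c + t *\<^sub>R d"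
    using s t by (intro exI[of _ s] exI[of _ t]) simp
  qed
  finally show "y \<in> {y. \<exists>x. x \<in> {0..1} \<times> {0..1} \<and> (x, y) \<in> S} \<longleftrightarrow>
    y \<in> {(a, b, c, d) | a b c d :: complex. closed_segment a b \<inter> closed_segment c d ~= {}}"
   by (simp add: y)
  qed
  finally show ?thesis .
qed

context circle_pairs
begin

definition seg :: "nat => 'w => complex set" where
  "seg i \<omega> = closed_segment (pt (2 * i) \<omega>) (pt (2 * i + 1) \<omega>)"

primrec kept :: "nat => 'w => nat set" where
  "kept 0 \<omega> = {}"
| "kept (Suc N) \<omega> = (if \<exists>j\<in>kept N \<omega>. seg N \<omega> \<inter> seg j \<omega> ~= {} then kept N \<omega> else insert N (kept N \<omega>))"

lemma kept_subset: "kept N \<omega> \<subseteq> {..<N}"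
  by (induction N) (auto simp: lessThan_Suc)

lemma kept_nonempty: "0 < N ==> kept N \<omega> ~= {}"
proof (induction N)
  case (Suc N)
  then show ?case by (cases "N = 0") auto
qed simp

lemma pt_eq: "U (Suc i) = pt (2 * i)" "V (Suc i) = pt (2 * i + 1)"
  by (auto simp: pt_def)

lemma L_seq_kept: "L_seq (\<lambda>i. U i \<omega>) (\<lambda>i. V i \<omega>) N = (\<Union>i\<in>kept N \<omega>. seg i \<omega>)"
proof (induction N)
  case (Suc N)
  have "closed_segment (U (Suc N) \<omega>) (V (Suc N) \<omega>) = seg N \<omega>" by (simp only: pt_eq seg_def)
  then show ?case by (auto simp: Suc)
qed simp

lemma pt_borel: "pt i \<in> borel_measurable \<Omega>"
proof -
  have "(\<lambda>x. x) \<in> uniform_circle \<rightarrow>\<^sub>M borel"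
  unfolding measurable_cong_sets[OF sets_uniform_circle refl] by (intro measurable_restrict_space1) simp
  from measurable_compose[OF pt_measurable this] show ?thesis .
qed

lemma meeting_event: "{\<omega> \<in> space \<Omega>. seg i \<omega> \<inter> seg j \<omega> ~= {}} \<in> events"
proof -
  have "(\<lambda>\<omega>. (pt (2 * i) \<omega>, pt (2 * i + 1) \<omega>, pt (2 * j) \<omega>, pt (2 * j + 1) \<omega>)) \<in> borel_measurable \<Omega>"
  by (intro borel_measurable_Pair pt_borel)
  from measurable_sets[OF this borel_closed[OF closed_meeting_segments]]
  show ?thesis by (simp add: seg_def vimage_def Int_def conj_commute)
qed

lemma kept_event: "{\<omega> \<in> space \<Omega>. kept N \<omega> = A} \<in> events"
proof (induction N arbitrary: A)
  case 0
  then show ?case by (cases "A = {}") auto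
next
  case (Suc N)
  have meet: "{\<omega> \<in> space \<Omega>. \<exists>j\<in>B. seg N \<omega> \<inter> seg j \<omega> ~= {}} \<in> events" for B
  proof -
  have "{\<omega> \<in> space \<Omega>. \<exists>j\<in>B. seg N \<omega> \<inter> seg j \<omega> ~= {}} = (\<Union>j\<in>B. {\<omega> \<in> space \<Omega>. seg N \<omega> \<inter> seg j \<omega> ~= {}})" by blast
  then show ?thesis using meeting_event by (simp add: sets.countable_UN' countableI_type)
  qed
  have N: "N \<notin> kept N \<omega>" for \<omega> using kept_subset[of N \<omega>] by auto
  let ?M = "\<lambda>B. {\<omega> \<in> space \<Omega>. \<exists>j\<in>B. seg N \<omega> \<inter> seg j \<omega> ~= {}}"
  have "{\<omega> \<in> space \<Omega>. kept (Suc N) \<omega> = A} = ({\<omega> \<in> space \<Omega>. kept N \<omega> = A} \<inter> ?M A) \<union>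
   (if N \<in> A then {\<omega> \<in> space \<Omega>. kept N \<omega> = A - {N}} - ?M (A - {N}) else {})"
  proof (intro set_eqI)
  fix \<omega>
  have ins: "insert N (kept N \<omega>) = A \<longleftrightarrow> N \<in> A \<and> kept N \<omega> = A - {N}" using N[of \<omega>] by blast
  show "\<omega> \<in> {\<omega> \<in> space \<Omega>. kept (Suc N) \<omega> = A} \<longleftrightarrow> \<omega> \<in> ({\<omega> \<in> space \<Omega>. kept N \<omega> = A} \<inter> ?M A) \<union>
   (if N \<in> A then {\<omega> \<in> space \<Omega>. kept N \<omega> = A - {N}} - ?M (A - {N}) else {})"
  proof (cases "\<exists>j\<in>kept N \<omega>. seg N \<omega> \<inter> seg j \<omega> ~= {}")
   case True
   then have "kept (Suc N) \<omega> = kept N \<omega>" by simp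
   then show ?thesis using True by auto
  next
   case False
   then have "kept (Suc N) \<omega> = insert N (kept N \<omega>)" by simp
   then show ?thesis using False ins by auto
  qed
  qed
  then show ?case using Suc meet by (simp split: if_splits)
qed

lemma dist_rounded_chord_point:
  assumes "\<omega> \<in> space \<Omega>" "0 < k" "0 \<le> t" "t \<le> 1"
  shows "dist (chord_point (y (2 * i) \<omega>) (y (2 * i + 1) \<omega>) t)
  (chord_point (real (rnd k (y (2 * i) \<omega>)) / real k) (real (rnd k (y (2 * i + 1) \<omega>)) / real k) t) \<le> 4 * pi / real k"
proof -
  have r: "dist (circ (y j \<omega>)) (circ (real (rnd k (y j \<omega>)) / real k)) \<le> 2 * pi / real k" for j
  proof -
  have "0 \<le> y j \<omega>" using y_range[OF assms(1), of j] by simp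
  note b = rnd_bounds[OF this assms(2)]
  have "\<bar>y j \<omega> - real (rnd k (y j \<omega>)) / real k\<bar> \<le> 1 / real k" using b by linarith
  then have "2 * pi * \<bar>y j \<omega> - real (rnd k (y j \<omega>)) / real k\<bar> \<le> 2 * pi * (1 / real k)" by (intro mult_left_mono) auto
  then show ?thesis using dist_circ_le[of "y j \<omega>" "real (rnd k (y j \<omega>)) / real k"] by simp
  qed
  have "dist (chord_point (y (2 * i) \<omega>) (y (2 * i + 1) \<omega>) t)
  (chord_point (real (rnd k (y (2 * i) \<omega>)) / real k) (real (rnd k (y (2 * i + 1) \<omega>)) / real k) t) \<le> 2 * pi / real k + 2 * pi / real k"
  using dist_chord_point_le[OF assms(3,4)] r[of "2 * i"] r[of "2 * i + 1"] by (meson add_mono order_trans)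
  then show ?thesis by simp
qed

definition rounded_set :: "nat => nat set => nat list => complex set" where
  "rounded_set k A l = (\<Union>i\<in>A. chord (real (l ! (2 * i)) / real k) (real (l ! (2 * i + 1)) / real k))"

text \<open>The index set of the chords that are kept takes finitely many values, on events that are determined by
  the intersections of segments. Together with rounded ends this gives random sets with finitely
  many values, and they converge to the limit at every sample point.\<close>

lemma L_inf_measurable:
  "(\<lambda>\<omega>. Abs_disk_compact (L_inf (\<lambda>i. U i \<omega>) (\<lambda>i. V i \<omega>))) \<in> borel_measurable \<Omega>"
proof (rule borel_measurable_LIMSEQ_metric)
  define Z where "Z k \<omega> = map (\<lambda>i. rnd k (y i \<omega>)) [0..<2 * k]" for k \<omega>
  define X where "X k \<omega> = Abs_disk_compact (rounded_set (Suc k) (kept (Suc k) \<omega>) (Z (Suc k) \<omega>))" for k \<omega>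
  show "X k \<in> borel_measurable \<Omega>" for k
  proof (rule measurableI)
  fix B :: "disk_compact set" assume "B \<in> sets borel"
  let ?g = "\<lambda>A l. Abs_disk_compact (rounded_set (Suc k) A l)"
  have "X k -` B \<inter> space \<Omega> = (\<Union>A\<in>Pow {..<Suc k}. {\<omega> \<in> space \<Omega>. kept (Suc k) \<omega> = A} \<inter> (Z (Suc k) -` {l. ?g A l \<in> B} \<inter> space \<Omega>))"
  proof (rule set_eqI)
   fix \<omega>
   have "kept (Suc k) \<omega> \<in> Pow {..<Suc k}" using kept_subset by (rule PowI)
   then show "\<omega> \<in> X k -` B \<inter> space \<Omega> \<longleftrightarrow> \<omega> \<in> (\<Union>A\<in>Pow {..<Suc k}. {\<omega> \<in> space \<Omega>. kept (Suc k) \<omega> = A} \<inter> (Z (Suc k) -` {l. ?g A l \<in> B} \<inter> space \<Omega>))"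
    unfolding X_def vimage_def UN_iff Int_iff mem_Collect_eq by blast
  qed
  also have "\<dots> \<in> events"
  proof (rule sets.finite_UN)
   fix A
   have "Z (Suc k) -` {l. ?g A l \<in> B} \<inter> space \<Omega> \<in> events"
    unfolding Z_def by (rule measurable_sets[OF point_list_law(1)]) simp
   then show "{\<omega> \<in> space \<Omega>. kept (Suc k) \<omega> = A} \<inter> (Z (Suc k) -` {l. ?g A l \<in> B} \<inter> space \<Omega>) \<in> events"
    by (rule sets.Int[OF kept_event])
  qed simp
  finally show "X k -` B \<inter> space \<Omega> \<in> events" .
  qed simp
  fix \<omega> assume \<omega>: "\<omega> \<in> space \<Omega>"
  define L where "L N = L_seq (\<lambda>i. U i \<omega>) (\<lambda>i. V i \<omega>) N" for N
  have L_eq: "L N = (\<Union>i\<in>kept N \<omega>. seg i \<omega>)" for N unfolding L_def by (rule L_seq_kept)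
  have seg_chord: "seg i \<omega> = chord (y (2 * i) \<omega>) (y (2 * i + 1) \<omega>)" for i
  unfolding seg_def circ_y[OF \<omega>] ..
  have mono: "incseq L" by (rule incseq_SucI) (auto simp: L_def)
  have disk: "L N \<subseteq> cball 0 1" for N unfolding L_eq seg_chord using chord_subset_disk by blast
  have inf: "L_inf (\<lambda>i. U i \<omega>) (\<lambda>i. V i \<omega>) = closure (\<Union>N. L N)" (is "?L = _")
  proof -
  have "(\<Union>n\<in>{1..}. L n) = (\<Union>N. L N)"
  proof
   show "(\<Union>N. L N) \<subseteq> (\<Union>n\<in>{1..}. L n)"
   proof
    fix z assume "z \<in> (\<Union>N. L N)"
    then obtain N where "z \<in> L N" by blast
    then have "z \<in> L (Suc N)" using mono by (metis incseq_SucD subsetD)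
    then show "z \<in> (\<Union>n\<in>{1..}. L n)" by force
   qed
  qed auto
  then show ?thesis unfolding L_inf_def L_def by (rule arg_cong)
  qed
  have bdd: "(\<Union>N. L N) \<subseteq> cball 0 1" using disk by blast
  have bounded: "bounded (\<Union>N. L N)" using bdd bounded_cball bounded_subset by blast
  have LK: "compact ?L" "?L \<subseteq> cball 0 1"
  unfolding inf using bounded bdd by (simp_all add: compact_closure closure_minimal)
  have L1: "L (Suc k) ~= {}" for k unfolding L_eq using kept_nonempty[of "Suc k" \<omega>] by (auto simp: seg_def)
  from L1[of 0] have Lne: "?L ~= {}" unfolding inf by auto
  have nth: "Z k \<omega> ! j = rnd k (y j \<omega>)" if "j < 2 * k" for j k using that by (simp add: Z_def)
  have R: "rounded_set k (kept k \<omega>) (Z k \<omega>) =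
   (\<Union>i\<in>kept k \<omega>. chord (real (rnd k (y (2 * i) \<omega>)) / real k) (real (rnd k (y (2 * i + 1) \<omega>)) / real k))" for k
  unfolding rounded_set_def
  proof (intro SUP_cong refl)
  fix i assume "i \<in> kept k \<omega>"
  then have "i < k" using kept_subset by blast
  then show "chord (real (Z k \<omega> ! (2 * i)) / real k) (real (Z k \<omega> ! (2 * i + 1)) / real k) =
    chord (real (rnd k (y (2 * i) \<omega>)) / real k) (real (rnd k (y (2 * i + 1) \<omega>)) / real k)" by (simp add: nth)
  qed
  let ?R = "\<lambda>k. rounded_set k (kept k \<omega>) (Z k \<omega>)"
  have RK: "compact (?R k)" "?R k \<subseteq> cball 0 1" for k
  proof -
  have "finite (kept k \<omega>)" using finite_subset[OF kept_subset] by simp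
  then show "compact (?R k)" unfolding R by (intro compact_UN) auto
  show "?R k \<subseteq> cball 0 1" unfolding R using chord_subset_disk by blast
  qed
  have Rne: "?R (Suc k) ~= {}" for k unfolding R using kept_nonempty[of "Suc k" \<omega>] by auto
  show "(\<lambda>k. X k \<omega>) \<longlonglongrightarrow> Abs_disk_compact ?L"
  unfolding tendsto_iff
  proof (intro allI impI)
  fix e :: real assume e: "0 < e"
  obtain N0 where N0: "\<And>N z. N \<ge> N0 ==> z \<in> ?L ==> \<exists>w\<in>L N. dist z w < e / 3"
   unfolding inf using closure_incseq_close[OF mono bounded, of "e / 3"] e by auto
  have "(\<lambda>k. 4 * pi / real (Suc k)) \<longlonglongrightarrow> 0"
   using LIMSEQ_inverse_real_of_nat_add[of 0] tendsto_mult_right_zero[OF LIMSEQ_inverse_real_of_nat, of "4 * pi"]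
   by (simp add: divide_inverse)
  then have "eventually (\<lambda>k. 4 * pi / real (Suc k) < e / 3) sequentially" by (rule order_tendstoD) (use e in simp)
  then show "eventually (\<lambda>k. dist (X k \<omega>) (Abs_disk_compact ?L) < e) sequentially"
   using eventually_ge_at_top[of N0]
  proof eventually_elim
   case (elim k)
   have "dist (X k \<omega>) (Abs_disk_compact ?L) = hausdorff_dist (?R (Suc k)) ?L"
    unfolding X_def by (rule dist_Abs_disk_compact[OF RK(1) Rne RK(2) LK(1) Lne LK(2)])
   also have "\<dots> \<le> 2 * e / 3"
   proof (rule hausdorff_dist_leI[OF Rne Lne])
    fix z assume "z \<in> ?R (Suc k)"
    then obtain i t where i: "i \<in> kept (Suc k) \<omega>" and t: "0 \<le> t" "t \<le> 1"
     "z = chord_point (real (rnd (Suc k) (y (2 * i) \<omega>)) / real (Suc k)) (real (rnd (Suc k) (y (2 * i + 1) \<omega>)) / real (Suc k)) t"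
     unfolding R chord_altdef by auto
    define w where "w = chord_point (y (2 * i) \<omega>) (y (2 * i + 1) \<omega>) t"
    have "w \<in> seg i \<omega>" unfolding seg_chord w_def using t by (intro chord_point_mem)
    then have "w \<in> L (Suc k)" unfolding L_eq using i by blast
    then have "w \<in> (\<Union>N. L N)" by (rule UN_I[OF UNIV_I])
    then have "w \<in> ?L" unfolding inf by (rule subsetD[OF closure_subset])
    moreover have "dist z w \<le> 2 * e / 3"
     using dist_rounded_chord_point[OF \<omega> _ t(1,2), of "Suc k" i] elim(1) e by (simp add: t(3) w_def dist_commute)
    ultimately show "infdist z ?L \<le> 2 * e / 3" by (rule infdist_le2)
   next
    fix z assume "z \<in> ?L"
    then obtain w where w: "w \<in> L (Suc k)" "dist z w < e / 3" using N0[of "Suc k"] elim(2) by auto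
    then obtain i t where i: "i \<in> kept (Suc k) \<omega>" and t: "0 \<le> t" "t \<le> 1" "w = chord_point (y (2 * i) \<omega>) (y (2 * i + 1) \<omega>) t"
     unfolding L_eq seg_chord chord_altdef by auto
    define x where "x = chord_point (real (rnd (Suc k) (y (2 * i) \<omega>)) / real (Suc k)) (real (rnd (Suc k) (y (2 * i + 1) \<omega>)) / real (Suc k)) t"
    have "x \<in> ?R (Suc k)" unfolding R x_def by (rule UN_I[OF i chord_point_mem[OF t(1,2)]])
    moreover have "dist w x \<le> e / 3"
     using dist_rounded_chord_point[OF \<omega> _ t(1,2), of "Suc k" i] elim(1) by (simp add: t(3) x_def)
    then have "dist z x \<le> 2 * e / 3" using w(2) dist_triangle[of z x w] by linarith
    ultimately show "infdist z (?R (Suc k)) \<le> 2 * e / 3" by (rule infdist_le2)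
   qed
   also have "\<dots> < e" using e by simp
   finally show ?case .
  qed
  qed
qed

end

section \<open>Coupled kernels\<close>

lemma (in prob_space) kernel_integral:
  fixes h :: "'b => real" and Z :: "'a => 'e"
  assumes "\<And>b. \<bar>h b\<bar> \<le> B" "Z \<in> M \<rightarrow>\<^sub>M count_space UNIV" "distr M (count_space UNIV) Z = measure_pmf p"
  shows "(\<lambda>\<omega>. \<integral>b. h b \<partial>measure_pmf (K (Z \<omega>))) \<in> borel_measurable M"
  and "(\<integral>\<omega>. (\<integral>b. h b \<partial>measure_pmf (K (Z \<omega>))) \<partial>M) = (\<integral>b. h b \<partial>bind_pmf p K)"
proof -
  let ?I = "\<lambda>z. \<integral>b. h b \<partial>measure_pmf (K z)"
  show "(\<lambda>\<omega>. ?I (Z \<omega>)) \<in> borel_measurable M" using measurable_compose[OF assms(2), of ?I borel] by simp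
  have "(\<integral>\<omega>. ?I (Z \<omega>) \<partial>M) = (\<integral>z. ?I z \<partial>distr M (count_space UNIV) Z)"
  by (rule integral_distr[symmetric, OF assms(2)]) simp
  also have "\<dots> = (\<integral>b. h b \<partial>bind_pmf p K)"
  unfolding assms(3) by (rule integral_bind_pmf_bounded[OF assms(1), symmetric])
  finally show "(\<integral>\<omega>. ?I (Z \<omega>) \<partial>M) = (\<integral>b. h b \<partial>bind_pmf p K)" .
qed

lemma pmf_integral_close:
  fixes h :: "'b => real"
  assumes "\<And>b. \<bar>h b\<bar> \<le> B" "\<And>b. b \<in> set_pmf q ==> \<bar>h b - c\<bar> \<le> e"
  shows "\<bar>(\<integral>b. h b \<partial>measure_pmf q) - c\<bar> \<le> e"
proof -
  have int: "integrable (measure_pmf q) h" using assms(1) by (intro measure_pmf.integrable_const_bound[where B = B]) auto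
  have "(\<integral>b. h b \<partial>measure_pmf q) \<le> (\<integral>b. c + e \<partial>measure_pmf q)"
  by (intro integral_mono_AE int) (auto simp: AE_measure_pmf_iff dest!: assms(2))
  moreover have "(\<integral>b. c - e \<partial>measure_pmf q) \<le> (\<integral>b. h b \<partial>measure_pmf q)"
  by (intro integral_mono_AE int) (auto simp: AE_measure_pmf_iff dest!: assms(2))
  ultimately show ?thesis by simp
qed

lemma kernel_limit:
  fixes f :: "'k::metric_space => real"
  assumes "continuous_on UNIV f" "\<And>x. \<bar>f x\<bar> \<le> B"
  and "\<And>\<epsilon>. 0 < \<epsilon> ==> eventually (\<lambda>n. \<forall>b\<in>set_pmf (K n). dist (G n b) Y \<le> \<epsilon>) sequentially"
  shows "(\<lambda>n. \<integral>b. f (G n b) \<partial>measure_pmf (K n)) \<longlonglongrightarrow> f Y"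
  unfolding tendsto_iff
proof (intro allI impI)
  fix e :: real assume e: "0 < e"
  have "isCont f Y" using assms(1) by (simp add: continuous_on_eq_continuous_at)
  then obtain \<delta> where \<delta>: "0 < \<delta>" "\<And>x. dist x Y < \<delta> ==> dist (f x) (f Y) < e / 2"
  using e unfolding continuous_at_eps_delta by (metis half_gt_zero)
  have "eventually (\<lambda>n. \<forall>b\<in>set_pmf (K n). dist (G n b) Y \<le> \<delta> / 2) sequentially"
  by (rule assms(3)) (use \<delta>(1) in simp)
  then show "eventually (\<lambda>n. dist (\<integral>b. f (G n b) \<partial>measure_pmf (K n)) (f Y) < e) sequentially"
  proof eventually_elim
  case (elim n)
  have "\<bar>(\<integral>b. f (G n b) \<partial>measure_pmf (K n)) - f Y\<bar> \<le> e / 2"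
  proof (rule pmf_integral_close[OF assms(2)])
   fix b assume "b \<in> set_pmf (K n)"
   then have "dist (G n b) Y \<le> \<delta> / 2" using elim by blast
   then have "dist (f (G n b)) (f Y) < e / 2" using \<delta> by (intro \<delta>(2)) simp
   then show "\<bar>f (G n b) - f Y\<bar> \<le> e / 2" by (simp add: dist_real_def)
  qed
  then show ?case using e by (simp add: dist_real_def)
  qed
qed

lemma (in prob_space) tendsto_integral_bounded:
  fixes g :: "nat => 'a => real"
  assumes "\<And>n. n \<ge> n0 ==> g n \<in> borel_measurable M" "g' \<in> borel_measurable M"
  and "\<And>n \<omega>. \<bar>g n \<omega>\<bar> \<le> B" "AE \<omega> in M. (\<lambda>n. g n \<omega>) \<longlonglongrightarrow> g' \<omega>"
  shows "(\<lambda>n. \<integral>\<omega>. g n \<omega> \<partial>M) \<longlonglongrightarrow> (\<integral>\<omega>. g' \<omega> \<partial>M)"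
proof (rule LIMSEQ_offset[where k = n0])
  show "(\<lambda>n. \<integral>\<omega>. g (n + n0) \<omega> \<partial>M) \<longlonglongrightarrow> (\<integral>\<omega>. g' \<omega> \<partial>M)"
  proof (rule integral_dominated_convergence[where w = "\<lambda>_. B"])
  show "AE \<omega> in M. (\<lambda>n. g (n + n0) \<omega>) \<longlonglongrightarrow> g' \<omega>"
   using assms(4) by eventually_elim (rule LIMSEQ_ignore_initial_segment)
  qed (use assms in auto)
qed

lemma pmf_integral_bounded:
  fixes h :: "'b => real"
  assumes "\<And>b. \<bar>h b\<bar> \<le> B"
  shows "\<bar>\<integral>b. h b \<partial>measure_pmf q\<bar> \<le> B"
  using pmf_integral_close[of h B q 0 B] assms by simp


section \<open>The matching construction as a run\<close>

definition pending :: "'a state => 'a set" where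
  "pending s = {x. \<exists>r\<in>set (snd s). fst (snd r) = Some x}"

text \<open>A free vertex can be joined to \<open>y\<close> exactly if it waits in the region of \<open>y\<close>, as long as no diagonal
  in question is an edge. In particular there is then only one such vertex.\<close>

lemma matching_step:
  fixes s :: "nat state"
  assumes cons: "consistent {..<n} s" and y: "y < n" "y \<notin> ends (chords_of (fst s))" "y \<notin> pending s"
  and dia: "\<And>x. x \<in> pending s ==> vertex_chord n (x, y) \<in> diagonals n"
  and M: "M = vertex_chord n ` chords_of (fst s)" and F: "F = root_vertex n ` pending s"
  shows "joinable n M F (root_vertex n y) z ==>
   M \<union> {closed_segment z (root_vertex n y)} = vertex_chord n ` chords_of (fst (step point_move y s)) \<and>
   F - {z} = root_vertex n ` pending (step point_move y s)"
  and "\<nexists>z. joinable n M F (root_vertex n y) z ==>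
   M = vertex_chord n ` chords_of (fst (step point_move y s)) \<and>
   F \<union> {root_vertex n y} = root_vertex n ` pending (step point_move y s)"
  and "ends (chords_of (fst (step point_move y s))) \<union> pending (step point_move y s) \<subseteq>
   insert y (ends (chords_of (fst s)) \<union> pending s)"
proof -
  let ?C = "chords_of (fst s)"
  let ?s' = "step point_move y s"
  have disj: "sorted_wrt (\<lambda>r r'. fst r \<inter> fst r' = {}) (snd s)"
  using cons unfolding consistent_def by (elim conjE)
  have reg: "fst r \<subseteq> {..<n} - ends ?C" "pend_ok r" if "r \<in> set (snd s)" for r
  using cons that unfolding consistent_def by blast+
  have ch: "u < n \<and> v < n" if "(u, v) \<in> ?C" for u v
  using cons that unfolding consistent_def by blast
  have chd: "u ~= v" if "(u, v) \<in> ?C" for u v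
  using cons that unfolding consistent_def by blast
  have uniq: "r = r'" if "r \<in> set (snd s)" "r' \<in> set (snd s)" "t \<in> fst r" "t \<in> fst r'" for r r' t
  using sorted_wrt_disjoint_value[OF disj] that by blast
  have yX: "y \<in> {..<n} - ends ?C" using y by simp
  have "\<not> separates u v y y" for u v by (auto simp: separates_def dest: arc_in_imp_not_out)
  then have "\<exists>r\<in>set (snd s). y \<in> fst r" using consistent_same_region[OF cons yX yX] by blast
  then obtain r where r: "r \<in> set (snd s)" "y \<in> fst r" by blast
  obtain X p j where X: "r = (X, p, j)" by (cases r)
  have other: "point_move y r' = ({}, [r'])" if "r' \<in> set (snd s)" "r' ~= r" for r'
  proof -
  obtain X' p' j' where X': "r' = (X', p', j')" by (cases r')
  have "y \<notin> X'" using uniq[OF r(1) that(1) r(2)] that(2) X' by auto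
  then show ?thesis using X' by simp
  qed
  have fst_s': "fst ?s' = fst s \<union> fst (point_move y r)"
  proof -
  have "(\<Union>r\<in>set (snd s). fst (point_move y r)) = fst (point_move y r)" using other r(1) by force
  then show ?thesis by (simp add: step_def)
  qed
  have snd_s': "set (snd ?s') = (set (snd s) - {r}) \<union> set (snd (point_move y r))"
  proof -
  have "set (snd ?s') = (\<Union>r'\<in>set (snd s). set (snd (point_move y r')))" by (simp add: step_def)
  also have "\<dots> = (\<Union>r'\<in>set (snd s) - {r}. set (snd (point_move y r'))) \<union> set (snd (point_move y r))"
   using r(1) by auto
  also have "(\<Union>r'\<in>set (snd s) - {r}. set (snd (point_move y r'))) = set (snd s) - {r}" using other by force
  finally show ?thesis .
  qed
  have pend: "x < n \<and> x \<notin> ends ?C \<and> (\<exists>r'\<in>set (snd s). x \<in> fst r' \<and> fst (snd r') = Some x)" if "x \<in> pending s" for x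
  proof -
  obtain r' where r': "r' \<in> set (snd s)" "fst (snd r') = Some x" using \<open>x \<in> pending s\<close> by (auto simp: pending_def)
  then have "x \<in> fst r'" using reg(2)[OF r'(1)] by (simp add: pend_ok_def)
  then show ?thesis using r' reg(1)[OF r'(1)] by auto
  qed
  have rv: "closed_segment (root_vertex n x) (root_vertex n y) = vertex_chord n (x, y)" for x
  by (simp only: root_vertex_circ vertex_chord_def fst_conv snd_conv)
  have meets: "vertex_chord n (x, y) \<inter> vertex_chord n (u, v) ~= {} \<longleftrightarrow> separates u v x y"
  if x: "x \<in> pending s" and uv: "(u, v) \<in> ?C" for x u v
  proof -
  define \<theta> where "\<theta> m = real m / real n" for m
  have \<theta>: "\<theta> m \<in> {0..<1}" if "m < n" for m using vertex_angle[OF that] by (simp add: \<theta>_def)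
  have \<theta>_less: "\<theta> a < \<theta> b \<longleftrightarrow> a < b" for a b using y(1) by (auto simp: \<theta>_def divide_less_cancel)
  have \<theta>_eq: "\<theta> a = \<theta> b \<longleftrightarrow> a = b" for a b using y(1) by (auto simp: \<theta>_def)
  have sep: "separates (\<theta> u) (\<theta> v) (\<theta> x) (\<theta> y) \<longleftrightarrow> separates u v x y"
   by (simp add: side_defs min_def max_def \<theta>_less not_less[symmetric])
  have lt: "u < n" "v < n" "x < n" "y < n" using ch[OF uv] pend[OF x] y(1) by auto
  have ne: "x ~= u" "x ~= v" "y ~= u" "y ~= v" using pend[OF x] y(2) endsI[OF uv] by auto
  have vc: "vertex_chord n (a, b) = chord (\<theta> a) (\<theta> b)" for a b by (simp add: vertex_chord_def \<theta>_def)
  show ?thesis unfolding vc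
  proof
   assume "chord (\<theta> x) (\<theta> y) \<inter> chord (\<theta> u) (\<theta> v) ~= {}"
   then show "separates u v x y"
    using chords_disjoint[OF \<theta>[OF lt(1)] \<theta>[OF lt(2)] \<theta>[OF lt(3)] \<theta>[OF lt(4)]] ne
    unfolding \<theta>_eq sep by (metis inf_commute)
  next
   assume "separates u v x y"
   then have "separates (\<theta> u) (\<theta> v) (\<theta> x) (\<theta> y)" using sep by simp
   from separates_imp_open_segments_meet[OF \<theta>[OF lt(1)] \<theta>[OF lt(2)] \<theta>[OF lt(3)] \<theta>[OF lt(4)] this]
   show "chord (\<theta> x) (\<theta> y) \<inter> chord (\<theta> u) (\<theta> v) ~= {}" using open_closed_segment by blast
  qed
  qed
  have join: "joinable n M F (root_vertex n y) (root_vertex n x) \<longleftrightarrow> p = Some x" if x: "x \<in> pending s" for x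
  proof -
  obtain r' where r': "r' \<in> set (snd s)" "x \<in> fst r'" "fst (snd r') = Some x" using pend[OF x] by blast
  have "joinable n M F (root_vertex n y) (root_vertex n x) \<longleftrightarrow> (\<forall>(u, v)\<in>?C. \<not> separates u v x y)"
   unfolding joinable_def rv F M using dia[OF x] x meets[OF x] by fastforce
  also have "\<dots> \<longleftrightarrow> (\<exists>r\<in>set (snd s). x \<in> fst r \<and> y \<in> fst r)"
   using consistent_same_region[OF cons _ yX, of x] pend[OF x] by simp
  also have "\<dots> \<longleftrightarrow> p = Some x"
  proof
   assume "\<exists>r\<in>set (snd s). x \<in> fst r \<and> y \<in> fst r"
   then obtain r2 where r2: "r2 \<in> set (snd s)" "x \<in> fst r2" "y \<in> fst r2" by blast
   have "r2 = r" by (rule uniq[OF r2(1) r(1) r2(3) r(2)])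
   moreover have "r2 = r'" by (rule uniq[OF r2(1) r'(1) r2(2) r'(2)])
   ultimately show "p = Some x" using r'(3) X by simp
  next
   assume p: "p = Some x"
   then have "x \<in> fst r" using reg(2)[OF r(1)] X by (simp add: pend_ok_def)
   then show "\<exists>r\<in>set (snd s). x \<in> fst r \<and> y \<in> fst r" using r by blast
  qed
  finally show ?thesis .
  qed
  have yX': "y \<in> X" using r X by simp
  have p_ne: "p ~= Some y" using y(3) r(1) X by (auto simp: pending_def)
  have case_Some: "chords_of (fst ?s') = insert (x, y) ?C \<and> pending ?s' = pending s - {x} \<and> x \<in> pending s" if p: "p = Some x" for x
  proof -
  have move: "point_move y r = split_region X j x y" using p p_ne yX' X by auto
  have xr: "x \<in> fst r" using reg(2)[OF r(1)] X p by (simp add: pend_ok_def)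
  have "x \<in> pending s" using r(1) X p by (force simp: pending_def)
  moreover have "pending ?s' = pending s - {x}"
  proof (intro set_eqI)
   fix t
   have "t \<in> pending ?s' \<longleftrightarrow> (\<exists>r'\<in>set (snd s) - {r}. fst (snd r') = Some t)"
    unfolding pending_def snd_s' move by (auto simp: split_region_def)
   also have "\<dots> \<longleftrightarrow> t \<in> pending s \<and> t ~= x"
   proof
    assume "\<exists>r'\<in>set (snd s) - {r}. fst (snd r') = Some t"
    then obtain r' where r': "r' \<in> set (snd s)" "r' ~= r" "fst (snd r') = Some t" by blast
    then have "t \<in> fst r'" using reg(2)[OF r'(1)] by (simp add: pend_ok_def)
    then have "t ~= x" using uniq[OF r'(1) r(1)] xr r'(2) by blast
    then show "t \<in> pending s \<and> t ~= x" using r' by (auto simp: pending_def)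
   next
    assume t: "t \<in> pending s \<and> t ~= x"
    then obtain r' where r': "r' \<in> set (snd s)" "fst (snd r') = Some t" by (auto simp: pending_def)
    then have "r' ~= r" using t X p by auto
    then show "\<exists>r'\<in>set (snd s) - {r}. fst (snd r') = Some t" using r' by blast
   qed
   finally show "t \<in> pending ?s' \<longleftrightarrow> t \<in> pending s - {x}" by simp
  qed
  moreover have "chords_of (fst ?s') = insert (x, y) ?C" unfolding fst_s' move by (simp add: split_region_def)
  ultimately show ?thesis by blast
  qed
  have case_None: "chords_of (fst ?s') = ?C \<and> pending ?s' = insert y (pending s)" if p: "p = None"
  proof -
  have move: "point_move y r = ({}, [(X, Some y, j)])" using p yX' X by auto
  have "t \<in> pending ?s' \<longleftrightarrow> t \<in> insert y (pending s)" for t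
  proof -
   have "t \<in> pending ?s' \<longleftrightarrow> (\<exists>r'\<in>set (snd s) - {r}. fst (snd r') = Some t) \<or> t = y"
    unfolding pending_def snd_s' move by auto
   also have "(\<exists>r'\<in>set (snd s) - {r}. fst (snd r') = Some t) \<longleftrightarrow> t \<in> pending s"
    using p X by (auto simp: pending_def)
   finally show ?thesis by blast
  qed
  then have "pending ?s' = insert y (pending s)" by blast
  moreover have "chords_of (fst ?s') = ?C" unfolding fst_s' move by simp
  ultimately show ?thesis by blast
  qed
  have inj: "root_vertex n a = root_vertex n b \<longleftrightarrow> a = b" if "a \<in> pending s" "b \<in> pending s" for a b
  using vertex_inj[of a n b] pend that by (simp add: root_vertex_circ)
  show "M \<union> {closed_segment z (root_vertex n y)} = vertex_chord n ` chords_of (fst ?s') \<and>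
   F - {z} = root_vertex n ` pending ?s'" if z: "joinable n M F (root_vertex n y) z"
  proof -
  obtain x where x: "x \<in> pending s" "z = root_vertex n x" using z unfolding joinable_def F by blast
  then have "p = Some x" using join z by blast
  note * = case_Some[OF this]
  have "F - {z} = root_vertex n ` (pending s - {x})"
   unfolding F x(2) using inj x(1) by auto
  then show ?thesis using * rv[of x] unfolding M x(2) by auto
  qed
  show "M = vertex_chord n ` chords_of (fst ?s') \<and> F \<union> {root_vertex n y} = root_vertex n ` pending ?s'"
  if no: "\<nexists>z. joinable n M F (root_vertex n y) z"
  proof (cases p)
  case None
  then show ?thesis using case_None M F by simp
  next
  case (Some x)
  then show ?thesis using case_Some[OF Some] join[of x] no by blast
  qed
  show "ends (chords_of (fst ?s')) \<union> pending ?s' \<subseteq> insert y (ends ?C \<union> pending s)"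
  proof (cases p)
  case None
  then show ?thesis using case_None by auto
  next
  case (Some x)
  note * = case_Some[OF Some]
  have "ends (insert (x, y) ?C) = {x, y} \<union> ends ?C" by (auto simp: ends_def)
  then show ?thesis using * by auto
  qed
qed

text \<open>For the finitely many first draws, which are neither equal nor neighbours, the construction agrees with
  the point model. Later choices between several free vertices do not affect this part.\<close>

lemma matching_run_prefix:
  assumes run: "matching_run n \<sigma> M F" and n: "length ds \<le> n" "set ds \<subseteq> {..<n}" "distinct ds"
  and \<sigma>: "\<And>k. k < length ds ==> \<sigma> (Suc k) mod n = ds ! k"
  and dia: "\<And>x y. x \<in> set ds ==> y \<in> set ds ==> x ~= y ==> vertex_chord n (x, y) \<in> diagonals n"
  shows "M (length ds) = vertex_chord n ` chords_of (fst (run point_move ds (start {..<n})))"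
proof -
  define s where "s k = run point_move (take k ds) (start {..<n})" for k
  have "M k = vertex_chord n ` chords_of (fst (s k)) \<and> F k = root_vertex n ` pending (s k) \<and>
   ends (chords_of (fst (s k))) \<union> pending (s k) \<subseteq> set (take k ds)" if "k \<le> length ds" for k
  using that
  proof (induction k)
  case 0
  then show ?case using run by (auto simp: s_def start_def matching_run_def pending_def)
  next
  case (Suc k)
  define y where "y = ds ! k"
  have k: "k < length ds" "k < n" using Suc.prems n(1) by auto
  have take: "take (Suc k) ds = take k ds @ [y]" using k by (simp add: take_Suc_conv_app_nth y_def)
  have s_Suc: "s (Suc k) = step point_move y (s k)" unfolding s_def take by simp
  have IH: "M k = vertex_chord n ` chords_of (fst (s k))" "F k = root_vertex n ` pending (s k)"
   "ends (chords_of (fst (s k))) \<union> pending (s k) \<subseteq> set (take k ds)" using Suc by auto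
  have "distinct (take k ds @ [y])" using n(3) unfolding take[symmetric] by (rule distinct_take)
  then have y_new: "y \<notin> set (take k ds)" by simp
  have y_in: "y \<in> set ds" using k by (simp add: y_def)
  have cons: "consistent {..<n} (s k)" unfolding s_def by (rule consistent_run[OF point_move_proper consistent_start])
  have rv: "root_vertex n (\<sigma> (Suc k)) = root_vertex n y"
   using root_vertex_mod[of n "\<sigma> (Suc k)"] \<sigma>[OF k(1)] k(2) by (simp add: y_def)
  have dia': "vertex_chord n (x, y) \<in> diagonals n" if "x \<in> pending (s k)" for x
   using dia[of x y] that IH(3) y_new y_in set_take_subset[of k ds] by blast
  have y3: "y < n" "y \<notin> ends (chords_of (fst (s k)))" "y \<notin> pending (s k)"
   using y_in n(2) y_new IH(3) by blast+
  note step = matching_step[OF cons y3 dia' IH(1,2), folded s_Suc]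
  have "let y = root_vertex n (\<sigma> (Suc k)) in
    (\<exists>x. joinable n (M (Suc k - 1)) (F (Suc k - 1)) y x \<and>
       M (Suc k) = M (Suc k - 1) \<union> {closed_segment x y} \<and> F (Suc k) = F (Suc k - 1) - {x})
   \<or> ((\<nexists>x. joinable n (M (Suc k - 1)) (F (Suc k - 1)) y x) \<and>
       M (Suc k) = M (Suc k - 1) \<and> F (Suc k) = F (Suc k - 1) \<union> {y})"
   using run k(2) unfolding matching_run_def by (metis Suc_leI atLeastAtMost_iff le_add1 plus_1_eq_Suc)
  then have "(\<exists>x. joinable n (M k) (F k) (root_vertex n y) x \<and>
       M (Suc k) = M k \<union> {closed_segment x (root_vertex n y)} \<and> F (Suc k) = F k - {x})
   \<or> ((\<nexists>x. joinable n (M k) (F k) (root_vertex n y) x) \<and>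
       M (Suc k) = M k \<and> F (Suc k) = F k \<union> {root_vertex n y})"
   unfolding rv Let_def diff_Suc_1 .
  then have "M (Suc k) = vertex_chord n ` chords_of (fst (s (Suc k))) \<and> F (Suc k) = root_vertex n ` pending (s (Suc k))"
  proof
   assume "\<exists>x. joinable n (M k) (F k) (root_vertex n y) x \<and>
       M (Suc k) = M k \<union> {closed_segment x (root_vertex n y)} \<and> F (Suc k) = F k - {x}"
   then obtain x where x: "joinable n (M k) (F k) (root_vertex n y) x"
    "M (Suc k) = M k \<union> {closed_segment x (root_vertex n y)}" "F (Suc k) = F k - {x}" by (elim exE conjE)
   show ?thesis unfolding x(2,3) by (rule step(1)[OF _ x(1)])
  next
   assume none: "(\<nexists>x. joinable n (M k) (F k) (root_vertex n y) x) \<and>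
       M (Suc k) = M k \<and> F (Suc k) = F k \<union> {root_vertex n y}"
   note x = conjunct1[OF none] conjunct1[OF conjunct2[OF none]] conjunct2[OF conjunct2[OF none]]
   show ?thesis unfolding x(2,3) by (rule step(2)[OF _ x(1)])
  qed
  moreover have "ends (chords_of (fst (s (Suc k)))) \<union> pending (s (Suc k)) \<subseteq> set (take (Suc k) ds)"
   using step(3) IH(3) unfolding take by auto
  ultimately show ?case by blast
  qed
  from this[of "length ds"] show ?thesis by (simp add: s_def)
qed

lemma matching_run_diagonals:
  assumes run: "matching_run n \<sigma> M F" and "k \<le> n"
  shows "M k \<subseteq> diagonals n" "\<And>c d. c \<in> M k ==> d \<in> M k ==> c ~= d ==> c \<inter> d = {}" "\<And>i. i \<le> k ==> M i \<subseteq> M k"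
proof -
  have "M k \<subseteq> diagonals n \<and> (\<forall>c\<in>M k. \<forall>d\<in>M k. c ~= d --> c \<inter> d = {}) \<and> (\<forall>i\<le>k. M i \<subseteq> M k)"
  using assms(2)
  proof (induction k)
  case 0
  then show ?case using run by (simp add: matching_run_def)
  next
  case (Suc k)
  have "Suc k \<in> {1..n}" using Suc.prems by simp
  then have "(\<exists>x. joinable n (M k) (F k) (root_vertex n (\<sigma> (Suc k))) x \<and>
    M (Suc k) = M k \<union> {closed_segment x (root_vertex n (\<sigma> (Suc k)))}) \<or> M (Suc k) = M k"
   using run unfolding matching_run_def Let_def by (metis diff_Suc_1)
  then consider c where "c \<in> diagonals n" "\<forall>d\<in>M k. c \<inter> d = {}" "M (Suc k) = insert c (M k)" | "M (Suc k) = M k"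
   unfolding joinable_def by auto
  then show ?case
  proof cases
   case 1
   then show ?thesis using Suc by (auto simp: le_Suc_eq)
  next
   case 2
   then show ?thesis using Suc by (auto simp: le_Suc_eq)
  qed
  qed
  then show "M k \<subseteq> diagonals n" "\<And>c d. c \<in> M k ==> d \<in> M k ==> c ~= d ==> c \<inter> d = {}" "\<And>i. i \<le> k ==> M i \<subseteq> M k"
  by blast+
qed

section \<open>A uniform permutation from independent uniform points\<close>

definition push :: "'a => 'a list => 'a list" where
  "push v l = (if v \<in> set l then l else l @ [v])"

definition fill_up :: "'a set => 'a list => 'a list pmf" where
  "fill_up A l = map_pmf ((@) l) (pmf_of_set (permutations_of_set (A - set l)))"

text \<open>A repeated point is ignored, a new one is the next entry of a uniform permutation.\<close>

lemma fill_up_push: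
  assumes A: "finite A" "A ~= {}"
  shows "pmf_of_set A \<bind> (\<lambda>v. fill_up A (push v l)) = fill_up A l"
proof (cases "A \<subseteq> set l")
  case True
  have "pmf_of_set A \<bind> (\<lambda>v. fill_up A (push v l)) = pmf_of_set A \<bind> (\<lambda>v. fill_up A l)"
  using True A by (intro bind_pmf_cong) (auto simp: push_def)
  then show ?thesis by simp
next
  case False
  define T where "T = A - set l"
  have T: "finite T" "T ~= {}" "T \<subseteq> A" using False A by (auto simp: T_def)
  have "fill_up A (l @ [v]) = map_pmf (\<lambda>xs. l @ v # xs) (pmf_of_set (permutations_of_set (T - {v})))" for v
  proof -
  have "A - set (l @ [v]) = T - {v}" by (auto simp: T_def)
  then show ?thesis by (simp add: fill_up_def) (intro map_pmf_cong refl, simp)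
  qed
  then have fill: "fill_up A l = pmf_of_set T \<bind> (\<lambda>v. fill_up A (l @ [v]))"
  unfolding fill_up_def[of A l] T_def[symmetric] random_permutation_of_set[OF T(1,2)]
  by (simp add: map_pmf_def bind_assoc_pmf bind_return_pmf)
  have "pmf_of_set A \<bind> (\<lambda>v. fill_up A (push v l)) = pmf_of_set T \<bind> (\<lambda>v. fill_up A (l @ [v]))"
  proof (rule bind_pmf_of_set_reject[OF A(1) T(3,2)])
  show "fill_up A (push v l) = (if v \<in> T then fill_up A (l @ [v]) else pmf_of_set T \<bind> (\<lambda>v. fill_up A (l @ [v])))"
   if "v \<in> A" for v
   unfolding fill[symmetric] using that by (auto simp: T_def push_def)
  qed
  then show ?thesis unfolding fill .
qed

lemma fill_up_replicate:
  assumes A: "finite A" "A ~= {}"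
  shows "replicate_pmf N (pmf_of_set A) \<bind> (\<lambda>ds. fill_up A (fold push ds l)) = fill_up A l"
proof (induction N arbitrary: l)
  case 0
  then show ?case by (simp add: bind_return_pmf)
next
  case (Suc N)
  have "replicate_pmf (Suc N) (pmf_of_set A) \<bind> (\<lambda>ds. fill_up A (fold push ds l)) =
   pmf_of_set A \<bind> (\<lambda>v. replicate_pmf N (pmf_of_set A) \<bind> (\<lambda>ds. fill_up A (fold push ds (push v l))))"
  by (simp add: replicate_pmf.simps bind_assoc_pmf bind_return_pmf)
  then show ?case using Suc fill_up_push[OF A] by simp
qed

lemma fill_up_Nil: "fill_up A [] = pmf_of_set (permutations_of_set A)"
proof -
  have "(@) [] = (\<lambda>xs :: 'a list. xs)" by auto
  then show ?thesis by (simp add: fill_up_def)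
qed

lemma fold_push_distinct: "distinct (l @ ds) ==> fold push ds l = l @ ds"
proof (induction ds arbitrary: l)
  case (Cons v ds)
  then show ?case using Cons.IH[of "l @ [v]"] by (simp add: push_def)
qed simp

lemma fold_push_extends: "\<exists>r. fold push ds l = l @ r"
proof (induction ds arbitrary: l)
  case (Cons v ds)
  obtain r where "fold push ds (push v l) = push v l @ r" using Cons by blast
  moreover have "\<exists>r'. push v l = l @ r'" by (simp add: push_def)
  ultimately show ?case by auto
qed simp

text \<open>The vertices are numbered from 0 in the list and from 1 in the permutation; vertex 0 is vertex \<open>n\<close>.\<close>

definition to_perm :: "nat => nat list => nat => nat" where
  "to_perm n l k = (if k \<in> {1..n} then (if l ! (k - 1) = 0 then n else l ! (k - 1)) else k)"

lemma bij_to_perm: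
  "bij_betw (to_perm n) (permutations_of_set {..<n}) {\<sigma>. \<sigma> permutes {1..n}}"
proof (rule bij_betw_byWitness[where f' = "\<lambda>\<sigma>. map (\<lambda>k. \<sigma> (Suc k) mod n) [0..<n]"])
  have mem: "set l = {..<n}" "distinct l" "length l = n" if "l \<in> permutations_of_set {..<n}" for l
  using that length_finite_permutations_of_set[of l "{..<n}"] by (auto simp: permutations_of_set_def)
  have lt: "l ! k < n" if "l \<in> permutations_of_set {..<n}" "k < n" for l k
  using mem[OF that(1)] that(2) nth_mem[of k l] by auto
  show "\<forall>l\<in>permutations_of_set {..<n}. map (\<lambda>k. to_perm n l (Suc k) mod n) [0..<n] = l"
  proof
  fix l assume l: "l \<in> permutations_of_set {..<n}"
  show "map (\<lambda>k. to_perm n l (Suc k) mod n) [0..<n] = l"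
   by (rule nth_equalityI) (use mem[OF l] lt[OF l] in \<open>auto simp: to_perm_def\<close>)
  qed
  show "\<forall>\<sigma>\<in>{\<sigma>. \<sigma> permutes {1..n}}. to_perm n (map (\<lambda>k. \<sigma> (Suc k) mod n) [0..<n]) = \<sigma>"
  proof
  fix \<sigma> assume "\<sigma> \<in> {\<sigma>. \<sigma> permutes {1..n}}"
  then have \<sigma>: "\<sigma> permutes {1..n}" by simp
  show "to_perm n (map (\<lambda>k. \<sigma> (Suc k) mod n) [0..<n]) = \<sigma>"
  proof
   fix k
   show "to_perm n (map (\<lambda>k. \<sigma> (Suc k) mod n) [0..<n]) k = \<sigma> k"
   proof (cases "k \<in> {1..n}")
    case True
    then have "\<sigma> k \<in> {1..n}" using permutes_in_image[OF \<sigma>] by blast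
    then have res: "(if \<sigma> k mod n = 0 then n else \<sigma> k mod n) = \<sigma> k" by (cases "\<sigma> k = n") auto
    have nth: "map (\<lambda>k. \<sigma> (Suc k) mod n) [0..<n] ! (k - 1) = \<sigma> k mod n" using True by (cases k) auto
    show ?thesis unfolding to_perm_def if_P[OF True] nth by (rule res)
   next
    case False
    then show ?thesis using permutes_not_in[OF \<sigma>] by (auto simp: to_perm_def)
   qed
  qed
  qed
  show "to_perm n ` permutations_of_set {..<n} \<subseteq> {\<sigma>. \<sigma> permutes {1..n}}"
  proof (intro image_subsetI CollectI)
  fix l assume l: "l \<in> permutations_of_set {..<n}"
  show "to_perm n l permutes {1..n}"
  proof (rule bij_imp_permutes)
   have sub: "to_perm n l ` {1..n} \<subseteq> {1..n}"
   proof (rule image_subsetI)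
    fix k assume k: "k \<in> {1..n}"
    then have "l ! (k - 1) < n" by (intro lt[OF l]) auto
    then show "to_perm n l k \<in> {1..n}" using k by (auto simp: to_perm_def)
   qed
   have inj: "inj_on (to_perm n l) {1..n}"
   proof (rule inj_onI)
    fix a b assume ab: "a \<in> {1..n}" "b \<in> {1..n}" "to_perm n l a = to_perm n l b"
    have "l ! (a - 1) < n" "l ! (b - 1) < n" using ab by (auto intro!: lt[OF l])
    then have "l ! (a - 1) = l ! (b - 1)" using ab by (auto simp: to_perm_def split: if_splits)
    moreover have "a - 1 < length l" "b - 1 < length l" using ab mem(3)[OF l] by auto
    ultimately have "a - 1 = b - 1" using nth_eq_iff_index_eq[OF mem(2)[OF l]] by blast
    then show "a = b" using ab by auto
   qed
   show "bij_betw (to_perm n l) {1..n} {1..n}"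
    unfolding bij_betw_def using inj endo_inj_surj[OF _ sub inj] by simp
  qed (auto simp: to_perm_def)
  qed
  show "(\<lambda>\<sigma>. map (\<lambda>k. \<sigma> (Suc k) mod n) [0..<n]) ` {\<sigma>. \<sigma> permutes {1..n}} \<subseteq> permutations_of_set {..<n}"
  proof (rule image_subsetI)
  fix \<sigma> assume "\<sigma> \<in> {\<sigma>. \<sigma> permutes {1..n}}"
  then have \<sigma>: "\<sigma> permutes {1..n}" by simp
  have inj: "inj_on (\<lambda>k. \<sigma> (Suc k) mod n) {0..<n}"
  proof (rule inj_onI)
   fix a b assume ab: "a \<in> {0..<n}" "b \<in> {0..<n}" "\<sigma> (Suc a) mod n = \<sigma> (Suc b) mod n"
   have "\<sigma> (Suc a) \<in> {1..n}" "\<sigma> (Suc b) \<in> {1..n}" using ab permutes_in_image[OF \<sigma>, of "Suc a"] permutes_in_image[OF \<sigma>, of "Suc b"] by auto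
   then have "\<sigma> (Suc a) = \<sigma> (Suc b)" using ab(3) by (cases "\<sigma> (Suc a) = n"; cases "\<sigma> (Suc b) = n") auto
   then show "a = b" using permutes_inj[OF \<sigma>] by (auto dest: injD)
  qed
  have "(\<lambda>k. \<sigma> (Suc k) mod n) ` {0..<n} = {0..<n}"
   using inj by (intro endo_inj_surj) auto
  then show "map (\<lambda>k. \<sigma> (Suc k) mod n) [0..<n] \<in> permutations_of_set {..<n}"
   using inj by (auto simp: permutations_of_set_def distinct_map lessThan_atLeast0)
  qed
qed

lemma uniform_permutation_from_points:
  assumes "0 < n"
  shows "pmf_of_set {\<sigma>. \<sigma> permutes {1..n}} =
  replicate_pmf N (pmf_of_set {..<n}) \<bind> (\<lambda>ds. map_pmf (to_perm n) (fill_up {..<n} (fold push ds [])))"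
proof -
  have ne: "{..<n} ~= {}" using assms by auto
  have "pmf_of_set {\<sigma>. \<sigma> permutes {1..n}} = map_pmf (to_perm n) (pmf_of_set (permutations_of_set {..<n}))"
  by (rule map_pmf_of_set_bij_betw[OF bij_to_perm, symmetric]) auto
  also have "\<dots> = map_pmf (to_perm n) (replicate_pmf N (pmf_of_set {..<n}) \<bind> (\<lambda>ds. fill_up {..<n} (fold push ds [])))"
  using fill_up_replicate[OF _ ne, of N "[]"] by (simp add: fill_up_Nil)
  finally show ?thesis by (simp add: map_bind_pmf)
qed

lemma fill_up_support:
  assumes "finite A" "distinct ds" "set ds \<subseteq> A" "l \<in> set_pmf (fill_up A (fold push (ds @ ds') []))"
  "distinct (fold push (ds @ ds') [])" "set (fold push (ds @ ds') []) \<subseteq> A"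
  shows "l \<in> permutations_of_set A \<and> take (length ds) l = ds"
proof -
  define l0 where "l0 = fold push (ds @ ds') []"
  obtain r where r: "l0 = ds @ r"
  using fold_push_extends[of ds' ds] fold_push_distinct[of "[]" ds] assms(2) by (auto simp: l0_def)
  have fin: "finite (A - set l0)" using assms(1) by simp
  then obtain xs where xs: "xs \<in> permutations_of_set (A - set l0)" "l = l0 @ xs"
  using assms(4) unfolding fill_up_def l0_def[symmetric] by auto
  then show ?thesis using r assms(5,6) unfolding l0_def[symmetric] by (auto simp: permutations_of_set_def)
qed

lemma fold_push_wf:
  assumes "distinct l" "set l \<subseteq> A" "set ds \<subseteq> A"
  shows "distinct (fold push ds l) \<and> set (fold push ds l) \<subseteq> A"
  using assms
proof (induction ds arbitrary: l)
  case (Cons v ds)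
  show ?case using Cons.IH[of "push v l"] Cons.prems by (auto simp: push_def)
qed simp


section \<open>The almost sure limits along the coupling\<close>

context circle_pairs
begin

definition dp :: "'w => nat => real \<times> real" where
  "dp \<omega> i = (y (2 * i) \<omega>, y (2 * i + 1) \<omega>)"

lemma pairs_dp: "pairs n i \<omega> = rnd2 n (dp \<omega> i)"
  by (simp add: pairs_def dp_def)

lemma good_runs:
  "AE \<omega> in \<Omega>. pair_run (dp \<omega>) \<and> point_run (\<lambda>i. y i \<omega>)"
  using AE_distinct AE_nonzero AE_hits AE_space
proof eventually_elim
  case (elim \<omega>)
  have pos: "y i \<omega> \<in> {0<..<1}" for i
  using y_range[OF elim(4), of i] elim(2)[THEN spec, of i] by auto
  have ne: "y i \<omega> ~= y j \<omega>" if "i ~= j" for i j using elim(1) that by blast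
  have hit: "\<exists>i\<ge>m. y (2 * i) \<omega> \<in> {p<..<q} \<and> y (2 * i + 1) \<omega> \<in> {p<..<q}" if "0 \<le> p" "p < q" "q \<le> 1" for p q m
  using elim(3) that by blast
  have par: "2 * i ~= 2 * j + 1" for i j :: nat by presburger
  have "pair_run (dp \<omega>)"
  by standard (use pos ne hit par in \<open>auto simp: dp_def\<close>)
  moreover have "point_run (\<lambda>i. y i \<omega>)"
  by standard (use pos ne hit in auto)
  ultimately show ?case by blast
qed

lemma pair_filling: "AE \<omega> in \<Omega>. pair_run (dp \<omega>) \<and> filling (real_run.lam pair_move (dp \<omega>))"
  using good_runs AE_pair_not_deep
proof eventually_elim
  case (elim \<omega>)
  then interpret pair_run "dp \<omega>" by blast
  have "filling lam"
  by (rule filling_lam) (use elim(2) in \<open>simp add: pairs_dp\<close>)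
  then show ?case using elim(1) by blast
qed

lemma point_filling: "AE \<omega> in \<Omega>. point_run (\<lambda>i. y i \<omega>) \<and> filling (real_run.lam point_move (\<lambda>i. y i \<omega>))"
  using good_runs AE_point_not_deep
proof eventually_elim
  case (elim \<omega>)
  then interpret point_run "\<lambda>i. y i \<omega>" by blast
  have "filling lam"
  by (rule filling_lam) (use elim(2) in simp)
  then show ?case using elim(1) by blast
qed

end

lemma filling_limit_set:
  assumes "filling L"
  shows "compact (limit_set L)" "limit_set L ~= {}"
  "limit_set L \<subseteq> cball 0 1"
proof -
  have sub: "(\<Union>N. chord_union (L N)) \<subseteq> cball 0 1" using chord_union_subset_disk by blast
  have "bounded (\<Union>N. chord_union (L N))" using bounded_subset[OF bounded_cball sub] .
  then show "compact (limit_set L)" by (simp add: compact_closure)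
  show "limit_set L \<subseteq> cball 0 1" using sub by (simp add: closure_minimal)
  have "\<forall>p q. 0 \<le> p --> p < q --> q \<le> 1 --> (\<exists>N. \<exists>u\<in>ends (L N). p < u \<and> u < q)"
  using assms unfolding filling_def by (elim conjE)
  from this[THEN spec, of 0, THEN spec, of 1] obtain N u where "u \<in> ends (L N)" by auto
  then obtain c where c: "c \<in> L N" by (auto simp: ends_def)
  obtain a b where "c = (a, b)" by (cases c)
  then have "circ a \<in> chord_union (L N)" using c by (intro chord_unionI[of a b]) auto
  then show "limit_set L ~= {}" by auto
qed

lemma dist_to_filling_limit:
  assumes "filling L" "compact A" "A ~= {}" "A \<subseteq> cball 0 1"
  shows "dist (Abs_disk_compact A) (Abs_disk_compact (limit_set L)) =
  hausdorff_dist A (limit_set L)"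
  by (rule dist_Abs_disk_compact[OF assms(2-4) filling_limit_set[OF assms(1)]])

lemma diagonals_union:
  assumes "3 \<le> n" "C \<subseteq> diagonals n" "C ~= {}"
  shows "compact (\<Union>C)" "\<Union>C ~= {}" "\<Union>C \<subseteq> cball 0 1"
proof -
  have fin: "finite C" using finite_subset[OF assms(2) finite_diagonals[OF assms(1)]] .
  have c: "\<exists>k. c = vertex_chord n k" if "c \<in> C" for c using assms(2) that unfolding diagonals_eq[OF assms(1)] by blast
  show "compact (\<Union>C)"
  proof (rule compact_Union[OF fin])
  fix D assume "D \<in> C"
  then obtain k where "D = vertex_chord n k" using c by blast
  then show "compact D" by (simp only: vertex_chord_def compact_segment)
  qed
  show "\<Union>C \<subseteq> cball 0 1"
  proof (rule Union_least)
  fix D assume "D \<in> C"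
  then obtain k where "D = vertex_chord n k" using c by blast
  then show "D \<subseteq> cball 0 1" by (simp add: vertex_chord_def chord_subset_disk)
  qed
  obtain c0 where c0: "c0 \<in> C" using assms(3) by blast
  then obtain k where "c0 = vertex_chord n k" using c by blast
  then have "circ (real (fst k) / real n) \<in> \<Union>C" using c0 by (auto simp: vertex_chord_def)
  then show "\<Union>C ~= {}" by blast
qed

lemma polygon_chords_set:
  assumes "C ~= {}" "C \<subseteq> {..<n} \<times> {..<n}"
  shows "compact (polygon_chords n C)" "polygon_chords n C ~= {}" "polygon_chords n C \<subseteq> cball 0 1"
proof -
  have "finite C" by (rule finite_subset[OF assms(2)]) simp
  then show "compact (polygon_chords n C)" unfolding polygon_chords_def by (intro compact_UN) auto
  obtain a b where "(a, b) \<in> C" using assms(1) by auto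
  then have "circ (real a / real n) \<in> polygon_chords n C" unfolding polygon_chords_def by force
  then show "polygon_chords n C ~= {}" by blast
  show "polygon_chords n C \<subseteq> cball 0 1" unfolding polygon_chords_def using chord_subset_disk by blast
qed

lemma disjoint_not_cross: "c \<inter> d = {} ==> \<not> chords_cross c d"
  unfolding chords_cross_def using open_closed_segment by blast

lemma (in pair_run) triangulations_close:
  assumes fill: "filling lam" and "0 < \<epsilon>"
  shows "eventually (\<lambda>n. \<forall>cs'\<in>set_pmf (let cs = fold (\<lambda>c. try_chord n (vertex_chord n c))
   (map (\<lambda>i. rnd2 n (d i)) [0..<n - 3]) [] in extend_uniformly n (n - 3 - length cs) cs).
  dist (Abs_disk_compact (\<Union>(set cs'))) (Abs_disk_compact (limit_set lam)) \<le> \<epsilon>) sequentially"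
proof -
  obtain N where N: "eventually (\<lambda>n. \<forall>C. C \<subseteq> diagonals n --> vertex_chord n ` rnd2 n ` lam N \<subseteq> C -->
  (\<forall>c\<in>C. \<forall>d\<in>C. c ~= d --> \<not> chords_cross c d) -->
  C ~= {} \<and> hausdorff_dist (\<Union>C) (limit_set lam) \<le> \<epsilon>) sequentially"
  using diagonal_set_close[OF assms] by (elim exE)
  show ?thesis using N greedy_rounded[of N] eventually_ge_at_top[of "N + 3"]
  proof eventually_elim
  case (elim n)
  let ?try = "\<lambda>c. try_chord n (vertex_chord n c)" and ?x = "\<lambda>i. rnd2 n (d i)"
  have n3: "3 \<le> n" using elim(3) by simp
  show ?case
  proof (rule ballI)
   fix cs' assume "cs' \<in> set_pmf (let cs = fold ?try (map ?x [0..<n - 3]) [] in extend_uniformly n (n - 3 - length cs) cs)"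
   then have sup: "noncrossing_diagonals n cs' \<and> set (fold ?try (map ?x [0..<n - 3]) []) \<subseteq> set cs'"
    unfolding Let_def by (intro greedy_support[OF _ refl]) auto
   have grow: "set cs \<subseteq> set (fold ?try ds cs)" for cs ds
   proof (induction ds arbitrary: cs)
    case (Cons c ds)
    have "set cs \<subseteq> set (?try c cs)" by (auto simp: try_chord_def)
    then show ?case using Cons[of "?try c cs"] by simp
   qed simp
   have "[0..<n - 3] = [0..<N] @ [N..<n - 3]" using elim(3) upt_add_eq_append[of 0 N "n - 3 - N"] by simp
   then have "set (fold ?try (map ?x [0..<N]) []) \<subseteq> set (fold ?try (map ?x [0..<n - 3]) [])"
    using grow by simp
   then have sub: "vertex_chord n ` rnd2 n ` lam N \<subseteq> set cs'" using sup elim(2) by blast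
   have dia: "set cs' \<subseteq> diagonals n" using sup by (simp add: noncrossing_diagonals_def)
   have nc: "\<forall>c\<in>set cs'. \<forall>d\<in>set cs'. c ~= d --> \<not> chords_cross c d"
   proof (intro ballI impI)
    fix c d assume cd: "c \<in> set cs'" "d \<in> set cs'" "c ~= d"
    obtain a b where ab: "a < length cs'" "cs' ! a = c" "b < length cs'" "cs' ! b = d"
     using cd(1,2) by (auto simp: in_set_conv_nth)
    have sorted: "\<not> chords_cross (cs' ! j) (cs' ! i)" if "i < j" "j < length cs'" for i j
     using sup that by (auto simp: noncrossing_diagonals_def sorted_wrt_iff_nth_less)
    have "a < b \<or> b < a" using ab cd(3) by (cases a b rule: linorder_cases) auto
    then show "\<not> chords_cross c d" using sorted[of a b] sorted[of b a] ab chords_cross_commute[of c d] by auto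
   qed
   have *: "set cs' ~= {} \<and> hausdorff_dist (\<Union>(set cs')) (limit_set lam) \<le> \<epsilon>"
    by (rule elim(1)[THEN spec, THEN mp, THEN mp, THEN mp, OF dia sub nc])
   show "dist (Abs_disk_compact (\<Union>(set cs'))) (Abs_disk_compact (limit_set lam)) \<le> \<epsilon>"
    using * dist_to_filling_limit[OF fill diagonals_union[OF n3 dia]] by simp
  qed
  qed
qed

lemma (in real_run) completions_close:
  assumes fill: "filling lam" and "0 < \<epsilon>" and proper': "\<And>x r. pend_ok r ==> proper_move r (S' x r)"
  shows "eventually (\<lambda>n. \<forall>A\<in>set_pmf (completion (run S' (map (\<lambda>i. \<psi> (rnd n) (d i)) [0..<n]) (start {..<n}))).
  dist (Abs_disk_compact (polygon_chords n (chords_of A))) (Abs_disk_compact (limit_set lam)) \<le> \<epsilon>) sequentially"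
proof -
  have "\<exists>N. eventually (\<lambda>n. \<forall>C. confined (run S' (map (\<lambda>i. \<psi> (rnd n) (d i)) [0..<N]) (start {..<n})) C -->
  C ~= {} \<and> C \<subseteq> {..<n} \<times> {..<n} \<and> hausdorff_dist (polygon_chords n C) (limit_set lam) \<le> \<epsilon>) sequentially"
  by (rule confined_close[OF fill assms(2)]) (rule proper')
  then obtain N where N: "eventually (\<lambda>n. \<forall>C. confined (run S' (map (\<lambda>i. \<psi> (rnd n) (d i)) [0..<N]) (start {..<n})) C -->
  C ~= {} \<and> C \<subseteq> {..<n} \<times> {..<n} \<and> hausdorff_dist (polygon_chords n C) (limit_set lam) \<le> \<epsilon>) sequentially"
  by (elim exE)
  show ?thesis using N eventually_ge_at_top[of N]
  proof eventually_elim
  case (elim n)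
  let ?x = "\<lambda>i. \<psi> (rnd n) (d i)"
  show ?case
  proof (rule ballI)
   fix A assume A: "A \<in> set_pmf (completion (run S' (map ?x [0..<n]) (start {..<n})))"
   have cons: "consistent {..<n} (run S' ds (start {..<n}))" for ds by (rule consistent_run[OF proper' consistent_start])
   have reg: "finite (fst r) \<and> pend_ok r" if r: "r \<in> set (snd (run S' (map ?x [0..<n]) (start {..<n})))" for r
   proof -
    have "\<forall>r\<in>set (snd (run S' (map ?x [0..<n]) (start {..<n}))).
      fst r \<subseteq> {..<n} - ends (chords_of (fst (run S' (map ?x [0..<n]) (start {..<n})))) \<and> pend_ok r"
     using cons[of "map ?x [0..<n]"] unfolding consistent_def by (elim conjE)
    from bspec[OF this r] show ?thesis by (auto intro: finite_subset[of _ "{..<n}"])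
   qed
   have "confined (run S' (map ?x [0..<n]) (start {..<n})) (chords_of A)"
    by (rule completion_confined[OF reg A])
   moreover have "[0..<n] = [0..<N] @ [N..<n]" using elim(2) upt_add_eq_append[of 0 N "n - N"] by simp
   ultimately have later: "confined (run S' (map ?x [N..<n]) (run S' (map ?x [0..<N]) (start {..<n}))) (chords_of A)" by simp
   have conf: "confined (run S' (map ?x [0..<N]) (start {..<n})) (chords_of A)"
    by (rule confined_run[OF _ cons later]) (rule proper')
   from elim(1)[THEN spec, THEN mp, OF conf]
   have *: "chords_of A ~= {}" "chords_of A \<subseteq> {..<n} \<times> {..<n}"
    "hausdorff_dist (polygon_chords n (chords_of A)) (limit_set lam) \<le> \<epsilon>" by auto
   show "dist (Abs_disk_compact (polygon_chords n (chords_of A))) (Abs_disk_compact (limit_set lam)) \<le> \<epsilon>"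
    using *(3) dist_to_filling_limit[OF fill polygon_chords_set[OF *(1,2)]] by simp
  qed
  qed
qed

lemma (in point_run) matchings_close:
  assumes fill: "filling lam" and "0 < \<epsilon>"
  and run: "\<And>n \<sigma>. n \<ge> 3 ==> \<sigma> permutes {1..n} ==> matching_run n \<sigma> (M n \<sigma>) (F n \<sigma>)"
  shows "eventually (\<lambda>n. \<forall>\<sigma>\<in>set_pmf (map_pmf (to_perm n) (fill_up {..<n} (fold push (map (\<lambda>i. rnd n (x i)) [0..<n]) []))).
  dist (Abs_disk_compact (\<Union>(M n \<sigma> n))) (Abs_disk_compact (limit_set lam)) \<le> \<epsilon>) sequentially"
proof -
  obtain N where N: "eventually (\<lambda>n. \<forall>C. C \<subseteq> diagonals n --> vertex_chord n ` rnd2 n ` lam N \<subseteq> C -->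
  (\<forall>c\<in>C. \<forall>d\<in>C. c ~= d --> \<not> chords_cross c d) -->
  C ~= {} \<and> hausdorff_dist (\<Union>C) (limit_set lam) \<le> \<epsilon>) sequentially"
  using diagonal_set_close[OF assms(1,2)] by (elim exE)
  have dia: "eventually (\<lambda>n. \<forall>i\<in>{..<N}. \<forall>j\<in>{..<N}. i ~= j --> rnd n (x i) ~= rnd n (x j) \<and>
   vertex_chord n (rnd n (x i), rnd n (x j)) \<in> diagonals n) sequentially"
  proof (intro eventually_ball_finite ballI finite_lessThan)
  fix i j
  show "eventually (\<lambda>n. i ~= j --> rnd n (x i) ~= rnd n (x j) \<and>
   vertex_chord n (rnd n (x i), rnd n (x j)) \<in> diagonals n) sequentially"
  proof (cases "i = j")
   case False
   from eventually_rounded_diagonal[OF x_range x_range x_distinct[OF this]] show ?thesis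
    by eventually_elim simp
  qed simp
  qed
  have match: "eventually (\<lambda>n. \<exists>D. {} \<subseteq> D \<and> strict_mono_on D (rnd n) \<and>
  state_match (rnd n) D (st N) (run point_move (map (\<lambda>i. rnd n (x i)) [0..<N]) (start {..<n}))) sequentially"
  by (rule rounded_run) auto
  show ?thesis using N dia match eventually_ge_at_top[of "N + 3"]
  proof eventually_elim
  case (elim n)
  let ?ds = "map (\<lambda>i. rnd n (x i)) [0..<N]"
  have n: "3 \<le> n" "N \<le> n" using elim(4) by auto
  have rl: "rnd n (x i) < n" for i using x_range[of i] n by (intro rnd_less) auto
  have "inj_on (\<lambda>i. rnd n (x i)) {0..<N}"
  proof (rule inj_onI, rule ccontr)
   fix i j assume "i \<in> {0..<N}" "j \<in> {0..<N}" "rnd n (x i) = rnd n (x j)" "i ~= j"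
   then show False using elim(2) by auto
  qed
  then have dist: "distinct ?ds" by (simp add: distinct_map)
  have sub: "set ?ds \<subseteq> {..<n}" using rl by auto
  show ?case
  proof (rule ballI)
   fix \<sigma> assume "\<sigma> \<in> set_pmf (map_pmf (to_perm n) (fill_up {..<n} (fold push (map (\<lambda>i. rnd n (x i)) [0..<n]) [])))"
   then obtain l where l: "l \<in> set_pmf (fill_up {..<n} (fold push (map (\<lambda>i. rnd n (x i)) [0..<n]) []))" "\<sigma> = to_perm n l"
    by auto
   have "[0..<n] = [0..<N] @ [N..<n]" using n(2) upt_add_eq_append[of 0 N "n - N"] by simp
   then have split: "map (\<lambda>i. rnd n (x i)) [0..<n] = ?ds @ map (\<lambda>i. rnd n (x i)) [N..<n]" by simp
   have wf: "distinct (fold push (?ds @ map (\<lambda>i. rnd n (x i)) [N..<n]) []) \<and>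
     set (fold push (?ds @ map (\<lambda>i. rnd n (x i)) [N..<n]) []) \<subseteq> {..<n}"
    by (rule fold_push_wf) (use rl in auto)
   have lp: "l \<in> permutations_of_set {..<n} \<and> take (length ?ds) l = ?ds"
    by (rule fill_up_support[OF _ dist sub l(1)[unfolded split] conjunct1[OF wf] conjunct2[OF wf]]) simp
   have \<sigma>: "\<sigma> permutes {1..n}" using bij_betw_apply[OF bij_to_perm] lp l(2) by blast
   note mr = run[OF n(1) \<sigma>]
   have len: "length l = n" using lp length_finite_permutations_of_set[of l "{..<n}"] by simp
   have \<sigma>_nth: "\<sigma> (Suc k) mod n = ?ds ! k" if k: "k < length ?ds" for k
   proof -
    have "?ds ! k = l ! k" using lp k by (metis nth_take)
    moreover have "?ds ! k < n" using k rl by simp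
    ultimately show ?thesis using k n(2) by (simp add: l(2) to_perm_def)
   qed
   have pre: "M n \<sigma> (length ?ds) = vertex_chord n ` chords_of (fst (run point_move ?ds (start {..<n})))"
   proof (rule matching_run_prefix[OF mr _ sub dist \<sigma>_nth])
    show "length ?ds \<le> n" using n(2) by simp
    fix a b assume ab: "a \<in> set ?ds" "b \<in> set ?ds" "a ~= b"
    then obtain i j where ij: "i < N" "j < N" "a = rnd n (x i)" "b = rnd n (x j)" by auto
    then have "i ~= j" using ab(3) by auto
    then show "vertex_chord n (a, b) \<in> diagonals n" using elim(2) ij by simp
   qed
   have chords: "chords_of (fst (run point_move ?ds (start {..<n}))) = rnd2 n ` lam N"
    using elim(3) by (auto simp: state_match_def lam_def)
   note md = matching_run_diagonals[OF mr order_refl]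
   have incl: "vertex_chord n ` rnd2 n ` lam N \<subseteq> M n \<sigma> n"
    using pre md(3)[of "length ?ds"] n(2) unfolding chords by simp
   have nc: "\<forall>c\<in>M n \<sigma> n. \<forall>d\<in>M n \<sigma> n. c ~= d --> \<not> chords_cross c d"
    by (intro ballI impI disjoint_not_cross, rule md(2))
   have *: "M n \<sigma> n ~= {} \<and> hausdorff_dist (\<Union>(M n \<sigma> n)) (limit_set lam) \<le> \<epsilon>"
    by (rule elim(1)[THEN spec, THEN mp, THEN mp, THEN mp, OF md(1) incl nc])
   show "dist (Abs_disk_compact (\<Union>(M n \<sigma> n))) (Abs_disk_compact (limit_set lam)) \<le> \<epsilon>"
    using * dist_to_filling_limit[OF fill diagonals_union[OF n(1) md(1)]] by simp
  qed
  qed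
qed

section \<open>Convergence in distribution\<close>

context circle_pairs
begin

abbreviation limit :: "'w => disk_compact" where
  "limit \<omega> \<equiv> Abs_disk_compact (L_inf (\<lambda>i. U i \<omega>) (\<lambda>i. V i \<omega>))"

lemma limit_eq:
  assumes "pair_run (dp \<omega>)" "\<omega> \<in> space \<Omega>"
  shows "limit \<omega> = Abs_disk_compact (closure (\<Union>N. chord_union (real_run.lam pair_move (dp \<omega>) N)))"
proof -
  interpret pair_run "dp \<omega>" by (rule assms(1))
  have "L_inf (\<lambda>i. U i \<omega>) (\<lambda>i. V i \<omega>) = limit_set lam"
  proof (rule L_inf_eq_lam)
  show "U (Suc i) \<omega> = circ (fst (dp \<omega> i))" "V (Suc i) \<omega> = circ (snd (dp \<omega> i))" for i
   unfolding dp_def fst_conv snd_conv circ_y[OF assms(2)] pt_eq by simp_all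
  qed
  then show ?thesis by simp
qed

lemma kernel_converges:
  fixes f :: "disk_compact => real" and Z :: "nat => 'w => 'e" and K :: "nat => 'e => 'b pmf"
  assumes f: "continuous_on UNIV f" "\<And>x. \<bar>f x\<bar> \<le> B"
  and Z: "\<And>n. 0 < n ==> Z n \<in> \<Omega> \<rightarrow>\<^sub>M count_space UNIV" "\<And>n. 0 < n ==> distr \<Omega> (count_space UNIV) (Z n) = measure_pmf (p n)"
  and q: "\<And>n. 0 < n ==> bind_pmf (p n) (K n) = q n"
  and close: "AE \<omega> in \<Omega>. \<forall>\<epsilon>>0. eventually (\<lambda>n. \<forall>b\<in>set_pmf (K n (Z n \<omega>)). dist (G n b) (Y \<omega>) \<le> \<epsilon>) sequentially"
  defines "\<Phi> \<equiv> \<lambda>n \<omega>. \<integral>b. f (G n b) \<partial>measure_pmf (K n (Z n \<omega>))"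
  shows "\<And>n. 0 < n ==> \<Phi> n \<in> borel_measurable \<Omega>"
  and "\<And>n. 0 < n ==> (\<integral>\<omega>. \<Phi> n \<omega> \<partial>\<Omega>) = (\<integral>b. f (G n b) \<partial>measure_pmf (q n))"
  and "AE \<omega> in \<Omega>. (\<lambda>n. \<Phi> n \<omega>) \<longlonglongrightarrow> f (Y \<omega>)" and "\<And>n \<omega>. \<bar>\<Phi> n \<omega>\<bar> \<le> B"
proof -
  show "\<Phi> n \<in> borel_measurable \<Omega>" if "0 < n" for n
  unfolding \<Phi>_def by (rule kernel_integral(1)[OF f(2) Z(1)[OF that] Z(2)[OF that]])
  show "(\<integral>\<omega>. \<Phi> n \<omega> \<partial>\<Omega>) = (\<integral>b. f (G n b) \<partial>measure_pmf (q n))" if "0 < n" for n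
  unfolding \<Phi>_def q[OF that, symmetric] by (rule kernel_integral(2)[OF f(2) Z(1)[OF that] Z(2)[OF that]])
  show "\<bar>\<Phi> n \<omega>\<bar> \<le> B" for n \<omega> unfolding \<Phi>_def by (rule pmf_integral_bounded[OF f(2)])
  show "AE \<omega> in \<Omega>. (\<lambda>n. \<Phi> n \<omega>) \<longlonglongrightarrow> f (Y \<omega>)"
  using close
  proof eventually_elim
  case (elim \<omega>)
  show ?case unfolding \<Phi>_def by (rule kernel_limit[OF f]) (use elim in blast)
  qed
qed

lemma integral_limit_from_kernel:
  fixes f :: "disk_compact => real" and \<Phi> :: "nat => 'w => real"
  assumes f: "continuous_on UNIV f"
  and \<Phi>: "\<And>n. 0 < n ==> \<Phi> n \<in> borel_measurable \<Omega>" "\<And>n. 0 < n ==> (\<integral>\<omega>. \<Phi> n \<omega> \<partial>\<Omega>) = I n"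
   "AE \<omega> in \<Omega>. (\<lambda>n. \<Phi> n \<omega>) \<longlonglongrightarrow> f (limit \<omega>)" "\<And>n \<omega>. \<bar>\<Phi> n \<omega>\<bar> \<le> B"
  shows "I \<longlonglongrightarrow> (\<integral>\<omega>. f (limit \<omega>) \<partial>\<Omega>)"
proof -
  have "(\<lambda>\<omega>. f (limit \<omega>)) \<in> borel_measurable \<Omega>"
  using L_inf_measurable borel_measurable_continuous_onI[OF f] by (rule measurable_compose)
  from tendsto_integral_bounded[of 1 \<Phi>, OF _ this \<Phi>(4,3)] \<Phi>(1)
  have "(\<lambda>n. \<integral>\<omega>. \<Phi> n \<omega> \<partial>\<Omega>) \<longlonglongrightarrow> (\<integral>\<omega>. f (limit \<omega>) \<partial>\<Omega>)" by simp
  moreover have "eventually (\<lambda>n. (\<integral>\<omega>. \<Phi> n \<omega> \<partial>\<Omega>) = I n) sequentially"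
  using eventually_gt_at_top[of 0] by eventually_elim (rule \<Phi>(2))
  ultimately show ?thesis by (rule Lim_transform_eventually)
qed

theorem triangulations_converge:
  fixes f :: "disk_compact => real"
  assumes f: "continuous_on UNIV f" "bounded (range f)"
  shows "(\<lambda>n. \<integral>cs. f (Abs_disk_compact (\<Union>(set cs))) \<partial>measure_pmf (random_diagonals n (n - 3))) \<longlonglongrightarrow>
  (\<integral>\<omega>. f (limit \<omega>) \<partial>\<Omega>)"
proof -
  obtain B where B: "\<And>x. \<bar>f x\<bar> \<le> B" using f(2) by (auto simp: bounded_iff)
  let ?K = "\<lambda>n ds. let cs = fold (\<lambda>c. try_chord n (vertex_chord n c)) ds [] in extend_uniformly n (n - 3 - length cs) cs"
  let ?Z = "\<lambda>n \<omega>. map (\<lambda>i. pairs n (0 + i) \<omega>) [0..<n - 3]"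
  have close: "AE \<omega> in \<Omega>. \<forall>\<epsilon>>0. eventually (\<lambda>n. \<forall>b\<in>set_pmf (?K n (?Z n \<omega>)).
   dist (Abs_disk_compact (\<Union>(set b))) (limit \<omega>) \<le> \<epsilon>) sequentially"
  using pair_filling AE_space
  proof eventually_elim
  case (elim \<omega>)
  interpret pair_run "dp \<omega>" using elim(1) by blast
  show ?case
   unfolding limit_eq[OF conjunct1[OF elim(1)] elim(2)] add_0 pairs_dp
   by (intro allI impI, rule triangulations_close[OF conjunct2[OF elim(1)]])
  qed
  show ?thesis
  by (rule integral_limit_from_kernel[OF f(1) kernel_converges[OF f(1) B pair_list_law(1) pair_list_law(2)
    random_diagonals_greedy[symmetric] close]]) auto
qed

text \<open>The tree law seen through its representation by pairs; it is the bridge to the point model.\<close>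

theorem tree_converges:
  fixes f :: "disk_compact => real"
  assumes f: "continuous_on UNIV f" "bounded (range f)"
  shows "(\<lambda>n. \<integral>A. f (Abs_disk_compact (polygon_chords n (chords_of A))) \<partial>measure_pmf (region_law ({..<n}, None, 0))) \<longlonglongrightarrow>
  (\<integral>\<omega>. f (limit \<omega>) \<partial>\<Omega>)"
proof -
  obtain B where B: "\<And>x. \<bar>f x\<bar> \<le> B" using f(2) by (auto simp: bounded_iff)
  let ?K = "\<lambda>n ds. completion (run pair_move ds (start {..<n}))"
  let ?Z = "\<lambda>n \<omega>. map (\<lambda>i. pairs n (0 + i) \<omega>) [0..<n]"
  have close: "AE \<omega> in \<Omega>. \<forall>\<epsilon>>0. eventually (\<lambda>n. \<forall>b\<in>set_pmf (?K n (?Z n \<omega>)).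
   dist (Abs_disk_compact (polygon_chords n (chords_of b))) (limit \<omega>) \<le> \<epsilon>) sequentially"
  using pair_filling AE_space
  proof eventually_elim
  case (elim \<omega>)
  interpret pair_run "dp \<omega>" using elim(1) by blast
  show ?case
   unfolding limit_eq[OF conjunct1[OF elim(1)] elim(2)] add_0 pairs_dp
   by (intro allI impI, rule completions_close[OF conjunct2[OF elim(1)]], assumption) (rule pair_move_proper)
  qed
  have law: "replicate_pmf n (pmf_of_set ({..<n} \<times> {..<n})) \<bind> ?K n = region_law ({..<n}, None, 0)" if "0 < n" for n :: nat
  by (rule completion_pair_run) (use that in auto)
  show ?thesis
  by (rule integral_limit_from_kernel[OF f(1) kernel_converges[OF f(1) B pair_list_law(1) pair_list_law(2) law close]]) auto
qed

text \<open>The two kernels are coupled by the same points and have the same random limit, so the difference of the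
  expectations vanishes, and the second kernel has the tree law.\<close>

theorem matchings_converge:
  fixes f :: "disk_compact => real"
  assumes f: "continuous_on UNIV f" "bounded (range f)"
  and run: "\<And>n \<sigma>. n \<ge> 3 ==> \<sigma> permutes {1..n} ==> matching_run n \<sigma> (M n \<sigma>) (F n \<sigma>)"
  shows "(\<lambda>n. \<integral>\<sigma>. f (Abs_disk_compact (\<Union>(M n \<sigma> n))) \<partial>measure_pmf (pmf_of_set {\<sigma>. \<sigma> permutes {1..n}})) \<longlonglongrightarrow>
  (\<integral>\<omega>. f (limit \<omega>) \<partial>\<Omega>)"
proof -
  obtain B where B: "\<And>x. \<bar>f x\<bar> \<le> B" using f(2) by (auto simp: bounded_iff)
  let ?Z = "\<lambda>n \<omega>. map (\<lambda>i. rnd n (y i \<omega>)) [0..<n]"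
  let ?K1 = "\<lambda>n ds. map_pmf (to_perm n) (fill_up {..<n} (fold push ds []))"
  let ?K2 = "\<lambda>n ds. completion (run point_move ds (start {..<n}))"
  let ?Y = "\<lambda>\<omega>. Abs_disk_compact (closure (\<Union>N. chord_union (real_run.lam point_move (\<lambda>i. y i \<omega>) N)))"
  have close1: "AE \<omega> in \<Omega>. \<forall>\<epsilon>>0. eventually (\<lambda>n. \<forall>b\<in>set_pmf (?K1 n (?Z n \<omega>)).
   dist (Abs_disk_compact (\<Union>(M n b n))) (?Y \<omega>) \<le> \<epsilon>) sequentially"
  using point_filling
  proof eventually_elim
  case (elim \<omega>)
  interpret point_run "\<lambda>i. y i \<omega>" using elim by blast
  show ?case
   by (intro allI impI, rule matchings_close[OF conjunct2[OF elim]], assumption) (rule run)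
  qed
  have close2: "AE \<omega> in \<Omega>. \<forall>\<epsilon>>0. eventually (\<lambda>n. \<forall>b\<in>set_pmf (?K2 n (?Z n \<omega>)).
   dist (Abs_disk_compact (polygon_chords n (chords_of b))) (?Y \<omega>) \<le> \<epsilon>) sequentially"
  using point_filling
  proof eventually_elim
  case (elim \<omega>)
  interpret point_run "\<lambda>i. y i \<omega>" using elim by blast
  show ?case
   by (intro allI impI, rule completions_close[OF conjunct2[OF elim]], assumption) (rule point_move_proper)
  qed
  have law2: "replicate_pmf n (pmf_of_set {..<n}) \<bind> ?K2 n = region_law ({..<n}, None, 0)" if "0 < n" for n :: nat
  by (rule completion_point_run) (use that in auto)
  note k1 = kernel_converges[OF f(1) B point_list_law(1) point_list_law(2) uniform_permutation_from_points[symmetric] close1]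
  note k2 = kernel_converges[OF f(1) B point_list_law(1) point_list_law(2) law2 close2]
  let ?\<Phi>1 = "\<lambda>n \<omega>. \<integral>b. f (Abs_disk_compact (\<Union>(M n b n))) \<partial>measure_pmf (?K1 n (?Z n \<omega>))"
  let ?\<Phi>2 = "\<lambda>n \<omega>. \<integral>b. f (Abs_disk_compact (polygon_chords n (chords_of b))) \<partial>measure_pmf (?K2 n (?Z n \<omega>))"
  have m1: "?\<Phi>1 n \<in> borel_measurable \<Omega>" if "0 < n" for n by (rule k1(1)) (use that in auto)
  have i1: "(\<integral>\<omega>. ?\<Phi>1 n \<omega> \<partial>\<Omega>) = (\<integral>\<sigma>. f (Abs_disk_compact (\<Union>(M n \<sigma> n))) \<partial>measure_pmf (pmf_of_set {\<sigma>. \<sigma> permutes {1..n}}))" if "0 < n" for n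
  by (rule k1(2)) (use that in auto)
  have l1: "AE \<omega> in \<Omega>. (\<lambda>n. ?\<Phi>1 n \<omega>) \<longlonglongrightarrow> f (?Y \<omega>)" by (rule k1(3))
  have b1: "\<bar>?\<Phi>1 n \<omega>\<bar> \<le> B" for n \<omega> by (rule pmf_integral_bounded[OF B])
  have m2: "?\<Phi>2 n \<in> borel_measurable \<Omega>" if "0 < n" for n by (rule k2(1)) (use that in auto)
  have i2: "(\<integral>\<omega>. ?\<Phi>2 n \<omega> \<partial>\<Omega>) = (\<integral>A. f (Abs_disk_compact (polygon_chords n (chords_of A))) \<partial>measure_pmf (region_law ({..<n}, None, 0)))" if "0 < n" for n
  by (rule k2(2)) (use that in auto)
  have l2: "AE \<omega> in \<Omega>. (\<lambda>n. ?\<Phi>2 n \<omega>) \<longlonglongrightarrow> f (?Y \<omega>)" by (rule k2(3))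
  have b2: "\<bar>?\<Phi>2 n \<omega>\<bar> \<le> B" for n \<omega> by (rule pmf_integral_bounded[OF B])
  have lim0: "(\<lambda>n. \<integral>\<omega>. ?\<Phi>1 n \<omega> - ?\<Phi>2 n \<omega> \<partial>\<Omega>) \<longlonglongrightarrow> (\<integral>\<omega>. 0 \<partial>\<Omega>)"
  proof (rule tendsto_integral_bounded[of 1 "\<lambda>n \<omega>. ?\<Phi>1 n \<omega> - ?\<Phi>2 n \<omega>" "\<lambda>_. 0" "B + B"])
  show "(\<lambda>\<omega>. ?\<Phi>1 n \<omega> - ?\<Phi>2 n \<omega>) \<in> borel_measurable \<Omega>" if "1 \<le> n" for n
   by (intro borel_measurable_diff m1 m2) (use that in auto)
  show "\<bar>?\<Phi>1 n \<omega> - ?\<Phi>2 n \<omega>\<bar> \<le> B + B" for n \<omega> using b1[of n \<omega>] b2[of n \<omega>] by linarith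
  show "AE \<omega> in \<Omega>. (\<lambda>n. ?\<Phi>1 n \<omega> - ?\<Phi>2 n \<omega>) \<longlonglongrightarrow> 0"
   using l1 l2
  proof eventually_elim
   case (elim \<omega>)
   from tendsto_diff[OF elim] show ?case by simp
  qed
  qed simp
  have "eventually (\<lambda>n. (\<integral>\<omega>. ?\<Phi>1 n \<omega> - ?\<Phi>2 n \<omega> \<partial>\<Omega>) =
   (\<integral>\<sigma>. f (Abs_disk_compact (\<Union>(M n \<sigma> n))) \<partial>measure_pmf (pmf_of_set {\<sigma>. \<sigma> permutes {1..n}})) -
   (\<integral>A. f (Abs_disk_compact (polygon_chords n (chords_of A))) \<partial>measure_pmf (region_law ({..<n}, None, 0)))) sequentially"
  using eventually_gt_at_top[of 0]
  proof eventually_elim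
  case (elim n)
  have "integrable \<Omega> (?\<Phi>1 n)" using m1[OF elim] b1 by (intro integrable_const_bound[where B = B]) auto
  moreover have "integrable \<Omega> (?\<Phi>2 n)" using m2[OF elim] b2 by (intro integrable_const_bound[where B = B]) auto
  ultimately show ?case using i1[OF elim] i2[OF elim] by (subst Bochner_Integration.integral_diff) auto
  qed
  from Lim_transform_eventually[OF lim0 this]
  have diff: "(\<lambda>n. (\<integral>\<sigma>. f (Abs_disk_compact (\<Union>(M n \<sigma> n))) \<partial>measure_pmf (pmf_of_set {\<sigma>. \<sigma> permutes {1..n}})) -
   (\<integral>A. f (Abs_disk_compact (polygon_chords n (chords_of A))) \<partial>measure_pmf (region_law ({..<n}, None, 0)))) \<longlonglongrightarrow> 0"
  by simp
  from tendsto_add[OF this tree_converges[OF f]] show ?thesis by simp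
qed

end

theorem theorem1p4:
  fixes \<Omega> :: "'w measure"
  and U V :: "nat \<Rightarrow> 'w \<Rightarrow> complex"
  and M :: "nat \<Rightarrow> (nat \<Rightarrow> nat) \<Rightarrow> nat \<Rightarrow> complex set set"
  and F :: "nat \<Rightarrow> (nat \<Rightarrow> nat) \<Rightarrow> nat \<Rightarrow> complex set"
  assumes "prob_space \<Omega>"
  and "prob_space.indep_vars \<Omega> (\<lambda>_. uniform_circle) (case_sum U V) ({1..} <+> {1..})"
  and "\<And>i. i \<ge> 1 \<Longrightarrow> distr \<Omega> uniform_circle (U i) = uniform_circle"
  and "\<And>i. i \<ge> 1 \<Longrightarrow> distr \<Omega> uniform_circle (V i) = uniform_circle"
  and "\<And>n \<sigma>. n \<ge> 3 \<Longrightarrow> \<sigma> permutes {1..n} \<Longrightarrow> matching_run n \<sigma> (M n \<sigma>) (F n \<sigma>)"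
  shows "converges_in_distribution
      (\<lambda>n. measure_pmf (random_diagonals n (n - 3)))
      (\<lambda>n cs. Abs_disk_compact (\<Union>(set cs)))
      \<Omega> (\<lambda>\<omega>. Abs_disk_compact (L_inf (\<lambda>i. U i \<omega>) (\<lambda>i. V i \<omega>)))
     \<and> converges_in_distribution
      (\<lambda>n. measure_pmf (pmf_of_set {\<sigma>. \<sigma> permutes {1..n}}))
      (\<lambda>n \<sigma>. Abs_disk_compact (\<Union>(M n \<sigma> n)))
      \<Omega> (\<lambda>\<omega>. Abs_disk_compact (L_inf (\<lambda>i. U i \<omega>) (\<lambda>i. V i \<omega>)))"
proof -
  interpret circle_pairs \<Omega> U V
  by (intro circle_pairs.intro circle_pairs_axioms.intro assms(1-4))
  show ?thesis
  unfolding converges_in_distribution_def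
  proof (intro conjI allI impI)
  fix f :: "disk_compact \<Rightarrow> real" assume f: "continuous_on UNIV f" "bounded (range f)"
  show "(\<lambda>n. \<integral>\<omega>. f (Abs_disk_compact (\<Union>(set \<omega>))) \<partial>measure_pmf (random_diagonals n (n - 3))) \<longlonglongrightarrow> (\<integral>\<omega>. f (limit \<omega>) \<partial>\<Omega>)"
   by (rule triangulations_converge[OF f])
  show "(\<lambda>n. \<integral>\<sigma>. f (Abs_disk_compact (\<Union>(M n \<sigma> n))) \<partial>measure_pmf (pmf_of_set {\<sigma>. \<sigma> permutes {1..n}})) \<longlonglongrightarrow> (\<integral>\<omega>. f (limit \<omega>) \<partial>\<Omega>)"
   by (rule matchings_converge[OF f assms(5)])
  qed (simp_all add: L_inf_measurable)
qed

end
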